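(* Let $Q$ be the type $A_n$ quiver $1\leftarrow 2\leftarrow\cdots\leftarrow n-1\leftarrow n$ and $m$ a vertex. For every $M\in\mathcal C_{Q,m}$, $\rho_{Q,m}(M)=HG(M)$, where $\rho_{Q,m}(M)$ and $M$ are regarded respectively as a reverse plane partition and a multiset of rim hooks of the rectangular Young diagram with $n+1-m$ rows and $m$ columns, as described in the context.
   Context: $\Bbbk$ algebraically closed. Indecomposable representations of $Q$ are the interval modules with support $[a,b]$, $1\le a\le b\le n$; $\mathcal C_{Q,m}$ consists of direct sums of those with $a\le m\le b$. $\mathsf P_{Q,m}$: these intervals, with $x\le y$ iff there is a path from $x$ to $y$ in the full subquiver of the Auslander–Reiten quiver on them; $\pi(x)$: vertex $i$ with $P_i$ in the $\tau$-orbit of $x$. $\operatorname{GenJF}(M)^i$: Jordan type at vertex $i$ of a generic nilpotent endomorphism of $M$; $\rho_{Q,m}(M):\mathsf P_{Q,m}\to\mathbb N$ lists on each chain $\pi^{-1}(i)$ the parts of $\operatorname{GenJF}(M)^i$ padded with zeros, decreasing going up. Let $\lambda$ be the Young diagram with $n+1-m$ rows of length $m$ (English notation); a reverse plane partition of $\lambda$ is a filling by nonnegative integers weakly increasing along rows and down columns. The element with support $[a,b]$ corresponds to the cell in row $n+1-b$ and column $m+1-a$; this turns $\rho_{Q,m}(M)$ into a reverse plane partition of $\lambda$. The southeast border of $\lambda$ consists of $n$ cells, read from southwest to northeast (bottom row left to right, then the last column upward); the indecomposable with support $[a,b]$ is identified with the rim hook consisting of the border cells in positions $a,a+1,\dots,b$.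 Thus $M$ is a multiset of rim hooks of $\lambda$ (with multiplicities), and $HG(M)$ denotes the reverse plane partition of $\lambda$ assigned to this multiset by the Hillman–Grassl correspondence (the classical bijection between multisets of rim hooks of $\lambda$ and reverse plane partitions of $\lambda$). *)

theory Defs
  imports "Jordan_Normal_Form.Jordan_Normal_Form" "HOL-Library.Multiset"
begin

definition alg_closed :: "'k::field itself \<Rightarrow> bool" where
  "alg_closed _ \<longleftrightarrow> (\<forall>p :: 'k poly. degree p \<ge> 1 \<longrightarrow> (\<exists>x. poly p x = 0))"

text \<open>M is given as a multiset of intervals (a,b) (interval modules with support [a,b]).
  We fix a list of its summands; at vertex i the space is k^(dimv i), with basis
  indexed by the summands whose support contains i; the arrow i+1 -> i acts as the
  identity on summands supported at both vertices and as zero otherwise.\<close>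

definition summands :: "(nat \<times> nat) multiset \<Rightarrow> (nat \<times> nat) list" where
  "summands M = (SOME L. mset L = M)"

definition idx :: "(nat \<times> nat) list \<Rightarrow> nat \<Rightarrow> nat list" where
  "idx L i = filter (\<lambda>j. fst (L ! j) \<le> i \<and> i \<le> snd (L ! j)) [0..<length L]"

definition dimv :: "(nat \<times> nat) list \<Rightarrow> nat \<Rightarrow> nat" where
  "dimv L i = length (idx L i)"

definition arrow_mat :: "(nat \<times> nat) list \<Rightarrow> nat \<Rightarrow> 'k::field mat" where
  "arrow_mat L i = mat (dimv L i) (dimv L (Suc i))
     (\<lambda>(p, q). if idx L i ! p = idx L (Suc i) ! q then 1 else 0)"

text \<open>Nilpotent endomorphisms of the representation (a family of matrices, one per vertex;
  vertices outside 1..n carry the zero space).\<close>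
definition nil_endos :: "nat \<Rightarrow> (nat \<times> nat) list \<Rightarrow> (nat \<Rightarrow> 'k::field mat) set" where
  "nil_endos n L = {F. (\<forall>i. F i \<in> carrier_mat (dimv L i) (dimv L i))
      \<and> (\<forall>i. 1 \<le> i \<and> i < n \<longrightarrow> F i * arrow_mat L i = arrow_mat L i * F (Suc i))
      \<and> (\<exists>k. \<forall>i. F i ^\<^sub>m k = 0\<^sub>m (dimv L i) (dimv L i))}"

inductive_set poly_funs :: "(nat \<Rightarrow> nat) \<Rightarrow> ((nat \<Rightarrow> 'k::field mat) \<Rightarrow> 'k) set"
  for d :: "nat \<Rightarrow> nat" where
  const: "(\<lambda>F. c) \<in> poly_funs d"
| coord: "p < d i \<Longrightarrow> q < d i \<Longrightarrow> (\<lambda>F. F i $$ (p, q)) \<in> poly_funs d"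
| add: "f \<in> poly_funs d \<Longrightarrow> g \<in> poly_funs d \<Longrightarrow> (\<lambda>F. f F + g F) \<in> poly_funs d"
| mult: "f \<in> poly_funs d \<Longrightarrow> g \<in> poly_funs d \<Longrightarrow> (\<lambda>F. f F * g F) \<in> poly_funs d"

definition zariski_open_in :: "(nat \<Rightarrow> nat) \<Rightarrow> (nat \<Rightarrow> 'k::field mat) set \<Rightarrow> (nat \<Rightarrow> 'k mat) set \<Rightarrow> bool" where
  "zariski_open_in d X U \<longleftrightarrow> (\<exists>S \<subseteq> poly_funs d. U = {F \<in> X. \<exists>f \<in> S. f F \<noteq> 0})"

definition generically :: "(nat \<Rightarrow> nat) \<Rightarrow> (nat \<Rightarrow> 'k::field mat) set \<Rightarrow> ((nat \<Rightarrow> 'k mat) \<Rightarrow> bool) \<Rightarrow> bool" where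
  "generically d X P \<longleftrightarrow> (\<exists>U. zariski_open_in d X U
      \<and> (\<forall>V. zariski_open_in d X V \<and> V \<noteq> {} \<longrightarrow> U \<inter> V \<noteq> {})
      \<and> (\<forall>F \<in> U. P F))"

definition jordan_type :: "'k::field mat \<Rightarrow> nat multiset" where
  "jordan_type A = mset (map fst (SOME n_as. jordan_nf A n_as))"

definition GenJF :: "'k::field itself \<Rightarrow> nat \<Rightarrow> (nat \<times> nat) multiset \<Rightarrow> nat \<Rightarrow> nat multiset" where
  "GenJF _ n M i = (THE J. generically (dimv (summands M)) (nil_endos n (summands M) :: (nat \<Rightarrow> 'k mat) set)
        (\<lambda>F. jordan_type (F i) = J))"

definition PQ :: "nat \<Rightarrow> nat \<Rightarrow> (nat \<times> nat) set" where
  "PQ n m = {(a, b). 1 \<le> a \<and> a \<le> m \<and> m \<le> b \<and> b \<le> n}"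

text \<open>Arrows of the Auslander-Reiten quiver of Q between indecomposables [a,b]:
  [a,b] -> [a,b+1] and [a,b] -> [a+1,b].\<close>
definition ar_arrow :: "nat \<Rightarrow> nat \<times> nat \<Rightarrow> nat \<times> nat \<Rightarrow> bool" where
  "ar_arrow n x y \<longleftrightarrow> 1 \<le> fst x \<and> fst x \<le> snd x \<and> snd x \<le> n \<and>
     ((y = (fst x, Suc (snd x)) \<and> Suc (snd x) \<le> n) \<or> (y = (Suc (fst x), snd x) \<and> Suc (fst x) \<le> snd x))"

definition PQ_le :: "nat \<Rightarrow> nat \<Rightarrow> nat \<times> nat \<Rightarrow> nat \<times> nat \<Rightarrow> bool" where
  "PQ_le n m x y \<longleftrightarrow> (\<lambda>u v. u \<in> PQ n m \<and> v \<in> PQ n m \<and> ar_arrow n u v)\<^sup>*\<^sup>* x y"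

text \<open>AR translate: tau [a,b] = [a-1,b-1] for a > 1; projectives (a = 1) go to 0 (encoded (0,0)).\<close>
definition tau :: "nat \<times> nat \<Rightarrow> nat \<times> nat" where
  "tau x = (if 1 < fst x then (fst x - 1, snd x - 1) else (0, 0))"

definition tau_orbit :: "nat \<times> nat \<Rightarrow> (nat \<times> nat) set" where
  "tau_orbit x = {y. \<exists>k. (tau ^^ k) x = y \<or> (tau ^^ k) y = x}"

text \<open>pi(x): the vertex i such that P_i = [1,i] lies in the tau-orbit of x.\<close>
definition pi_vertex :: "nat \<Rightarrow> nat \<times> nat \<Rightarrow> nat" where
  "pi_vertex n x = (THE i. 1 \<le> i \<and> i \<le> n \<and> (1, i) \<in> tau_orbit x)"

definition part :: "nat multiset \<Rightarrow> nat \<Rightarrow> nat" where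
  "part J k = (if k < size J then rev (sorted_list_of_multiset J) ! k else 0)"

text \<open>rho: on the chain pi^{-1}(i) the parts of J i, decreasing going up
  (the position of x is the number of elements of its chain strictly below it).\<close>
definition rho :: "nat \<Rightarrow> nat \<Rightarrow> (nat \<Rightarrow> nat multiset) \<Rightarrow> nat \<times> nat \<Rightarrow> nat" where
  "rho n m J x = part (J (pi_vertex n x))
     (card {y \<in> PQ n m. pi_vertex n y = pi_vertex n x \<and> y \<noteq> x \<and> PQ_le n m y x})"

definition rho_QM :: "'k::field itself \<Rightarrow> nat \<Rightarrow> nat \<Rightarrow> (nat \<times> nat) multiset \<Rightarrow> nat \<times> nat \<Rightarrow> nat" where
  "rho_QM K n m M = rho n m (GenJF K n M)"

text \<open>Cells (row, column), 1-based, English notation: R rows, C columns.\<close>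
definition cells :: "nat \<Rightarrow> nat \<Rightarrow> (nat \<times> nat) set" where
  "cells R C = {(r, c). 1 \<le> r \<and> r \<le> R \<and> 1 \<le> c \<and> c \<le> C}"

definition is_rpp :: "nat \<Rightarrow> nat \<Rightarrow> (nat \<times> nat \<Rightarrow> nat) \<Rightarrow> bool" where
  "is_rpp R C P \<longleftrightarrow> (\<forall>x. x \<notin> cells R C \<longrightarrow> P x = 0)
     \<and> (\<forall>r c. (r, c) \<in> cells R C \<and> (r, Suc c) \<in> cells R C \<longrightarrow> P (r, c) \<le> P (r, Suc c))
     \<and> (\<forall>r c. (r, c) \<in> cells R C \<and> (Suc r, c) \<in> cells R C \<longrightarrow> P (r, c) \<le> P (Suc r, c))"

text \<open>rho_{Q,m}(M) as a filling of lambda: [a,b] sits in row n+1-b, column m+1-a.\<close>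
definition rpp_of :: "nat \<Rightarrow> nat \<Rightarrow> (nat \<times> nat \<Rightarrow> nat) \<Rightarrow> nat \<times> nat \<Rightarrow> nat" where
  "rpp_of n m f = (\<lambda>(r, c). if (r, c) \<in> cells (n + 1 - m) m then f (m + 1 - c, n + 1 - r) else 0)"

text \<open>Border cell number p (1..n), read from southwest to northeast.\<close>
definition border_cell :: "nat \<Rightarrow> nat \<Rightarrow> nat \<Rightarrow> nat \<times> nat" where
  "border_cell n m p = (if p \<le> m then (n + 1 - m, p) else (n + 1 - m - (p - m), m))"

definition rim_hook_of_interval :: "nat \<Rightarrow> nat \<Rightarrow> nat \<times> nat \<Rightarrow> (nat \<times> nat) set" where
  "rim_hook_of_interval n m x = border_cell n m ` {fst x..snd x}"

text \<open>Rim hook associated with the hook of cell (r,c) of the R x C rectangle: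
  from the bottom of column c to the end of row r.\<close>
definition rim_hook_of_cell :: "nat \<Rightarrow> nat \<Rightarrow> nat \<times> nat \<Rightarrow> (nat \<times> nat) set" where
  "rim_hook_of_cell R C u = {(R, j) | j. snd u \<le> j \<and> j \<le> C} \<union> {(i, C) | i. fst u \<le> i \<and> i \<le> R}"

fun hg_zz :: "nat \<Rightarrow> nat \<Rightarrow> (nat \<times> nat \<Rightarrow> nat) \<Rightarrow> nat \<Rightarrow> nat \<Rightarrow> (nat \<times> nat) list" where
  "hg_zz 0 C P a b = [(a, b)]"
| "hg_zz (Suc k) C P a b = (a, b) #
     (if 1 < a \<and> P (a - 1, b) = P (a, b) then hg_zz k C P (a - 1) b
      else if b < C then hg_zz k C P a (Suc b) else [])"

definition hg_start_col :: "nat \<Rightarrow> nat \<Rightarrow> (nat \<times> nat \<Rightarrow> nat) \<Rightarrow> nat" where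
  "hg_start_col R C P = (LEAST c. 1 \<le> c \<and> c \<le> C \<and> (\<exists>r. 1 \<le> r \<and> r \<le> R \<and> P (r, c) \<noteq> 0))"

definition hg_path :: "nat \<Rightarrow> nat \<Rightarrow> (nat \<times> nat \<Rightarrow> nat) \<Rightarrow> (nat \<times> nat) list" where
  "hg_path R C P = hg_zz (R + C) C P R (hg_start_col R C P)"

definition hg_remove :: "nat \<Rightarrow> nat \<Rightarrow> (nat \<times> nat \<Rightarrow> nat) \<Rightarrow> nat \<times> nat \<Rightarrow> nat" where
  "hg_remove R C P = (\<lambda>x. if x \<in> set (hg_path R C P) then P x - 1 else P x)"

definition hg_cell :: "nat \<Rightarrow> nat \<Rightarrow> (nat \<times> nat \<Rightarrow> nat) \<Rightarrow> nat \<times> nat" where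
  "hg_cell R C P = (fst (last (hg_path R C P)), hg_start_col R C P)"

inductive hg_rel :: "nat \<Rightarrow> nat \<Rightarrow> (nat \<times> nat \<Rightarrow> nat) \<Rightarrow> (nat \<times> nat) set multiset \<Rightarrow> bool"
  for R C where
  zero: "(\<forall>x \<in> cells R C. P x = 0) \<Longrightarrow> hg_rel R C P {#}"
| step: "\<not> (\<forall>x \<in> cells R C. P x = 0) \<Longrightarrow> hg_rel R C (hg_remove R C P) A \<Longrightarrow>
         hg_rel R C P (add_mset (rim_hook_of_cell R C (hg_cell R C P)) A)"

definition HG :: "nat \<Rightarrow> nat \<Rightarrow> (nat \<times> nat) multiset \<Rightarrow> nat \<times> nat \<Rightarrow> nat" where
  "HG n m M = (THE P. is_rpp (n + 1 - m) m P \<and>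
       hg_rel (n + 1 - m) m P (image_mset (rim_hook_of_interval n m) M))"

end

theory Submission
  imports Defs "Jordan_Normal_Form.Jordan_Normal_Form_Existence"
begin

text \<open>For a vertex \<open>i\<close>, order the summands of \<open>M\<close> supported at \<open>i\<close> componentwise as pairs \<open>(a, b)\<close> and let
  \<open>shape M i\<close> be their Greene--Kleitman partition, whose first \<open>k\<close> parts count the largest number of
  summands covered by \<open>k\<close> chains. Both sides of the theorem have \<open>shape M i\<close> on the diagonal of \<open>i\<close>.

  Removing the first Hillman--Grassl path from the filling by these shapes corresponds to removing the
  lexicographically least interval \<open>(a, b)\<close>. By Greene's theorem the shapes at the vertices on either
  side of \<open>m\<close> form Gelfand-Tsetlin patterns of two tableaux of one shape, and the path is
  the trace of a row insertion on one side and of a jeu de taquin slide on the other.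

  On the representation side, a nilpotent endomorphism is a block matrix supported on the componentwise
  order. A coefficient of its characteristic matrix bordered by \<open>k\<close> rows and columns bounds the \<open>k\<close>
  largest Jordan blocks at \<open>i\<close> by the \<open>k\<close>-chain number. Conversely, the shift along an optimal chain
  family makes a minor of its \<open>j\<close>-th power nonzero, and nonvanishing of minors is Zariski open and
  dense: each nilpotent endomorphism is conjugate, by a block diagonal matrix, to a strictly triangular
  one, and the line from there to the shift stays nilpotent.\<close>

section \<open>Greene invariants of words\<close>

text \<open>The lexicographically least interval \<open>(a, b)\<close> is chosen because one step
  can then be seen from both sides of \<open>m\<close>. Its left endpoint is a smallest letter and
  occupies the corner of the left tableau, so deleting it opens a vacancy; in the order used on the
  right it comes last, so adding it is a single row insertion. At vertex \<open>m\<close> both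
  trajectories mark the part in which one partition changes, and this glues them. Slide and
  insertion test exactly the equalities between neighbouring diagonals that send a Hillman-Grassl
  path up or right. The slid tableau is never built: only its row lengths matter, and they are
  Greene numbers of the word without the corner letter, bounded below by recut rows and above by
  shifted columns. \<open>HG\<close> is given by a unique description, so running the algorithm on
  the filling is not enough; other reverse plane partitions with the same rim hooks are excluded by
  reversing the algorithm. For modules the obstacle is equal summands: a nilpotent matrix may act
  between them in both directions, and only a change of basis inside each class makes its support
  acyclic.\<close>

text \<open>A coloured word is a list of pairs (letter, colour). The colours below \<open>k\<close> mark \<open>k\<close> disjoint
  weakly increasing subsequences; any other colour means that the letter is not selected.\<close>

definition kinc :: "nat \<Rightarrow> (nat \<times> nat) list \<Rightarrow> bool" where
  "kinc k z \<longleftrightarrow> sorted_wrt (\<lambda>e e'. snd e = snd e' \<and> snd e < k \<longrightarrow> fst e \<le> fst e') z"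

definition kval :: "nat \<Rightarrow> (nat \<times> nat) list \<Rightarrow> nat" where
  "kval k z = length (filter (\<lambda>e. snd e < k) z)"

definition word_greene :: "nat list \<Rightarrow> nat \<Rightarrow> nat" where
  "word_greene w k = Max {kval k z | z. map fst z = w \<and> kinc k z}"

lemma word_greene_set:
  "finite {kval k z | z. map fst z = w \<and> kinc k z}" "{kval k z | z. map fst z = w \<and> kinc k z} \<noteq> {}"
proof -
  have "kval k z \<le> length z" for z :: "(nat \<times> nat) list"
    by (simp add: kval_def)
  hence "{kval k z | z. map fst z = w \<and> kinc k z} \<subseteq> {..length w}"
    by (auto simp: length_map[of fst, symmetric] simp del: length_map)
  thus "finite {kval k z | z. map fst z = w \<and> kinc k z}" by (rule finite_subset) simp
  have "kinc k (map (\<lambda>a. (a, k)) w)"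
    unfolding kinc_def by (auto simp: sorted_wrt_iff_nth_less)
  moreover have "map fst (map (\<lambda>a. (a, k)) w) = w" by (simp add: comp_def)
  ultimately show "{kval k z | z. map fst z = w \<and> kinc k z} \<noteq> {}" by blast
qed

lemma word_greene_ge: "map fst z = w \<Longrightarrow> kinc k z \<Longrightarrow> kval k z \<le> word_greene w k"
  unfolding word_greene_def by (rule Max_ge[OF word_greene_set(1)]) blast

lemma word_greene_ex: "\<exists>z. map fst z = w \<and> kinc k z \<and> kval k z = word_greene w k"
  using Max_in[OF word_greene_set, of k w] unfolding word_greene_def[symmetric] by auto

lemma word_greene_le_iff: "word_greene w k \<le> d \<longleftrightarrow> (\<forall>z. map fst z = w \<and> kinc k z \<longrightarrow> kval k z \<le> d)"
  using word_greene_ge word_greene_ex by (metis order_trans)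

section \<open>Knuth relations and the exchange of chain tails\<close>

definition swap_cols :: "nat \<Rightarrow> nat \<Rightarrow> (nat \<times> nat) list \<Rightarrow> (nat \<times> nat) list" where
  "swap_cols c d = map (\<lambda>e. (fst e, if snd e = c then d else if snd e = d then c else snd e))"

lemma map_fst_swap_cols [simp]: "map fst (swap_cols c d z) = map fst z"
  by (simp add: swap_cols_def)

lemma kval_swap_cols: "c < k \<Longrightarrow> d < k \<Longrightarrow> kval k (swap_cols c d z) = kval k z"
  unfolding kval_def swap_cols_def by (induction z) auto

lemma kinc_swap_cols: "c < k \<Longrightarrow> d < k \<Longrightarrow> kinc k z \<Longrightarrow> kinc k (swap_cols c d z)"
  unfolding kinc_def swap_cols_def by (auto simp: sorted_wrt_iff_nth_less split: if_splits)

text \<open>Plactic relations in the convention for weakly increasing rows and strictly increasing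
  columns. Each one transposes the smallest and the largest letter of a triple; one orientation is
  listed, and \<open>equivclp\<close> supplies the other.\<close>

inductive knuth :: "nat list \<Rightarrow> nat list \<Rightarrow> bool" where
  yzx: "x < y \<Longrightarrow> y \<le> z \<Longrightarrow> knuth (s @ [y,z,x] @ t) (s @ [y,x,z] @ t)"
| xzy: "x \<le> y \<Longrightarrow> y < z \<Longrightarrow> knuth (s @ [x,z,y] @ t) (s @ [z,x,y] @ t)"

lemma set_swap_cols: "e \<in> set (swap_cols c d t) \<Longrightarrow>
   \<exists>e'\<in>set t. fst e = fst e' \<and> snd e = (if snd e' = c then d else if snd e' = d then c else snd e')"
  unfolding swap_cols_def set_map by (elim imageE, rule bexI) auto

lemma kval_append [simp]: "kval k (z @ z') = kval k z + kval k z'"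
  by (simp add: kval_def)
lemma kval_Cons [simp]: "kval k (e # z) = (if snd e < k then 1 else 0) + kval k z"
  by (simp add: kval_def)
lemma kval_Nil [simp]: "kval k [] = 0"
  by (simp add: kval_def)

lemma kinc_append: "kinc k (z @ z') \<longleftrightarrow> kinc k z \<and> kinc k z' \<and>
   (\<forall>e\<in>set z. \<forall>e'\<in>set z'. snd e = snd e' \<and> snd e < k \<longrightarrow> fst e \<le> fst e')"
  by (simp add: kinc_def sorted_wrt_append)
lemma kinc_Cons: "kinc k (e # z) \<longleftrightarrow> 
   (\<forall>e'\<in>set z. snd e = snd e' \<and> snd e < k \<longrightarrow> fst e \<le> fst e') \<and> kinc k z"
  by (simp add: kinc_def)
lemma kinc_Nil [simp]: "kinc k []"
  by (simp add: kinc_def)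

text \<open>Two selected subsequences may exchange their tails behind a modified middle factor.
  Renaming colours keeps the tail itself admissible; what has to be supplied are the comparisons
  across the boundaries, in particular between a prefix letter of colour \<open>c\<close> and a tail
  letter formerly of colour \<open>d\<close>, and conversely.\<close>

lemma kinc_recolour_tail:
  assumes "kinc k (s @ p @ t)" "c < k" "d < k" "kinc k q"
   and "\<And>e e'. e \<in> set s \<Longrightarrow> e' \<in> set q \<Longrightarrow> snd e = snd e' \<Longrightarrow> snd e < k \<Longrightarrow> fst e \<le> fst e'"
   and "\<And>e e'. e \<in> set q \<Longrightarrow> e' \<in> set t \<Longrightarrow> snd e = (if snd e' = c then d else if snd e' = d then c else snd e')
      \<Longrightarrow> snd e < k \<Longrightarrow> fst e \<le> fst e'"
   and "\<And>e e'. e \<in> set s \<Longrightarrow> e' \<in> set t \<Longrightarrow> snd e = c \<Longrightarrow> snd e' = d \<Longrightarrow> fst e \<le> fst e'"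
   and "\<And>e e'. e \<in> set s \<Longrightarrow> e' \<in> set t \<Longrightarrow> snd e = d \<Longrightarrow> snd e' = c \<Longrightarrow> fst e \<le> fst e'"
  shows "kinc k (s @ q @ swap_cols c d t)"
proof -
  have sp: "kinc k s" and t: "kinc k t" and st: "\<And>e e'. e \<in> set s \<Longrightarrow> e' \<in> set t \<Longrightarrow> snd e = snd e' \<Longrightarrow> snd e < k \<Longrightarrow> fst e \<le> fst e'"
    using assms(1) by (auto simp: kinc_append)
  have 1: "fst e \<le> fst e'" if "e \<in> set q" "e' \<in> set (swap_cols c d t)" "snd e = snd e'" "snd e < k" for e e'
    using set_swap_cols[OF that(2)] assms(6)[OF that(1)] that(3,4) by auto
  have 2: "fst e \<le> fst e'" if h: "e \<in> set s" "e' \<in> set (swap_cols c d t)" "snd e = snd e'" "snd e < k" for e e'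
  proof -
    obtain e'' where e'': "e'' \<in> set t" "fst e' = fst e''" "snd e' = (if snd e'' = c then d else if snd e'' = d then c else snd e'')"
      using set_swap_cols[OF h(2)] by auto
    show ?thesis
      using assms(7,8)[OF h(1) e''(1)] st[OF h(1) e''(1)] e''(2,3) h(3,4) by (auto split: if_splits)
  qed
  have "kinc k (swap_cols c d t)" by (rule kinc_swap_cols[OF assms(2,3) t])
  thus ?thesis using sp assms(4,5) 1 2 unfolding kinc_append set_append by blast
qed

lemma split_word3:
  assumes "map fst z = s @ [a,b,c] @ t"
  obtains s' i j l t' where "z = s' @ [(a,i),(b,j),(c,l)] @ t'" "map fst s' = s" "map fst t' = t"
  using assms by (auto simp: map_eq_append_conv map_eq_Cons_conv) 

text \<open>The letter \<open>z\<close> precedes the smaller \<open>x\<close>, so the two never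
  share a selected colour and can be transposed together with their colours.\<close>

lemma greene_yzx_le:
  assumes "x < y" "y \<le> z"
  shows "word_greene (s @ [y,z,x] @ t) k \<le> word_greene (s @ [y,x,z] @ t) k"
  unfolding word_greene_le_iff
proof (intro allI impI, elim conjE)
  fix v assume eq: "map fst v = s @ [y,z,x] @ t" and k: "kinc k v"
  from split_word3[OF eq] obtain s' i j l t' where v: "v = s' @ [(y,i),(z,j),(x,l)] @ t'" "map fst s' = s" "map fst t' = t"
    by metis
  have "kinc k (s' @ [(y,i),(x,l),(z,j)] @ t')"
    using k assms unfolding v by (auto simp: kinc_append kinc_Cons)
  from word_greene_ge[OF _ this, of "s @ [y,x,z] @ t"] v
  show "kval k v \<le> word_greene (s @ [y,x,z] @ t) k" by (simp add: add_ac)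
qed

text \<open>Here \<open>x\<close> and \<open>z\<close> may belong to one selected subsequence, which
  the transposition would break; the middle letter \<open>y\<close> repairs it.\<close>

lemma greene_yxz_le:
  assumes "x < y" "y \<le> z"
  shows "word_greene (s @ [y,x,z] @ t) k \<le> word_greene (s @ [y,z,x] @ t) k"
  unfolding word_greene_le_iff
proof (intro allI impI, elim conjE)
  fix v assume eq: "map fst v = s @ [y,x,z] @ t" and k: "kinc k v"
  from split_word3[OF eq] obtain s' i l j t' where v: "v = s' @ [(y,i),(x,l),(z,j)] @ t'" "map fst s' = s" "map fst t' = t"
    by metis
  have main: "kinc k u \<Longrightarrow> map fst u = s @ [y,z,x] @ t \<Longrightarrow> kval k u = kval k v \<Longrightarrow> kval k v \<le> word_greene (s @ [y,z,x] @ t) k" for u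
    using word_greene_ge by metis
  consider "j \<noteq> l \<or> j \<ge> k" | "j = l" "j < k" "i \<ge> k" | "j = l" "j < k" "i < k" by linarith
  then show "kval k v \<le> word_greene (s @ [y,z,x] @ t) k"
  proof cases
    case 1
    show ?thesis by (rule main[of "s' @ [(y,i),(z,j),(x,l)] @ t'"])
      (use 1 k v in \<open>auto simp: kinc_append kinc_Cons\<close>)
  next
    \<comment> \<open>\<open>y\<close> is not selected: it replaces \<open>x\<close> in the chain,
      which stays increasing because x < y <= z, and \<open>x\<close> takes the unselected
      colour.\<close>
    case 2
    show ?thesis by (rule main[of "s' @ [(y,j),(z,j),(x,i)] @ t'"])
      (use 2 k v assms in \<open>force simp: kinc_append kinc_Cons\<close>)+
  next
    case 3
    hence "i \<noteq> j" using k v assms by (auto simp: kinc_append kinc_Cons)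
    \<comment> \<open>Both chains are selected: \<open>z\<close> joins the chain of \<open>y\<close>
      and brings the later letters of colour \<open>j\<close>, while \<open>x\<close> keeps colour
      \<open>j\<close> and is continued by the former tail of \<open>y\<close>, whose letters are at
      least y > x.\<close>
    have "kinc k (s' @ [(y,i),(z,i),(x,j)] @ swap_cols i j t')"
    proof (rule kinc_recolour_tail[OF k[unfolded v(1)]])
      have S: "fst e \<le> y" if "e \<in> set s'" "snd e = i" for e using k 3 that unfolding v by (auto simp: kinc_append)
      have S': "fst e \<le> x" if "e \<in> set s'" "snd e = j" for e using k 3 that unfolding v by (auto simp: kinc_append)
      have T: "y \<le> fst e" if "e \<in> set t'" "snd e = i" for e using k 3 that unfolding v by (auto simp: kinc_append kinc_Cons)
      have T': "z \<le> fst e" if "e \<in> set t'" "snd e = j" for e using k 3 that unfolding v by (auto simp: kinc_append kinc_Cons)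
      show "i < k" "j < k" using 3 by auto
      show "kinc k [(y,i),(z,i),(x,j)]" using assms \<open>i \<noteq> j\<close> by (simp add: kinc_Cons)
      show "fst e \<le> fst e'" if "e \<in> set s'" "e' \<in> set [(y,i),(z,i),(x,j)]" "snd e = snd e'" "snd e < k" for e e'
        using S[OF that(1)] S'[OF that(1)] that(2,3) assms by force
      show "fst e \<le> fst e'" if "e \<in> set [(y,i),(z,i),(x,j)]" "e' \<in> set t'"
        "snd e = (if snd e' = i then j else if snd e' = j then i else snd e')" "snd e < k" for e e'
        using T[OF that(2)] T'[OF that(2)] that(1,3) assms \<open>i \<noteq> j\<close>
        by (cases e; cases "snd e' = i"; cases "snd e' = j") auto
      show "fst e \<le> fst e'" if "e \<in> set s'" "e' \<in> set t'" "snd e = i" "snd e' = j" for e e'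
        using S[OF that(1,3)] T'[OF that(2,4)] assms by linarith
      show "fst e \<le> fst e'" if "e \<in> set s'" "e' \<in> set t'" "snd e = j" "snd e' = i" for e e'
        using S'[OF that(1,3)] T[OF that(2,4)] assms by linarith
    qed
    thus ?thesis by (rule main) (use 3 v in \<open>auto simp: kval_swap_cols\<close>)
  qed
qed

text \<open>The mirror case: \<open>x\<close> and \<open>z\<close> may share a colour, and the
  middle letter \<open>y\<close>, now on the right, either replaces \<open>z\<close> in the chain or
  trades chains and tails with it.\<close>

lemma greene_xzy_le:
  assumes "x \<le> y" "y < z"
  shows "word_greene (s @ [x,z,y] @ t) k \<le> word_greene (s @ [z,x,y] @ t) k"
  unfolding word_greene_le_iff
proof (intro allI impI, elim conjE)
  fix v assume eq: "map fst v = s @ [x,z,y] @ t" and k: "kinc k v"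
  from split_word3[OF eq] obtain s' l j i t' where v: "v = s' @ [(x,l),(z,j),(y,i)] @ t'" "map fst s' = s" "map fst t' = t"
    by metis
  have main: "kinc k u \<Longrightarrow> map fst u = s @ [z,x,y] @ t \<Longrightarrow> kval k u = kval k v \<Longrightarrow> kval k v \<le> word_greene (s @ [z,x,y] @ t) k" for u
    using word_greene_ge by metis
  consider "j \<noteq> l \<or> j \<ge> k" | "j = l" "j < k" "i \<ge> k" | "j = l" "j < k" "i < k" by linarith
  then show "kval k v \<le> word_greene (s @ [z,x,y] @ t) k"
  proof cases
    case 1
    show ?thesis by (rule main[of "s' @ [(z,j),(x,l),(y,i)] @ t'"])
      (use 1 k v in \<open>auto simp: kinc_append kinc_Cons\<close>)
  next
    case 2
    show ?thesis by (rule main[of "s' @ [(z,i),(x,j),(y,j)] @ t'"])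
      (use 2 k v assms in \<open>force simp: kinc_append kinc_Cons\<close>)+
  next
    case 3
    hence "i \<noteq> j" using k v assms by (auto simp: kinc_append kinc_Cons)
    have "kinc k (s' @ [(z,i),(x,j),(y,j)] @ swap_cols i j t')"
    proof (rule kinc_recolour_tail[OF k[unfolded v(1)]])
      have S: "fst e \<le> y" if "e \<in> set s'" "snd e = i" for e using k 3 that unfolding v by (auto simp: kinc_append)
      have S': "fst e \<le> x" if "e \<in> set s'" "snd e = j" for e using k 3 that unfolding v by (auto simp: kinc_append)
      have T: "y \<le> fst e" if "e \<in> set t'" "snd e = i" for e using k 3 that unfolding v by (auto simp: kinc_append kinc_Cons)
      have T': "z \<le> fst e" if "e \<in> set t'" "snd e = j" for e using k 3 that unfolding v by (auto simp: kinc_append kinc_Cons)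
      show "i < k" "j < k" using 3 by auto
      show "kinc k [(z,i),(x,j),(y,j)]" using assms \<open>i \<noteq> j\<close> by (simp add: kinc_Cons)
      show "fst e \<le> fst e'" if "e \<in> set s'" "e' \<in> set [(z,i),(x,j),(y,j)]" "snd e = snd e'" "snd e < k" for e e'
        using S[OF that(1)] S'[OF that(1)] that(2,3) assms by force
      show "fst e \<le> fst e'" if "e \<in> set [(z,i),(x,j),(y,j)]" "e' \<in> set t'"
        "snd e = (if snd e' = i then j else if snd e' = j then i else snd e')" "snd e < k" for e e'
        using T[OF that(2)] T'[OF that(2)] that(1,3) assms \<open>i \<noteq> j\<close>
        by (cases e; cases "snd e' = i"; cases "snd e' = j") auto
      show "fst e \<le> fst e'" if "e \<in> set s'" "e' \<in> set t'" "snd e = i" "snd e' = j" for e e'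
        using S[OF that(1,3)] T'[OF that(2,4)] assms by linarith
      show "fst e \<le> fst e'" if "e \<in> set s'" "e' \<in> set t'" "snd e = j" "snd e' = i" for e e'
        using S'[OF that(1,3)] T[OF that(2,4)] assms by linarith
    qed
    thus ?thesis by (rule main) (use 3 v in \<open>auto simp: kval_swap_cols\<close>)
  qed
qed

lemma greene_zxy_le:
  assumes "x \<le> y" "y < z"
  shows "word_greene (s @ [z,x,y] @ t) k \<le> word_greene (s @ [x,z,y] @ t) k"
  unfolding word_greene_le_iff
proof (intro allI impI, elim conjE)
  fix v assume eq: "map fst v = s @ [z,x,y] @ t" and k: "kinc k v"
  from split_word3[OF eq] obtain s' j l i t' where v: "v = s' @ [(z,j),(x,l),(y,i)] @ t'" "map fst s' = s" "map fst t' = t"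
    by metis
  have "kinc k (s' @ [(x,l),(z,j),(y,i)] @ t')"
    using k assms unfolding v by (auto simp: kinc_append kinc_Cons)
  from word_greene_ge[OF _ this, of "s @ [x,z,y] @ t"] v
  show "kval k v \<le> word_greene (s @ [x,z,y] @ t) k" by (simp add: add_ac)
qed

lemma knuth_greene: "knuth w w' \<Longrightarrow> word_greene w k = word_greene w' k"
  by (induction rule: knuth.induct)
     (meson antisym greene_yzx_le greene_yxz_le greene_xzy_le greene_zxy_le)+

abbreviation knuth_equiv :: "nat list \<Rightarrow> nat list \<Rightarrow> bool" where
  "knuth_equiv \<equiv> equivclp knuth"

lemma knuth_equiv_greene: "knuth_equiv w w' \<Longrightarrow> word_greene w k = word_greene w' k"
  by (induction rule: equivclp_induct) (simp, metis knuth_greene)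

lemma knuth_append: "knuth w w' \<Longrightarrow> knuth (p @ w @ q) (p @ w' @ q)"
proof (induction rule: knuth.induct)
  case (yzx x y z s t) show ?case using knuth.yzx[OF yzx, of "p @ s" "t @ q"] by simp
next
  case (xzy x y z s t) show ?case using knuth.xzy[OF xzy, of "p @ s" "t @ q"] by simp
qed

lemma knuth_equiv_map:
  assumes "\<And>w w'. knuth w w' \<Longrightarrow> knuth_equiv (h w) (h w')" and "knuth_equiv w w'"
  shows "knuth_equiv (h w) (h w')"
  using assms(2) by (induction rule: equivclp_induct)
    (simp, meson equivclp_trans assms(1) equivclp_sym)

lemma knuth_equiv_append: "knuth_equiv w w' \<Longrightarrow> knuth_equiv (p @ w @ q) (p @ w' @ q)"
  by (rule knuth_equiv_map[where h = "\<lambda>w. p @ w @ q"]) (auto intro: knuth_append)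

text \<open>If the restriction deletes any letter of the triple, it deletes the largest, and then
  both sides coincide; otherwise the relation survives. This lets one tableau describe all levels at
  once.\<close>

lemma knuth_filter: "knuth w w' \<Longrightarrow> knuth_equiv (filter (\<lambda>a. a \<le> c) w) (filter (\<lambda>a. a \<le> (c::nat)) w')"
proof (induction rule: knuth.induct)
  case (yzx x y z s t) thus ?case
    using r_into_equivclp[of knuth, OF knuth.yzx[OF yzx]] by auto
next
  case (xzy x y z s t) thus ?case
    using r_into_equivclp[of knuth, OF knuth.xzy[OF xzy]] by auto
qed

lemma knuth_equiv_filter:
  "knuth_equiv w w' \<Longrightarrow> knuth_equiv (filter (\<lambda>a. a \<le> c) w) (filter (\<lambda>a. a \<le> (c::nat)) w')"
  by (rule knuth_equiv_map[OF knuth_filter])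

lemma knuth_set: "knuth w w' \<Longrightarrow> set w = set w'"
  by (induction rule: knuth.induct) auto

lemma knuth_equiv_set: "knuth_equiv w w' \<Longrightarrow> set w = set w'"
  by (induction rule: equivclp_induct) (auto dest: knuth_set)

text \<open>\<open>remove1\<close> deletes the first occurrence. Inside a triple this can only hit
  the smallest letter, and without it both sides agree; elsewhere the relation is untouched.
  Deleting the first minimal letter thus passes from a word to the reading of its tableau.\<close>

lemma knuth_remove_min:
  "knuth w w' \<Longrightarrow> (\<And>b. b \<in> set w \<Longrightarrow> a \<le> b) \<Longrightarrow> knuth_equiv (remove1 a w) (remove1 a w')"
proof (induction rule: knuth.induct)
  case (yzx x y z s t) 
  have "knuth_equiv (s' @ [y,z,x] @ t') (s' @ [y,x,z] @ t')" for s' t'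
    using r_into_equivclp[of knuth, OF knuth.yzx[OF yzx(1,2)]] by auto
  note K = this[of "remove1 a s" t] this[of s "remove1 a t"]
  have "a \<le> x" using yzx(3) by simp
  then consider "a \<in> set s" | "a \<notin> set s" "a = x" | "a \<notin> set s" "a < x" by fastforce
  then show ?case using K yzx(1,2) by cases (auto simp: remove1_append)
next
  case (xzy x y z s t)
  have "knuth_equiv (s' @ [x,z,y] @ t') (s' @ [z,x,y] @ t')" for s' t'
    using r_into_equivclp[of knuth, OF knuth.xzy[OF xzy(1,2)]] by auto
  note K = this[of "remove1 a s" t] this[of s "remove1 a t"]
  have "a \<le> x" using xzy(3) by simp
  then consider "a \<in> set s" | "a \<notin> set s" "a = x" | "a \<notin> set s" "a < x" by fastforce
  then show ?case using K xzy(1,2) by cases (auto simp: remove1_append)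
qed

lemma knuth_equiv_remove_min:
  assumes "knuth_equiv w w'" "\<And>b. b \<in> set w \<Longrightarrow> a \<le> b"
  shows "knuth_equiv (remove1 a w) (remove1 a w')"
  using assms(1)
proof (induction rule: equivclp_induct)
  case (step y z)
  have "set y = set w" "set z = set w" using step(1,2) knuth_equiv_set by blast+
  with step(2) have "knuth_equiv (remove1 a y) (remove1 a z)"
    by (metis knuth_remove_min equivclp_sym assms(2))
  with step.IH show ?case by (meson equivclp_trans)
qed simp

section \<open>Tableaux and row insertion\<close>

definition below :: "nat list \<Rightarrow> nat list \<Rightarrow> bool" where
  "below r s \<longleftrightarrow> length s \<le> length r \<and> (\<forall>c<length s. r ! c < s ! c)"

fun tableau :: "nat list list \<Rightarrow> bool" where
  "tableau [] = True"
| "tableau [r] = sorted r"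
| "tableau (r # s # T) = (sorted r \<and> below r s \<and> tableau (s # T))"

abbreviation reading :: "nat list list \<Rightarrow> nat list" where
  "reading T \<equiv> concat (rev T)"

fun row_insert :: "nat list list \<Rightarrow> nat \<Rightarrow> nat list list" where
  "row_insert [] x = [[x]]"
| "row_insert (r # T) x = (case dropWhile (\<lambda>a. a \<le> x) r of
     [] \<Rightarrow> (r @ [x]) # T
   | y # B \<Rightarrow> (takeWhile (\<lambda>a. a \<le> x) r @ x # B) # row_insert T y)"

lemma row_split:
  assumes "sorted r" "dropWhile (\<lambda>a. a \<le> x) r = y # B"
  obtains A where "takeWhile (\<lambda>a. a \<le> x) r = A" "r = A @ y # B" "\<forall>a\<in>set A. a \<le> (x::nat)" "x < y" 
    "\<forall>b\<in>set B. y \<le> b" "sorted A" "sorted B"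
proof
  let ?A = "takeWhile (\<lambda>a. a \<le> x) r"
  show r: "r = ?A @ y # B" using takeWhile_dropWhile_id[of "\<lambda>a. a \<le> x" r] assms(2) by simp
  show "\<forall>a\<in>set ?A. a \<le> x" by (auto dest: set_takeWhileD)
  show "x < y" using assms(2) by (metis dropWhile_eq_Cons_conv not_le)
  have "sorted (?A @ y # B)" using assms(1) r by simp
  thus "\<forall>b\<in>set B. y \<le> b" "sorted ?A" "sorted B" by (auto simp: sorted_append)
qed simp

lemma dropWhile_NilD: "dropWhile (\<lambda>a. a \<le> x) r = [] \<Longrightarrow> \<forall>a\<in>set r. a \<le> (x::nat)"
  by (simp add: dropWhile_eq_Nil_conv)

lemma row_insert_append: 
  assumes "\<forall>a\<in>set r. a \<le> x" shows "row_insert (r # T) x = (r @ [x]) # T"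
proof -
  have "dropWhile (\<lambda>a. a \<le> x) r = []" using assms by simp
  thus ?thesis by (simp only: row_insert.simps list.case)
qed

lemma row_insert_bump: "dropWhile (\<lambda>a. a \<le> x) r = y # B \<Longrightarrow>
  row_insert (r # T) x = (takeWhile (\<lambda>a. a \<le> x) r @ x # B) # row_insert T y"
  by simp

declare row_insert.simps(2) [simp del]

text \<open>\<open>x\<close> passes the letters of \<open>B\<close> from right to left; the left
  neighbour of the letter being passed, finally \<open>y\<close> itself, is the middle letter of the
  relation.\<close>

lemma knuth_row_tail:
  assumes "x < y" "\<forall>b\<in>set B. y \<le> b" "sorted B"
  shows "knuth_equiv (y # B @ [x]) (y # x # B)"
  using assms(2,3)
proof (induction B rule: rev_induct)
  case (snoc b B)
  have "knuth_equiv (y # B @ [x]) (y # x # B)" using snoc by (auto simp: sorted_append)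
  from knuth_equiv_append[OF this, of "[]" "[b]"]
  have 1: "knuth_equiv (y # B @ [x, b]) (y # x # B @ [b])" by simp
  have 2: "knuth_equiv (y # B @ [b, x]) (y # B @ [x, b])"
  proof (cases B rule: rev_exhaust)
    case Nil
    thus ?thesis using knuth.yzx[of x y b "[]" "[]"] assms snoc by auto
  next
    case B: (snoc B' b')
    have "y \<le> b'" "b' \<le> b" using snoc.prems B by (auto simp: sorted_append)
    thus ?thesis using knuth.yzx[of x b' b "y # B'" "[]"] assms B by auto
  qed
  from equivclp_trans[OF 2 1] show ?case by simp
qed simp

text \<open>\<open>y\<close> passes the letters of \<open>A\<close> from right to left; its right
  neighbour, at first \<open>x\<close>, is the middle letter of the relation.\<close>

lemma knuth_row_head:
  assumes "x < (y::nat)" "\<forall>a\<in>set A. a \<le> x" "sorted A"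
  shows "knuth_equiv (A @ [y, x]) (y # A @ [x])"
  using assms(2,3)
proof (induction A)
  case (Cons a A)
  have 1: "knuth_equiv (a # A @ [y,x]) (a # y # A @ [x])"
    using knuth_equiv_append[OF Cons.IH, of "[a]" "[]"] Cons.prems by auto
  have 2: "knuth_equiv (a # y # A @ [x]) (y # a # A @ [x])"
  proof (cases A)
    case Nil thus ?thesis using knuth.xzy[of a x y "[]" "[]"] assms Cons.prems by auto
  next
    case (Cons a' A')
    have "a \<le> a'" "a' < y" using Cons.prems \<open>A = _\<close> assms(1) by auto
    thus ?thesis using knuth.xzy[of a a' y "[]" "A' @ [x]"] Cons by auto
  qed
  from equivclp_trans[OF 1 2] show ?case by simp
qed simp

lemma knuth_row:
  assumes "x < (y::nat)" "\<forall>a\<in>set A. a \<le> x" "sorted A" "\<forall>b\<in>set B. y \<le> b" "sorted B"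
  shows "knuth_equiv (A @ y # B @ [x]) (y # A @ x # B)"
  using equivclp_trans[OF knuth_equiv_append[OF knuth_row_tail[OF assms(1,4,5)], of A "[]"]]
    knuth_equiv_append[OF knuth_row_head[OF assms(1-3)], of "[]" B] by simp

lemma tableau_ConsD: "tableau (r # T) \<Longrightarrow> sorted r \<and> tableau T"
  by (cases T) auto

text \<open>In the reading word the bumped letter comes to stand directly behind the rows below,
  which is where the recursive call inserts it.\<close>

lemma reading_row_insert:
  "tableau T \<Longrightarrow> knuth_equiv (reading T @ [x]) (reading (row_insert T x))"
proof (induction T arbitrary: x)
  case (Cons r T)
  from Cons.prems have r: "sorted r" "tableau T" by (auto dest: tableau_ConsD)
  show ?case
  proof (cases "dropWhile (\<lambda>a. a \<le> x) r")
    case Nil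
    show ?thesis unfolding row_insert_append[OF dropWhile_NilD[OF Nil]] by simp
  next
    case yB: (Cons y B)
    from row_split[OF r(1) yB] obtain A where A: "takeWhile (\<lambda>a. a \<le> x) r = A" "r = A @ y # B"
      "\<forall>a\<in>set A. a \<le> x" "x < y" "\<forall>b\<in>set B. y \<le> b" "sorted A" "sorted B" .
    have "knuth_equiv (reading T @ (A @ y # B @ [x])) (reading T @ (y # A @ x # B))"
      using knuth_equiv_append[OF knuth_row[OF A(4,3,6,5,7)], of "reading T" "[]"] by simp
    also have "knuth_equiv (reading T @ (y # A @ x # B)) (reading (row_insert T y) @ A @ x # B)"
      using knuth_equiv_append[OF Cons.IH[OF r(2)], of "[]" y "A @ x # B"] by simp
    finally show ?thesis unfolding row_insert_bump[OF yB] A(1) by (simp add: A(2))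
  qed
qed simp

text \<open>The bumped letter \<open>y\<close> enters the next row weakly to the left of the column
  it left, because the entry of \<open>s\<close> in that column, if present, already exceeds
  \<open>y\<close>. It therefore stands under a letter at most \<open>x\<close>.\<close>

lemma below_insert:
  assumes b: "below r s" and r: "r = A @ y # B" "\<forall>a\<in>set A. a \<le> x" "x < (y::nat)" and s: "sorted s"
  shows "below (A @ x # B) (hd (row_insert (s # T) y))"
proof -
  have b': "length s \<le> length r" "\<And>c. c < length s \<Longrightarrow> r ! c < s ! c" using b by (auto simp: below_def)
  have new: "(A @ x # B) ! c \<le> r ! c" for c using r by (auto simp: nth_append nth_Cons split: nat.split)
  have new': "(A @ x # B) ! c \<le> x" if "c \<le> length A" for c using r that by (auto simp: nth_append nth_Cons split: nat.split)
  show ?thesis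
  proof (cases "dropWhile (\<lambda>a. a \<le> y) s")
    case Nil
    hence le: "\<forall>a\<in>set s. a \<le> y" by (rule dropWhile_NilD)
    have "r ! length A = y" using r by simp
    with le have "length s \<le> length A" using b'(2)[of "length A"] 
      by (metis not_le nth_mem)
    moreover have "(A @ x # B) ! c < (s @ [y]) ! c" if "c < Suc (length s)" for c
      using that new'[of c] new[of c] b'(2)[of c] r(3) \<open>length s \<le> length A\<close>
      by (cases "c = length s") (auto simp: nth_append[of s])
    ultimately show ?thesis unfolding row_insert_append[OF le] below_def r(1) by simp
  next
    case yB: (Cons y' B')
    from row_split[OF s yB] obtain A' where A: "takeWhile (\<lambda>a. a \<le> y) s = A'" "s = A' @ y' # B'"
      "\<forall>a\<in>set A'. a \<le> y" "y < y'" "\<forall>b\<in>set B'. y' \<le> b" .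
    have "r ! length A = y" using r by simp
    have le: "length A' \<le> length A"
    proof (rule ccontr)
      assume "\<not> ?thesis"
      hence l: "length A < length A'" by simp
      hence "s ! length A \<in> set A'" using A by (auto simp: nth_append)
      moreover have "y < s ! length A" using b'(2)[of "length A"] l A \<open>r ! length A = y\<close> by simp
      ultimately show False using A by auto
    qed
    have "(A @ x # B) ! c < (A' @ y # B') ! c" if "c < length s" for c
    proof (cases "c = length A'")
      case True thus ?thesis using new'[of c] le r by simp
    next
      case False
      hence "(A' @ y # B') ! c = s ! c" using A by (auto simp: nth_append nth_Cons split: nat.split)
      thus ?thesis using b'(2)[OF that] new[of c] by simp
    qed
    thus ?thesis using A(2) b'(1) r(1) unfolding row_insert_bump[OF yB] A(1) below_def by simp
  qed
qed

lemma sorted_replace: "sorted (A @ y # B) \<Longrightarrow> \<forall>a\<in>set A. a \<le> x \<Longrightarrow> x < (y::nat) \<Longrightarrow> sorted (A @ x # B)"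
  by (auto simp: sorted_append)

lemma row_insert_ne: "row_insert T x \<noteq> []"
  by (cases T) (auto simp: row_insert.simps(2) split: list.split)

lemma tableau_Cons_iff: "T \<noteq> [] \<Longrightarrow> tableau (r # T) \<longleftrightarrow> sorted r \<and> below r (hd T) \<and> tableau T"
  by (cases T) auto

lemma tableau_row_insert: "tableau T \<Longrightarrow> tableau (row_insert T x)"
proof (induction T arbitrary: x)
  case (Cons r T)
  from Cons.prems have r: "sorted r" "tableau T" by (auto dest: tableau_ConsD)
  show ?case
  proof (cases "dropWhile (\<lambda>a. a \<le> x) r")
    case Nil
    from dropWhile_NilD[OF Nil] Cons.prems show ?thesis unfolding row_insert_append[OF dropWhile_NilD[OF Nil]]
      by (cases T) (auto simp: sorted_append below_def nth_append)
  next
    case yB: (Cons y B)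
    from row_split[OF r(1) yB] obtain A where A: "takeWhile (\<lambda>a. a \<le> x) r = A" "r = A @ y # B"
      "\<forall>a\<in>set A. a \<le> x" "x < y" "\<forall>b\<in>set B. y \<le> b" "sorted A" "sorted B" .
    have "below (A @ x # B) (hd (row_insert T y))"
    proof (cases T)
      case Nil
      have "(A @ x # B) ! 0 < y" using A by (cases A) auto
      thus ?thesis by (simp add: below_def Nil)
    next
      case (Cons s T')
      have "below r s" "sorted s" using Cons.prems unfolding Cons by (auto dest: tableau_ConsD)
      from below_insert[OF this(1) A(2,3,4) this(2)] show ?thesis unfolding Cons .
    qed
    moreover have "sorted (A @ x # B)" using sorted_replace[OF _ A(3,4), of B] r(1) A(2) by simp
    ultimately show ?thesis using Cons.IH[OF r(2)] unfolding row_insert_bump[OF yB] A(1)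
      by (simp add: tableau_Cons_iff row_insert_ne)
  qed
qed simp

lemma ex_tableau: "\<exists>T. tableau T \<and> knuth_equiv w (reading T)"
proof (induction w rule: rev_induct)
  case Nil
  show ?case by (rule exI[of _ "[]"]) simp
next
  case (snoc x w)
  then obtain T where T: "tableau T" "knuth_equiv w (reading T)" by blast
  have "knuth_equiv (w @ [x]) (reading T @ [x])"
    using knuth_equiv_append[OF T(2), of "[]" "[x]"] by simp
  from equivclp_trans[OF this reading_row_insert[OF T(1)]] tableau_row_insert[OF T(1)]
  show ?case by blast
qed

text \<open>\<open>cnt T l j\<close> is the Gelfand-Tsetlin pattern of the tableau \<open>T\<close>, rows numbered from 0.\<close>

definition cnt :: "nat list list \<Rightarrow> nat \<Rightarrow> nat \<Rightarrow> nat" where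
  "cnt T l j = (if l < length T then length (filter (\<lambda>a. a \<le> j) (T ! l)) else 0)"

lemma cnt_Nil [simp]: "cnt [] l j = 0"
  by (simp add: cnt_def)
lemma cnt_Cons_0 [simp]: "cnt (r # T) 0 j = length (filter (\<lambda>a. a \<le> j) r)"
  by (simp add: cnt_def)
lemma cnt_Cons_Suc [simp]: "cnt (r # T) (Suc l) j = cnt T l j"
  by (simp add: cnt_def)

text \<open>\<open>\<kappa> j\<close> is the row in which the shape of the letters up to
  \<open>j\<close> grows. This row bumps out a letter \<open>Suc j\<close> exactly when it contains
  one, and then the growth at level \<open>Suc j\<close> happens one row lower, where that letter is
  the largest one considered. A recursion over levels, rather than along the bumping path, is what a
  Hillman-Grassl path follows.\<close>

lemma cnt_row_insert:
  assumes "tableau T"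
  shows "\<exists>\<kappa>. \<kappa> x = 0 \<and>
    (\<forall>l j. cnt (row_insert T x) l j = cnt T l j + (if x \<le> j \<and> l = \<kappa> j then 1 else 0)) \<and>
    (\<forall>j\<ge>x. \<kappa> (Suc j) = (if cnt T (\<kappa> j) (Suc j) = cnt T (\<kappa> j) j then \<kappa> j else Suc (\<kappa> j)))"
  using assms
proof (induction T arbitrary: x)
  case Nil
  have "cnt [[x]] l j = (if x \<le> j \<and> l = 0 then 1 else 0)" for l j by (simp add: cnt_def)
  thus ?case by (intro exI[of _ "\<lambda>_. 0"]) auto
next
  case (Cons r T)
  from Cons.prems have r: "sorted r" "tableau T" by (auto dest: tableau_ConsD)
  show ?case
  proof (cases "dropWhile (\<lambda>a. a \<le> x) r")
    case Nil
    from dropWhile_NilD[OF Nil] have "j \<ge> x \<Longrightarrow> filter (\<lambda>a. a \<le> j) r = r" for j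
      by (auto simp: filter_id_conv)
    thus ?thesis unfolding row_insert_append[OF dropWhile_NilD[OF Nil]]
      by (intro exI[of _ "\<lambda>_. 0"]) (auto simp: cnt_def nth_Cons split: nat.split)
  next
    case yB: (Cons y B)
    from row_split[OF r(1) yB] obtain A where A: "takeWhile (\<lambda>a. a \<le> x) r = A" "r = A @ y # B"
      "\<forall>a\<in>set A. a \<le> x" "x < y" "\<forall>b\<in>set B. y \<le> b" "sorted A" "sorted B" .
    from Cons.IH[OF r(2), of y] obtain \<kappa> where \<kappa>: "\<kappa> y = 0"
      "\<And>l j. cnt (row_insert T y) l j = cnt T l j + (if y \<le> j \<and> l = \<kappa> j then 1 else 0)"
      "\<And>j. y \<le> j \<Longrightarrow> \<kappa> (Suc j) = (if cnt T (\<kappa> j) (Suc j) = cnt T (\<kappa> j) j then \<kappa> j else Suc (\<kappa> j))"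
      by blast
    \<comment> \<open>Level \<open>y\<close> is the first one that the recursive insertion affects;
      before it the new cell lies in the top row.\<close>
    let ?k = "\<lambda>j. if j < y then 0 else Suc (\<kappa> j)"
    have ins: "row_insert (r # T) x = (A @ x # B) # row_insert T y" unfolding row_insert_bump[OF yB] A(1) ..
    have B0: "filter (\<lambda>a. a \<le> j) B = []" if "j < y" for j
      using A(5) that by (auto simp: filter_empty_conv)
    have AA: "filter (\<lambda>a. a \<le> j) A = A" if "x \<le> j" for j
      using A(3) that by (auto simp: filter_id_conv)
    have 1: "cnt (row_insert (r # T) x) l j = cnt (r # T) l j + (if x \<le> j \<and> l = ?k j then 1 else 0)" for l j
      unfolding ins using A(4) B0[of j] by (cases l) (auto simp: \<kappa>(2) A(2))
    have 2: "?k (Suc j) = (if cnt (r # T) (?k j) (Suc j) = cnt (r # T) (?k j) j then ?k j else Suc (?k j))" if "x \<le> j" for j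
    proof -
      consider "Suc j < y" | "Suc j = y" | "y \<le> j" by linarith
      thus ?thesis
      proof cases
        case 1 thus ?thesis using B0[of j] B0[of "Suc j"] AA[of j] AA[of "Suc j"] that by (simp add: A(2))
      next
        case 2 thus ?thesis using B0[of j] AA[of j] AA[of "Suc j"] that \<kappa>(1) by (simp add: A(2))
      next
        case 3 thus ?thesis using \<kappa>(3)[of j] by simp
      qed
    qed
    show ?thesis using 1 2 A(4) by (intro exI[of _ ?k]) simp
  qed
qed

section \<open>Greene's theorem for tableaux, with colours attached to cells\<close>

fun colour_word :: "nat list list \<Rightarrow> (nat \<Rightarrow> nat \<Rightarrow> nat) \<Rightarrow> (nat \<times> nat) list" where
  "colour_word [] cl = []"
| "colour_word (r # T) cl = colour_word T (\<lambda>l. cl (Suc l)) @ map (\<lambda>c. (r ! c, cl 0 c)) [0..<length r]"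

text \<open>Two cells of one row impose no condition, since rows are sorted and read from left to
  right. Of two rows the lower one is read earlier, so \<open>l' < l\<close> makes the cell in row
  \<open>l\<close> the earlier letter.\<close>

definition cell_ok :: "nat \<Rightarrow> nat list list \<Rightarrow> (nat \<Rightarrow> nat \<Rightarrow> nat) \<Rightarrow> bool" where
  "cell_ok k T cl \<longleftrightarrow> (\<forall>l<length T. \<forall>l'<l. \<forall>c<length (T ! l). \<forall>c'<length (T ! l').
     cl l c = cl l' c' \<longrightarrow> cl l c < k \<longrightarrow> T ! l ! c \<le> T ! l' ! c')"

definition cell_count :: "nat \<Rightarrow> nat list list \<Rightarrow> (nat \<Rightarrow> nat \<Rightarrow> nat) \<Rightarrow> nat" where
  "cell_count k T cl = (\<Sum>l<length T. card {c. c < length (T ! l) \<and> cl l c < k})"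

lemma map_fst_colour_word [simp]: "map fst (colour_word T cl) = reading T"
  by (induction T arbitrary: cl) (auto simp: comp_def map_nth)

lemma set_colour_word: "set (colour_word T cl) = {(T ! l ! c, cl l c) | l c. l < length T \<and> c < length (T ! l)}"
proof (induction T arbitrary: cl)
  case (Cons r T)
  show ?case unfolding colour_word.simps set_append Cons.IH
    by (auto simp: less_Suc_eq_0_disj; force)
qed simp

lemma cell_ok_Cons: "cell_ok k (r # T) cl \<longleftrightarrow> cell_ok k T (\<lambda>l. cl (Suc l)) \<and>
  (\<forall>l<length T. \<forall>c<length (T ! l). \<forall>c'<length r. cl (Suc l) c = cl 0 c' \<longrightarrow> cl (Suc l) c < k \<longrightarrow> T ! l ! c \<le> r ! c')"
proof
  assume *: "cell_ok k (r # T) cl"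
  show "cell_ok k T (\<lambda>l. cl (Suc l)) \<and>
  (\<forall>l<length T. \<forall>c<length (T ! l). \<forall>c'<length r. cl (Suc l) c = cl 0 c' \<longrightarrow> cl (Suc l) c < k \<longrightarrow> T ! l ! c \<le> r ! c')"
  proof (intro conjI allI impI)
    show "cell_ok k T (\<lambda>l. cl (Suc l))" unfolding cell_ok_def
    proof (intro allI impI)
      fix l l' c c' assume "l < length T" "l' < l" "c < length (T ! l)" "c' < length (T ! l')"
        "cl (Suc l) c = cl (Suc l') c'" "cl (Suc l) c < k"
      thus "T ! l ! c \<le> T ! l' ! c'"
        using *[unfolded cell_ok_def, rule_format, of "Suc l" "Suc l'" c c'] by simp
    qed
  next
    fix l c c' assume "l < length T" "c < length (T ! l)" "c' < length r" "cl (Suc l) c = cl 0 c'" "cl (Suc l) c < k"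
    thus "T ! l ! c \<le> r ! c'"
      using *[unfolded cell_ok_def, rule_format, of "Suc l" 0 c c'] by simp
  qed
next
  assume *: "cell_ok k T (\<lambda>l. cl (Suc l)) \<and>
  (\<forall>l<length T. \<forall>c<length (T ! l). \<forall>c'<length r. cl (Suc l) c = cl 0 c' \<longrightarrow> cl (Suc l) c < k \<longrightarrow> T ! l ! c \<le> r ! c')"
  show "cell_ok k (r # T) cl" unfolding cell_ok_def
  proof (intro allI impI)
    fix l l' c c' assume a: "l < length (r # T)" "l' < l" "c < length ((r # T) ! l)" "c' < length ((r # T) ! l')"
       "cl l c = cl l' c'" "cl l c < k"
    then obtain l1 where l: "l = Suc l1" by (cases l) auto
    show "(r # T) ! l ! c \<le> (r # T) ! l' ! c'"
      using * a unfolding l cell_ok_def by (cases l') auto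
  qed
qed

lemma kinc_colour_word: "\<forall>r\<in>set T. sorted r \<Longrightarrow> kinc k (colour_word T cl) \<longleftrightarrow> cell_ok k T cl"
proof (induction T arbitrary: cl)
  case Nil thus ?case by (simp add: cell_ok_def)
next
  case (Cons r T)
  have "kinc k (map (\<lambda>c. (r ! c, cl 0 c)) [0..<length r])"
    using Cons.prems by (auto simp: kinc_def sorted_wrt_iff_nth_less sorted_iff_nth_mono)
  moreover have "(\<forall>e\<in>set (colour_word T (\<lambda>l. cl (Suc l))). \<forall>e'\<in>set (map (\<lambda>c. (r ! c, cl 0 c)) [0..<length r]).
      snd e = snd e' \<and> snd e < k \<longrightarrow> fst e \<le> fst e') \<longleftrightarrow>
    (\<forall>l<length T. \<forall>c<length (T ! l). \<forall>c'<length r. cl (Suc l) c = cl 0 c' \<longrightarrow> cl (Suc l) c < k \<longrightarrow> T ! l ! c \<le> r ! c')"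
    unfolding set_colour_word by fastforce
  ultimately show ?case using Cons by (simp add: kinc_append cell_ok_Cons) 
qed

lemma kval_colour_word: "kval k (colour_word T cl) = cell_count k T cl"
proof (induction T arbitrary: cl)
  case (Cons r T)
  have "kval k (map (\<lambda>c. (r ! c, cl 0 c)) [0..<length r]) = card {c. c < length r \<and> cl 0 c < k}"
    unfolding kval_def length_filter_conv_card by (rule arg_cong[of _ _ card]) auto
  thus ?case by (simp add: Cons cell_count_def sum.lessThan_Suc_shift del: sum.lessThan_Suc)
qed (simp add: cell_count_def)

lemma ex_colour_word: "map fst z = reading T \<Longrightarrow> \<exists>cl. z = colour_word T cl"
proof (induction T arbitrary: z)
  case (Cons r T)
  from Cons.prems obtain z1 z2 where z: "z = z1 @ z2" "map fst z1 = reading T" "map fst z2 = r"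
    by (auto simp: map_eq_append_conv)
  from Cons.IH[OF z(2)] obtain cl where cl: "z1 = colour_word T cl" by blast
  have "z2 = map (\<lambda>c. (r ! c, snd (z2 ! c))) [0..<length r]"
    by (rule nth_equalityI) (use z(3) in \<open>auto simp: prod_eq_iff\<close>)
  hence "z = colour_word (r # T) (\<lambda>l c. case l of 0 \<Rightarrow> snd (z2 ! c) | Suc l' \<Rightarrow> cl l' c)"
    using z cl by simp
  thus ?case by blast
qed simp

lemma sorted_rows: "tableau T \<Longrightarrow> \<forall>r\<in>set T. sorted r"
  by (induction T rule: tableau.induct) auto

lemma cell_count_le_greene:
  "tableau T \<Longrightarrow> cell_ok k T cl \<Longrightarrow> cell_count k T cl \<le> word_greene (reading T) k"
  using word_greene_ge[of "colour_word T cl" "reading T" k]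
  by (simp add: kinc_colour_word sorted_rows kval_colour_word)

lemma ex_cell_count_greene:
  "tableau T \<Longrightarrow> \<exists>cl. cell_ok k T cl \<and> cell_count k T cl = word_greene (reading T) k"
  using word_greene_ex[of "reading T" k] ex_colour_word[of _ T] 
  by (metis kinc_colour_word sorted_rows kval_colour_word)

lemma kinc_uncoloured: "kinc k (z1 @ (a, d) # z2) \<Longrightarrow> kinc k (z1 @ z2)"
  "kinc k (z1 @ z2) \<Longrightarrow> k \<le> d \<Longrightarrow> kinc k (z1 @ (a, d) # z2)"
  by (auto simp: kinc_append kinc_Cons)

text \<open>The word without the corner letter is treated as the reading of the whole tableau with
  the corner forbidden, that is, given a colour that is not selected. Row and column arguments for
  tableaux then apply to it.\<close>

lemma skew_count_le_greene:
  assumes "tableau ((a # r) # T)" "cell_ok k ((a # r) # T) cl" "k \<le> cl 0 0"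
  shows "cell_count k ((a # r) # T) cl \<le> word_greene (reading T @ r) k"
proof -
  let ?z1 = "colour_word T (\<lambda>l. cl (Suc l))" and ?z2 = "map (\<lambda>c. (r ! c, cl 0 (Suc c))) [0..<length r]"
  have cw: "colour_word ((a # r) # T) cl = ?z1 @ (a, cl 0 0) # ?z2"
    by (simp add: upt_conv_Cons map_Suc_upt[symmetric] comp_def del: upt_Suc map_Suc_upt)
  have "kinc k (colour_word ((a # r) # T) cl)"
    using assms kinc_colour_word sorted_rows by blast
  hence "kinc k (?z1 @ ?z2)" unfolding cw by (rule kinc_uncoloured)
  from word_greene_ge[OF _ this, of "reading T @ r"]
  have "kval k (?z1 @ ?z2) \<le> word_greene (reading T @ r) k"
    by (simp add: comp_def map_nth)
  moreover have "kval k (?z1 @ ?z2) = cell_count k ((a # r) # T) cl"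
    unfolding kval_colour_word[symmetric] cw using assms(3) by simp
  ultimately show ?thesis by simp
qed

lemma ex_skew_count_greene:
  assumes "tableau ((a # r) # T)"
  shows "\<exists>cl. cell_ok k ((a # r) # T) cl \<and> k \<le> cl 0 0 \<and>
    cell_count k ((a # r) # T) cl = word_greene (reading T @ r) k"
proof -
  obtain z where z: "map fst z = reading T @ r" "kinc k z" "kval k z = word_greene (reading T @ r) k"
    using word_greene_ex by blast
  then obtain z1 z2 where z12: "z = z1 @ z2" "map fst z1 = reading T" "map fst z2 = r"
    by (auto simp: map_eq_append_conv)
  have "map fst (z1 @ (a, k) # z2) = reading ((a # r) # T)" using z12 by simp
  from ex_colour_word[OF this] obtain cl where cl: "z1 @ (a, k) # z2 = colour_word ((a # r) # T) cl" by blast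
  have "length z1 = length (colour_word T (\<lambda>l. cl (Suc l)))"
    using z12(2) map_fst_colour_word[of T "\<lambda>l. cl (Suc l)"] by (metis length_map)
  hence "cl 0 0 = k" using cl by (simp add: upt_conv_Cons del: upt_Suc)
  moreover have "kinc k (z1 @ (a, k) # z2)" using z(2) z12(1) kinc_uncoloured(2) by blast
  hence "cell_ok k ((a # r) # T) cl" unfolding cl using kinc_colour_word sorted_rows assms by blast
  moreover have "cell_count k ((a # r) # T) cl = kval k z"
    unfolding kval_colour_word[symmetric] cl[symmetric] z12(1) by simp
  ultimately show ?thesis using z(3) by auto
qed

text \<open>Chain-antichain duality as a counting bound: a label below \<open>D\<close> singles out
  cells of which no selected chain contains two, so its class contributes at most \<open>k\<close>
  and at most its size. Selected cells with other labels are merely counted.\<close>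

lemma card_le_by_labels:
  fixes f lab :: "'a \<Rightarrow> nat"
  assumes "finite E"
    and inj: "\<And>e e'. e \<in> E \<Longrightarrow> e' \<in> E \<Longrightarrow> e \<noteq> e' \<Longrightarrow> lab e = lab e' \<Longrightarrow> lab e < D \<Longrightarrow> f e < k \<Longrightarrow> f e \<noteq> f e'"
  shows "card {e \<in> E. f e < k} \<le> (\<Sum>d<D. min k (card {e \<in> E. lab e = d})) + card {e \<in> E. f e < k \<and> D \<le> lab e}"
proof -
  have "{e \<in> E. f e < k} = (\<Union>d\<in>{..<D}. {e \<in> E. f e < k \<and> lab e = d}) \<union> {e \<in> E. f e < k \<and> D \<le> lab e}"
    by (auto simp: not_less)
  hence "card {e \<in> E. f e < k} \<le> card (\<Union>d\<in>{..<D}. {e \<in> E. f e < k \<and> lab e = d}) + card {e \<in> E. f e < k \<and> D \<le> lab e}"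
    by (simp add: card_Un_le)
  also have "card (\<Union>d\<in>{..<D}. {e \<in> E. f e < k \<and> lab e = d}) \<le> (\<Sum>d<D. card {e \<in> E. f e < k \<and> lab e = d})"
    by (rule card_UN_le) simp
  also have "\<dots> \<le> (\<Sum>d<D. min k (card {e \<in> E. lab e = d}))"
  proof (rule sum_mono)
    fix d assume "d \<in> {..<D}"
    have "inj_on f {e \<in> E. f e < k \<and> lab e = d}"
      using inj \<open>d \<in> _\<close> unfolding inj_on_def by (metis (mono_tags, lifting) lessThan_iff mem_Collect_eq)
    hence "card {e \<in> E. f e < k \<and> lab e = d} \<le> card {..<k}"
      by (rule card_inj_on_le) auto
    moreover have "card {e \<in> E. f e < k \<and> lab e = d} \<le> card {e \<in> E. lab e = d}"
      using assms(1) by (intro card_mono) auto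
    ultimately show "card {e \<in> E. f e < k \<and> lab e = d} \<le> min k (card {e \<in> E. lab e = d})" by simp
  qed
  finally show ?thesis by simp
qed

text \<open>Double counting of the cells in the first \<open>k\<close> rows, with \<open>F\<close>
  as row lengths.\<close>

lemma sum_conjugate:
  fixes F :: "nat \<Rightarrow> nat"
  assumes "\<And>l. F l \<le> D"
  shows "(\<Sum>d<D. card {l. l < k \<and> d < F l}) = (\<Sum>l<k. F l)"
proof -
  have "(\<Sum>d<D. card {l. l < k \<and> d < F l}) = (\<Sum>d<D. \<Sum>l<k. if d < F l then 1 else 0)"
    by (intro sum.cong refl) (simp add: sum.If_cases Collect_conj_eq lessThan_def)
  also have "\<dots> = (\<Sum>l<k. \<Sum>d<D. if d < F l then 1 else 0)" by (rule sum.swap)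
  also have "\<dots> = (\<Sum>l<k. F l)"
  proof (intro sum.cong refl)
    fix l
    have "{..<D} \<inter> {d. d < F l} = {..<F l}" using assms[of l] by auto
    thus "(\<Sum>d<D. if d < F l then 1 else 0) = F l" by (simp add: sum.If_cases)
  qed
  finally show ?thesis .
qed

lemma min_card_initial:
  fixes F :: "nat \<Rightarrow> nat"
  assumes "antimono F" "finite {l. d < F l}"
  shows "min k (card {l. d < F l}) = card {l. l < k \<and> d < F l}"
proof -
  have down: "l' \<in> {l. d < F l}" if "l' \<le> l" "l \<in> {l. d < F l}" for l l'
    using antimonoD[OF assms(1) that(1)] that(2) by simp
  obtain h where h: "{l. d < F l} = {..<h}"
  proof (cases "{l. d < F l} = {}")
    case True thus ?thesis using that[of 0] by auto
  next
    case False
    have "{l. d < F l} = {..<Suc (Max {l. d < F l})}"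
    proof (intro equalityI subsetI)
      fix l assume "l \<in> {l. d < F l}"
      thus "l \<in> {..<Suc (Max {l. d < F l})}" using Max_ge[OF assms(2)] by (simp add: less_Suc_eq_le)
    next
      fix l assume "l \<in> {..<Suc (Max {l. d < F l})}"
      thus "l \<in> {l. d < F l}" by (intro down[OF _ Max_in[OF assms(2) False]]) (simp add: less_Suc_eq_le)
    qed
    thus ?thesis using that by blast
  qed
  have h': "d < F l \<longleftrightarrow> l < h" for l using h by (metis lessThan_iff mem_Collect_eq)
  have "{l. l < k \<and> d < F l} = {..<min k h}" unfolding h' by auto
  thus ?thesis unfolding h by simp
qed

lemma lt_length_filter_le:
  "sorted r \<Longrightarrow> c < length (filter (\<lambda>a. a \<le> j) r) \<longleftrightarrow> c < length r \<and> r ! c \<le> (j::nat)"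
proof (induction r arbitrary: c)
  case (Cons b r)
  show ?case
  proof (cases "b \<le> j")
    case True thus ?thesis using Cons by (cases c) auto
  next
    case False
    hence "\<forall>x\<in>set r. \<not> x \<le> j" using Cons.prems by auto
    hence *: "filter (\<lambda>a. a \<le> j) (b # r) = []" using False by (simp add: filter_empty_conv)
    have "b \<le> (b # r) ! c" if "c < length (b # r)" using that Cons.prems by (cases c) auto
    thus ?thesis unfolding * using False by fastforce
  qed
qed simp

lemma nth_filter_le:
  "sorted r \<Longrightarrow> c < length (filter (\<lambda>a. a \<le> j) r) \<Longrightarrow> filter (\<lambda>a. a \<le> j) r ! c = r ! (c::nat)"
  for j :: nat
proof (induction r arbitrary: c)
  case (Cons b r)
  show ?case
  proof (cases "b \<le> j")
    case True thus ?thesis using Cons by (cases c) auto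
  next
    case False
    hence "\<forall>x\<in>set r. \<not> x \<le> j" using Cons.prems by auto
    hence "filter (\<lambda>a. a \<le> j) (b # r) = []" using False by (simp add: filter_empty_conv)
    thus ?thesis using Cons.prems by simp
  qed
qed simp

lemma tableau_sorted_nth: "tableau T \<Longrightarrow> l < length T \<Longrightarrow> sorted (T ! l)"
  using sorted_rows by auto

lemma lt_cnt: "tableau T \<Longrightarrow> c < cnt T l j \<longleftrightarrow> l < length T \<and> c < length (T ! l) \<and> T ! l ! c \<le> j"
  by (auto simp: cnt_def lt_length_filter_le tableau_sorted_nth)

lemma cnt_mono: "j \<le> j' \<Longrightarrow> cnt T l j \<le> cnt T l j'"
proof -
  assume "j \<le> j'"
  hence *: "length (filter (\<lambda>a. a \<le> j) r) \<le> length (filter (\<lambda>a. a \<le> j') r)" for r :: "nat list"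
    by (induction r) auto
  show ?thesis unfolding cnt_def using * by auto
qed

lemma tableau_column:
  "tableau T \<Longrightarrow> Suc l < length T \<Longrightarrow> c < length (T ! Suc l) \<Longrightarrow> c < length (T ! l) \<and> T ! l ! c < T ! Suc l ! c"
proof (induction T arbitrary: l rule: tableau.induct)
  case (3 r s T)
  thus ?case by (cases l) (auto simp: below_def)
qed auto

text \<open>A letter at most \<open>j\<close> in row \<open>Suc l\<close> lies under a strictly
  smaller one, so its column is occupied in row \<open>l\<close> one level earlier. This is the
  interlacing of the Gelfand-Tsetlin pattern.\<close>

lemma cnt_Suc_less: "tableau T \<Longrightarrow> cnt T (Suc l) j \<le> cnt T l (j - 1)"
proof (rule ccontr)
  assume T: "tableau T" and "\<not> ?thesis"
  hence "cnt T l (j - 1) < cnt T (Suc l) j" by simp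
  hence 1: "Suc l < length T" "cnt T l (j - 1) < length (T ! Suc l)" "T ! Suc l ! cnt T l (j - 1) \<le> j"
    unfolding lt_cnt[OF T] by auto
  from tableau_column[OF T this(1,2)] 1 have "cnt T l (j - 1) < cnt T l (j - 1)"
    unfolding lt_cnt[OF T, of "cnt T l (j - 1)" l] by auto
  thus False by simp
qed

lemma cnt_interlace: "tableau T \<Longrightarrow> cnt T (Suc l) (Suc j) \<le> cnt T l j"
  using cnt_Suc_less[of T l "Suc j"] by simp

lemma cnt_antimono: "tableau T \<Longrightarrow> antimono (\<lambda>l. cnt T l j)"
  unfolding antimono_iff_le_Suc
  using cnt_interlace cnt_mono[of j "Suc j"] by (meson le_SucI lessI less_imp_le order_trans)

lemma tableau_column_less:
  assumes "tableau T" "l' < l" "c < cnt T l j"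
  shows "T ! l' ! c < T ! l ! c"
  using assms(2,3)
proof (induction l)
  case (Suc l)
  have "Suc l < length T" "c < length (T ! Suc l)" "T ! Suc l ! c \<le> j" using Suc.prems(2) lt_cnt[OF assms(1)] by auto
  from tableau_column[OF assms(1) this(1,2)] have c: "c < length (T ! l)" "T ! l ! c < T ! Suc l ! c" by auto
  hence "c < cnt T l j" using lt_cnt[OF assms(1)] \<open>Suc l < length T\<close> \<open>T ! Suc l ! c \<le> j\<close> by auto
  thus ?case using Suc c(2) by (cases "l' = l") auto
qed simp

lemma tableau_row_mono:
  assumes "tableau T" "c \<le> c'" "c' < cnt T l j"
  shows "T ! l ! c \<le> T ! l ! c'"
proof -
  have "l < length T" "c' < length (T ! l)" using assms lt_cnt by blast+
  thus ?thesis using assms(2) tableau_sorted_nth[OF assms(1)] sorted_nth_mono by blast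
qed

abbreviation restr :: "nat \<Rightarrow> nat list list \<Rightarrow> nat list list" where
  "restr i \<equiv> map (filter (\<lambda>a. a \<le> i))"

lemma reading_restr: "reading (restr i T) = filter (\<lambda>a. a \<le> i) (reading T)"
  by (simp add: filter_concat rev_map)

lemma length_restr_nth: "l < length T \<Longrightarrow> length (restr i T ! l) = cnt T l i"
  by (simp add: cnt_def)

lemma restr_nth: "tableau T \<Longrightarrow> c < cnt T l i \<Longrightarrow> restr i T ! l ! c = T ! l ! c"
  using lt_cnt[of T c l i] by (simp add: nth_filter_le tableau_sorted_nth lt_length_filter_le)

lemma tableau_iff_nth:
  "tableau T \<longleftrightarrow> (\<forall>r\<in>set T. sorted r) \<and> (\<forall>l. Suc l < length T \<longrightarrow> below (T ! l) (T ! Suc l))"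
  by (induction T rule: tableau.induct) (auto simp: nth_Cons less_Suc_eq_0_disj split: nat.split)

lemma tableau_restr: 
  assumes "tableau T" shows "tableau (restr i T)"
proof -
  have "below (restr i T ! l) (restr i T ! Suc l)" if "Suc l < length T" for l
  proof -
    have "cnt T (Suc l) i \<le> cnt T l i" using cnt_antimono[OF assms] by (simp add: antimono_iff_le_Suc)
    thus ?thesis unfolding below_def using that length_restr_nth[of l T i] length_restr_nth[of "Suc l" T i]
      restr_nth[OF assms] tableau_column_less[OF assms lessI, of _ l i]
      by (metis Suc_lessD order_less_le_trans)
  qed
  thus ?thesis unfolding tableau_iff_nth using sorted_rows[OF assms] by (auto simp: sorted_wrt_filter)
qed

lemma cell_count_restr_sum:
  "cell_count k (restr i T) cl = (\<Sum>l<length T. card {c. c < cnt T l i \<and> cl l c < k})"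
  unfolding cell_count_def by (intro sum.cong) (auto simp: length_restr_nth simp del: nth_map)

definition level_cells :: "nat list list \<Rightarrow> nat \<Rightarrow> (nat \<times> nat) set" where
  "level_cells T i = (SIGMA l:{..<length T}. {..<cnt T l i})"

lemma finite_level_cells [simp]: "finite (level_cells T i)"
  by (simp add: level_cells_def)

lemma level_cells_iff: "(l, c) \<in> level_cells T i \<longleftrightarrow> c < cnt T l i"
  by (auto simp: level_cells_def cnt_def split: if_splits)

lemma cell_ok_restr: 
  assumes "tableau T"
  shows "cell_ok k (restr i T) cl \<longleftrightarrow> (\<forall>l c l' c'. c < cnt T l i \<and> c' < cnt T l' i \<and> l' < l \<and>
    cl l c = cl l' c' \<and> cl l c < k \<longrightarrow> T ! l ! c \<le> T ! l' ! c')"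
proof -
  have "l < length T" if "c < cnt T l i" for c l using that by (auto simp: cnt_def split: if_splits)
  thus ?thesis unfolding cell_ok_def using length_restr_nth[of _ T i] restr_nth[OF assms, of _ _ i]
    by (smt (verit) length_map less_trans)
qed

lemma cell_count_restr: 
  "cell_count k (restr i T) cl = card {e \<in> level_cells T i. (\<lambda>(l, c). cl l c) e < k}"
proof -
  have "{e \<in> level_cells T i. (\<lambda>(l, c). cl l c) e < k} = (SIGMA l:{..<length T}. {c. c < cnt T l i \<and> cl l c < k})"
    by (auto simp: level_cells_def)
  also have "card \<dots> = (\<Sum>l<length T. card {c. c < cnt T l i \<and> cl l c < k})" by simp
  also have "\<dots> = cell_count k (restr i T) cl" by (rule cell_count_restr_sum[symmetric])
  finally show ?thesis by simp
qed

lemma sum_cnt_mono_length: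
  "(\<Sum>l<length T. if l < k then cnt T l i else 0) = (\<Sum>l<k. cnt T l i)"
proof -
  have "(\<Sum>l<length T. if l < k then cnt T l i else 0) = (\<Sum>l<min k (length T). cnt T l i)"
    by (rule sum.mono_neutral_cong_right) auto
  also have "\<dots> = (\<Sum>l<k. cnt T l i)"
    by (rule sum.mono_neutral_cong_left) (auto simp: cnt_def)
  finally show ?thesis .
qed

lemma card_rows_of_column:
  assumes "tableau T"
  shows "card {e \<in> level_cells T i. snd e = d} = card {l. d < cnt T l i}"
proof -
  have "{e \<in> level_cells T i. snd e = d} = (\<lambda>l. (l, d)) ` {l. d < cnt T l i}"
    by (auto simp: level_cells_iff)
  thus ?thesis by (simp add: card_image inj_on_def)
qed

lemma finite_rows: "finite {l. d < cnt T l i}"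
  by (rule finite_subset[of _ "{..<length T}"]) (auto simp: cnt_def split: if_splits)

text \<open>From below, the rows are chains. From above, a column is strictly decreasing in reading
  order, so a selected chain meets it at most once; the column lengths, each cut off at
  \<open>k\<close>, add up to the first \<open>k\<close> rows.\<close>

theorem greene_tableau:
  assumes T: "tableau T"
  shows "word_greene (filter (\<lambda>a. a \<le> i) (reading T)) k = (\<Sum>l<k. cnt T l i)"
proof (rule antisym)
  have "cell_ok k (restr i T) (\<lambda>l c. l)" by (auto simp: cell_ok_restr[OF T])
  from cell_count_le_greene[OF tableau_restr[OF T] this]
  have "cell_count k (restr i T) (\<lambda>l c. l) \<le> word_greene (filter (\<lambda>a. a \<le> i) (reading T)) k"
    by (simp add: reading_restr)
  moreover have "cell_count k (restr i T) (\<lambda>l c. l) = (\<Sum>l<length T. if l < k then cnt T l i else 0)"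
    unfolding cell_count_restr_sum by (intro sum.cong) auto
  ultimately show "(\<Sum>l<k. cnt T l i) \<le> word_greene (filter (\<lambda>a. a \<le> i) (reading T)) k"
    by (simp add: sum_cnt_mono_length)
next
  obtain cl where cl: "cell_ok k (restr i T) cl" 
    "cell_count k (restr i T) cl = word_greene (filter (\<lambda>a. a \<le> i) (reading T)) k"
    using ex_cell_count_greene[OF tableau_restr[OF T], of k i] unfolding reading_restr by blast
  let ?D = "cnt T 0 i" and ?f = "\<lambda>(l, c). cl l c"
  have "cell_count k (restr i T) cl \<le> (\<Sum>d<?D. min k (card {e \<in> level_cells T i. snd e = d})) 
     + card {e \<in> level_cells T i. ?f e < k \<and> ?D \<le> snd e}"
    unfolding cell_count_restr
  proof (rule card_le_by_labels)
    fix e e' assume e: "e \<in> level_cells T i" "e' \<in> level_cells T i" "e \<noteq> e'" "snd e = snd e'" "?f e < k"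
    obtain l c l' where le: "e = (l, c)" "e' = (l', c)" using e(4) by (metis prod.collapse)
    have c: "c < cnt T l i" "c < cnt T l' i" using e(1,2) by (simp_all add: le level_cells_iff)
    show "?f e \<noteq> ?f e'"
    proof
      assume eq: "?f e = ?f e'"
      consider "l' < l" | "l < l'" using e(3) le by force
      thus False
      proof cases
        case 1
        have "T ! l ! c \<le> T ! l' ! c" using cl(1) c 1 eq e(5) le unfolding cell_ok_restr[OF T] by force
        thus False using tableau_column_less[OF T 1 c(1)] by simp
      next
        case 2
        have "T ! l' ! c \<le> T ! l ! c" using cl(1) c 2 eq e(5) le unfolding cell_ok_restr[OF T] by force
        thus False using tableau_column_less[OF T 2 c(2)] by simp
      qed
    qed
  qed simp
  also have "{e \<in> level_cells T i. ?f e < k \<and> ?D \<le> snd e} = {}"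
  proof -
    have "snd e < ?D" if "e \<in> level_cells T i" for e
      using antimonoD[OF cnt_antimono[OF T, of i], of 0 "fst e"] that by (cases e) (simp add: level_cells_iff)
    thus ?thesis by (auto simp: not_le)
  qed
  also have "(\<Sum>d<?D. min k (card {e \<in> level_cells T i. snd e = d})) = (\<Sum>d<?D. card {l. l < k \<and> d < cnt T l i})"
    by (simp only: card_rows_of_column[OF T] min_card_initial[OF cnt_antimono[OF T] finite_rows])
  also have "\<dots> = (\<Sum>l<k. cnt T l i)"
    by (rule sum_conjugate) (use antimonoD[OF cnt_antimono[OF T, of i], of 0] in simp)
  finally show "word_greene (filter (\<lambda>a. a \<le> i) (reading T)) k \<le> (\<Sum>l<k. cnt T l i)"
    using cl(2) by simp
qed

section \<open>Greene numbers of a tableau without its corner letter\<close>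

text \<open>\<open>\<kappa> j\<close> is the row in which the jeu de taquin slide into the corner of \<open>T\<close> ends when \<open>T\<close> is
  restricted to the letters up to \<open>j\<close>; its letters are recorded only through \<open>cnt T\<close>.\<close>

locale slide =
  fixes T :: "nat list list" and a :: nat and r T' \<kappa>
  assumes T: "tableau T" and T_eq: "T = (a # r) # T'"
    and a_min: "\<And>b. b \<in> set (reading T) \<Longrightarrow> a \<le> b"
    and \<kappa>_a: "\<kappa> a = 0"
    and \<kappa>_Suc: "\<And>j. a \<le> j \<Longrightarrow>
      \<kappa> (Suc j) = (if cnt T (Suc (\<kappa> j)) (Suc j) = cnt T (\<kappa> j) j then Suc (\<kappa> j) else \<kappa> j)"
begin

lemma entry_ge: "l < length T \<Longrightarrow> c < length (T ! l) \<Longrightarrow> a \<le> T ! l ! c"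
  using nth_mem by (intro a_min) fastforce

lemma cnt_Suc_a: "cnt T (Suc l) a = 0"
proof (rule ccontr)
  assume "\<not> ?thesis"
  hence 0: "0 < cnt T (Suc l) a" by simp
  from tableau_column_less[OF T lessI this] have "T ! l ! 0 < T ! Suc l ! 0" .
  moreover have "T ! Suc l ! 0 \<le> a" "Suc l < length T" "0 < length (T ! Suc l)" using 0 lt_cnt[OF T] by auto
  moreover from this have "a \<le> T ! l ! 0" using tableau_column[OF T, of l 0] by (intro entry_ge) auto
  ultimately show False by simp
qed

lemma cnt_0_a: "0 < cnt T 0 a"
  by (simp add: T_eq)

lemma \<kappa>_step: "a \<le> j \<Longrightarrow> \<kappa> j \<le> \<kappa> (Suc j) \<and> \<kappa> (Suc j) \<le> Suc (\<kappa> j)"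
  by (simp add: \<kappa>_Suc)

lemma \<kappa>_mono: assumes "a \<le> j" "j \<le> j'" shows "\<kappa> j \<le> \<kappa> j'"
  using assms(2)
proof (induction j' rule: dec_induct)
  case (step j') thus ?case using \<kappa>_step[of j'] assms(1) by linarith
qed simp

text \<open>At level \<open>j\<close> the vacancy stands in the last cell of row
  \<open>\<kappa> j\<close>, and nothing lies beneath it, so removing this cell leaves a partition.
  Interlacing preserves this along the recursion for \<open>\<kappa>\<close>.\<close>

lemma outer_corner: "a \<le> j \<Longrightarrow> cnt T (Suc (\<kappa> j)) j < cnt T (\<kappa> j) j"
proof (induction j rule: dec_induct)
  case base show ?case using cnt_0_a cnt_Suc_a by (simp add: \<kappa>_a)
next
  case (step j)
  let ?q = "\<kappa> j"
  show ?case
  proof (cases "cnt T (Suc ?q) (Suc j) = cnt T ?q j")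
    case True
    have "cnt T (Suc (Suc ?q)) (Suc j) \<le> cnt T (Suc ?q) j" by (rule cnt_interlace[OF T])
    thus ?thesis using True step by (simp add: \<kappa>_Suc)
  next
    case False
    have "cnt T (Suc ?q) (Suc j) \<le> cnt T ?q j" by (rule cnt_interlace[OF T])
    moreover have "cnt T ?q j \<le> cnt T ?q (Suc j)" by (rule cnt_mono) simp
    ultimately show ?thesis using False step by (simp add: \<kappa>_Suc)
  qed
qed

text \<open>For a row \<open>l > 0\<close> that the vacancy reaches, this is the letter that the
  slide lifts from row \<open>l\<close> into row \<open>l - 1\<close>, hence the level at which the
  vacancy enters row \<open>l\<close>.\<close>

definition arrival :: "nat \<Rightarrow> nat" where
  "arrival l = (LEAST j. a \<le> j \<and> l \<le> \<kappa> j)"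

lemma arrival_0: "arrival 0 = a"
  unfolding arrival_def by (rule Least_equality) auto

lemma arrival:
  assumes "a \<le> i" "l \<le> \<kappa> i"
  shows "a \<le> arrival l" "arrival l \<le> i" "\<kappa> (arrival l) = l"
    "\<And>j. a \<le> j \<Longrightarrow> j < arrival l \<Longrightarrow> \<kappa> j < l"
proof -
  have "a \<le> arrival l \<and> l \<le> \<kappa> (arrival l)" unfolding arrival_def
    by (rule LeastI[of _ i]) (use assms in simp)
  thus 1: "a \<le> arrival l" and 2: "\<kappa> (arrival l) = l"
  proof -
    assume *: "a \<le> arrival l \<and> l \<le> \<kappa> (arrival l)"
    show "a \<le> arrival l" using * by simp
    show "\<kappa> (arrival l) = l"
    proof (cases "arrival l = a")
      case True thus ?thesis using * \<kappa>_a by simp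
    next
      case False
      then obtain j where j: "arrival l = Suc j" "a \<le> j" using * by (cases "arrival l") auto
      have "\<not> l \<le> \<kappa> j"
        using not_less_Least[of j "\<lambda>j. a \<le> j \<and> l \<le> \<kappa> j"] j unfolding arrival_def by auto
      thus ?thesis using \<kappa>_step[OF j(2)] * j(1) by simp
    qed
  qed
  show "arrival l \<le> i" unfolding arrival_def by (rule Least_le) (use assms in simp)
  show "\<kappa> j < l" if "a \<le> j" "j < arrival l" for j
    using not_less_Least[of j "\<lambda>j. a \<le> j \<and> l \<le> \<kappa> j"] that unfolding arrival_def by auto
qed

lemma arrival_Suc:
  assumes "a \<le> i" "Suc l \<le> \<kappa> i"
  shows "arrival l < arrival (Suc l)" "\<kappa> (arrival (Suc l) - 1) = l"
    "cnt T (Suc l) (arrival (Suc l)) = cnt T l (arrival (Suc l) - 1)"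
proof -
  note A = arrival[OF assms] and B = arrival[OF assms(1), of l]
  have ne: "arrival (Suc l) \<noteq> a" using A(3) \<kappa>_a by auto
  then obtain j where j: "arrival (Suc l) = Suc j" "a \<le> j" using A(1) by (cases "arrival (Suc l)") auto
  have "\<kappa> j < Suc l" using A(4)[OF j(2)] j by simp
  hence kj: "\<kappa> j = l" using \<kappa>_step[OF j(2)] A(3) j(1) by simp
  thus "\<kappa> (arrival (Suc l) - 1) = l" using j by simp
  show "arrival l < arrival (Suc l)"
  proof (rule ccontr)
    assume "\<not> ?thesis"
    hence "arrival (Suc l) \<le> arrival l" by simp
    from \<kappa>_mono[OF A(1) this] show False using A(3) B(3) assms(2) by simp
  qed
  show "cnt T (Suc l) (arrival (Suc l)) = cnt T l (arrival (Suc l) - 1)"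
    using \<kappa>_Suc[OF j(2)] kj A(3) j by (simp split: if_splits)
qed

lemma restr_T: "a \<le> i \<Longrightarrow> restr i T = (a # filter (\<lambda>b. b \<le> i) r) # restr i T'"
  by (simp add: T_eq)

lemma filter_skew: "filter (\<lambda>b. b \<le> i) (reading T' @ r) = reading (restr i T') @ filter (\<lambda>b. b \<le> i) r"
  by (simp add: reading_restr)

lemma cell_nonempty_length: "c < cnt T l i \<Longrightarrow> l < length T"
  by (auto simp: cnt_def split: if_splits)

text \<open>When the vacancy has moved below the first \<open>k\<close> rows, the missing corner
  costs nothing: chain \<open>l\<close> starts with the left part of row \<open>Suc l\<close> and
  continues with the right part of row \<open>l\<close>, both cut where the vacancy passes from row
  \<open>l\<close> to row \<open>Suc l\<close>.\<close>

lemma skew_greene_ge_long: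
  assumes i: "a \<le> i" and k: "k \<le> \<kappa> i"
  shows "(\<Sum>l<k. cnt T l i) \<le> word_greene (filter (\<lambda>b. b \<le> i) (reading T' @ r)) k"
proof (cases "k = 0")
  case False
  \<comment> \<open>\<open>P l\<close> counts the letters of row \<open>l\<close> up to the arrival
    of the vacancy there, \<open>Q l\<close> those before it leaves for row \<open>Suc l\<close>.
    Left of \<open>P l\<close> the letters are at most \<open>arrival l\<close>, from
    \<open>Q l\<close> on they are at least \<open>arrival (Suc l)\<close>, and those between stay
    unselected. As \<open>P (Suc l) = Q l\<close>, chain \<open>l\<close> is as long as row
    \<open>l\<close>.\<close>
  define P where "P l = (if l = 0 then 0 else cnt T l (arrival l))" for l
  define Q where "Q l = (if l < k then cnt T l (arrival (Suc l) - 1) else cnt T l i)" for l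
  define cl where "cl l c = (if c < P l then l - 1 else if l < k \<and> Q l \<le> c then l else k)" for l c
  have PS: "P (Suc l) = Q l" if "l < k" for l
    using arrival_Suc(3)[OF i, of l] that k by (simp add: P_def Q_def)
  have PQ: "P l \<le> Q l" if "l \<le> k" for l
  proof (cases "l < k")
    case True
    have "arrival l \<le> arrival (Suc l) - 1" using arrival_Suc(1)[OF i, of l] True k by simp
    thus ?thesis using True by (auto simp: P_def Q_def intro: cnt_mono)
  next
    case False
    thus ?thesis using arrival(2)[OF i, of l] that k by (auto simp: P_def Q_def intro: cnt_mono)
  qed
  have Qi: "Q l \<le> cnt T l i" if "l \<le> k" for l
    using arrival(2)[OF i, of "Suc l"] that k by (auto simp: Q_def intro!: cnt_mono)
  have Pl: "1 \<le> l" "T ! l ! c \<le> arrival l" if "c < P l" for l c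
    using that lt_cnt[OF T] by (auto simp: P_def split: if_splits)
  have Ql: "arrival (Suc l) \<le> T ! l ! c" if "l < k" "Q l \<le> c" "c < cnt T l i" for l c
    using that lt_cnt[OF T, of c l i] lt_cnt[OF T, of c l "arrival (Suc l) - 1"] by (auto simp: Q_def not_le)
  have ok: "cell_ok k (restr i T) cl" unfolding cell_ok_restr[OF T]
  proof (intro allI impI, elim conjE)
    fix l c l' c' assume a: "c < cnt T l i" "c' < cnt T l' i" "l' < l" "cl l c = cl l' c'" "cl l c < k"
    have 1: "c < P l" "cl l c = l - 1"
      using a Pl(1)[of c' l'] by (auto simp: cl_def split: if_splits)
    have 2: "\<not> c' < P l'" using a 1 Pl(1)[of c l] Pl(1)[of c' l'] by (auto simp: cl_def)
    hence "l' < k" "Q l' \<le> c'" "l = Suc l'" using a 1 Pl(1)[of c l] by (auto simp: cl_def split: if_splits)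
    thus "T ! l ! c \<le> T ! l' ! c'" using Pl(2)[OF 1(1)] Ql[of l' c'] a(2) by simp
  qed
  have cnt_pos: "k < length T"
  proof -
    have "0 < cnt T (\<kappa> i) i" using outer_corner[OF i] by simp
    thus ?thesis using k cell_nonempty_length by fastforce
  qed
  have "cl 0 0 = k"
  proof -
    have "0 < Q 0"
    proof -
      have "a \<le> arrival 1 - 1" using arrival_Suc(1)[OF i, of 0] False k arrival_0 by simp
      from cnt_mono[OF this, of T 0] cnt_0_a False show ?thesis by (simp add: Q_def)
    qed
    thus ?thesis by (simp add: cl_def P_def)
  qed
  have row: "card {c. c < cnt T l i \<and> cl l c < k} \<ge> P l + (if l < k then cnt T l i - Q l else 0)" if "l \<le> k" for l
  proof -
    have "{..<P l} \<union> (if l < k then {Q l..<cnt T l i} else {}) \<subseteq> {c. c < cnt T l i \<and> cl l c < k}"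
      using PQ[OF that] Qi[OF that] that Pl(1)[of _ l] False by (auto simp: cl_def)
    hence "card ({..<P l} \<union> (if l < k then {Q l..<cnt T l i} else {})) \<le> card {c. c < cnt T l i \<and> cl l c < k}"
      by (intro card_mono) auto
    moreover have "card ({..<P l} \<union> (if l < k then {Q l..<cnt T l i} else {})) = P l + (if l < k then cnt T l i - Q l else 0)"
      using PQ[OF that] by (subst card_Un_disjoint) auto
    ultimately show ?thesis by simp
  qed
  have "(\<Sum>l<k. cnt T l i) = (\<Sum>l<k. P (Suc l) + (cnt T l i - Q l))"
    using PS Qi by (intro sum.cong) auto
  also have "\<dots> = (\<Sum>l<k. P (Suc l)) + (\<Sum>l<k. cnt T l i - Q l)" by (rule sum.distrib)
  also have "(\<Sum>l<k. P (Suc l)) = (\<Sum>l<Suc k. P l)"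
    unfolding sum.lessThan_Suc_shift by (simp add: P_def)
  also have "(\<Sum>l<k. cnt T l i - Q l) = (\<Sum>l<Suc k. if l < k then cnt T l i - Q l else 0)" by simp
  also have "(\<Sum>l<Suc k. P l) + (\<Sum>l<Suc k. if l < k then cnt T l i - Q l else 0) =
      (\<Sum>l<Suc k. P l + (if l < k then cnt T l i - Q l else 0))" by (rule sum.distrib[symmetric])
  also have "\<dots> \<le> (\<Sum>l<Suc k. card {c. c < cnt T l i \<and> cl l c < k})"
    using row by (intro sum_mono) (simp only: lessThan_iff less_Suc_eq_le)
  also have "\<dots> \<le> (\<Sum>l<length T. card {c. c < cnt T l i \<and> cl l c < k})"
    using cnt_pos by (intro sum_mono2) auto
  also have "\<dots> = cell_count k (restr i T) cl" by (rule cell_count_restr_sum[symmetric])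
  also have "\<dots> \<le> word_greene (reading (restr i T') @ filter (\<lambda>b. b \<le> i) r) k"
    using skew_count_le_greene[of a "filter (\<lambda>b. b \<le> i) r" "restr i T'" k cl] tableau_restr[OF T, of i] ok \<open>cl 0 0 = k\<close>
    unfolding restr_T[OF i] by simp
  finally show ?thesis unfolding filter_skew .
qed simp

text \<open>The rows are still chains, and only the corner is lost.\<close>

lemma skew_greene_ge_short:
  assumes i: "a \<le> i"
  shows "(\<Sum>l<k. cnt T l i) \<le> Suc (word_greene (filter (\<lambda>b. b \<le> i) (reading T' @ r)) k)"
proof -
  define cl where "cl l c = (if l = 0 \<and> c = 0 then k else l)" for l c :: nat
  have ok: "cell_ok k (restr i T) cl"
    by (auto simp: cell_ok_restr[OF T] cl_def split: if_splits)
  have "(\<Sum>l<k. cnt T l i) = (\<Sum>l<length T. if l < k then cnt T l i else 0)"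
    by (rule sum_cnt_mono_length[symmetric])
  also have "\<dots> \<le> (\<Sum>l<length T. card {c. c < cnt T l i \<and> cl l c < k} + (if l = 0 then 1 else 0))"
  proof (rule sum_mono)
    fix l
    have "{c. c < cnt T l i \<and> cl l c < k} = (if l < k then {..<cnt T l i} - (if l = 0 then {0} else {}) else {})"
      by (auto simp: cl_def)
    thus "(if l < k then cnt T l i else 0) \<le> card {c. c < cnt T l i \<and> cl l c < k} + (if l = 0 then 1 else 0)"
      by (auto simp: card_Diff_singleton_if)
  qed
  also have "\<dots> = cell_count k (restr i T) cl + 1"
    unfolding cell_count_restr_sum sum.distrib by (simp add: T_eq)
  also have "cell_count k (restr i T) cl \<le> word_greene (reading (restr i T') @ filter (\<lambda>b. b \<le> i) r) k"
    using skew_count_le_greene[of a "filter (\<lambda>b. b \<le> i) r" "restr i T'" k cl] tableau_restr[OF T, of i] ok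
    unfolding restr_T[OF i] by (simp add: cl_def)
  finally show ?thesis unfolding filter_skew by simp
qed

lemma ex_skew_colouring:
  assumes i: "a \<le> i"
  obtains cl where "cell_ok k (restr i T) cl" "k \<le> cl 0 0"
    "cell_count k (restr i T) cl = word_greene (filter (\<lambda>b. b \<le> i) (reading T' @ r)) k"
  using ex_skew_count_greene[of a "filter (\<lambda>b. b \<le> i) r" "restr i T'" k] tableau_restr[OF T, of i] 
  unfolding restr_T[OF i] filter_skew by blast

text \<open>A selection that avoids the corner is in particular a selection in the whole
  tableau.\<close>

lemma skew_greene_le_long:
  assumes i: "a \<le> i"
  shows "word_greene (filter (\<lambda>b. b \<le> i) (reading T' @ r)) k \<le> (\<Sum>l<k. cnt T l i)"
proof -
  obtain cl where cl: "cell_ok k (restr i T) cl" 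
    "cell_count k (restr i T) cl = word_greene (filter (\<lambda>b. b \<le> i) (reading T' @ r)) k"
    by (rule ex_skew_colouring[OF i])
  have "cell_count k (restr i T) cl \<le> word_greene (reading (restr i T)) k"
    by (rule cell_count_le_greene[OF tableau_restr[OF T] cl(1)])
  thus ?thesis using cl(2) greene_tableau[OF T] by (simp add: reading_restr)
qed

text \<open>Columns are replaced by sets that follow the slide and are still strictly decreasing in
  reading order: in each row up to \<open>q\<close> the cell where the vacancy enters is taken out,
  and the cells to its right, up to the final column \<open>e\<close>, move one column to the left.
  Column \<open>e\<close>, of length \<open>Suc q\<close>, disappears, while at most
  \<open>q\<close> of the cells taken out can be selected, the corner being forbidden. This loses
  one letter.\<close>

lemma skew_greene_le_short:
  assumes i: "a \<le> i" and k: "\<kappa> i < k"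
  shows "Suc (word_greene (filter (\<lambda>b. b \<le> i) (reading T' @ r)) k) \<le> (\<Sum>l<k. cnt T l i)"
proof -
  obtain cl where cl: "cell_ok k (restr i T) cl" "k \<le> cl 0 0"
    "cell_count k (restr i T) cl = word_greene (filter (\<lambda>b. b \<le> i) (reading T' @ r)) k"
    by (rule ex_skew_colouring[OF i])
  define q where "q = \<kappa> i"
  define e where "e = cnt T q i - 1"
  \<comment> \<open>The column in which the vacancy enters row \<open>l\<close>, namely the last one
    at level \<open>arrival l\<close>; for row 0 it is the corner.\<close>
  define g where "g l = (if l = 0 then 0 else cnt T l (arrival l) - 1)" for l
  define D where "D = cnt T 0 i"
  \<comment> \<open>The label \<open>D\<close>, beyond all columns, marks the cells taken
    out.\<close>
  define lab where "lab = (\<lambda>(l, c). if q < l \<or> c < g l \<or> e < c then c else if c = g l then D else c - 1)"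
  let ?f = "\<lambda>(l, c). cl l c"
  have qk: "q < k" using k by (simp add: q_def)
  have corner: "cnt T (Suc q) i \<le> e" "cnt T q i = Suc e"
    using outer_corner[OF i] by (auto simp: e_def q_def)
  have anti: "cnt T l i \<le> cnt T l' i" if "l' \<le> l" for l l'
    using antimonoD[OF cnt_antimono[OF T] that] .
  have lenq: "e < cnt T l i" if "l \<le> q" for l using anti[OF that] corner(2) by simp
  have lenq': "cnt T l i \<le> e" if "q < l" for l using anti[of "Suc q" l] that corner(1) by simp
  have leD: "cnt T l i \<le> D" for l using anti[of 0 l] by (simp add: D_def)
  have arr_le: "arrival l \<le> arrival (Suc l) - 1" if "Suc l \<le> q" for l
    using arrival_Suc(1)[OF i, of l] that by (simp add: q_def)
  have g_Suc: "g (Suc l) = cnt T l (arrival (Suc l) - 1) - 1" if "Suc l \<le> q" for l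
    using arrival_Suc(3)[OF i, of l] that by (simp add: g_def q_def)
  have g_mono1: "g l \<le> g (Suc l)" if "Suc l \<le> q" for l
    using g_Suc[OF that] cnt_mono[OF arr_le[OF that], of T l] by (auto simp: g_def intro: diff_le_mono)
  have g_mono: "g l \<le> g l'" if "l \<le> l'" "l' \<le> q" for l l'
    using that by (induction l' rule: dec_induct) (auto intro: order_trans[OF _ g_mono1])
  have g_e: "g l \<le> e" if "l \<le> q" for l
  proof -
    have "g q \<le> e" using arrival(2)[OF i, of q] cnt_mono[of "arrival q" i T q] by (auto simp: g_def e_def q_def)
    thus ?thesis using g_mono[OF that order_refl] by simp
  qed
  \<comment> \<open>Between its entry and exit columns in row \<open>\<rho>\<close>, or up to
    \<open>e\<close> in the last row, the vacancy moves right, so the letter to its right is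
    strictly smaller than the one below; a tie would have sent it down.\<close>
  have up: "T ! \<rho> ! Suc d < T ! Suc \<rho> ! d"
    if \<rho>: "\<rho> \<le> q" "g \<rho> \<le> d" "\<rho> = q \<or> d < g (Suc \<rho>)" "d < e" and d: "d < cnt T (Suc \<rho>) i" for \<rho> d
  proof -
    define v where "v = T ! \<rho> ! Suc d"
    have cell: "Suc d < cnt T \<rho> i" using lenq[OF \<rho>(1)] \<rho>(4) by simp
    hence vi: "v \<le> i" "a \<le> v" using lt_cnt[OF T] entry_ge by (auto simp: v_def)
    have ltv: "Suc d < cnt T \<rho> j \<longleftrightarrow> v \<le> j" for j
      using cell lt_cnt[OF T] by (auto simp: v_def)
    have Sd: "T ! Suc \<rho> ! d \<le> j \<longleftrightarrow> d < cnt T (Suc \<rho>) j" for j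
      using d lt_cnt[OF T] by auto
    show ?thesis
    proof (cases "v = a")
      case True
      have "\<not> T ! Suc \<rho> ! d \<le> a" unfolding Sd cnt_Suc_a by simp
      thus ?thesis using True by (simp add: v_def)
    next
      case False
      have arr: "a \<le> arrival \<rho>" "arrival \<rho> \<le> i" "\<kappa> (arrival \<rho>) = \<rho>"
        using arrival[OF i, of \<rho>] \<rho>(1) by (auto simp: q_def)
      have "arrival \<rho> < v"
      proof (cases "\<rho> = 0")
        case True thus ?thesis using False vi(2) arrival_0 by simp
      next
        case False
        hence "\<not> Suc d < cnt T \<rho> (arrival \<rho>)" using \<rho>(2) by (simp add: g_def)
        thus ?thesis unfolding ltv by simp
      qed
      then obtain u where u: "v = Suc u" "arrival \<rho> \<le> u" by (cases v) auto
      have "\<kappa> v \<le> \<rho>"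
      proof (cases "\<rho> = q")
        case True thus ?thesis using \<kappa>_mono[OF vi(2,1)] by (simp add: q_def)
      next
        case False
        hence S: "Suc \<rho> \<le> q" "d < g (Suc \<rho>)" using \<rho> by auto
        hence "Suc d < cnt T \<rho> (arrival (Suc \<rho>) - 1)" using g_Suc[OF S(1)] by simp
        hence "v \<le> arrival (Suc \<rho>) - 1" unfolding ltv .
        from \<kappa>_mono[OF vi(2) this] arrival_Suc(2)[OF i, of \<rho>] S(1) show ?thesis by (simp add: q_def)
      qed
      moreover have "\<rho> \<le> \<kappa> u" using \<kappa>_mono[OF arr(1) u(2)] arr(3) by simp
      moreover have au: "a \<le> u" using arr(1) u(2) by simp
      ultimately have ku: "\<kappa> u = \<rho>" "\<kappa> (Suc u) = \<rho>" using \<kappa>_step[OF au] u(1) by auto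
      hence "cnt T (Suc \<rho>) v \<noteq> cnt T \<rho> u" using \<kappa>_Suc[OF au] u(1) by (auto split: if_splits)
      hence "cnt T (Suc \<rho>) v < cnt T \<rho> u" using cnt_interlace[OF T, of \<rho> u] u(1) by simp
      moreover have "\<not> Suc d < cnt T \<rho> u" unfolding ltv using u(1) by simp
      ultimately have "\<not> T ! Suc \<rho> ! d \<le> v" unfolding Sd by simp
      thus ?thesis by (simp add: v_def)
    qed
  qed
  have dec: "T ! l' ! c' < T ! l ! c" if cells: "c < cnt T l i" "c' < cnt T l' i" and l: "l' < l"
    and lab: "lab (l, c) = lab (l', c')" "lab (l, c) < D" for l c l' c'
  proof (cases "c' \<le> c")
    case True
    have "T ! l' ! c' < T ! l ! c'" using tableau_column_less[OF T l, of c' i] cells(1) True by simp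
    also have "\<dots> \<le> T ! l ! c" by (rule tableau_row_mono[OF T True cells(1)])
    finally show ?thesis .
  next
    case False
    hence c: "c' = Suc c" "\<not> (q < l' \<or> c' < g l' \<or> e < c')" "c' \<noteq> g l'" "q < l \<or> c < g l"
      using lab by (auto simp: lab_def split: if_splits)
    \<comment> \<open>As \<open>g\<close> increases, a label class uses column \<open>Suc c\<close>
      in upper rows and column \<open>c\<close> in lower ones. From \<open>l'\<close> on,
      \<open>\<rho>\<close> is the row right before the change, or \<open>q\<close>.\<close>
    define \<rho> where "\<rho> = (LEAST \<rho>. l' \<le> \<rho> \<and> (\<rho> = q \<or> c < g (Suc \<rho>)))"
    have ex: "l' \<le> q \<and> (q = q \<or> c < g (Suc q))" using c by simp
    have \<rho>1: "l' \<le> \<rho>" "\<rho> = q \<or> c < g (Suc \<rho>)" using LeastI[of "\<lambda>\<rho>. l' \<le> \<rho> \<and> (\<rho> = q \<or> c < g (Suc \<rho>))", OF ex]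
      unfolding \<rho>_def by blast+
    have \<rho>q: "\<rho> \<le> q" unfolding \<rho>_def by (rule Least_le) (rule ex)
    have g\<rho>: "g \<rho> \<le> c"
    proof (cases "\<rho> = l'")
      case True thus ?thesis using c by simp
    next
      case False
      then obtain x where x: "\<rho> = Suc x" "l' \<le> x" using \<rho>1(1) by (cases \<rho>) auto
      have "\<not> (l' \<le> x \<and> (x = q \<or> c < g (Suc x)))"
        using not_less_Least[of x "\<lambda>\<rho>. l' \<le> \<rho> \<and> (\<rho> = q \<or> c < g (Suc \<rho>))"] x(1) unfolding \<rho>_def by simp
      thus ?thesis using x by auto
    qed
    have \<rho>l: "\<rho> < l"
    proof (cases "q < l")
      case False
      then obtain x where x: "l = Suc x" using l by (cases l) auto
      have "\<rho> \<le> x" unfolding \<rho>_def by (rule Least_le) (use c False x l in auto)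
      thus ?thesis using x by simp
    qed (use \<rho>q in simp)
    have "c < e" using c by simp
    have cS: "c < cnt T (Suc \<rho>) i" using anti[of "Suc \<rho>" l] \<rho>l cells(1) by simp
    have "T ! l' ! c' \<le> T ! \<rho> ! c'"
      using tableau_column_less[OF T, of l' \<rho> c' i] \<rho>1(1) lenq[OF \<rho>q] c(1) \<open>c < e\<close>
      by (cases "l' = \<rho>") auto
    also have "\<dots> < T ! Suc \<rho> ! c" unfolding c(1) using up[OF \<rho>q g\<rho> \<rho>1(2) \<open>c < e\<close> cS] .
    also have "\<dots> \<le> T ! l ! c" using tableau_column_less[OF T, of "Suc \<rho>" l c i] \<rho>l cells(1)
      by (cases "Suc \<rho> = l") auto
    finally show ?thesis .
  qed
  have inj_row: "c = c'" if "lab (l, c) = lab (l, c')" "lab (l, c) < D" for l c c'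
    using that g_e[of l] by (auto simp: lab_def split: if_splits)
  have labD: "lab (l, c) = D \<longleftrightarrow> l \<le> q \<and> c = g l" if "c < cnt T l i" for l c
    using that leD[of l] g_e[of l] by (auto simp: lab_def)
  have lab_le: "lab (l, c) \<le> D" if "c < cnt T l i" for l c
    using that leD[of l] by (auto simp: lab_def)
  have lab_lt: "lab (l, c) < cnt T l i" if "c < cnt T l i" "lab (l, c) < D" for l c
    using that by (auto simp: lab_def split: if_splits)
  have lab_e: "lab (l, c) \<noteq> e" if "c < cnt T l i" for l c
    using that lenq'[of l] lenq[of 0] g_e[of l] by (cases "q < l") (auto simp: lab_def D_def split: if_splits)
  have E1: "card {x \<in> level_cells T i. ?f x < k} \<le> (\<Sum>d<D. min k (card {x \<in> level_cells T i. lab x = d})) 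
     + card {x \<in> level_cells T i. ?f x < k \<and> D \<le> lab x}"
  proof (rule card_le_by_labels)
    fix x x' assume x: "x \<in> level_cells T i" "x' \<in> level_cells T i" "x \<noteq> x'" "lab x = lab x'" "lab x < D" "?f x < k"
    obtain l c l' c' where [simp]: "x = (l, c)" "x' = (l', c')" by fastforce
    have cells: "c < cnt T l i" "c' < cnt T l' i" using x(1,2) by (simp_all add: level_cells_iff)
    consider "l = l'" | "l' < l" | "l < l'" by linarith
    thus "?f x \<noteq> ?f x'"
    proof cases
      case 1 thus ?thesis using inj_row[of l c c'] x by auto
    next
      case 2
      from dec[OF cells this] x show ?thesis using cl(1) 2 cells unfolding cell_ok_restr[OF T] by fastforce
    next
      case 3
      from dec[OF cells(2,1) this] x show ?thesis using cl(1) 3 cells unfolding cell_ok_restr[OF T] by fastforce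
    qed
  qed simp
  have E2: "card {x \<in> level_cells T i. ?f x < k \<and> D \<le> lab x} \<le> q"
  proof -
    have "{x \<in> level_cells T i. ?f x < k \<and> D \<le> lab x} \<subseteq> (\<lambda>l. (l, g l)) ` {1..q}"
    proof
      fix x assume "x \<in> {x \<in> level_cells T i. ?f x < k \<and> D \<le> lab x}"
      moreover obtain l c where [simp]: "x = (l, c)" by fastforce
      ultimately have x: "c < cnt T l i" "cl l c < k" "D \<le> lab (l, c)" by (auto simp: level_cells_iff)
      hence "l \<le> q" "c = g l" using labD[of c l] lab_le[of c l] by auto
      moreover have "l \<noteq> 0" using \<open>c = g l\<close> x(2) cl(2) by (cases "l = 0") (auto simp: g_def)
      ultimately show "x \<in> (\<lambda>l. (l, g l)) ` {1..q}" by auto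
    qed
    from surj_card_le[OF _ this] show ?thesis by simp
  qed
  have E3: "(\<Sum>d<D. min k (card {x \<in> level_cells T i. lab x = d})) 
     \<le> (\<Sum>d<D. if d = e then 0 else card {l. l < k \<and> d < cnt T l i})"
  proof (rule sum_mono)
    fix d assume "d \<in> {..<D}"
    show "min k (card {x \<in> level_cells T i. lab x = d}) \<le> (if d = e then 0 else card {l. l < k \<and> d < cnt T l i})"
    proof (cases "d = e")
      case True
      hence no: "{x \<in> level_cells T i. lab x = d} = {}" using lab_e by (auto simp: level_cells_iff)
      show ?thesis unfolding no using True by simp
    next
      case False
      have "inj_on fst {x \<in> level_cells T i. lab x = d}"
        using inj_row \<open>d \<in> _\<close> by (fastforce simp: inj_on_def)
      moreover have "fst ` {x \<in> level_cells T i. lab x = d} \<subseteq> {l. d < cnt T l i}"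
        using lab_lt \<open>d \<in> _\<close> by (auto simp: level_cells_iff)
      ultimately have "card {x \<in> level_cells T i. lab x = d} \<le> card {l. d < cnt T l i}"
        using finite_rows by (rule card_inj_on_le)
      hence "min k (card {x \<in> level_cells T i. lab x = d}) \<le> min k (card {l. d < cnt T l i})" by simp
      also have "\<dots> = card {l. l < k \<and> d < cnt T l i}"
        by (rule min_card_initial[OF cnt_antimono[OF T] finite_rows])
      finally show ?thesis using False by simp
    qed
  qed
  have E4: "(\<Sum>d<D. if d = e then 0 else card {l. l < k \<and> d < cnt T l i}) + Suc q
      = (\<Sum>d<D. card {l. l < k \<and> d < cnt T l i})"
  proof -
    have "e < D" using lenq[of 0] by (simp add: D_def)
    moreover have "{l. l < k \<and> e < cnt T l i} = {..q}"
      using lenq lenq' qk by (auto simp: not_le[symmetric])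
    hence "card {l. l < k \<and> e < cnt T l i} = Suc q" by simp
    ultimately show ?thesis by (simp add: sum.remove[of "{..<D}" e])
  qed
  have E5: "(\<Sum>d<D. card {l. l < k \<and> d < cnt T l i}) = (\<Sum>l<k. cnt T l i)" by (rule sum_conjugate[OF leD])
  show ?thesis using E1 E2 E3 E4 E5 cl(3) unfolding cell_count_restr by linarith
qed

text \<open>The Greene numbers of the word without the corner letter are those of the row lengths
  with one cell removed from row \<open>\<kappa> i\<close>, which is the shape after the
  slide.\<close>

theorem skew_greene:
  assumes "a \<le> i"
  shows "word_greene (filter (\<lambda>b. b \<le> i) (reading T' @ r)) k + (if \<kappa> i < k then 1 else 0) = (\<Sum>l<k. cnt T l i)"
  using skew_greene_ge_long[OF assms, of k] skew_greene_ge_short[OF assms, of k]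
    skew_greene_le_long[OF assms, of k] skew_greene_le_short[OF assms, of k] by auto

end

section \<open>Greene--Kleitman shapes of interval multisets\<close>

definition comparable :: "nat \<times> nat \<Rightarrow> nat \<times> nat \<Rightarrow> bool" where
  "comparable x y \<longleftrightarrow> (fst x \<le> fst y \<and> snd x \<le> snd y) \<or> (fst y \<le> fst x \<and> snd y \<le> snd x)"

text \<open>Colours sit on the elements of a multiset, so copies of an interval are coloured
  independently; \<open>comparable\<close> is reflexive, and copies fit into one chain.\<close>

definition chain_coloured :: "nat \<Rightarrow> ((nat \<times> nat) \<times> nat) multiset \<Rightarrow> bool" where
  "chain_coloured k Z \<longleftrightarrow> (\<forall>z\<in>#Z. \<forall>z'\<in>#Z. snd z = snd z' \<longrightarrow> snd z < k \<longrightarrow> comparable (fst z) (fst z'))"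

definition greene :: "(nat \<times> nat) multiset \<Rightarrow> nat \<Rightarrow> nat" where
  "greene M k = Max {size {#z \<in># Z. snd z < k#} | Z. image_mset fst Z = M \<and> chain_coloured k Z}"

lemma greene_set:
  "finite {size {#z \<in># Z. snd z < k#} | Z. image_mset fst Z = M \<and> chain_coloured k Z}"
  "{size {#z \<in># Z. snd z < k#} | Z. image_mset fst Z = M \<and> chain_coloured k Z} \<noteq> {}"
proof -
  have "size {#z \<in># Z. snd z < k#} \<le> size (image_mset fst Z)" for Z :: "((nat \<times> nat) \<times> nat) multiset"
    by (simp add: size_filter_mset_lesseq)
  hence "{size {#z \<in># Z. snd z < k#} | Z. image_mset fst Z = M \<and> chain_coloured k Z} \<subseteq> {..size M}" by auto
  thus "finite {size {#z \<in># Z. snd z < k#} | Z. image_mset fst Z = M \<and> chain_coloured k Z}"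
    by (rule finite_subset) simp
  have "chain_coloured k (image_mset (\<lambda>x. (x, k)) M)" by (auto simp: chain_coloured_def)
  moreover have "image_mset fst (image_mset (\<lambda>x. (x, k)) M) = M" by (simp add: multiset.map_comp comp_def)
  ultimately show "{size {#z \<in># Z. snd z < k#} | Z. image_mset fst Z = M \<and> chain_coloured k Z} \<noteq> {}" by blast
qed

lemma greene_ge: "image_mset fst Z = M \<Longrightarrow> chain_coloured k Z \<Longrightarrow> size {#z \<in># Z. snd z < k#} \<le> greene M k"
  unfolding greene_def by (rule Max_ge[OF greene_set(1)]) blast

lemma greene_ex: "\<exists>Z. image_mset fst Z = M \<and> chain_coloured k Z \<and> size {#z \<in># Z. snd z < k#} = greene M k"
  using Max_in[OF greene_set, of k M] unfolding greene_def[symmetric] by auto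

lemma ex_list_image_mset: "image_mset f Z = mset xs \<Longrightarrow> \<exists>zs. mset zs = Z \<and> map f zs = xs"
proof (induction xs arbitrary: Z)
  case (Cons x xs)
  have "x \<in># image_mset f Z" using Cons.prems by simp
  then obtain z where z: "z \<in># Z" "f z = x" by auto
  then obtain Z' where Z': "Z = add_mset z Z'" using multi_member_split by metis
  from Cons.prems have "image_mset f Z' = mset xs" using z Z' by simp
  from Cons.IH[OF this] obtain zs where "mset zs = Z'" "map f zs = xs" by blast
  thus ?case using z Z' by (intro exI[of _ "z # zs"]) simp
qed simp

lemma comparable_sym: "comparable x y \<longleftrightarrow> comparable y x"
  by (auto simp: comparable_def)

lemma comparable_refl [simp]: "comparable x x"
  by (simp add: comparable_def)

text \<open>Under the order hypothesis the same colourings describe families of chains and families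
  of weakly increasing subsequences. This turns two-dimensional chains into words.\<close>

lemma greene_word:
  assumes "sorted_wrt (\<lambda>x y. comparable x y \<longleftrightarrow> \<phi> x \<le> \<phi> y) xs"
  shows "greene (mset xs) k = word_greene (map \<phi> xs) k"
proof (rule antisym)
  obtain Z where Z: "image_mset fst Z = mset xs" "chain_coloured k Z" "size {#z \<in># Z. snd z < k#} = greene (mset xs) k"
    using greene_ex by blast
  obtain zs where zs: "mset zs = Z" "map fst zs = xs" using ex_list_image_mset[OF Z(1)] by blast
  let ?z = "map (\<lambda>z. (\<phi> (fst z), snd z)) zs"
  have "sorted_wrt (\<lambda>z z'. comparable (fst z) (fst z') \<longleftrightarrow> \<phi> (fst z) \<le> \<phi> (fst z')) zs"
    using assms unfolding zs(2)[symmetric] sorted_wrt_map .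
  hence "sorted_wrt (\<lambda>z z'. snd z = snd z' \<and> snd z < k \<longrightarrow> \<phi> (fst z) \<le> \<phi> (fst z')) zs"
  proof (rule sorted_wrt_mono_rel[rotated])
    fix z z' assume "z \<in> set zs" "z' \<in> set zs" "comparable (fst z) (fst z') \<longleftrightarrow> \<phi> (fst z) \<le> \<phi> (fst z')"
    moreover from this have "z \<in># Z" "z' \<in># Z" using zs(1) by auto
    ultimately show "snd z = snd z' \<and> snd z < k \<longrightarrow> \<phi> (fst z) \<le> \<phi> (fst z')"
      using Z(2) unfolding chain_coloured_def by blast
  qed
  hence "kinc k ?z" unfolding kinc_def sorted_wrt_map by simp
  from word_greene_ge[OF _ this, of "map \<phi> xs"] have "kval k ?z \<le> word_greene (map \<phi> xs) k"
    by (simp add: zs(2)[symmetric] comp_def)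
  moreover have "kval k ?z = size {#z \<in># Z. snd z < k#}"
    unfolding kval_def zs(1)[symmetric] mset_filter[symmetric] size_mset filter_map by (simp add: comp_def)
  ultimately show "greene (mset xs) k \<le> word_greene (map \<phi> xs) k" using Z(3) by simp
next
  obtain z where z: "map fst z = map \<phi> xs" "kinc k z" "kval k z = word_greene (map \<phi> xs) k"
    using word_greene_ex by blast
  have len: "length z = length xs" using z(1) by (metis length_map)
  let ?Z = "mset (zip xs (map snd z))"
  have fstz: "fst (z ! p) = \<phi> (xs ! p)" if "p < length xs" for p
    using that z(1) len by (metis nth_map)
  have cmp: "comparable (xs ! p) (xs ! q)" if "p < q" "q < length xs" "snd (z ! p) = snd (z ! q)" "snd (z ! p) < k" for p q
  proof -
    have "fst (z ! p) \<le> fst (z ! q)" using z(2) that len unfolding kinc_def sorted_wrt_iff_nth_less by simp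
    thus ?thesis using assms that fstz[of p] fstz[of q] unfolding sorted_wrt_iff_nth_less by simp
  qed
  have "chain_coloured k ?Z" unfolding chain_coloured_def
  proof (intro ballI impI)
    fix u u' assume u: "u \<in># ?Z" "u' \<in># ?Z" "snd u = snd u'" "snd u < k"
    obtain p where p: "p < length xs" "u = (xs ! p, snd (z ! p))" using u(1) len by (auto simp: in_set_conv_nth)
    obtain q where q: "q < length xs" "u' = (xs ! q, snd (z ! q))" using u(2) len by (auto simp: in_set_conv_nth)
    show "comparable (fst u) (fst u')"
      using cmp[of p q] cmp[of q p] p q u(3,4) comparable_sym by (cases p q rule: linorder_cases) auto
  qed
  moreover have "image_mset fst ?Z = mset xs" using len by (simp flip: mset_map)
  ultimately have "size {#u \<in># ?Z. snd u < k#} \<le> greene (mset xs) k" by (intro greene_ge)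
  moreover have "size {#u \<in># ?Z. snd u < k#} = kval k z"
  proof -
    have "size {#u \<in># ?Z. snd u < k#} = length (filter (\<lambda>c. c < k) (map snd (zip xs (map snd z))))"
      by (simp add: filter_map comp_def flip: mset_filter)
    also have "\<dots> = kval k z" using len by (simp add: kval_def filter_map comp_def)
    finally show ?thesis .
  qed
  ultimately show "word_greene (map \<phi> xs) k \<le> greene (mset xs) k" using z(3) by simp
qed

lemma ex_sorted_wrt_list:
  assumes "\<And>x y. R x y \<or> R y x" "\<And>x y z. R x y \<Longrightarrow> R y z \<Longrightarrow> R x z"
  shows "\<exists>xs. mset xs = M \<and> sorted_wrt R xs"
proof (induction M)
  case (add x M)
  then obtain xs where xs: "mset xs = M" "sorted_wrt R xs" by blast
  let ?A = "filter (\<lambda>y. R y x) xs" and ?B = "filter (\<lambda>y. \<not> R y x) xs"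
  have "sorted_wrt R (?A @ x # ?B)"
    using xs(2) assms unfolding sorted_wrt_append sorted_wrt.simps
    by (auto intro: sorted_wrt_filter) blast+
  moreover have "mset (?A @ x # ?B) = add_mset x M" using xs(1) by (simp flip: multiset_partition)
  ultimately show ?case by blast
qed simp

section \<open>Shapes at the vertices as rows of Gelfand-Tsetlin patterns\<close>

definition lev :: "(nat \<times> nat) multiset \<Rightarrow> nat \<Rightarrow> (nat \<times> nat) multiset" where
  "lev M i = {#x \<in># M. fst x \<le> i \<and> i \<le> snd x#}"

text \<open>For multisets in \<open>PQ n m\<close> the truncated difference is a genuine one:
  \<open>shape_sum_antimono\<close> shows that these numbers form a partition with the Greene
  numbers as partial sums.\<close>

definition shape :: "(nat \<times> nat) multiset \<Rightarrow> nat \<Rightarrow> nat \<Rightarrow> nat" where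
  "shape M i k = greene (lev M i) (Suc k) - greene (lev M i) k"

text \<open>Listed in this order, the intervals containing \<open>i \<le> m\<close> are those whose left endpoint is a letter
  up to \<open>i\<close>, and chains are weakly increasing subsequences of left endpoints; \<open>right_order\<close> does the
  same for \<open>i \<ge> m\<close> with the reversed right endpoints.\<close>

definition left_order :: "nat \<times> nat \<Rightarrow> nat \<times> nat \<Rightarrow> bool" where
  "left_order x y \<longleftrightarrow> snd x < snd y \<or> snd x = snd y \<and> fst x \<le> fst y"

definition right_order :: "nat \<times> nat \<Rightarrow> nat \<times> nat \<Rightarrow> bool" where
  "right_order x y \<longleftrightarrow> fst y < fst x \<or> fst y = fst x \<and> snd y \<le> snd x"

lemma ex_left_list: "\<exists>xs. mset xs = M \<and> sorted_wrt left_order xs"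
  by (rule ex_sorted_wrt_list) (auto simp: left_order_def)

lemma ex_right_list: "\<exists>xs. mset xs = M \<and> sorted_wrt right_order xs"
  by (rule ex_sorted_wrt_list) (auto simp: right_order_def)

lemma greene_left:
  assumes "sorted_wrt left_order us" "\<forall>x\<in>set us. i \<le> snd x"
  shows "greene (lev (mset us) i) k = word_greene (filter (\<lambda>a. a \<le> i) (map fst us)) k"
proof -
  let ?us = "filter (\<lambda>x. fst x \<le> i) us"
  have 1: "lev (mset us) i = mset ?us"
    unfolding lev_def mset_filter by (rule filter_mset_cong) (use assms(2) in auto)
  have 2: "sorted_wrt (\<lambda>x y. comparable x y \<longleftrightarrow> fst x \<le> fst y) ?us"
    by (rule sorted_wrt_mono_rel[OF _ sorted_wrt_filter[OF assms(1)]]) (auto simp: comparable_def left_order_def)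
  show ?thesis unfolding 1 greene_word[OF 2] by (simp add: filter_map comp_def)
qed

text \<open>The letter \<open>Suc n - snd x\<close> reverses right endpoints, so containing
  \<open>j\<close> means having a letter at most \<open>Suc n - j\<close>.\<close>

lemma greene_right:
  assumes "sorted_wrt right_order vs" "\<forall>x\<in>set vs. fst x \<le> j \<and> snd x \<le> n" "j \<le> Suc n"
  shows "greene (lev (mset vs) j) k = word_greene (filter (\<lambda>a. a \<le> Suc n - j) (map (\<lambda>x. Suc n - snd x) vs)) k"
proof -
  let ?vs = "filter (\<lambda>x. Suc n - snd x \<le> Suc n - j) vs"
  have 1: "lev (mset vs) j = mset ?vs"
    unfolding lev_def mset_filter by (rule filter_mset_cong) (use assms(2,3) in auto)
  have 2: "sorted_wrt (\<lambda>x y. comparable x y \<longleftrightarrow> Suc n - snd x \<le> Suc n - snd y) ?vs"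
    by (rule sorted_wrt_mono_rel[OF _ sorted_wrt_filter[OF assms(1)]])
      (use assms(2) in \<open>auto simp: comparable_def right_order_def\<close>)
  show ?thesis unfolding 1 greene_word[OF 2] by (simp add: filter_map comp_def)
qed

lemma shape_tableau:
  assumes "\<And>k. greene (lev M i) k = word_greene (filter (\<lambda>a. a \<le> c) w) k" "knuth_equiv w (reading T)" "tableau T"
  shows "shape M i k = cnt T k c" "(\<Sum>l<k. shape M i l) = greene (lev M i) k"
proof -
  have g: "greene (lev M i) k = (\<Sum>l<k. cnt T l c)" for k
    using assms(1) knuth_equiv_greene[OF knuth_equiv_filter[OF assms(2)]] greene_tableau[OF assms(3)] by simp
  show s: "shape M i k = cnt T k c" for k by (simp add: shape_def g)
  show "(\<Sum>l<k. shape M i l) = greene (lev M i) k" by (simp add: s g)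
qed

lemma mem_PQ_iff: "x \<in> PQ n m \<longleftrightarrow> 1 \<le> fst x \<and> fst x \<le> m \<and> m \<le> snd x \<and> snd x \<le> n"
  by (cases x) (simp add: PQ_def)

text \<open>One tableau serves all vertices up to \<open>m\<close>: every interval reaches
  \<open>m\<close>, so passing to a lower vertex only discards large left endpoints.\<close>

lemma left_tableau:
  assumes "\<forall>x\<in>#M. x \<in> PQ n m"
  obtains T where "tableau T" "\<And>i k. i \<le> m \<Longrightarrow> shape M i k = cnt T k i"
    "\<And>i k. i \<le> m \<Longrightarrow> (\<Sum>l<k. shape M i l) = greene (lev M i) k" "\<And>a. a \<in> set (reading T) \<Longrightarrow> 1 \<le> a"
proof -
  obtain us where us: "mset us = M" "sorted_wrt left_order us" using ex_left_list by blast
  obtain T where T: "tableau T" "knuth_equiv (map fst us) (reading T)" using ex_tableau by blast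
  have "\<forall>x\<in>set us. i \<le> snd x" if "i \<le> m" for i
    using assms that unfolding us(1)[symmetric] mem_PQ_iff by fastforce
  note S = shape_tableau[OF greene_left[OF us(2) this, unfolded us(1)] T(2,1)]
  show ?thesis
  proof
    fix a assume "a \<in> set (reading T)"
    hence "a \<in> set (map fst us)" using knuth_equiv_set[OF T(2)] by simp
    thus "1 \<le> a" using assms us(1) by (auto simp: mem_PQ_iff)
  qed (use T(1) S in auto)
qed

lemma right_tableau:
  assumes "\<forall>x\<in>#M. x \<in> PQ n m"
  obtains T where "tableau T" "\<And>j k. m \<le> j \<Longrightarrow> j \<le> Suc n \<Longrightarrow> shape M j k = cnt T k (Suc n - j)"
    "\<And>j k. m \<le> j \<Longrightarrow> j \<le> Suc n \<Longrightarrow> (\<Sum>l<k. shape M j l) = greene (lev M j) k" 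
    "\<And>a. a \<in> set (reading T) \<Longrightarrow> 1 \<le> a"
proof -
  obtain vs where vs: "mset vs = M" "sorted_wrt right_order vs" using ex_right_list by blast
  obtain T where T: "tableau T" "knuth_equiv (map (\<lambda>x. Suc n - snd x) vs) (reading T)" using ex_tableau by blast
  have "\<forall>x\<in>set vs. fst x \<le> j \<and> snd x \<le> n" if "m \<le> j" for j
    using assms that unfolding vs(1)[symmetric] mem_PQ_iff by fastforce
  note S = shape_tableau[OF greene_right[OF vs(2) this, unfolded vs(1)] T(2,1)]
  show ?thesis
  proof
    fix a assume "a \<in> set (reading T)"
    hence "a \<in> set (map (\<lambda>x. Suc n - snd x) vs)" using knuth_equiv_set[OF T(2)] by simp
    then obtain x where "x \<in># M" "a = Suc n - snd x" using vs(1) by auto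
    thus "1 \<le> a" using assms by (simp add: mem_PQ_iff Suc_le_eq less_Suc_eq_le)
  qed (use T(1) S in auto)
qed

text \<open>Columns increase strictly from entries that are at least 1, so the letters of row
  \<open>l\<close>, counted from 0, exceed \<open>l\<close>.\<close>

lemma cnt_vanish:
  assumes "tableau T" "\<And>a. a \<in> set (reading T) \<Longrightarrow> 1 \<le> a" "j \<le> l"
  shows "cnt T l j = 0"
  using assms(3)
proof (induction l arbitrary: j)
  case 0
  have "1 \<le> T ! 0 ! 0" if "0 < length T" "0 < length (T ! 0)"
    by (rule assms(2)) (use that nth_mem in fastforce)
  hence "\<not> 0 < cnt T 0 0" using lt_cnt[OF assms(1), of 0 0 0] by auto
  thus ?case using 0 by simp
next
  case (Suc l)
  show ?case
  proof (cases j)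
    case 0
    have "cnt T (Suc l) 0 \<le> cnt T l 0" using cnt_Suc_less[OF assms(1), of l 0] by simp
    thus ?thesis using Suc.IH[of 0] 0 by simp
  next
    case (Suc j')
    thus ?thesis using cnt_interlace[OF assms(1), of l j'] Suc.IH[of j'] Suc.prems by simp
  qed
qed

lemma lev_lev: "\<forall>x\<in>#M. x \<in> PQ n m \<Longrightarrow> lev (lev M i) m = lev M i"
  unfolding lev_def filter_filter_mset by (rule filter_mset_cong) (auto simp: mem_PQ_iff)

lemma lev_PQ: "\<forall>x\<in>#M. x \<in> PQ n m \<Longrightarrow> \<forall>x\<in>#lev M i. x \<in> PQ n m"
  by (simp add: lev_def)

text \<open>All intervals contain \<open>m\<close>, so the shape at \<open>i\<close> is the shape at
  \<open>m\<close> of a smaller multiset. The two bounds on the number of parts at \<open>m\<close>,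
  one from each tableau, thereby hold at every vertex.\<close>

lemma shape_lev: "\<forall>x\<in>#M. x \<in> PQ n m \<Longrightarrow> shape M i k = shape (lev M i) m k"
  unfolding shape_def using lev_lev by simp

lemma shape_vanish:
  assumes "\<forall>x\<in>#M. x \<in> PQ n m" "m \<le> n"
  shows "m \<le> k \<Longrightarrow> shape M i k = 0" "Suc n - m \<le> k \<Longrightarrow> shape M i k = 0"
    "i \<le> m \<Longrightarrow> i \<le> k \<Longrightarrow> shape M i k = 0"
    "m \<le> i \<Longrightarrow> i \<le> n \<Longrightarrow> Suc n - i \<le> k \<Longrightarrow> shape M i k = 0"
proof -
  show "shape M i k = 0" if "m \<le> k"
  proof -
    obtain T where "tableau T" "\<And>j k. j \<le> m \<Longrightarrow> shape (lev M i) j k = cnt T k j" "\<And>a. a \<in> set (reading T) \<Longrightarrow> 1 \<le> a"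
      using left_tableau[OF lev_PQ[OF assms(1)]] by metis
    thus ?thesis using shape_lev[OF assms(1)] cnt_vanish that by simp
  qed
  show "shape M i k = 0" if "Suc n - m \<le> k"
  proof -
    obtain T where "tableau T" "\<And>j k. m \<le> j \<Longrightarrow> j \<le> Suc n \<Longrightarrow> shape (lev M i) j k = cnt T k (Suc n - j)" "\<And>a. a \<in> set (reading T) \<Longrightarrow> 1 \<le> a"
      using right_tableau[OF lev_PQ[OF assms(1)]] by metis
    thus ?thesis using shape_lev[OF assms(1)] cnt_vanish that assms(2) by simp
  qed
  show "shape M i k = 0" if "i \<le> m" "i \<le> k"
    using left_tableau[OF assms(1)] cnt_vanish that by metis
  show "shape M i k = 0" if "m \<le> i" "i \<le> n" "Suc n - i \<le> k"
    using right_tableau[OF assms(1)] cnt_vanish that by (metis le_SucI)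
qed

lemma shape_interlace:
  assumes "\<forall>x\<in>#M. x \<in> PQ n m"
  shows "i < m \<Longrightarrow> shape M i k \<le> shape M (Suc i) k" "i < m \<Longrightarrow> shape M (Suc i) (Suc k) \<le> shape M i k"
    "m \<le> i \<Longrightarrow> i \<le> n \<Longrightarrow> shape M (Suc i) k \<le> shape M i k" "m \<le> i \<Longrightarrow> i \<le> n \<Longrightarrow> shape M i (Suc k) \<le> shape M (Suc i) k"
proof -
  obtain T where T: "tableau T" "\<And>i k. i \<le> m \<Longrightarrow> shape M i k = cnt T k i" using left_tableau[OF assms] by metis
  show "shape M i k \<le> shape M (Suc i) k" if "i < m" using T that by (simp add: cnt_mono)
  show "shape M (Suc i) (Suc k) \<le> shape M i k" if "i < m" using T that by (simp add: cnt_interlace)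
  obtain T where T: "tableau T" "\<And>j k. m \<le> j \<Longrightarrow> j \<le> Suc n \<Longrightarrow> shape M j k = cnt T k (Suc n - j)"
    using right_tableau[OF assms] by metis
  show "shape M (Suc i) k \<le> shape M i k" if "m \<le> i" "i \<le> n" using T that by (simp add: cnt_mono)
  show "shape M i (Suc k) \<le> shape M (Suc i) k" if "m \<le> i" "i \<le> n" 
    using T that by (simp add: cnt_interlace Suc_diff_le)
qed

lemma shape_sum_antimono:
  assumes "\<forall>x\<in>#M. x \<in> PQ n m" "m \<le> n" "i \<le> n"
  shows "antimono (shape M i)" "(\<Sum>l<k. shape M i l) = greene (lev M i) k"
proof -
  have "antimono (shape M i) \<and> (\<Sum>l<k. shape M i l) = greene (lev M i) k"
  proof (cases "i \<le> m")
    case True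
    obtain T where T: "tableau T" "\<And>k. shape M i k = cnt T k i" "\<And>k. (\<Sum>l<k. shape M i l) = greene (lev M i) k"
      using left_tableau[OF assms(1)] True by metis
    thus ?thesis using cnt_antimono[OF T(1), of i] by (simp add: antimono_def)
  next
    case False
    obtain T where T: "tableau T" "\<And>k. shape M i k = cnt T k (Suc n - i)" "\<And>k. (\<Sum>l<k. shape M i l) = greene (lev M i) k"
      using right_tableau[OF assms(1)] False assms(3) by (metis le_SucI nat_le_linear)
    thus ?thesis using cnt_antimono[OF T(1), of "Suc n - i"] by (simp add: antimono_def)
  qed
  thus "antimono (shape M i)" "(\<Sum>l<k. shape M i l) = greene (lev M i) k" by auto
qed

section \<open>Diagonals under the Hillman--Grassl algorithm\<close>

definition lex_min :: "nat \<times> nat \<Rightarrow> (nat \<times> nat) multiset \<Rightarrow> bool" where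
  "lex_min x M \<longleftrightarrow> (\<forall>y\<in>#M. fst x < fst y \<or> fst x = fst y \<and> snd x \<le> snd y)"

lemma greene_empty [simp]: "greene {#} k = 0"
  using greene_ex[of "{#}" k] by auto

lemma lev_empty: "(\<And>y. y \<in># M \<Longrightarrow> i < fst y) \<Longrightarrow> lev M i = {#}"
proof -
  assume *: "\<And>y. y \<in># M \<Longrightarrow> i < fst y"
  have "set_mset (lev M i) = {}" unfolding lev_def using * by fastforce
  thus ?thesis by simp
qed

text \<open>In \<open>right_order\<close> the lexicographically least interval comes last, so its
  letter is appended to the word and inserted into the tableau. Higher letter levels are lower
  vertices, so \<open>\<kappa>\<close> starts at \<open>snd x\<close> and runs down to
  \<open>m\<close>.\<close>

lemma shape_add_right:
  assumes PQ: "\<forall>x\<in>#add_mset x M. x \<in> PQ n m" and min: "lex_min x M"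
  shows "\<exists>\<kappa>. \<kappa> (snd x) = 0 \<and>
    (\<forall>j k. m \<le> j \<longrightarrow> j \<le> n \<longrightarrow> shape (add_mset x M) j k = shape M j k + (if j \<le> snd x \<and> k = \<kappa> j then 1 else 0)) \<and>
    (\<forall>j. m \<le> j \<longrightarrow> j < snd x \<longrightarrow>
      \<kappa> j = (if shape M (Suc j) (\<kappa> (Suc j)) = shape M j (\<kappa> (Suc j)) then \<kappa> (Suc j) else Suc (\<kappa> (Suc j))))"
proof -
  obtain vs where vs: "mset vs = M" "sorted_wrt right_order vs" using ex_right_list by blast
  let ?\<phi> = "\<lambda>x. Suc n - snd x"
  let ?vs = "vs @ [x]"
  have vs': "mset ?vs = add_mset x M" "sorted_wrt right_order ?vs"
    using vs min by (auto simp: sorted_wrt_append right_order_def lex_min_def)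
  obtain T where T: "tableau T" "knuth_equiv (map ?\<phi> vs) (reading T)" using ex_tableau by blast
  define T' where "T' = row_insert T (?\<phi> x)"
  have T': "tableau T'" "knuth_equiv (map ?\<phi> ?vs) (reading T')"
    using tableau_row_insert[OF T(1)] equivclp_trans[OF _ reading_row_insert[OF T(1)]]
      knuth_equiv_append[OF T(2), of "[]" "[?\<phi> x]"] by (auto simp: T'_def)
  have bound: "\<forall>y\<in>set ?vs. fst y \<le> j \<and> snd y \<le> n" if "m \<le> j" for j
    using PQ that unfolding vs'(1)[symmetric] mem_PQ_iff by fastforce
  hence bound': "\<forall>y\<in>set vs. fst y \<le> j \<and> snd y \<le> n" if "m \<le> j" for j
    using that by simp
  have S: "shape M j k = cnt T k (Suc n - j)" if "m \<le> j" "j \<le> n" for j k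
    using shape_tableau(1)[OF greene_right[OF vs(2) bound'[OF that(1)]] T(2,1)] that by (simp add: vs(1))
  have S': "shape (add_mset x M) j k = cnt T' k (Suc n - j)" if "m \<le> j" "j \<le> n" for j k
    using shape_tableau(1)[OF greene_right[OF vs'(2) bound[OF that(1)]] T'(2,1)] that unfolding vs'(1) by simp
  have x: "snd x \<le> n" "m \<le> snd x" using PQ by (auto simp: mem_PQ_iff)
  from cnt_row_insert[OF T(1), of "?\<phi> x"] obtain \<kappa> where \<kappa>: "\<kappa> (?\<phi> x) = 0"
    "\<And>l j. cnt T' l j = cnt T l j + (if ?\<phi> x \<le> j \<and> l = \<kappa> j then 1 else 0)"
    "\<And>j. ?\<phi> x \<le> j \<Longrightarrow> \<kappa> (Suc j) = (if cnt T (\<kappa> j) (Suc j) = cnt T (\<kappa> j) j then \<kappa> j else Suc (\<kappa> j))"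
    unfolding T'_def by blast
  show ?thesis
  proof (intro exI[of _ "\<lambda>j. \<kappa> (Suc n - j)"] conjI allI impI)
    show "\<kappa> (Suc n - snd x) = 0" by (rule \<kappa>)
    show "shape (add_mset x M) j k = shape M j k + (if j \<le> snd x \<and> k = \<kappa> (Suc n - j) then 1 else 0)"
      if "m \<le> j" "j \<le> n" for j k
    proof -
      have "?\<phi> x \<le> Suc n - j \<longleftrightarrow> j \<le> snd x" using that x by linarith
      thus ?thesis using S S' that \<kappa>(2) by simp
    qed
    fix j assume j: "m \<le> j" "j < snd x"
    have "Suc (n - j) = Suc n - j" "?\<phi> x \<le> n - j" "Suc n - Suc j = n - j" using j x by linarith+
    thus "\<kappa> (Suc n - j) = (if shape M (Suc j) (\<kappa> (Suc n - Suc j)) = shape M j (\<kappa> (Suc n - Suc j))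
       then \<kappa> (Suc n - Suc j) else Suc (\<kappa> (Suc n - Suc j)))"
      using \<kappa>(3)[of "n - j"] S[of j] S[of "Suc j"] j x by auto
  qed
qed

text \<open>In the word of the larger multiset \<open>x\<close> gives the first occurrence of the
  smallest letter, and deleting it starts a slide. The equalities are therefore tested on
  \<open>add_mset x M\<close>, whereas the insertion on the right tests them on
  \<open>M\<close>.\<close>

lemma shape_add_left:
  assumes PQ: "\<forall>x\<in>#add_mset x M. x \<in> PQ n m" and min: "lex_min x M"
  shows "\<exists>\<kappa>. \<kappa> (fst x) = 0 \<and>
    (\<forall>i k. i \<le> m \<longrightarrow> shape (add_mset x M) i k = shape M i k + (if fst x \<le> i \<and> k = \<kappa> i then 1 else 0)) \<and>
    (\<forall>i. fst x \<le> i \<longrightarrow> i < m \<longrightarrow> \<kappa> (Suc i) = 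
      (if shape (add_mset x M) (Suc i) (Suc (\<kappa> i)) = shape (add_mset x M) i (\<kappa> i) then Suc (\<kappa> i) else \<kappa> i))"
proof -
  let ?M = "add_mset x M" and ?a = "fst x"
  obtain us where us: "mset us = ?M" "sorted_wrt left_order us" using ex_left_list by blast
  have "x \<in> set us" using us(1) by (metis set_mset_mset union_single_eq_member)
  then obtain us1 us2 where us12: "us = us1 @ x # us2" "x \<notin> set us1" using split_list_first by metis
  have M: "mset (us1 @ us2) = M" using us(1) us12(1) by simp
  have sorted': "sorted_wrt left_order (us1 @ us2)" using us(2) us12(1) by (auto simp: sorted_wrt_append)
  have ge: "?a \<le> fst y" if "y \<in> set us" for y
  proof -
    have "y \<in># ?M" using that us(1) by (metis set_mset_mset)
    thus ?thesis using min unfolding lex_min_def by fastforce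
  qed
  \<comment> \<open>An earlier interval with the same left endpoint has right endpoint at most
    \<open>snd x\<close> by the order and at least \<open>snd x\<close> by minimality, so it equals
    \<open>x\<close>; but \<open>us1\<close> ends before the first \<open>x\<close>.\<close>
  have ne: "fst y \<noteq> ?a" if "y \<in> set us1" for y
  proof
    assume eq: "fst y = ?a"
    have "left_order y x" using us(2) that unfolding us12(1) sorted_wrt_append by auto
    moreover have "y \<in># M" using that unfolding M[symmetric] by simp
    hence "snd x \<le> snd y" using min eq unfolding lex_min_def by fastforce
    ultimately have "y = x" using eq by (auto simp: left_order_def prod_eq_iff)
    thus False using that us12(2) by simp
  qed
  have rem: "remove1 ?a (map fst us) = map fst (us1 @ us2)"
  proof -
    have "?a \<notin> set (map fst us1)" using ne by fastforce
    thus ?thesis by (simp add: us12(1) remove1_append)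
  qed
  obtain T where T: "tableau T" "knuth_equiv (map fst us) (reading T)" using ex_tableau by blast
  have setT: "set (reading T) = fst ` set us" using knuth_equiv_set[OF T(2)] by simp
  have a_min: "?a \<le> b" if "b \<in> set (reading T)" for b using that ge unfolding setT by auto
  have "?a \<in> set (reading T)" unfolding setT using us12(1) by simp
  then obtain t where t: "t \<in> set T" "?a \<in> set t" by auto
  then obtain l where l: "l < length T" "T ! l = t" by (metis in_set_conv_nth)
  then obtain c where c: "c < length (T ! l)" "T ! l ! c = ?a" using t(2) by (metis in_set_conv_nth)
  have entry: "?a \<le> T ! l ! c" if "l < length T" "c < length (T ! l)" for l c
    by (rule a_min) (use that nth_mem in fastforce)
  have cell: "c < cnt T l ?a" using lt_cnt[OF T(1)] l c by simp
  have len: "c < length (T ! 0)" "0 < length T"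
    using antimonoD[OF cnt_antimono[OF T(1), of ?a], of 0 l] cell lt_cnt[OF T(1), of c 0 ?a] by auto
  \<comment> \<open>A cell above an occurrence of the minimum would hold something smaller, so it
    lies in the top row, and sortedness puts the minimum into the corner.\<close>
  have "l = 0"
  proof (rule ccontr)
    assume "l \<noteq> 0"
    hence "T ! 0 ! c < T ! l ! c" using tableau_column_less[OF T(1) _ cell] by simp
    thus False using entry[OF len(2,1)] c(2) by simp
  qed
  have "T ! 0 ! 0 \<le> T ! 0 ! c" by (rule tableau_row_mono[OF T(1) _ cell[unfolded \<open>l = 0\<close>]]) simp
  hence T00: "T ! 0 ! 0 = ?a" using entry[OF len(2), of 0] len c(2) \<open>l = 0\<close> by (metis antisym less_nat_zero_code not_gr_zero)
  obtain r T' where T_eq: "T = (?a # r) # T'"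
  proof -
    obtain r0 T' where "T = r0 # T'" using len by (cases T) auto
    moreover obtain b r where "r0 = b # r" using len calculation by (cases r0) auto
    ultimately show ?thesis using that T00 by simp
  qed
  \<comment> \<open>The lower rows are read before the top row, so this makes the corner the first
    occurrence of the minimum in the reading word.\<close>
  have "?a \<notin> set (reading T')"
  proof
    assume "?a \<in> set (reading T')"
    then obtain t where t: "t \<in> set T'" "?a \<in> set t" by auto
    then obtain l where l: "l < length T'" "T' ! l = t" by (metis in_set_conv_nth)
    then obtain c where c: "c < length (T' ! l)" "T' ! l ! c = ?a" using t(2) by (metis in_set_conv_nth)
    have cell: "c < cnt T (Suc l) ?a" using l c unfolding lt_cnt[OF T(1)] by (simp add: T_eq)
    have "T ! 0 ! c < T ! Suc l ! c" using tableau_column_less[OF T(1) _ cell] by simp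
    moreover have "c < length (T ! 0)" using antimonoD[OF cnt_antimono[OF T(1), of ?a], of 0 "Suc l"] cell lt_cnt[OF T(1), of c 0 ?a] by auto
    ultimately show False using entry[OF len(2), of c] c(2) by (simp add: T_eq)
  qed
  hence rT: "remove1 ?a (reading T) = reading T' @ r" by (simp add: T_eq remove1_append)
  have K: "knuth_equiv (map fst (us1 @ us2)) (reading T' @ r)"
  proof -
    have "?a \<le> b" if "b \<in> set (map fst us)" for b using that ge by auto
    from knuth_equiv_remove_min[OF T(2) this] show ?thesis unfolding rem rT .
  qed
  define \<kappa> where "\<kappa> j = rec_nat 0 (\<lambda>d q. if cnt T (Suc q) (Suc (?a + d)) = cnt T q (?a + d) then Suc q else q) (j - ?a)" for j
  note TT = T
  interpret slide T ?a r T' \<kappa>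
  proof
    show "\<kappa> ?a = 0" by (simp add: \<kappa>_def)
    fix j assume "?a \<le> j"
    thus "\<kappa> (Suc j) = (if cnt T (Suc (\<kappa> j)) (Suc j) = cnt T (\<kappa> j) j then Suc (\<kappa> j) else \<kappa> j)"
      by (simp add: \<kappa>_def Suc_diff_le)
  qed (use T(1) T_eq a_min in auto)
  have bound: "\<forall>y\<in>set us. i \<le> snd y" if "i \<le> m" for i
    using PQ that unfolding us(1)[symmetric] mem_PQ_iff by fastforce
  hence bound': "\<forall>y\<in>set (us1 @ us2). i \<le> snd y" if "i \<le> m" for i
    using that by (simp add: us12(1))
  have S: "shape ?M i k = cnt T k i" if "i \<le> m" for i k
    using shape_tableau(1)[OF greene_left[OF us(2) bound[OF that]] TT(2,1)] by (simp add: us(1))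
  have S': "shape M i k + (if ?a \<le> i \<and> k = \<kappa> i then 1 else 0) = cnt T k i" if "i \<le> m" for i k
  proof (cases "?a \<le> i")
    case True
    have g: "greene (lev M i) k + (if \<kappa> i < k then 1 else 0) = (\<Sum>l<k. cnt T l i)" for k
      using skew_greene[OF True, of k] greene_left[OF sorted' bound'[OF that], of k]
        knuth_equiv_greene[OF knuth_equiv_filter[OF K]] unfolding M by simp
    show ?thesis using g[of k] g[of "Suc k"] outer_corner[OF True] True
      by (cases "k = \<kappa> i") (auto simp: shape_def split: if_splits)
  next
    \<comment> \<open>Below the smallest letter both the pattern and the set of intervals are
      empty.\<close>
    case False
    have "T ! k ! c \<ge> ?a" if "k < length T" "c < length (T ! k)" for c using entry that by blast
    hence "\<not> 0 < cnt T k i" using lt_cnt[OF T(1), of 0 k i] False by fastforce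
    moreover have "lev M i = {#}"
      by (rule lev_empty) (use min False in \<open>fastforce simp: lex_min_def\<close>)
    hence "shape M i k = 0" by (simp add: shape_def)
    ultimately show ?thesis using False by simp
  qed
  show ?thesis
  proof (intro exI[of _ \<kappa>] conjI allI impI)
    show "\<kappa> ?a = 0" by (rule \<kappa>_a)
    show "shape ?M i k = shape M i k + (if ?a \<le> i \<and> k = \<kappa> i then 1 else 0)" if "i \<le> m" for i k
      using S[OF that] S'[OF that] by simp
    show "\<kappa> (Suc i) = (if shape ?M (Suc i) (Suc (\<kappa> i)) = shape ?M i (\<kappa> i) then Suc (\<kappa> i) else \<kappa> i)"
      if "?a \<le> i" "i < m" for i
      using \<kappa>_Suc[OF that(1)] S[of i] S[of "Suc i"] that(2) by simp
  qed
qed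

text \<open>The vertex attached to \<open>[a, b]\<close> is \<open>b - a + 1\<close>, and the second
  index is the number of diagonal steps from \<open>[a, b]\<close> down to the boundary of the
  poset, so the largest part stands at the lowest element of a chain.\<close>

definition fill :: "nat \<Rightarrow> nat \<Rightarrow> (nat \<times> nat) multiset \<Rightarrow> nat \<times> nat \<Rightarrow> nat" where
  "fill n m M = rpp_of n m (\<lambda>(a, b). shape M (b - a + 1) (min (a - 1) (b - m)))"

text \<open>The cell holding the \<open>k\<close>-th largest entry (counted from 0) of diagonal \<open>i\<close>.\<close>

definition diag_cell :: "nat \<Rightarrow> nat \<Rightarrow> nat \<Rightarrow> nat \<Rightarrow> nat \<times> nat" where
  "diag_cell n m i k = (if i \<le> m then (n + 1 - m - k, i - k) else (n + 1 - i - k, m - k))"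

text \<open>The pairs for which diagonal \<open>i\<close> really has a cell in position
  \<open>k\<close>; parts outside this range vanish by \<open>diag_range_shape\<close>.\<close>

definition diag_range :: "nat \<Rightarrow> nat \<Rightarrow> nat \<Rightarrow> nat \<Rightarrow> bool" where
  "diag_range n m i k \<longleftrightarrow> i \<le> n \<and> k < i \<and> k < m \<and> k < n + 1 - m \<and> k < n + 1 - i"

lemma diag_cell_in_cells: "m \<le> n \<Longrightarrow> diag_range n m i k \<Longrightarrow> diag_cell n m i k \<in> cells (n + 1 - m) m"
  by (auto simp: diag_cell_def diag_range_def cells_def)

lemma diag_cell_surj:
  assumes "m \<le> n" "(r, c) \<in> cells (n + 1 - m) m"
  obtains i k where "diag_range n m i k" "(r, c) = diag_cell n m i k"
proof (cases "c + (n + 1 - m) - r \<le> m")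
  case True
  show ?thesis by (rule that[of "c + (n + 1 - m) - r" "n + 1 - m - r"])
    (use assms True in \<open>auto simp: diag_cell_def diag_range_def cells_def\<close>)
next
  case False
  show ?thesis by (rule that[of "c + (n + 1 - m) - r" "m - c"])
    (use assms False in \<open>auto simp: diag_cell_def diag_range_def cells_def\<close>)
qed

lemma diag_cell_coords:
  assumes "m \<le> n" "diag_range n m i k" "diag_cell n m i k = (r, c)"
  shows "i = c + (n + 1 - m) - r" "k = min (m - c) (n + 1 - m - r)"
  using assms by (auto simp: diag_cell_def diag_range_def split: if_splits)

lemma diag_cell_inj:
  assumes "m \<le> n" "diag_range n m i k" "diag_range n m i' k'" "diag_cell n m i k = diag_cell n m i' k'"
  shows "i = i' \<and> k = k'"
proof -
  obtain r c where rc: "diag_cell n m i k = (r, c)" by fastforce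
  from diag_cell_coords[OF assms(1,2) rc] diag_cell_coords[OF assms(1,3) rc[unfolded assms(4)]]
  show ?thesis by simp
qed

lemma fill_diag_cell:
  assumes "m \<le> n" "diag_range n m i k"
  shows "fill n m M (diag_cell n m i k) = shape M i k"
proof -
  obtain r c where rc: "diag_cell n m i k = (r, c)" by fastforce
  have "(r, c) \<in> cells (n + 1 - m) m" using diag_cell_in_cells[OF assms] rc by simp
  moreover have "n + 1 - r - (m + 1 - c) + 1 = i" "min (m + 1 - c - 1) (n + 1 - r - m) = k"
    using rc assms by (auto simp: diag_cell_def diag_range_def split: if_splits)
  ultimately show ?thesis by (simp add: rc fill_def rpp_of_def)
qed

lemma fill_outside: "x \<notin> cells (n + 1 - m) m \<Longrightarrow> fill n m M x = 0"
  by (cases x) (simp add: fill_def rpp_of_def)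

lemma diag_range_shape:
  assumes "\<forall>x\<in>#M. x \<in> PQ n m" "m \<le> n" "i \<le> n" "shape M i k \<noteq> 0"
  shows "diag_range n m i k"
proof -
  have k: "k < m" "k < Suc n - m"
    using shape_vanish(1,2)[OF assms(1,2), of k i] assms(4) by (meson not_le)+
  show ?thesis
  proof (cases "i \<le> m")
    case True
    have "\<not> i \<le> k" using shape_vanish(3)[OF assms(1,2) True] assms(4) by auto
    thus ?thesis using k True assms(2,3) by (simp add: diag_range_def)
  next
    case False
    hence "m \<le> i" by simp
    hence "\<not> Suc n - i \<le> k" using shape_vanish(4)[OF assms(1,2) _ assms(3)] assms(4) by auto
    thus ?thesis using k False assms(2,3) by (simp add: diag_range_def)
  qed
qed

text \<open>Neighbouring cells lie on neighbouring diagonals, so the inequalities are the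
  interlacing relations on the two sides of \<open>m\<close>. Left of \<open>m\<close> a step to the
  right keeps the position on the diagonal and a step up raises it; from \<open>m\<close> on a step
  up keeps it and a step to the right lowers it.\<close>

lemma fill_rpp:
  assumes "\<forall>x\<in>#M. x \<in> PQ n m" "m \<le> n"
  shows "is_rpp (n + 1 - m) m (fill n m M)"
  unfolding is_rpp_def
proof (intro conjI allI impI)
  fix r c assume rc: "(r, c) \<in> cells (n + 1 - m) m \<and> (r, Suc c) \<in> cells (n + 1 - m) m"
  then obtain i k where ik: "diag_range n m i k" "(r, c) = diag_cell n m i k" using diag_cell_surj[OF assms(2)] by metis
  show "fill n m M (r, c) \<le> fill n m M (r, Suc c)"
  proof (cases "i < m")
    case True
    have "(r, Suc c) = diag_cell n m (Suc i) k" "diag_range n m (Suc i) k"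
      using ik rc True by (auto simp: diag_cell_def diag_range_def cells_def split: if_splits; linarith)+
    thus ?thesis unfolding ik(2) using ik(1) fill_diag_cell[OF assms(2)] shape_interlace(1)[OF assms(1) True] by simp
  next
    case False
    have "(r, Suc c) = diag_cell n m (Suc i) (k - 1)" "diag_range n m (Suc i) (k - 1)" "k = Suc (k - 1)"
      using ik rc False by (auto simp: diag_cell_def diag_range_def cells_def split: if_splits; linarith)+
    thus ?thesis unfolding ik(2) using ik(1) fill_diag_cell[OF assms(2)] shape_interlace(4)[OF assms(1), of i "k - 1"] False
      by (metis diag_range_def not_le)
  qed
next
  fix r c assume rc: "(r, c) \<in> cells (n + 1 - m) m \<and> (Suc r, c) \<in> cells (n + 1 - m) m"
  then obtain i k where ik: "diag_range n m i k" "(Suc r, c) = diag_cell n m i k" using diag_cell_surj[OF assms(2)] by metis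
  show "fill n m M (r, c) \<le> fill n m M (Suc r, c)"
  proof (cases "i < m")
    case True
    have "(r, c) = diag_cell n m (Suc i) (Suc k)" "diag_range n m (Suc i) (Suc k)"
      using ik rc True by (auto simp: diag_cell_def diag_range_def cells_def split: if_splits; linarith)+
    thus ?thesis unfolding ik(2) using ik(1) fill_diag_cell[OF assms(2)] shape_interlace(2)[OF assms(1) True] by simp
  next
    case False
    have "(r, c) = diag_cell n m (Suc i) k" "diag_range n m (Suc i) k"
      using ik rc False by (auto simp: diag_cell_def diag_range_def cells_def split: if_splits; linarith)+
    thus ?thesis unfolding ik(2) using ik(1) fill_diag_cell[OF assms(2)] shape_interlace(3)[OF assms(1), of i k] False
      by (metis diag_range_def not_le)
  qed
qed (rule fill_outside)

lemma rpp_column_mono: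
  assumes "is_rpp R C P" "r \<le> r'" "(r, c) \<in> cells R C" "(r', c) \<in> cells R C"
  shows "P (r, c) \<le> P (r', c)"
  using assms(2,4)
proof (induction r' rule: dec_induct)
  case (step r')
  have "(r', c) \<in> cells R C" using assms(3) step by (auto simp: cells_def)
  moreover from this have "P (r', c) \<le> P (Suc r', c)" using assms(1) step.prems unfolding is_rpp_def by blast
  ultimately show ?case using step.IH by linarith
qed simp

lemma rim_hook_interval_cell:
  assumes "1 \<le> a" "a \<le> m" "m \<le> b" "b \<le> n"
  shows "rim_hook_of_cell (n + 1 - m) m (n + 1 - b, a) = rim_hook_of_interval n m (a, b)"
proof -
  have "{a..b} = {a..m} \<union> {m<..b}" using assms by auto
  hence "rim_hook_of_interval n m (a, b) = border_cell n m ` {a..m} \<union> border_cell n m ` {m<..b}"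
    by (simp add: rim_hook_of_interval_def image_Un)
  also have "border_cell n m ` {a..m} = {(n + 1 - m, j) | j. a \<le> j \<and> j \<le> m}"
    by (auto simp: border_cell_def image_iff)
  also have "border_cell n m ` {m<..b} = {(i, m) | i. n + 1 - b \<le> i \<and> i < n + 1 - m}"
  proof (intro equalityI subsetI)
    fix x assume "x \<in> {(i, m) | i. n + 1 - b \<le> i \<and> i < n + 1 - m}"
    then obtain i where i: "x = (i, m)" "n + 1 - b \<le> i" "i < n + 1 - m" by auto
    have "x = border_cell n m (n + 1 - i)" "n + 1 - i \<in> {m<..b}" using i assms by (auto simp: border_cell_def)
    thus "x \<in> border_cell n m ` {m<..b}" by blast
  qed (use assms in \<open>auto simp: border_cell_def\<close>)
  also have "{(n + 1 - m, j) | j. a \<le> j \<and> j \<le> m} \<union> {(i, m) | i. n + 1 - b \<le> i \<and> i < n + 1 - m} =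
    rim_hook_of_cell (n + 1 - m) m (n + 1 - b, a)"
  proof -
    have "(n + 1 - m, m) \<in> {(n + 1 - m, j) | j. a \<le> j \<and> j \<le> m}" using assms by simp
    moreover have "{(i, m) | i. n + 1 - b \<le> i \<and> i \<le> n + 1 - m} = insert (n + 1 - m, m) {(i, m) | i. n + 1 - b \<le> i \<and> i < n + 1 - m}"
      using assms by (auto simp: le_less)
    ultimately show ?thesis unfolding rim_hook_of_cell_def by auto
  qed
  finally show ?thesis ..
qed

locale hook_added =
  fixes n m :: nat and M :: "(nat \<times> nat) multiset" and a b :: nat
  assumes PQ: "\<forall>x\<in>#add_mset (a, b) M. x \<in> PQ n m" and min: "lex_min (a, b) M" and mn: "m \<le> n"
begin

abbreviation "M' \<equiv> add_mset (a, b) M"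
abbreviation "P \<equiv> fill n m M'"
abbreviation "R \<equiv> n + 1 - m"

lemma ab: "1 \<le> a" "a \<le> m" "m \<le> b" "b \<le> n"
  using PQ by (auto simp: mem_PQ_iff)

lemma PQ': "\<forall>x\<in>#M. x \<in> PQ n m"
  using PQ by simp

text \<open>Both one-sided trajectories record where the shape at \<open>m\<close> grows, so they
  agree there and form one path. The insertion rule is restated for \<open>M'\<close>, whose shapes
  are the entries that the algorithm compares.\<close>

lemma ex_path:
  obtains \<kappa> where "\<kappa> a = 0" "\<kappa> b = 0" 
    "\<And>i k. i \<le> n \<Longrightarrow> shape M' i k = shape M i k + (if a \<le> i \<and> i \<le> b \<and> k = \<kappa> i then 1 else 0)"
    "\<And>i. a \<le> i \<Longrightarrow> i < m \<Longrightarrow> \<kappa> (Suc i) = (if shape M' (Suc i) (Suc (\<kappa> i)) = shape M' i (\<kappa> i) then Suc (\<kappa> i) else \<kappa> i)"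
    "\<And>i. m \<le> i \<Longrightarrow> i < b \<Longrightarrow> if shape M' (Suc i) (\<kappa> i) = shape M' i (\<kappa> i) then \<kappa> (Suc i) = \<kappa> i else \<kappa> i = Suc (\<kappa> (Suc i))"
proof -
  from shape_add_left[OF PQ min] obtain \<kappa>1 where 1: "\<kappa>1 a = 0"
    "\<And>i k. i \<le> m \<Longrightarrow> shape M' i k = shape M i k + (if a \<le> i \<and> k = \<kappa>1 i then 1 else 0)"
    "\<And>i. a \<le> i \<Longrightarrow> i < m \<Longrightarrow> \<kappa>1 (Suc i) = (if shape M' (Suc i) (Suc (\<kappa>1 i)) = shape M' i (\<kappa>1 i) then Suc (\<kappa>1 i) else \<kappa>1 i)"
    by auto
  from shape_add_right[OF PQ min] obtain \<kappa>2 where 2: "\<kappa>2 b = 0"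
    "\<And>j k. m \<le> j \<Longrightarrow> j \<le> n \<Longrightarrow> shape M' j k = shape M j k + (if j \<le> b \<and> k = \<kappa>2 j then 1 else 0)"
    "\<And>j. m \<le> j \<Longrightarrow> j < b \<Longrightarrow>
      \<kappa>2 j = (if shape M (Suc j) (\<kappa>2 (Suc j)) = shape M j (\<kappa>2 (Suc j)) then \<kappa>2 (Suc j) else Suc (\<kappa>2 (Suc j)))"
    by auto
  have eq: "\<kappa>1 m = \<kappa>2 m"
  proof (rule ccontr)
    assume "\<kappa>1 m \<noteq> \<kappa>2 m"
    hence "shape M' m (\<kappa>1 m) = shape M m (\<kappa>1 m)" using 2(2)[of m "\<kappa>1 m"] mn by simp
    moreover have "shape M' m (\<kappa>1 m) = shape M m (\<kappa>1 m) + 1" using 1(2)[of m "\<kappa>1 m"] ab by simp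
    ultimately show False by simp
  qed
  define \<kappa> where "\<kappa> i = (if i \<le> m then \<kappa>1 i else \<kappa>2 i)" for i
  have k1: "\<kappa> i = \<kappa>1 i" if "i \<le> m" for i using that by (simp add: \<kappa>_def)
  have k2: "\<kappa> i = \<kappa>2 i" if "m \<le> i" for i using that eq by (auto simp: \<kappa>_def)
  show ?thesis
  proof
    show "\<kappa> a = 0" "\<kappa> b = 0" using 1(1) 2(1) k1 k2 ab by auto
    show "shape M' i k = shape M i k + (if a \<le> i \<and> i \<le> b \<and> k = \<kappa> i then 1 else 0)" if "i \<le> n" for i k
      using 1(2)[of i k] 2(2)[of i k] k1[of i] k2[of i] ab that by (cases "i \<le> m") auto
    show "\<kappa> (Suc i) = (if shape M' (Suc i) (Suc (\<kappa> i)) = shape M' i (\<kappa> i) then Suc (\<kappa> i) else \<kappa> i)"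
      if "a \<le> i" "i < m" for i using 1(3)[OF that] k1 that by simp
    fix j assume j: "m \<le> j" "j < b"
    have le: "shape M (Suc j) k \<le> shape M j k" for k using shape_interlace(3)[OF PQ'] j ab by simp
    have s1: "shape M' j k = shape M j k + (if k = \<kappa>2 j then 1 else 0)" 
      "shape M' (Suc j) k = shape M (Suc j) k + (if k = \<kappa>2 (Suc j) then 1 else 0)" for k
      using 2(2)[of j] 2(2)[of "Suc j"] j ab by auto
    \<comment> \<open>If the position changes, the tested entry on diagonal \<open>Suc j\<close> is
      the old one while that on diagonal \<open>j\<close> has grown, so monotonicity makes them
      unequal; otherwise both have grown by one.\<close>
    show "if shape M' (Suc j) (\<kappa> j) = shape M' j (\<kappa> j) then \<kappa> (Suc j) = \<kappa> j else \<kappa> j = Suc (\<kappa> (Suc j))"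
      using 2(3)[OF j] k2[of j] k2[of "Suc j"] j le[of "\<kappa>2 j"] unfolding s1 by (auto split: if_splits)
  qed
qed

text \<open>The path meets every diagonal from \<open>a\<close> to \<open>b\<close> in exactly one
  cell, the one in position \<open>\<kappa> i\<close>; subtracting 1 there undoes the growth of the
  shapes.\<close>

theorem hg_step:
  "hg_start_col R m P = a" "hg_cell R m P = (n + 1 - b, a)" "hg_remove R m P = fill n m M"
  "\<not> (\<forall>x\<in>cells R m. P x = 0)"
proof -
  obtain \<kappa> where \<kappa>: "\<kappa> a = 0" "\<kappa> b = 0" 
    "\<And>i k. i \<le> n \<Longrightarrow> shape M' i k = shape M i k + (if a \<le> i \<and> i \<le> b \<and> k = \<kappa> i then 1 else 0)"
    "\<And>i. a \<le> i \<Longrightarrow> i < m \<Longrightarrow> \<kappa> (Suc i) = (if shape M' (Suc i) (Suc (\<kappa> i)) = shape M' i (\<kappa> i) then Suc (\<kappa> i) else \<kappa> i)"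
    "\<And>i. m \<le> i \<Longrightarrow> i < b \<Longrightarrow> if shape M' (Suc i) (\<kappa> i) = shape M' i (\<kappa> i) then \<kappa> (Suc i) = \<kappa> i else \<kappa> i = Suc (\<kappa> (Suc i))"
    by (rule ex_path) (rule that)
  define cl where "cl i = diag_cell n m i (\<kappa> i)" for i
  have pos: "shape M' i (\<kappa> i) \<noteq> 0" if "a \<le> i" "i \<le> b" for i using \<kappa>(3)[of i "\<kappa> i"] that ab by simp
  have rng: "diag_range n m i (\<kappa> i)" if "a \<le> i" "i \<le> b" for i
    by (rule diag_range_shape[OF PQ mn _ pos[OF that]]) (use that ab in simp)
  have Pd: "P (diag_cell n m i k) = shape M' i k" if "diag_range n m i k" for i k
    by (rule fill_diag_cell[OF mn that])
  have cla: "cl a = (R, a)" using ab by (simp add: cl_def diag_cell_def \<kappa>(1))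
  have clb: "cl b = (n + 1 - b, m)" using ab by (auto simp: cl_def diag_cell_def \<kappa>(2))
  have start: "hg_start_col R m P = a" unfolding hg_start_col_def
  proof (rule Least_equality)
    have "P (R, a) \<noteq> 0" using Pd[OF rng[of a]] pos[of a] cla ab by (simp add: cl_def)
    moreover have "1 \<le> R" using mn by simp
    ultimately show "1 \<le> a \<and> a \<le> m \<and> (\<exists>r. 1 \<le> r \<and> r \<le> R \<and> P (r, a) \<noteq> 0)" using ab by blast
  next
    fix c assume c: "1 \<le> c \<and> c \<le> m \<and> (\<exists>r. 1 \<le> r \<and> r \<le> R \<and> P (r, c) \<noteq> 0)"
    then obtain r where r: "1 \<le> r" "r \<le> R" "P (r, c) \<noteq> 0" by blast
    have rc: "diag_range n m c 0" using c mn by (auto simp: diag_range_def)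
    show "a \<le> c"
    proof (rule ccontr)
      assume "\<not> a \<le> c"
      \<comment> \<open>No interval starts before \<open>a\<close>, so the shape at a vertex further
        left is empty, and the bottom entry bounds the whole column.\<close>
      hence "lev M' c = {#}"
        by (intro lev_empty) (use min in \<open>fastforce simp: lex_min_def\<close>)
      hence "shape M' c 0 = 0" by (simp add: shape_def)
      moreover have "diag_cell n m c 0 = (R, c)" using c by (simp add: diag_cell_def)
      ultimately have "P (R, c) = 0" using Pd[OF rc] by simp
      moreover have "P (r, c) \<le> P (R, c)"
        by (rule rpp_column_mono[OF fill_rpp[OF PQ mn]]) (use r c in \<open>auto simp: cells_def\<close>)
      ultimately show False using r(3) by simp
    qed
  qed
  \<comment> \<open>\<open>k\<close> is the fuel; the last premise says that the rest of the path
    fits into it.\<close>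
  have zz: "hg_zz k m P (fst (cl i)) (snd (cl i)) = map cl [i..<Suc b]" if "a \<le> i" "i \<le> b" "b \<le> i + k" for k i
    using that
  proof (induction k arbitrary: i)
    case 0 thus ?case by simp
  next
    case (Suc k)
    obtain r c where rc: "cl i = (r, c)" by fastforce
    have rg: "diag_range n m i (\<kappa> i)" using rng Suc.prems by blast
    have Prc: "P (r, c) = shape M' i (\<kappa> i)" using Pd[OF rg] rc by (simp add: cl_def)
    have cons: "map cl [i..<Suc b] = (r, c) # map cl [Suc i..<Suc b]" using Suc.prems rc by (simp add: upt_conv_Cons del: upt_Suc)
    show ?case
    proof (cases "i = b")
      case True
      have rc': "r = n + 1 - b" "c = m" using clb rc True by auto
      \<comment> \<open>The cell above the end of the path lies on diagonal \<open>Suc b\<close>,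
        which the new interval does not reach, whereas the end itself has been raised; so the path
        cannot climb, and in the last column it stops.\<close>
      have nup: "\<not> (1 < r \<and> P (r - 1, c) = P (r, c))"
      proof
        assume *: "1 < r \<and> P (r - 1, c) = P (r, c)"
        have r1: "diag_range n m (Suc b) 0" "diag_cell n m (Suc b) 0 = (r - 1, c)"
          using * rc' ab mn by (auto simp: diag_range_def diag_cell_def)
        have "P (r - 1, c) = shape M' (Suc b) 0" using Pd[OF r1(1)] r1(2) by simp
        also have "\<dots> = shape M (Suc b) 0" using \<kappa>(3)[of "Suc b"] r1 by (simp add: diag_range_def)
        also have "\<dots> \<le> shape M b 0" using shape_interlace(3)[OF PQ', of b] ab by simp
        also have "\<dots> < shape M' b 0" using \<kappa>(2) \<kappa>(3)[of b 0] ab by simp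
        also have "\<dots> = P (r, c)" using Prc True \<kappa>(2) by simp
        finally show False using * by simp
      qed
      have "hg_zz (Suc k) m P r c = [(r, c)]" unfolding hg_zz.simps if_not_P[OF nup] using rc' by simp
      thus ?thesis using True rc by simp
    next
      case False
      hence ib: "i < b" "Suc i \<le> b" using Suc.prems by auto
      have rg': "diag_range n m (Suc i) (\<kappa> (Suc i))" using rng[of "Suc i"] Suc.prems ib by simp
      have IH: "hg_zz k m P (fst (cl (Suc i))) (snd (cl (Suc i))) = map cl [Suc i..<Suc b]"
        using Suc.IH[of "Suc i"] Suc.prems ib by simp
      show ?thesis
      proof (cases "i < m")
        case True
        have rc': "r = n + 1 - m - \<kappa> i" "c = i - \<kappa> i" using rc True by (auto simp: cl_def diag_cell_def)
        show ?thesis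
        proof (cases "shape M' (Suc i) (Suc (\<kappa> i)) = shape M' i (\<kappa> i)")
          case up: True
          hence k': "\<kappa> (Suc i) = Suc (\<kappa> i)" using \<kappa>(4)[OF Suc.prems(1) True] by simp
          have "cl (Suc i) = (r - 1, c)" using rc' True by (auto simp: cl_def diag_cell_def k')
          moreover have "1 < r" using rg' rc' unfolding k' diag_range_def by linarith
          moreover have "P (r - 1, c) = P (r, c)" using Pd[OF rg'] calculation(1) up Prc k' by (simp add: cl_def)
          ultimately have "hg_zz (Suc k) m P r c = (r, c) # hg_zz k m P (fst (cl (Suc i))) (snd (cl (Suc i)))" by simp
          thus ?thesis using IH rc cons by (simp only: fst_conv snd_conv)
        next
          case right: False
          hence k': "\<kappa> (Suc i) = \<kappa> i" using \<kappa>(4)[OF Suc.prems(1) True] by simp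
          have cl': "cl (Suc i) = (r, Suc c)" using rc' True rg by (auto simp: cl_def diag_cell_def k' diag_range_def)
          have nup: "\<not> (1 < r \<and> P (r - 1, c) = P (r, c))"
          proof
            assume *: "1 < r \<and> P (r - 1, c) = P (r, c)"
            have r1: "diag_range n m (Suc i) (Suc (\<kappa> i))" "diag_cell n m (Suc i) (Suc (\<kappa> i)) = (r - 1, c)"
            proof -
              have "Suc (\<kappa> i) < n + 1 - m" using * rc' by linarith
              thus "diag_range n m (Suc i) (Suc (\<kappa> i))" using rg True mn unfolding diag_range_def by linarith
              show "diag_cell n m (Suc i) (Suc (\<kappa> i)) = (r - 1, c)" using rc' True by (simp add: diag_cell_def)
            qed
            show False using Pd[OF r1(1)] r1(2) * right Prc by simp
          qed
          have "c < m" using rc' True by linarith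
          hence "hg_zz (Suc k) m P r c = (r, c) # hg_zz k m P r (Suc c)"
            unfolding hg_zz.simps if_not_P[OF nup] by simp
          thus ?thesis using IH rc cons cl' by (simp only: fst_conv snd_conv)
        qed
      next
        case mi: False
        hence rc': "r = n + 1 - i - \<kappa> i" "c = m - \<kappa> i"
          using rc by (cases "i = m"; auto simp: cl_def diag_cell_def)+
        note k5 = \<kappa>(5)[OF leI[OF mi] ib(1)]
        show ?thesis
        proof (cases "shape M' (Suc i) (\<kappa> i) = shape M' i (\<kappa> i)")
          case up: True
          hence k': "\<kappa> (Suc i) = \<kappa> i" using k5 by simp
          have "cl (Suc i) = (r - 1, c)" using rc' mi by (auto simp: cl_def diag_cell_def k')
          moreover have "1 < r" using rg' rc' unfolding k' diag_range_def by linarith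
          moreover have "P (r - 1, c) = P (r, c)" using Pd[OF rg'] calculation(1) up Prc k' by (simp add: cl_def)
          ultimately have "hg_zz (Suc k) m P r c = (r, c) # hg_zz k m P (fst (cl (Suc i))) (snd (cl (Suc i)))" by simp
          thus ?thesis using IH rc cons by (simp only: fst_conv snd_conv)
        next
          case right: False
          hence k': "\<kappa> i = Suc (\<kappa> (Suc i))" using k5 by simp
          have cl': "cl (Suc i) = (r, Suc c)" using rc' mi rg rg' by (auto simp: cl_def diag_cell_def k' diag_range_def)
          have nup: "\<not> (1 < r \<and> P (r - 1, c) = P (r, c))"
          proof
            assume *: "1 < r \<and> P (r - 1, c) = P (r, c)"
            have r1: "diag_range n m (Suc i) (\<kappa> i)" "diag_cell n m (Suc i) (\<kappa> i) = (r - 1, c)"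
            proof -
              have "Suc (\<kappa> i) < n + 1 - i" using * rc' by linarith
              thus "diag_range n m (Suc i) (\<kappa> i)" using rg mi mn unfolding diag_range_def by linarith
              show "diag_cell n m (Suc i) (\<kappa> i) = (r - 1, c)" using rc' mi by (simp add: diag_cell_def)
            qed
            show False using Pd[OF r1(1)] r1(2) * right Prc by simp
          qed
          have "c < m" using rc' k' rg by (auto simp: diag_range_def)
          hence "hg_zz (Suc k) m P r c = (r, c) # hg_zz k m P r (Suc c)"
            unfolding hg_zz.simps if_not_P[OF nup] by simp
          thus ?thesis using IH rc cons cl' by (simp only: fst_conv snd_conv)
        qed
      qed
    qed
  qed
  have path: "hg_path R m P = map cl [a..<Suc b]"
  proof -
    have "b \<le> a + (R + m)" using ab mn by linarith
    from zz[OF order_refl _ this] ab have "hg_zz (R + m) m P (fst (cl a)) (snd (cl a)) = map cl [a..<Suc b]" by (meson le_trans)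
    thus ?thesis unfolding hg_path_def start cla by (simp only: fst_conv snd_conv)
  qed
  show "hg_start_col R m P = a" by (rule start)
  show "hg_cell R m P = (n + 1 - b, a)"
    using path start clb ab by (simp add: hg_cell_def)
  show "\<not> (\<forall>x\<in>cells R m. P x = 0)"
    using Pd[OF rng[of a]] pos[of a] diag_cell_in_cells[OF mn rng[of a]] ab by (metis dual_order.trans order_refl)
  show "hg_remove R m P = fill n m M"
  proof
    fix x
    show "hg_remove R m P x = fill n m M x"
    proof (cases "x \<in> cells R m")
      case False
      thus ?thesis by (simp add: hg_remove_def fill_outside)
    next
      case True
      then obtain i k where ik: "diag_range n m i k" "x = diag_cell n m i k" 
        using diag_cell_surj[OF mn] by (metis prod.collapse)
      have A: "x \<in> set (hg_path R m P) \<longleftrightarrow> a \<le> i \<and> i \<le> b \<and> k = \<kappa> i"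
      proof
        assume "x \<in> set (hg_path R m P)"
        then obtain j where j: "a \<le> j" "j \<le> b" "x = cl j" unfolding path by auto
        from diag_cell_inj[OF mn ik(1) rng[OF j(1,2)]] j(3) ik(2) have "i = j \<and> k = \<kappa> j" unfolding cl_def by simp
        thus "a \<le> i \<and> i \<le> b \<and> k = \<kappa> i" using j by simp
      next
        assume "a \<le> i \<and> i \<le> b \<and> k = \<kappa> i"
        hence "x = cl i" "i \<in> {a..<Suc b}" by (simp_all add: ik(2) cl_def)
        thus "x \<in> set (hg_path R m P)" unfolding path set_map set_upt by (rule image_eqI)
      qed
      have "i \<le> n" using ik(1) by (simp add: diag_range_def)
      hence B: "P x = shape M i k + (if a \<le> i \<and> i \<le> b \<and> k = \<kappa> i then 1 else 0)"
        using \<kappa>(3)[of i k] Pd[OF ik(1)] ik(2) by (simp only:)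
      have "fill n m M x = shape M i k" using fill_diag_cell[OF mn ik(1), of M] ik(2) by (simp only:)
      thus ?thesis unfolding hg_remove_def A B by simp
    qed
  qed
qed

end

lemma ex_lex_min: 
  assumes "M \<noteq> {#}" shows "\<exists>x M'. M = add_mset x M' \<and> lex_min x M'"
proof -
  have fin: "finite (set_mset M)" "set_mset M \<noteq> {}" using assms by auto
  define a where "a = Min (fst ` set_mset M)"
  have "a \<in> fst ` set_mset M" unfolding a_def using fin by (intro Min_in) auto
  hence ne: "{y. (a, y) \<in># M} \<noteq> {}" by force
  have "{y. (a, y) \<in># M} \<subseteq> snd ` set_mset M" using image_eqI[of _ snd] by fastforce
  hence fin': "finite {y. (a, y) \<in># M}" by (rule finite_subset) simp
  define b where "b = Min {y. (a, y) \<in># M}"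
  have "b \<in> {y. (a, y) \<in># M}" unfolding b_def by (rule Min_in[OF fin' ne])
  hence "(a, b) \<in># M" by simp
  from multi_member_split[OF this] obtain M' where M': "M = add_mset (a, b) M'" by blast
  have "a < fst y \<or> a = fst y \<and> b \<le> snd y" if "y \<in># M'" for y
  proof -
    have y: "y \<in># M" using that M' by simp
    hence "a \<le> fst y" unfolding a_def using fin by (intro Min_le) auto
    moreover have "b \<le> snd y" if "a = fst y" unfolding b_def by (rule Min_le[OF fin']) (use y that in simp)
    ultimately show ?thesis by linarith
  qed
  hence "lex_min (a, b) M'" by (simp add: lex_min_def)
  thus ?thesis using M' by blast
qed

theorem hg_rel_fill:
  assumes "\<forall>x\<in>#M. x \<in> PQ n m" "m \<le> n"
  shows "hg_rel (n + 1 - m) m (fill n m M) (image_mset (rim_hook_of_interval n m) M)"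
  using assms(1)
proof (induction "size M" arbitrary: M)
  case 0
  hence "M = {#}" by simp
  moreover have "fill n m {#} x = 0" for x by (cases x) (simp add: fill_def rpp_of_def shape_def lev_def)
  ultimately show ?case by (simp add: hg_rel.zero)
next
  case (Suc s)
  hence "M \<noteq> {#}" by auto
  then obtain x M' where M': "M = add_mset x M'" "lex_min x M'" using ex_lex_min by blast
  obtain a b where x: "x = (a, b)" by fastforce
  interpret hook_added n m M' a b
    by unfold_locales (use Suc.prems M' x assms(2) in auto)
  have "hg_rel R m (fill n m M') (image_mset (rim_hook_of_interval n m) M')"
    using Suc M' by simp
  hence "hg_rel R m P (add_mset (rim_hook_of_cell R m (hg_cell R m P)) (image_mset (rim_hook_of_interval n m) M'))"
    using hg_step by (intro hg_rel.step) simp_all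
  thus ?case using hg_step(2) rim_hook_interval_cell[OF ab] M'(1) x by simp
qed

section \<open>Reversing the algorithm on an arbitrary reverse plane partition\<close>

definition hg_next :: "(nat \<times> nat \<Rightarrow> nat) \<Rightarrow> nat \<times> nat \<Rightarrow> nat \<times> nat" where
  "hg_next P = (\<lambda>(r, c). if 1 < r \<and> P (r - 1, c) = P (r, c) then (r - 1, c) else (r, Suc c))"

text \<open>Without a stopping rule the path is an initial piece of an orbit of
  \<open>hg_next\<close>. \<open>N\<close> is the last step inside the rectangle, and the fuel
  covers all remaining up and right steps.\<close>

lemma hg_zz_path:
  assumes "1 \<le> r" "c \<le> C" "(r - 1) + (C - c) \<le> k"
  shows "\<exists>N. hg_zz k C P r c = map (\<lambda>j. (hg_next P ^^ j) (r, c)) [0..<Suc N] \<and>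
    snd ((hg_next P ^^ N) (r, c)) = C \<and> snd ((hg_next P ^^ Suc N) (r, c)) = Suc C \<and>
    (\<forall>j\<le>N. 1 \<le> fst ((hg_next P ^^ j) (r, c)) \<and> snd ((hg_next P ^^ j) (r, c)) \<le> C)"
  using assms
proof (induction k arbitrary: r c)
  case 0
  hence "r = 1" "c = C" by auto
  thus ?case by (intro exI[of _ 0]) (simp add: hg_next_def)
next
  case (Suc k)
  show ?case
  proof (cases "\<not> (1 < r \<and> P (r - 1, c) = P (r, c)) \<and> c = C")
    case True
    thus ?thesis using Suc.prems(1) by (intro exI[of _ 0]) (auto simp: hg_next_def)
  next
    case False
    obtain r' c' where rc: "hg_next P (r, c) = (r', c')" by fastforce
    have ok: "1 \<le> r'" "c' \<le> C" "(r' - 1) + (C - c') \<le> k"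
      using rc False Suc.prems by (auto simp: hg_next_def split: if_splits)
    have zz: "hg_zz (Suc k) C P r c = (r, c) # hg_zz k C P r' c'"
      using rc False Suc.prems(2) by (auto simp: hg_next_def split: if_splits)
    from Suc.IH[OF ok] obtain N where N: "hg_zz k C P r' c' = map (\<lambda>j. (hg_next P ^^ j) (r', c')) [0..<Suc N]"
      "snd ((hg_next P ^^ N) (r', c')) = C" "snd ((hg_next P ^^ Suc N) (r', c')) = Suc C"
      "\<forall>j\<le>N. 1 \<le> fst ((hg_next P ^^ j) (r', c')) \<and> snd ((hg_next P ^^ j) (r', c')) \<le> C" by blast
    have sh: "(hg_next P ^^ Suc j) (r, c) = (hg_next P ^^ j) (r', c')" for j
      by (simp only: funpow_Suc_right comp_def rc)
    have "[0..<Suc (Suc N)] = 0 # map Suc [0..<Suc N]" by (subst upt_conv_Cons) (simp_all only: map_Suc_upt zero_less_Suc)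
    hence "map (\<lambda>j. (hg_next P ^^ j) (r, c)) [0..<Suc (Suc N)] = (r, c) # map (\<lambda>j. (hg_next P ^^ Suc j) (r, c)) [0..<Suc N]"
      by (simp only: list.map map_map comp_def funpow_0)
    hence 1: "hg_zz (Suc k) C P r c = map (\<lambda>j. (hg_next P ^^ j) (r, c)) [0..<Suc (Suc N)]"
      unfolding zz N(1) by (simp only: sh)
    have 4: "1 \<le> fst ((hg_next P ^^ j) (r, c)) \<and> snd ((hg_next P ^^ j) (r, c)) \<le> C" if "j \<le> Suc N" for j
    proof (cases j)
      case 0 thus ?thesis using Suc.prems by simp
    next
      case (Suc i) thus ?thesis using N(4) that unfolding Suc sh by simp
    qed
    show ?thesis using 1 4 N(2,3) sh by (intro exI[of _ "Suc N"]) (simp only:, simp)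
  qed
qed

text \<open>Nothing is assumed about the origin of \<open>P\<close>, since the uniqueness of the
  solution in \<open>HG\<close> has to be shown among all reverse plane partitions.\<close>

locale nonzero_rpp =
  fixes R C :: nat and P
  assumes rpp: "is_rpp R C P" and nz: "\<not> (\<forall>x\<in>cells R C. P x = 0)"
begin

abbreviation "c0 \<equiv> hg_start_col R C P"
abbreviation "P' \<equiv> hg_remove R C P"

definition p :: "nat \<Rightarrow> nat \<times> nat" where
  "p j = (hg_next P ^^ j) (R, c0)"

lemma R1: "1 \<le> R"
  using nz by (auto simp: cells_def)

lemma c0: "1 \<le> c0" "c0 \<le> C" "P (R, c0) \<noteq> 0"
  and zero_before: "1 \<le> c \<Longrightarrow> c < c0 \<Longrightarrow> 1 \<le> r \<Longrightarrow> r \<le> R \<Longrightarrow> P (r, c) = 0"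
proof -
  obtain r c where rc: "(r, c) \<in> cells R C" "P (r, c) \<noteq> 0" using nz by auto
  have "1 \<le> c0 \<and> c0 \<le> C \<and> (\<exists>r. 1 \<le> r \<and> r \<le> R \<and> P (r, c0) \<noteq> 0)"
    unfolding hg_start_col_def by (rule LeastI[of _ c]) (use rc in \<open>auto simp: cells_def\<close>)
  then obtain r' where r': "1 \<le> c0" "c0 \<le> C" "1 \<le> r'" "r' \<le> R" "P (r', c0) \<noteq> 0" by blast
  show "1 \<le> c0" "c0 \<le> C" by (rule r')+
  have "P (r', c0) \<le> P (R, c0)" by (rule rpp_column_mono[OF rpp]) (use r' in \<open>auto simp: cells_def\<close>)
  thus "P (R, c0) \<noteq> 0" using r' by simp
  show "P (r, c) = 0" if "1 \<le> c" "c < c0" "1 \<le> r" "r \<le> R" for r c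
  proof (rule ccontr)
    assume "P (r, c) \<noteq> 0"
    hence "c0 \<le> c" unfolding hg_start_col_def by (intro Least_le) (use that r' in \<open>auto\<close>)
    thus False using that by simp
  qed
qed

lemma ex_N: "\<exists>N. hg_path R C P = map p [0..<Suc N] \<and> snd (p N) = C \<and> snd (p (Suc N)) = Suc C \<and>
    (\<forall>j\<le>N. 1 \<le> fst (p j) \<and> snd (p j) \<le> C)"
  unfolding p_def hg_path_def using hg_zz_path[OF R1 c0(2), of "R + C" P] R1 c0 by simp

definition N :: nat where
  "N = (SOME N. hg_path R C P = map p [0..<Suc N] \<and> snd (p N) = C \<and> snd (p (Suc N)) = Suc C \<and>
    (\<forall>j\<le>N. 1 \<le> fst (p j) \<and> snd (p j) \<le> C))"

lemma path: "hg_path R C P = map p [0..<Suc N]" "snd (p N) = C" "snd (p (Suc N)) = Suc C"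
  "j \<le> N \<Longrightarrow> 1 \<le> fst (p j) \<and> snd (p j) \<le> C"
  using someI_ex[OF ex_N] unfolding N_def[symmetric] by blast+

lemma p0: "p 0 = (R, c0)"
  by (simp add: p_def)

lemma p_Suc: "p (Suc j) = hg_next P (p j)"
  by (simp add: p_def)

lemma p_cases:
  obtains (up) "1 < fst (p j)" "P (fst (p j) - 1, snd (p j)) = P (p j)" "p (Suc j) = (fst (p j) - 1, snd (p j))"
  | (right) "\<not> (1 < fst (p j) \<and> P (fst (p j) - 1, snd (p j)) = P (p j))" "p (Suc j) = (fst (p j), Suc (snd (p j)))"
  using p_Suc[of j] by (cases "p j") (auto simp: hg_next_def split: if_splits)

text \<open>Every step changes one coordinate by one, so a cell of the path determines its step
  number.\<close>

lemma p_bounds: "fst (p j) \<le> R \<and> c0 \<le> snd (p j) \<and> fst (p j) + c0 + j = R + snd (p j) \<and> 1 \<le> fst (p j)"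
proof (induction j)
  case 0 show ?case using R1 by (simp add: p0)
next
  case (Suc j) thus ?case by (cases rule: p_cases[of j]) auto
qed

lemma p_row_antimono: "j \<le> j' \<Longrightarrow> fst (p j') \<le> fst (p j)"
proof (induction j' rule: dec_induct)
  case (step j') thus ?case by (cases rule: p_cases[of j']) auto
qed simp

lemma p_cells: "j \<le> N \<Longrightarrow> p j \<in> cells R C"
  using p_bounds[of j] path(4)[of j] c0 by (cases "p j") (auto simp: cells_def)

lemma p_pos: "j \<le> N \<Longrightarrow> 1 \<le> P (p j)"
proof (induction j)
  case 0 show ?case using c0(3) by (simp add: p0)
next
  case (Suc j)
  hence IH: "1 \<le> P (p j)" by simp
  show ?case
  proof (cases rule: p_cases[of j])
    case up thus ?thesis using IH by simp
  next
    case right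
    have "(fst (p j), snd (p j)) \<in> cells R C" "(fst (p j), Suc (snd (p j))) \<in> cells R C"
      using p_cells[of j] p_cells[of "Suc j"] Suc.prems right by auto
    hence "P (fst (p j), snd (p j)) \<le> P (fst (p j), Suc (snd (p j)))" using rpp unfolding is_rpp_def by blast
    thus ?thesis using IH right by simp
  qed
qed

lemma P'_eq: "P' x = (if \<exists>j\<le>N. x = p j then P x - 1 else P x)"
proof -
  have "x \<in> set (hg_path R C P) \<longleftrightarrow> (\<exists>j\<le>N. x = p j)" unfolding path(1) by (auto simp: less_Suc_eq_le simp del: upt_Suc)
  thus ?thesis by (simp add: hg_remove_def)
qed

lemma P_eq: "P x = P' x + (if \<exists>j\<le>N. x = p j then 1 else 0)"
proof (cases "\<exists>j\<le>N. x = p j")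
  case True
  then obtain j where "j \<le> N" "x = p j" by blast
  hence "1 \<le> P x" using p_pos by simp
  thus ?thesis using True by (simp add: P'_eq)
next
  case False
  show ?thesis unfolding P'_eq if_not_P[OF False] by simp
qed

lemma P'_path: "j \<le> N \<Longrightarrow> P (p j) = Suc (P' (p j))"
  by (subst P_eq) auto

text \<open>An inequality can only fail between equal entries when just the one on the larger side
  is reduced. In a column, equality sends the path up into the other cell. In a row, equality
  spreads down to where the path entered its column, and there it would have climbed in the column
  before.\<close>

lemma P'_rpp: "is_rpp R C P'"
  unfolding is_rpp_def
proof (intro conjI allI impI)
  fix x assume "x \<notin> cells R C"
  hence "P x = 0" using rpp unfolding is_rpp_def by blast
  thus "P' x = 0" by (simp add: P'_eq)
next
  fix r c assume rc: "(r, c) \<in> cells R C \<and> (r, Suc c) \<in> cells R C"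
  hence le: "P (r, c) \<le> P (r, Suc c)" using rpp unfolding is_rpp_def by blast
  show "P' (r, c) \<le> P' (r, Suc c)"
  proof (rule ccontr)
    assume "\<not> ?thesis"
    hence *: "P' (r, Suc c) < P' (r, c)" by simp
    have in1: "\<exists>j\<le>N. (r, Suc c) = p j" and notin: "\<not> (\<exists>j\<le>N. (r, c) = p j)" and eq: "P (r, c) = P (r, Suc c)"
      using * le P_eq[of "(r, c)"] P_eq[of "(r, Suc c)"] by (auto split: if_splits)
    \<comment> \<open>The path is traced back down column \<open>Suc c\<close>, along which the
      entries are equal, to the row where it came over from column \<open>c\<close>, or to its
      start.\<close>
    have "\<forall>j\<le>N. \<forall>s. p j = (s, Suc c) \<longrightarrow> r \<le> s \<longrightarrow> P (s, Suc c) = P (r, Suc c) \<longrightarrow> (\<exists>i\<le>N. \<exists>s'\<ge>r. p i = (s', c) \<and> P (s', Suc c) = P (r, Suc c)) \<or> Suc c = c0"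
    proof (intro allI impI)
      fix j s assume "j \<le> N" "p j = (s, Suc c)" "r \<le> s" "P (s, Suc c) = P (r, Suc c)"
      thus "(\<exists>i\<le>N. \<exists>s'\<ge>r. p i = (s', c) \<and> P (s', Suc c) = P (r, Suc c)) \<or> Suc c = c0"
      proof (induction j arbitrary: s)
        case 0
        have "Suc c = c0" using 0(2) p0 by (metis prod.inject)
        thus ?case by blast
      next
        case (Suc j)
        show ?case
        proof (cases rule: p_cases[of j])
          case up
          hence "p j = (Suc s, Suc c)" using Suc.prems by (cases "p j") auto
          moreover have "P (Suc s, Suc c) = P (r, Suc c)" using up(2) Suc.prems(4) calculation by simp
          ultimately show ?thesis using Suc.IH[of "Suc s"] Suc.prems by simp
        next
          case right
          hence "p j = (s, c)" using Suc.prems by (cases "p j") auto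
          thus ?thesis using Suc.prems by (intro disjI1 exI[of _ j]) auto
        qed
      qed
    qed
    moreover obtain j where "j \<le> N" "p j = (r, Suc c)" using in1 by metis
    ultimately consider "Suc c = c0" | i s where "i \<le> N" "r \<le> s" "p i = (s, c)" "P (s, Suc c) = P (r, Suc c)" by blast
    thus False
    proof cases
      case 1
      have "P (r, c) = 0" using zero_before[of c r] 1 rc by (auto simp: cells_def)
      moreover obtain j where "j \<le> N" "p j = (r, Suc c)" using in1 by metis
      ultimately show False using p_pos[of j] eq by simp
    next
      case (2 i s)
      \<comment> \<open>Column \<open>c\<close> is squeezed between the equal entries at
        \<open>(r, c)\<close> and \<open>(s, Suc c)\<close>; being constant, it would carry the path
        from \<open>(s, c)\<close> up to \<open>(r, c)\<close>.\<close>
      have all_eq: "P (s', c) = P (r, c)" if "r \<le> s'" "s' \<le> s" for s'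
      proof -
        have cs: "(s', c) \<in> cells R C" "(s', Suc c) \<in> cells R C" "(s, Suc c) \<in> cells R C"
          using p_cells[OF 2(1)] 2(3) rc that by (auto simp: cells_def)
        have "P (r, c) \<le> P (s', c)" by (rule rpp_column_mono[OF rpp that(1)]) (use cs rc in auto)
        moreover have "P (s', c) \<le> P (s', Suc c)" using rpp cs unfolding is_rpp_def by blast
        moreover have "P (s', Suc c) \<le> P (s, Suc c)" by (rule rpp_column_mono[OF rpp that(2)]) (use cs in auto)
        ultimately show ?thesis using 2(4) eq by simp
      qed
      have climb: "\<exists>i\<le>N. p i = (s - d, c)" if "d \<le> s - r" for d
        using that
      proof (induction d)
        case 0 thus ?case using 2 by auto
      next
        case (Suc d)
        then obtain i where i: "i \<le> N" "p i = (s - d, c)" by auto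
        have rs: "1 \<le> r" "r \<le> s - d - 1" using rc Suc.prems by (auto simp: cells_def)
        have "P (s - d - 1, c) = P (s - d, c)" using all_eq[of "s - d - 1"] all_eq[of "s - d"] rs by simp
        hence n: "p (Suc i) = (s - Suc d, c)" using i(2) rs by (cases rule: p_cases[of i]) auto
        have "i \<noteq> N" using path(3) n rc by (auto simp: cells_def)
        thus ?case using n i(1) by (intro exI[of _ "Suc i"]) simp
      qed
      from climb[of "s - r"] show False using notin 2(2) by auto
    qed
  qed
next
  fix r c assume rc: "(r, c) \<in> cells R C \<and> (Suc r, c) \<in> cells R C"
  hence le: "P (r, c) \<le> P (Suc r, c)" using rpp unfolding is_rpp_def by blast
  show "P' (r, c) \<le> P' (Suc r, c)"
  proof (rule ccontr)
    assume "\<not> ?thesis"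
    hence *: "P' (Suc r, c) < P' (r, c)" by simp
    have in1: "\<exists>j\<le>N. (Suc r, c) = p j" and notin: "\<not> (\<exists>j\<le>N. (r, c) = p j)" and eq: "P (r, c) = P (Suc r, c)"
      using * le P_eq[of "(r, c)"] P_eq[of "(Suc r, c)"] by (auto split: if_splits)
    obtain j where j: "j \<le> N" "p j = (Suc r, c)" using in1 by metis
    have n: "p (Suc j) = (r, c)" using j(2) eq rc by (cases rule: p_cases[of j]) (auto simp: cells_def)
    moreover have "j \<noteq> N" using path(3) n rc by (auto simp: cells_def)
    ultimately show False using notin j(1) by (metis Suc_leI le_neq_implies_less)
  qed
qed

text \<open>The path can be read backwards from the reduced filling. An up-step leaves two equal
  entries, both reduced; after a right-step the cell below is off the path and keeps an entry that
  exceeds the reduced one.\<close>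

lemma p_back:
  assumes "j < N" "p (Suc j) = (r, c)"
  shows "p j = (if r < R \<and> P' (Suc r, c) = P' (r, c) then (Suc r, c) else (r, c - 1))"
proof (cases rule: p_cases[of j])
  case up
  hence pj: "p j = (Suc r, c)" using assms by (cases "p j") auto
  have "P' (p j) = P' (p (Suc j))"
    using P'_path[of j] P'_path[of "Suc j"] assms up pj by simp
  thus ?thesis using pj assms(2) p_bounds[of j] by simp
next
  case right
  hence pj: "p j = (r, c - 1)" "1 \<le> c" using assms by (cases "p j"; auto)+
  have "\<not> (r < R \<and> P' (Suc r, c) = P' (r, c))"
  proof
    assume *: "r < R \<and> P' (Suc r, c) = P' (r, c)"
    have cs: "(r, c) \<in> cells R C" using p_cells[of "Suc j"] assms by simp
    hence cs': "(Suc r, c) \<in> cells R C" using * by (auto simp: cells_def)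
    \<comment> \<open>By its step number the cell below could only be the predecessor on the path,
      and that is the cell to the left.\<close>
    have notin: "\<not> (\<exists>i\<le>N. (Suc r, c) = p i)"
    proof
      assume "\<exists>i\<le>N. (Suc r, c) = p i"
      then obtain i where i: "p i = (Suc r, c)" by metis
      have "i = j" using p_bounds[of i] p_bounds[of j] unfolding i pj fst_conv snd_conv using pj(2) by linarith
      thus False using i pj by simp
    qed
    have "P' (Suc r, c) = P (Suc r, c)" unfolding P'_eq if_not_P[OF notin] ..
    moreover have "P (r, c) \<le> P (Suc r, c)" using rpp cs cs' unfolding is_rpp_def by blast
    moreover have "P (r, c) = Suc (P' (r, c))" using P'_path[of "Suc j"] assms by simp
    ultimately show False using * by simp
  qed
  thus ?thesis using pj by simp
qed

lemma hg_cell_eq: "hg_cell R C P = (fst (p N), c0)"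
  by (simp add: hg_cell_def path(1))

end

text \<open>\<open>hg_cell\<close> fixes the start and the end of the path, hence its length;
  \<open>p_back\<close> recovers the cells between, and with them the original entries.\<close>

lemma hg_remove_inj:
  assumes "nonzero_rpp R C P" "nonzero_rpp R C Q"
    and rem: "hg_remove R C P = hg_remove R C Q" and cell: "hg_cell R C P = hg_cell R C Q"
  shows "P = Q"
proof -
  interpret A: nonzero_rpp R C P by fact
  interpret B: nonzero_rpp R C Q by fact
  have c0: "A.c0 = B.c0" and fN: "fst (A.p A.N) = fst (B.p B.N)"
    using cell A.hg_cell_eq B.hg_cell_eq by auto
  have pN: "A.p A.N = B.p B.N" using fN A.path(2) B.path(2) by (simp add: prod_eq_iff)
  have N: "A.N = B.N" using A.p_bounds[of A.N] B.p_bounds[of B.N] pN c0 by simp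
  have "A.p (A.N - d) = B.p (A.N - d)" if "d \<le> A.N" for d
    using that
  proof (induction d)
    case 0 thus ?case using pN N by simp
  next
    case (Suc d)
    obtain r c where rc: "A.p (A.N - d) = (r, c)" by fastforce
    have s: "A.N - d = Suc (A.N - Suc d)" using Suc.prems by simp
    show ?case
      using A.p_back[of "A.N - Suc d" r c] B.p_back[of "A.N - Suc d" r c] Suc rc s N rem by simp
  qed
  hence "A.p j = B.p j" if "j \<le> A.N" for j using that by (metis diff_diff_cancel diff_le_self)
  hence iff: "(\<exists>j\<le>A.N. x = A.p j) \<longleftrightarrow> (\<exists>j\<le>B.N. x = B.p j)" for x using N by auto
  show ?thesis
  proof
    fix x show "P x = Q x" unfolding A.P_eq[of x] B.P_eq[of x] rem iff ..
  qed
qed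

text \<open>Two successive paths from one column: the second stays weakly above the first, because
  where they meet before an up-step of the first, both entries involved were equal and have both
  been reduced, so the second goes up as well. Right endpoints of removed intervals therefore weakly
  increase.\<close>

lemma hg_cell_mono:
  assumes "nonzero_rpp R C P" "nonzero_rpp R C (hg_remove R C P)"
    and col: "hg_start_col R C P = hg_start_col R C (hg_remove R C P)"
  shows "fst (hg_cell R C (hg_remove R C P)) \<le> fst (hg_cell R C P)"
proof -
  interpret A: nonzero_rpp R C P by fact
  interpret B: nonzero_rpp R C "hg_remove R C P" by fact
  have upB: "B.p (Suc j) = (fst (A.p j) - 1, snd (A.p j))" 
    if eq: "B.p j = A.p j" and j: "Suc j \<le> A.N" and up: "A.p (Suc j) = (fst (A.p j) - 1, snd (A.p j))" 
      "P (fst (A.p j) - 1, snd (A.p j)) = P (A.p j)" "1 < fst (A.p j)" for j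
  proof -
    have "A.P' (A.p (Suc j)) = A.P' (A.p j)"
      using A.P'_path[of j] A.P'_path[of "Suc j"] j up by simp
    thus ?thesis using eq up by (cases rule: B.p_cases[of j]) auto
  qed
  have le: "fst (B.p j) \<le> fst (A.p j)" if "j \<le> A.N" for j
    using that
  proof (induction j)
    case 0 thus ?case by (simp add: A.p0 B.p0)
  next
    case (Suc j)
    hence IH: "fst (B.p j) \<le> fst (A.p j)" by simp
    have "fst (B.p (Suc j)) \<le> fst (B.p j)" using B.p_row_antimono[of j "Suc j"] by simp
    show ?case
    proof (cases rule: A.p_cases[of j])
      case right thus ?thesis using IH \<open>fst (B.p (Suc j)) \<le> fst (B.p j)\<close> by simp
    next
      case up
      show ?thesis
      proof (cases "fst (B.p j) = fst (A.p j)")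
        case True
        hence "B.p j = A.p j" using A.p_bounds[of j] B.p_bounds[of j] col by (simp add: prod_eq_iff)
        from upB[OF this Suc.prems up(3,2,1)] show ?thesis using up by simp
      next
        case False
        thus ?thesis using IH \<open>fst (B.p (Suc j)) \<le> fst (B.p j)\<close> up by simp
      qed
    qed
  qed
  \<comment> \<open>A path that is higher after the same number of steps has made fewer right-steps,
    so it does not finish earlier.\<close>
  have "A.N \<le> B.N"
  proof (rule ccontr)
    assume "\<not> ?thesis"
    hence j: "B.N < A.N" by simp
    have "snd (A.p B.N) = snd (B.p B.N)" 
      using le[of B.N] A.p_bounds[of B.N] B.p_bounds[of B.N] A.path(4)[of B.N] B.path(2) j col by simp
    hence eq: "B.p B.N = A.p B.N" using A.p_bounds[of B.N] B.p_bounds[of B.N] col by (simp add: prod_eq_iff)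
    show False
    proof (cases rule: A.p_cases[of B.N])
      case right
      thus False using A.path(4)[of "Suc B.N"] j B.path(2) eq by simp
    next
      case up
      from upB[OF eq _ up(3,2,1)] j B.path(2,3) eq show False by simp
    qed
  qed
  hence "fst (B.p B.N) \<le> fst (B.p A.N)" by (rule B.p_row_antimono)
  also have "\<dots> \<le> fst (A.p A.N)" by (rule le) simp
  finally show ?thesis by (simp add: A.hg_cell_eq B.hg_cell_eq)
qed

lemma rim_hook_inj: "inj_on (rim_hook_of_interval n m) (PQ n m)"
proof (rule inj_onI)
  fix x y assume x: "x \<in> PQ n m" and y: "y \<in> PQ n m" and eq: "rim_hook_of_interval n m x = rim_hook_of_interval n m y"
  obtain a b a' b' where [simp]: "x = (a, b)" "y = (a', b')" by fastforce
  have X: "1 \<le> a" "a \<le> m" "m \<le> b" "b \<le> n" "1 \<le> a'" "a' \<le> m" "m \<le> b'" "b' \<le> n" using x y by (auto simp: PQ_def)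
  have E: "rim_hook_of_cell (n + 1 - m) m (n + 1 - b, a) = rim_hook_of_cell (n + 1 - m) m (n + 1 - b', a')"
    using eq rim_hook_interval_cell[OF X(1-4)] rim_hook_interval_cell[OF X(5-8)] by simp
  have "(n + 1 - m, a) \<in> rim_hook_of_cell (n + 1 - m) m (n + 1 - b', a')" unfolding E[symmetric]
    using X by (simp add: rim_hook_of_cell_def)
  moreover have "(n + 1 - m, a') \<in> rim_hook_of_cell (n + 1 - m) m (n + 1 - b, a)" unfolding E
    using X by (simp add: rim_hook_of_cell_def)
  moreover have "n + 1 - b \<le> n + 1 - m" "n + 1 - b' \<le> n + 1 - m" using X by simp_all
  moreover from this have "(n + 1 - b, m) \<in> rim_hook_of_cell (n + 1 - m) m (n + 1 - b', a')" unfolding E[symmetric]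
    using X by (simp add: rim_hook_of_cell_def)
  moreover from \<open>n + 1 - b' \<le> n + 1 - m\<close> have "(n + 1 - b', m) \<in> rim_hook_of_cell (n + 1 - m) m (n + 1 - b, a)" unfolding E
    using X by (simp add: rim_hook_of_cell_def)
  ultimately have "a = a' \<and> b = b'" using X by (auto simp: rim_hook_of_cell_def)
  thus "x = y" by simp
qed

text \<open>A derivation is replayed on fillings. The interval removed first is lexicographically
  least: start columns cannot move left, since earlier columns vanish, and
  \<open>hg_cell_mono\<close> orders the right endpoints for a fixed start column. Then
  \<open>P\<close> and the filling of the enlarged multiset have the same reduction and the same
  removed cell, so they agree.\<close>

lemma hg_rel_imp_fill:
  assumes "1 \<le> m" "m \<le> n"
  shows "hg_rel (n + 1 - m) m P A \<Longrightarrow> is_rpp (n + 1 - m) m P \<Longrightarrow>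
    \<exists>M. (\<forall>x\<in>#M. x \<in> PQ n m) \<and> A = image_mset (rim_hook_of_interval n m) M \<and> P = fill n m M"
proof (induction rule: hg_rel.induct)
  case (zero P)
  have "P x = fill n m {#} x" for x
    using zero by (cases x) (auto simp: is_rpp_def fill_def rpp_of_def shape_def lev_def)
  thus ?case by (intro exI[of _ "{#}"]) auto
next
  case (step P A)
  let ?R = "n + 1 - m"
  interpret nonzero_rpp ?R m P by unfold_locales (use step in auto)
  obtain M where M: "\<forall>x\<in>#M. x \<in> PQ n m" "A = image_mset (rim_hook_of_interval n m) M" "P' = fill n m M"
    using step.IH[OF P'_rpp] by blast
  define a b where "a = c0" and "b = n + 1 - fst (p N)"
  have pN: "1 \<le> fst (p N)" "fst (p N) \<le> ?R" using p_bounds[of N] by auto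
  have ab: "1 \<le> a" "a \<le> m" "m \<le> b" "b \<le> n" using c0 pN assms unfolding a_def b_def by linarith+
  have cell: "hg_cell ?R m P = (n + 1 - b, a)"
  proof -
    have "fst (p N) = n + 1 - b" using pN assms unfolding b_def by linarith
    thus ?thesis unfolding hg_cell_eq by (simp only: a_def)
  qed
  have "lex_min (a, b) M"
  proof (cases "M = {#}")
    case False
    then obtain y M' where y: "M = add_mset y M'" "lex_min y M'" using ex_lex_min by blast
    obtain a' b' where y': "y = (a', b')" by fastforce
    interpret B: hook_added n m M' a' b'
      by unfold_locales (use M(1) y y' assms in auto)
    have P': "P' = fill n m B.M'" using M(3) y y' by simp
    interpret Q: nonzero_rpp ?R m P' 
      by unfold_locales (use P'_rpp B.hg_step(4) P' in auto)
    have c: "Q.c0 = a'" using B.hg_step(1) P' by simp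
    have "P (?R, a') \<noteq> 0" using Q.c0(3) c P_eq[of "(?R, a')"] by simp
    hence le: "a \<le> a'" using zero_before[of a' ?R] B.ab R1 unfolding a_def by (meson leI order_refl)
    have "b \<le> b'" if "a = a'"
    proof -
      have "fst (hg_cell ?R m P') \<le> fst (hg_cell ?R m P)"
        by (rule hg_cell_mono) (unfold_locales, use that c in \<open>simp add: a_def\<close>)
      hence "n + 1 - b' \<le> n + 1 - b" using B.hg_step(2) P' cell by simp
      thus ?thesis using B.ab ab by linarith
    qed
    hence "a < a' \<or> a = a' \<and> b \<le> b'" using le by linarith
    thus ?thesis using y(2) unfolding lex_min_def y(1) y' by fastforce
  qed (simp add: lex_min_def)
  then interpret D: hook_added n m M a b
    by unfold_locales (use M(1) ab assms in \<open>auto simp: PQ_def\<close>)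
  have "P = fill n m D.M'"
  proof (rule hg_remove_inj)
    show "nonzero_rpp ?R m P" by unfold_locales
    show "nonzero_rpp ?R m (fill n m D.M')" by unfold_locales (use fill_rpp[OF D.PQ D.mn] D.hg_step(4) in auto)
    show "P' = hg_remove ?R m (fill n m D.M')" using M(3) D.hg_step(3) by simp
    show "hg_cell ?R m P = hg_cell ?R m (fill n m D.M')" using cell D.hg_step(2) by simp
  qed
  moreover have "rim_hook_of_cell ?R m (hg_cell ?R m P) = rim_hook_of_interval n m (a, b)"
    unfolding cell by (rule rim_hook_interval_cell[OF ab])
  ultimately show ?case using M(2) D.PQ by (intro exI[of _ D.M']) simp
qed

theorem HG_eq_fill:
  assumes "\<forall>x\<in>#M. x \<in> PQ n m" "1 \<le> m" "m \<le> n"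
  shows "HG n m M = fill n m M"
  unfolding HG_def
proof (rule the_equality)
  show "is_rpp (n + 1 - m) m (fill n m M) \<and> hg_rel (n + 1 - m) m (fill n m M) (image_mset (rim_hook_of_interval n m) M)"
    using fill_rpp[OF assms(1,3)] hg_rel_fill[OF assms(1,3)] by simp
next
  fix P assume P: "is_rpp (n + 1 - m) m P \<and> hg_rel (n + 1 - m) m P (image_mset (rim_hook_of_interval n m) M)"
  then obtain M' where M': "\<forall>x\<in>#M'. x \<in> PQ n m" "image_mset (rim_hook_of_interval n m) M = image_mset (rim_hook_of_interval n m) M'"
    "P = fill n m M'"
    using hg_rel_imp_fill[OF assms(2,3)] by blast
  have "image_mset (the_inv_into (PQ n m) (rim_hook_of_interval n m)) (image_mset (rim_hook_of_interval n m) N) = N"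
    if "\<forall>x\<in>#N. x \<in> PQ n m" for N
    using that unfolding multiset.map_comp
    by (intro multiset.map_ident_strong) (simp add: the_inv_into_f_f[OF rim_hook_inj])
  from this[OF assms(1)] this[OF M'(1)] M'(2) have "M = M'" by metis
  thus "P = fill n m M" using M'(3) by simp
qed

section \<open>Jordan types of endomorphisms with poset support\<close>

lemma zero_mat_mult_vec: "v \<in> carrier_vec n \<Longrightarrow> 0\<^sub>m k n *\<^sub>v v = (0\<^sub>v k :: 'a::semiring_0 vec)"
  by (intro eq_vecI) (auto simp: scalar_prod_def)

lemma det_pow: "(A :: 'a::field mat) \<in> carrier_mat n n \<Longrightarrow> det (A ^\<^sub>m k) = det A ^ k"
proof (induction k)
  case (Suc k)
  thus ?case by (simp add: det_mult[of _ n])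
qed simp

lemma pow_block_triangular:
  fixes A1 :: "'a::field mat"
  assumes "A1 \<in> carrier_mat n n" "A0 \<in> carrier_mat n m" "A2 \<in> carrier_mat m m"
  shows "\<exists>X\<in>carrier_mat n m. four_block_mat A1 A0 (0\<^sub>m m n) A2 ^\<^sub>m k = four_block_mat (A1 ^\<^sub>m k) X (0\<^sub>m m n) (A2 ^\<^sub>m k)"
proof (induction k)
  case 0
  show ?case using assms by (intro bexI[of _ "0\<^sub>m n m"]) auto
next
  case (Suc k)
  then obtain X where X: "X \<in> carrier_mat n m" 
    "four_block_mat A1 A0 (0\<^sub>m m n) A2 ^\<^sub>m k = four_block_mat (A1 ^\<^sub>m k) X (0\<^sub>m m n) (A2 ^\<^sub>m k)" by blast
  have "four_block_mat A1 A0 (0\<^sub>m m n) A2 ^\<^sub>m Suc k = four_block_mat (A1 ^\<^sub>m k) X (0\<^sub>m m n) (A2 ^\<^sub>m k) * four_block_mat A1 A0 (0\<^sub>m m n) A2"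
    by (simp add: X)
  also have "\<dots> = four_block_mat (A1 ^\<^sub>m k * A1 + X * 0\<^sub>m m n) (A1 ^\<^sub>m k * A0 + X * A2)
     (0\<^sub>m m n * A1 + A2 ^\<^sub>m k * 0\<^sub>m m n) (0\<^sub>m m n * A0 + A2 ^\<^sub>m k * A2)"
    by (rule mult_four_block_mat) (use assms X in auto)
  also have "\<dots> = four_block_mat (A1 ^\<^sub>m Suc k) (A1 ^\<^sub>m k * A0 + X * A2) (0\<^sub>m m n) (A2 ^\<^sub>m Suc k)"
    using assms X mult_carrier_mat[OF pow_carrier_mat[OF assms(1), of k] assms(1)]
      mult_carrier_mat[OF pow_carrier_mat[OF assms(3), of k] assms(3)] by simp
  finally show ?case using assms X by (intro bexI[of _ "A1 ^\<^sub>m k * A0 + X * A2"]) auto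
qed

lemma four_block_lower_right_zero:
  assumes "A1 \<in> carrier_mat n n" "A0 \<in> carrier_mat n m" "A3 \<in> carrier_mat m n" "A2 \<in> carrier_mat m m"
    "four_block_mat A1 A0 A3 A2 = 0\<^sub>m (n + m) (n + m)"
  shows "A2 = 0\<^sub>m m m"
proof (rule eq_matI)
  fix i j assume "i < dim_row (0\<^sub>m m m :: 'a mat)" "j < dim_col (0\<^sub>m m m :: 'a mat)"
  hence ij: "i < m" "j < m" by auto
  have "four_block_mat A1 A0 A3 A2 $$ (n + i, n + j) = A2 $$ (i, j)" using assms(1-4) ij by simp
  thus "A2 $$ (i, j) = 0\<^sub>m m m $$ (i, j)" unfolding assms(5) using ij by simp
qed (use assms in auto)

lemma ex_similar_first_col_zero:
  fixes A :: "'a::field mat"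
  assumes A: "A \<in> carrier_mat n n" and n: "0 < n" and d: "det A = 0"
  shows "\<exists>B\<in>carrier_mat n n. similar_mat A B \<and> (\<forall>p<n. B $$ (p, 0) = 0)"
proof -
  obtain v where v: "v \<in> carrier_vec n" "v \<noteq> 0\<^sub>v n" "A *\<^sub>v v = 0\<^sub>v n"
    using d det_0_iff_vec_prod_zero_field[OF A] by blast
  then obtain i where i: "i < n" "v $ i \<noteq> 0" by (metis carrier_vecD eq_vecI index_zero_vec)
  \<comment> \<open>\<open>s\<close> exchanges 0 and \<open>i\<close>, so the columns of
    \<open>P\<close> after the first, which is the kernel vector, are the standard vectors other
    than the one at the nonzero coordinate \<open>i\<close>.\<close>
  define s where "s q = (if q = i then 0 else if q = 0 then i else q)" for q
  have s: "s q < n" "q \<noteq> 0 \<Longrightarrow> s q \<noteq> i" if "q < n" for q using that i n by (auto simp: s_def)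
  have s_inj: "s q = s q' \<longleftrightarrow> q = q'" for q q' by (auto simp: s_def)
  define P where "P = mat n n (\<lambda>(p, q). if q = 0 then v $ p else if p = s q then 1 else 0)"
  \<comment> \<open>The explicit inverse: coordinate \<open>i\<close> divided by
    \<open>v $ i\<close> is the coefficient of \<open>v\<close>, and that multiple of
    \<open>v\<close> is subtracted from the other coordinates.\<close>
  define Q where "Q = mat n n (\<lambda>(p, q). (if q = i then (if p = 0 then 1 / v $ i else - v $ s p / v $ i) else 0)
     + (if q = s p then (if p = 0 then 0 else 1) else 0))"
  have P: "P \<in> carrier_mat n n" and Q: "Q \<in> carrier_mat n n" by (auto simp: P_def Q_def)
  have QP: "Q * P = 1\<^sub>m n"
  proof (rule eq_matI)
    fix p q assume "p < dim_row (1\<^sub>m n :: 'a mat)" "q < dim_col (1\<^sub>m n :: 'a mat)"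
    hence pq: "p < n" "q < n" by auto
    have "(Q * P) $$ (p, q) = (\<Sum>x<n. Q $$ (p, x) * P $$ (x, q))"
      using pq P Q by (simp add: scalar_prod_def atLeast0LessThan)
    also have "\<dots> = (\<Sum>x<n. (if x = i then (if p = 0 then 1 / v $ i else - v $ s p / v $ i) * P $$ (x, q) else 0) 
        + (if x = s p then (if p = 0 then 0 else 1) * P $$ (x, q) else 0))"
      using pq by (intro sum.cong) (auto simp: Q_def algebra_simps)
    also have "\<dots> = (if p = 0 then 1 / v $ i else - v $ s p / v $ i) * P $$ (i, q) + (if p = 0 then 0 else 1) * P $$ (s p, q)"
      using pq i s by (simp add: sum.distrib sum.delta)
    also have "\<dots> = 1\<^sub>m n $$ (p, q)"
      using pq i s[of p] s[of q] s_inj by (auto simp: P_def)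
    finally show "(Q * P) $$ (p, q) = 1\<^sub>m n $$ (p, q)" .
  qed (use P Q in auto)
  have PQ: "P * Q = 1\<^sub>m n" by (rule mat_mult_left_right_inverse[OF Q P QP])
  define B where "B = Q * A * P"
  have "similar_mat_wit B A Q P"
    by (rule similar_mat_witI[OF QP PQ]) (use P Q A in \<open>auto simp: B_def\<close>)
  hence "similar_mat A B" unfolding similar_mat_def using similar_mat_wit_sym by blast
  moreover have "B $$ (p, 0) = 0" if "p < n" for p
  proof -
    have "col P 0 = v" using n v(1) by (intro eq_vecI) (auto simp: P_def)
    hence "col (A * P) 0 = 0\<^sub>v n" using col_mult2[OF A P n] v(3) by simp
    moreover have "B = Q * (A * P)" using Q A P by (simp add: B_def)
    ultimately have "B $$ (p, 0) = row Q p \<bullet> 0\<^sub>v n" using that n Q A P by simp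
    also have "\<dots> = 0" using Q that by simp
    finally show ?thesis .
  qed
  ultimately show ?thesis using A P Q by (intro bexI[of _ B]) (auto simp: B_def)
qed

text \<open>Nilpotency makes the determinant zero; a kernel vector splits off a zero first column,
  and the lower right block is again nilpotent.\<close>

lemma nilpotent_similar_strict_upper:
  fixes A :: "'a::field mat"
  assumes "A \<in> carrier_mat n n" "A ^\<^sub>m k = 0\<^sub>m n n"
  shows "\<exists>B\<in>carrier_mat n n. similar_mat A B \<and> (\<forall>i<n. \<forall>j\<le>i. B $$ (i, j) = 0)"
  using assms
proof (induction n arbitrary: A)
  case 0
  thus ?case by (intro bexI[of _ A]) (auto intro: similar_mat_refl)
next
  case (Suc n)
  have "det A ^ k = 0" using det_pow[OF Suc.prems(1), of k] Suc.prems(2) by (simp add: det_zero)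
  hence "det A = 0" by (simp add: power_eq_0_iff)
  from ex_similar_first_col_zero[OF Suc.prems(1) _ this] obtain B where B: "B \<in> carrier_mat (Suc n) (Suc n)"
    "similar_mat A B" "\<And>p. p < Suc n \<Longrightarrow> B $$ (p, 0) = 0" by auto
  obtain A1 A0 A3 A2 where sb: "split_block B 1 1 = (A1, A0, A3, A2)" by (cases "split_block B 1 1") auto
  note sp = split_block[OF sb, of n n]
  have bl: "A1 \<in> carrier_mat 1 1" "A0 \<in> carrier_mat 1 n" "A3 \<in> carrier_mat n 1" "A2 \<in> carrier_mat n n"
    "B = four_block_mat A1 A0 A3 A2" using sp B(1) by auto
  have A1: "A1 = 0\<^sub>m 1 1" 
  proof (rule eq_matI)
    show "A1 $$ (i, j) = 0\<^sub>m 1 1 $$ (i, j)" if "i < dim_row (0\<^sub>m 1 1 :: 'a mat)" "j < dim_col (0\<^sub>m 1 1 :: 'a mat)" for i j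
      using B(3)[of 0] bl that by simp
  qed (use bl in auto)
  have A3: "A3 = 0\<^sub>m n 1"
  proof (rule eq_matI)
    show "A3 $$ (i, j) = 0\<^sub>m n 1 $$ (i, j)" if "i < dim_row (0\<^sub>m n 1 :: 'a mat)" "j < dim_col (0\<^sub>m n 1 :: 'a mat)" for i j
      using B(3)[of "Suc i"] bl that by simp
  qed (use bl in auto)
  have "B ^\<^sub>m k = 0\<^sub>m (Suc n) (Suc n)"
  proof -
    obtain P Q where "similar_mat_wit B A P Q" using B(2) similar_mat_sym similar_mat_def by blast
    from similar_mat_wit_pow_id[OF this] similar_mat_witD2[OF B(1) this] show ?thesis
      using Suc.prems(2) by simp
  qed
  moreover obtain X where X: "X \<in> carrier_mat 1 n" "B ^\<^sub>m k = four_block_mat (A1 ^\<^sub>m k) X (0\<^sub>m n 1) (A2 ^\<^sub>m k)"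
    using pow_block_triangular[OF bl(1,2,4), of k] unfolding bl(5) A3 by blast
  ultimately have "A2 ^\<^sub>m k = 0\<^sub>m n n"
    by (intro four_block_lower_right_zero[of "A1 ^\<^sub>m k" 1 X n "0\<^sub>m n 1"]) (use bl X in auto)
  from Suc.IH[OF bl(4) this] obtain B2 where B2: "B2 \<in> carrier_mat n n" "similar_mat A2 B2" 
    "\<And>i j. i < n \<Longrightarrow> j \<le> i \<Longrightarrow> B2 $$ (i, j) = 0" by blast
  obtain B0 where B0: "B0 \<in> carrier_mat 1 n" 
    "similar_mat (four_block_mat A1 A0 (0\<^sub>m n 1) A2) (four_block_mat A1 B0 (0\<^sub>m n 1) B2)"
    using similar_mat_four_block_0_ex[OF similar_mat_refl[OF bl(1)] B2(2) bl(2,1,4)] by blast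
  let ?B = "four_block_mat A1 B0 (0\<^sub>m n 1) B2"
  have "similar_mat A ?B" using similar_mat_trans[OF B(2)] B0(2) bl(5) A3 by simp
  moreover have "?B $$ (i, j) = 0" if "i < Suc n" "j \<le> i" for i j
    using that B2 B0 bl A1 by (cases i; cases j) auto
  moreover have "?B \<in> carrier_mat (Suc n) (Suc n)" using four_block_carrier_mat[OF bl(1) B2(1)] by simp
  ultimately show ?case by blast
qed

lemma nilpotent_jordan_nf:
  fixes A :: "'a::field mat"
  assumes "A \<in> carrier_mat n n" "A ^\<^sub>m k = 0\<^sub>m n n"
  shows "\<exists>n_as. jordan_nf A n_as" 
proof -
  obtain B where B: "B \<in> carrier_mat n n" "similar_mat A B" "\<And>i j. i < n \<Longrightarrow> j \<le> i \<Longrightarrow> B $$ (i, j) = 0"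
    using nilpotent_similar_strict_upper[OF assms] by blast
  hence "upper_triangular B" by auto
  from triangular_to_jnf_vector[OF B(1) this] B(2) show ?thesis
    unfolding jordan_nf_def using similar_mat_trans by blast
qed

lemma nilpotent_jordan_eigenvalue:
  fixes A :: "'a::field mat"
  assumes A: "A \<in> carrier_mat n n" and nil: "A ^\<^sub>m k = 0\<^sub>m n n" and jnf: "jordan_nf A n_as" and mem: "(s, a) \<in> set n_as"
  shows "a = 0" "0 < s"
proof -
  show s: "0 < s" using jnf mem unfolding jordan_nf_def by force
  have "char_poly A \<noteq> 0" using degree_monic_char_poly[OF A] by auto
  moreover have "s \<le> order a (char_poly A)" by (rule jordan_nf_block_size_order_bound[OF jnf mem])
  ultimately have "poly (char_poly A) a = 0" using s order_root by fastforce
  hence "eigenvalue A a" using eigenvalue_root_char_poly[OF A] by simp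
  then obtain v where v: "eigenvector A v a" unfolding eigenvalue_def by blast
  hence v': "v \<in> carrier_vec n" "v \<noteq> 0\<^sub>v n" using A unfolding eigenvector_def by auto
  have "a ^ k \<cdot>\<^sub>v v = 0\<^sub>v n" using eigenvector_pow[OF A v, of k] v'(1) unfolding nil
    by (simp add: zero_mat_mult_vec)
  moreover obtain i where "i < n" "v $ i \<noteq> 0" using v' by (metis carrier_vecD eq_vecI index_zero_vec)
  ultimately have "a ^ k = 0" using v'(1) by (metis carrier_vecD index_smult_vec(1) index_zero_vec(1) mult_eq_0_iff)
  thus "a = 0" by (simp add: power_eq_0_iff)
qed

lemma nilpotent_char_poly:
  fixes A :: "'a::field mat"
  assumes A: "A \<in> carrier_mat n n" and nil: "A ^\<^sub>m k = 0\<^sub>m n n"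
  shows "char_poly A = monom 1 n"
proof -
  obtain B where B: "B \<in> carrier_mat n n" "similar_mat A B" "\<And>i j. i < n \<Longrightarrow> j \<le> i \<Longrightarrow> B $$ (i, j) = 0"
    using nilpotent_similar_strict_upper[OF assms] by blast
  have ut: "upper_triangular B" using B by auto
  have "diag_mat B = replicate n 0" 
    by (rule nth_equalityI) (use B in \<open>auto simp: diag_mat_def\<close>)
  hence "char_poly B = [:0, 1:] ^ n" using char_poly_upper_triangular[OF B(1) ut] by (simp add: prod_list_replicate)
  thus ?thesis using char_poly_similar[OF B(2)] by (simp add: monom_altdef)
qed

lemma jordan_matrix_pow_Cons_index:
  assumes "p < s + sum_list (map fst n_as)" "q < s + sum_list (map fst n_as)"
  shows "(jordan_matrix ((s, 0 :: 'a::field) # n_as) ^\<^sub>m l) $$ (p, q) =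
    (if p < s then if q < s then (if p \<le> q \<and> q - p = l then 1 else 0) else 0
     else if q < s then 0 else (jordan_matrix n_as ^\<^sub>m l) $$ (p - s, q - s))"
proof -
  let ?D = "jordan_matrix n_as ^\<^sub>m l" and ?B = "jordan_block s (0::'a) ^\<^sub>m l"
  have D: "?D \<in> carrier_mat (sum_list (map fst n_as)) (sum_list (map fst n_as))" by simp
  have B: "?B \<in> carrier_mat s s" by simp
  have "jordan_matrix ((s, 0) # n_as) ^\<^sub>m l = four_block_mat ?B (0\<^sub>m (dim_row ?B) (dim_col ?D)) (0\<^sub>m (dim_row ?D) (dim_col ?B)) ?D"
    unfolding jordan_matrix_pow by (simp add: Let_def)
  thus ?thesis using D B assms by (auto simp: jordan_block_zero_pow)
qed

text \<open>\<open>u i\<close> and \<open>v i\<close> are the first and the last index of block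
  \<open>i\<close>. The basis vector at \<open>v i\<close> generates the Jordan chain of the block,
  and the coordinate at \<open>u i\<close> sees only its last nonzero stage. These become the border
  vectors of \<open>bordered_det\<close>.\<close>

lemma jordan_matrix_chain_ends:
  assumes "\<forall>sa\<in>set n_as. snd sa = (0 :: 'a::field) \<and> 0 < fst sa"
  shows "\<exists>u v. (\<forall>i<length n_as. u i < sum_list (map fst n_as) \<and> v i < sum_list (map fst n_as)) \<and>
    (\<forall>i<length n_as. \<forall>j<length n_as. \<forall>l. (jordan_matrix n_as ^\<^sub>m l) $$ (u i, v j) =
       (if i = j \<and> Suc l = fst (n_as ! j) then 1 else 0)) \<and>
    (\<forall>j<length n_as. \<forall>p<sum_list (map fst n_as). (jordan_matrix n_as ^\<^sub>m (fst (n_as ! j))) $$ (p, v j) = 0)"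
  using assms
proof (induction n_as)
  case Nil
  show ?case by simp
next
  case (Cons sa n_as)
  obtain s where sa: "sa = (s, 0)" "0 < s" using Cons.prems by (cases sa) auto
  let ?N = "sum_list (map fst n_as)"
  have "\<forall>sa\<in>set n_as. snd sa = 0 \<and> 0 < fst sa" using Cons.prems by simp
  from Cons.IH[OF this] obtain u v where uv: "\<And>i. i < length n_as \<Longrightarrow> u i < ?N \<and> v i < ?N"
    "\<And>i j l. i < length n_as \<Longrightarrow> j < length n_as \<Longrightarrow> (jordan_matrix n_as ^\<^sub>m l) $$ (u i, v j) = (if i = j \<and> Suc l = fst (n_as ! j) then 1 else 0)"
    "\<And>j p. j < length n_as \<Longrightarrow> p < ?N \<Longrightarrow> (jordan_matrix n_as ^\<^sub>m (fst (n_as ! j))) $$ (p, v j) = 0"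
    by blast
  define u' where "u' i = (case i of 0 \<Rightarrow> 0 | Suc i \<Rightarrow> s + u i)" for i
  define v' where "v' i = (case i of 0 \<Rightarrow> s - 1 | Suc i \<Rightarrow> s + v i)" for i
  have b: "u' i < s + ?N" "v' i < s + ?N" if "i < Suc (length n_as)" for i
    using that uv(1) sa(2) by (auto simp: u'_def v'_def split: nat.split)
  note idx = jordan_matrix_pow_Cons_index[of _ s n_as]
  have 1: "(jordan_matrix (sa # n_as) ^\<^sub>m l) $$ (u' i, v' j) = (if i = j \<and> Suc l = fst ((sa # n_as) ! j) then 1 else 0)"
    if "i < Suc (length n_as)" "j < Suc (length n_as)" for i j l
    unfolding sa(1) idx[OF b(1)[OF that(1)] b(2)[OF that(2)]] using that sa(2) uv(2)
    by (auto simp: u'_def v'_def split: nat.split)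
  have 2: "(jordan_matrix (sa # n_as) ^\<^sub>m (fst ((sa # n_as) ! j))) $$ (p, v' j) = 0"
    if "j < Suc (length n_as)" "p < s + ?N" for j p
    unfolding sa(1) idx[OF that(2) b(2)[OF that(1)]] using that sa(2) uv(3)
    by (auto simp: v'_def split: nat.split)
  show ?case using b 1 2 by (intro exI[of _ u'] exI[of _ v']) (simp add: sa(1))
qed

lemma mat_pow_Suc_left:
  assumes "(A :: 'a::semiring_1 mat) \<in> carrier_mat n n"
  shows "A ^\<^sub>m Suc k = A * A ^\<^sub>m k"
proof (induction k)
  case 0 thus ?case using assms by simp
next
  case (Suc k)
  have "A ^\<^sub>m Suc (Suc k) = A * A ^\<^sub>m k * A" using Suc by simp
  also have "\<dots> = A * (A ^\<^sub>m k * A)" using assms by (intro assoc_mult_mat[of _ n n _ n _ n]) auto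
  finally show ?case by simp
qed

lemma sum_monom: "(\<Sum>x\<in>S. monom (f x) n) = monom (\<Sum>x\<in>S. f x) n"
  by (induction S rule: infinite_finite_induct) (auto simp: add_monom)

lemma char_poly_matrix_index:
  "A \<in> carrier_mat n n \<Longrightarrow> p < n \<Longrightarrow> q < n \<Longrightarrow>
    char_poly_matrix A $$ (p, q) = (if p = q then [:0, 1:] else 0) + [:- A $$ (p, q):]"
  by (simp add: char_poly_matrix_def)

section \<open>Bordered characteristic matrices and the paths in their Leibniz terms\<close>

definition bordered :: "'a::field mat \<Rightarrow> nat \<Rightarrow> nat \<Rightarrow> (nat \<Rightarrow> 'a vec) \<Rightarrow> (nat \<Rightarrow> 'a vec) \<Rightarrow> 'a poly mat" where
  "bordered A r k x y = four_block_mat (char_poly_matrix A) (mat r k (\<lambda>(p, s). [:x s $ p:]))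
     (mat k r (\<lambda>(s, q). [:y s $ q:])) (0\<^sub>m k k)"

text \<open>The columns of \<open>X\<close> below are the truncated resolvent series applied to the border columns, so
  that multiplication by the block matrix \<open>(1, X; 0, Y)\<close> clears the upper right block.\<close>

lemma bordered_det:
  fixes A :: "'a::field mat"
  assumes A: "A \<in> carrier_mat r r"
    and w: "\<And>s l. s < k \<Longrightarrow> w s l \<in> carrier_vec r" and y: "\<And>s. s < k \<Longrightarrow> y s \<in> carrier_vec r"
    and w_Suc: "\<And>s l. s < k \<Longrightarrow> w s (Suc l) = A *\<^sub>v w s l" and w_end: "\<And>s. s < k \<Longrightarrow> w s (d s) = 0\<^sub>v r"
    and yw: "\<And>s s' l. s < k \<Longrightarrow> s' < k \<Longrightarrow> l < d s \<Longrightarrow> y s' \<bullet> w s l = (if s = s' \<and> Suc l = d s then 1 else 0)"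
    and d: "\<And>s. s < k \<Longrightarrow> 0 < d s"
  shows "det (bordered A r k (\<lambda>s. w s 0) y) * monom 1 (\<Sum>s<k. d s) = char_poly A * (-1) ^ k"
proof -
  let ?C = "char_poly_matrix A" and ?V = "mat r k (\<lambda>(p, s). [:w s 0 $ p:])" and ?U = "mat k r (\<lambda>(s, q). [:y s $ q:])"
  let ?Z = "bordered A r k (\<lambda>s. w s 0) y"
  define X where "X = mat r k (\<lambda>(p, s). - (\<Sum>l<d s. monom (w s l $ p) (d s - Suc l)))"
  define Y where "Y = mat k k (\<lambda>(i, j). if i = j then monom (1::'a) (d i) else 0)"
  define W where "W = four_block_mat (1\<^sub>m r) X (0\<^sub>m k r) Y"
  have C: "?C \<in> carrier_mat r r" using A by simp
  have X: "X \<in> carrier_mat r k" and Y: "Y \<in> carrier_mat k k" by (auto simp: X_def Y_def)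
  \<comment> \<open>The sum telescopes from the border column times \<open>monom 1 (d s)\<close> to
    \<open>w s (d s)\<close>, which is zero.\<close>
  have CX: "?C * X + ?V * Y = 0\<^sub>m r k"
  proof (rule eq_matI)
    fix p s assume "p < dim_row (0\<^sub>m r k :: 'a poly mat)" "s < dim_col (0\<^sub>m r k :: 'a poly mat)"
    hence ps: "p < r" "s < k" by auto
    define a where "a l = monom (w s l $ p) (d s - l)" for l
    have w_p: "w s (Suc l) $ p = (\<Sum>q<r. A $$ (p, q) * w s l $ q)" for l
      using w_Suc[OF ps(2)] ps A w[OF ps(2), of l] by (simp add: scalar_prod_def atLeast0LessThan)
    have "(?C * X) $$ (p, s) = (\<Sum>q<r. ?C $$ (p, q) * X $$ (q, s))"
      using ps C X by (simp add: scalar_prod_def atLeast0LessThan)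
    also have "\<dots> = (\<Sum>q<r. (if q = p then [:0, 1:] * X $$ (p, s) else 0) + [:- A $$ (p, q):] * X $$ (q, s))"
      using ps A by (intro sum.cong) (auto simp: char_poly_matrix_index algebra_simps)
    also have "\<dots> = [:0, 1:] * X $$ (p, s) + (\<Sum>q<r. [:- A $$ (p, q):] * X $$ (q, s))"
      unfolding sum.distrib using ps by simp
    also have "[:0, 1:] * X $$ (p, s) = - (\<Sum>l<d s. a l)"
    proof -
      have "[:0, 1:] * X $$ (p, s) = - (\<Sum>l<d s. [:0, 1:] * monom (w s l $ p) (d s - Suc l))"
        using ps by (simp add: X_def sum_distrib_left)
      also have "(\<Sum>l<d s. [:0, 1:] * monom (w s l $ p) (d s - Suc l)) = (\<Sum>l<d s. a l)"
        by (intro sum.cong) (auto simp: a_def monom_Suc[symmetric] Suc_diff_Suc)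
      finally show ?thesis .
    qed
    also have "(\<Sum>q<r. [:- A $$ (p, q):] * X $$ (q, s)) = (\<Sum>q<r. \<Sum>l<d s. monom (A $$ (p, q) * w s l $ q) (d s - Suc l))"
      using ps by (intro sum.cong refl) (simp add: X_def sum_distrib_left smult_monom sum_negf[symmetric] minus_monom)
    also have "\<dots> = (\<Sum>l<d s. \<Sum>q<r. monom (A $$ (p, q) * w s l $ q) (d s - Suc l))" by (rule sum.swap)
    also have "\<dots> = (\<Sum>l<d s. a (Suc l))" by (simp add: sum_monom a_def w_p)
    finally have 1: "(?C * X) $$ (p, s) = (\<Sum>l<d s. a (Suc l) - a l)" by (simp add: sum_subtractf)
    have "(?V * Y) $$ (p, s) = (\<Sum>t<k. [:w t 0 $ p:] * (if t = s then monom 1 (d t) else 0))"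
      using ps by (simp add: scalar_prod_def atLeast0LessThan Y_def)
    also have "\<dots> = (\<Sum>t<k. if t = s then [:w s 0 $ p:] * monom 1 (d s) else 0)" by (intro sum.cong) auto
    also have "\<dots> = a 0" using ps by (simp add: a_def smult_monom)
    finally have "(?C * X + ?V * Y) $$ (p, s) = (\<Sum>l<d s. a (Suc l) - a l) + a 0"
      using ps C X Y 1 by simp
    also have "\<dots> = a (d s)" by (simp add: sum_lessThan_telescope)
    also have "\<dots> = 0" using w_end[OF ps(2)] ps by (simp add: a_def)
    finally show "(?C * X + ?V * Y) $$ (p, s) = 0\<^sub>m r k $$ (p, s)" using ps by simp
  qed (use C X Y in auto)
  \<comment> \<open>A border row pairs nontrivially only with the last nonzero stage of its own
    chain, which leaves minus the identity.\<close>
  have UX: "?U * X = (-1) \<cdot>\<^sub>m 1\<^sub>m k"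
  proof (rule eq_matI)
    fix t s assume "t < dim_row ((-1) \<cdot>\<^sub>m 1\<^sub>m k :: 'a poly mat)" "s < dim_col ((-1) \<cdot>\<^sub>m 1\<^sub>m k :: 'a poly mat)"
    hence ts: "t < k" "s < k" by auto
    have yw': "y t \<bullet> w s l = (\<Sum>q<r. y t $ q * w s l $ q)" for l
      using w[OF ts(2), of l] by (simp add: scalar_prod_def atLeast0LessThan)
    have "(?U * X) $$ (t, s) = (\<Sum>q<r. [:y t $ q:] * X $$ (q, s))"
      using ts X by (simp add: scalar_prod_def atLeast0LessThan)
    also have "\<dots> = (\<Sum>q<r. \<Sum>l<d s. monom (- (y t $ q * w s l $ q)) (d s - Suc l))"
      using ts by (intro sum.cong refl) (simp add: X_def sum_distrib_left smult_monom sum_negf[symmetric] minus_monom)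
    also have "\<dots> = (\<Sum>l<d s. \<Sum>q<r. monom (- (y t $ q * w s l $ q)) (d s - Suc l))" by (rule sum.swap)
    also have "\<dots> = (\<Sum>l<d s. monom (- (y t \<bullet> w s l)) (d s - Suc l))"
      by (simp add: sum_monom yw' sum_negf)
    also have "\<dots> = (\<Sum>l<d s. if l = d s - 1 then (if s = t then -1 else 0) else 0)"
      using ts yw d[OF ts(2)] by (intro sum.cong) (auto simp: monom_0 one_pCons)
    also have "\<dots> = (if s = t then -1 else 0)" using d[OF ts(2)] by simp
    finally show "(?U * X) $$ (t, s) = ((-1) \<cdot>\<^sub>m 1\<^sub>m k) $$ (t, s)" using ts by auto
  qed (use X in auto)
  have "?Z * W = four_block_mat (?C * 1\<^sub>m r + ?V * 0\<^sub>m k r) (?C * X + ?V * Y) (?U * 1\<^sub>m r + 0\<^sub>m k k * 0\<^sub>m k r) (?U * X + 0\<^sub>m k k * Y)"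
    unfolding bordered_def W_def by (rule mult_four_block_mat) (use C X Y in auto)
  also have "\<dots> = four_block_mat ?C (0\<^sub>m r k) ?U ((-1) \<cdot>\<^sub>m 1\<^sub>m k)"
    unfolding CX UX using C Y by simp
  also have "det \<dots> = char_poly A * (-1) ^ k"
    by (subst det_four_block_mat_upper_right_zero[OF C refl]) (auto simp: char_poly_def det_smult)
  finally have "det (?Z * W) = char_poly A * (-1) ^ k" .
  moreover have Zc: "?Z \<in> carrier_mat (r + k) (r + k)" unfolding bordered_def using C by simp
  moreover have "W \<in> carrier_mat (r + k) (r + k)" unfolding W_def using Y by simp
  moreover have "det W = monom 1 (\<Sum>s<k. d s)"
  proof -
    have "det W = det (1\<^sub>m r) * det Y" unfolding W_def by (rule det_four_block_mat_lower_left_zero) (use X Y in auto)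
    also have "det Y = prod_list (diag_mat Y)" by (rule det_upper_triangular[OF _ Y]) (auto simp: Y_def)
    also have "diag_mat Y = map (\<lambda>i. monom 1 (d i)) [0..<k]" by (rule nth_equalityI) (auto simp: diag_mat_def Y_def)
    also have "prod_list \<dots> = monom 1 (\<Sum>s<k. d s)"
      by (induction k) (auto simp: mult_monom)
    finally show ?thesis by simp
  qed
  ultimately show ?thesis by (simp add: det_mult[of _ "r + k"])
qed

lemma coeff_det_nonzero_perm:
  fixes Z :: "'a::field poly mat"
  assumes "Z \<in> carrier_mat n n" "coeff (det Z) e \<noteq> 0"
  shows "\<exists>\<sigma>. \<sigma> permutes {0..<n} \<and> coeff (\<Prod>i=0..<n. Z $$ (i, \<sigma> i)) e \<noteq> 0"
proof (rule ccontr)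
  assume *: "\<not> ?thesis"
  have "coeff (signof \<sigma> * (\<Prod>i=0..<n. Z $$ (i, \<sigma> i))) e = 0" if "\<sigma> permutes {0..<n}" for \<sigma>
    using * that by (cases "evenperm \<sigma>") (auto simp: sign_def)
  hence "coeff (det Z) e = 0" unfolding det_def'[OF assms(1)] coeff_sum by (intro sum.neutral) auto
  thus False using assms(2) by simp
qed

text \<open>From a non-fixed index, \<open>\<sigma>\<close> lowers the height as long as it stays
  below \<open>r\<close>, so it reaches one of the \<open>k\<close> border indices, and this exit
  serves as colour. By injectivity, indices with a common exit lie on one trajectory, so one is an
  iterate of the other.\<close>

lemma perm_chain_colouring:
  fixes \<sigma> :: "nat \<Rightarrow> nat" and ht :: "nat \<Rightarrow> nat"
  assumes \<sigma>: "\<sigma> permutes {0..<r + k}"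
    and step: "\<And>i. i < r \<Longrightarrow> \<sigma> i \<noteq> i \<Longrightarrow> \<sigma> i < r \<Longrightarrow> ht (\<sigma> i) < ht i \<and> lq (\<sigma> i) i"
    and refl: "\<And>i. lq i i" and trans: "\<And>i j l. lq i j \<Longrightarrow> lq j l \<Longrightarrow> lq i l"
  shows "\<exists>cl. (\<forall>i<r. \<sigma> i \<noteq> i \<longrightarrow> cl i < k) \<and>
    (\<forall>i<r. \<forall>j<r. \<sigma> i \<noteq> i \<longrightarrow> \<sigma> j \<noteq> j \<longrightarrow> cl i = cl j \<longrightarrow> lq i j \<or> lq j i)"
proof -
  have inj: "inj \<sigma>" using permutes_inj[OF \<sigma>] .
  have bnd: "\<sigma> i < r + k" if "i < r + k" for i using permutes_in_image[OF \<sigma>, of i] that by simp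
  have ex: "\<exists>e. r \<le> (\<sigma> ^^ Suc e) i \<and> (\<sigma> ^^ Suc e) i < r + k \<and> (\<forall>j\<le>e. lq ((\<sigma> ^^ j) i) i)"
    if "i < r" "\<sigma> i \<noteq> i" for i
    using that
  proof (induction "ht i" arbitrary: i rule: less_induct)
    case less
    show ?case
    proof (cases "\<sigma> i < r")
      case False
      thus ?thesis using less.prems bnd[of i] refl by (intro exI[of _ 0]) auto
    next
      case True
      from step[OF less.prems True] have s: "ht (\<sigma> i) < ht i" "lq (\<sigma> i) i" by auto
      have "\<sigma> (\<sigma> i) \<noteq> \<sigma> i" using less.prems(2) inj by (auto dest: injD)
      from less.hyps[OF s(1) True this] obtain e where e: "r \<le> (\<sigma> ^^ Suc e) (\<sigma> i)" "(\<sigma> ^^ Suc e) (\<sigma> i) < r + k"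
        "\<forall>j\<le>e. lq ((\<sigma> ^^ j) (\<sigma> i)) (\<sigma> i)" by blast
      have sw: "(\<sigma> ^^ j) (\<sigma> i) = (\<sigma> ^^ Suc j) i" for j by (simp add: funpow_swap1)
      have "lq ((\<sigma> ^^ j) i) i" if "j \<le> Suc e" for j
      proof (cases j)
        case (Suc j')
        thus ?thesis using e(3) that trans[OF _ s(2)] unfolding sw by auto
      qed (simp add: refl)
      thus ?thesis using e(1,2) unfolding sw by (intro exI[of _ "Suc e"]) blast
    qed
  qed
  define ee where "ee i = (SOME e. r \<le> (\<sigma> ^^ Suc e) i \<and> (\<sigma> ^^ Suc e) i < r + k \<and> (\<forall>j\<le>e. lq ((\<sigma> ^^ j) i) i))" for i
  have ee: "r \<le> (\<sigma> ^^ Suc (ee i)) i" "(\<sigma> ^^ Suc (ee i)) i < r + k" "\<And>j. j \<le> ee i \<Longrightarrow> lq ((\<sigma> ^^ j) i) i"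
    if "i < r" "\<sigma> i \<noteq> i" for i
    using someI_ex[OF ex[OF that]] unfolding ee_def by blast+
  define cl where "cl i = (\<sigma> ^^ Suc (ee i)) i - r" for i
  have le1: "lq i j" if ij: "i < r" "\<sigma> i \<noteq> i" "j < r" "\<sigma> j \<noteq> j" "cl i = cl j" "ee i \<le> ee j" for i j
  proof -
    have "(\<sigma> ^^ Suc (ee i)) i = (\<sigma> ^^ Suc (ee j)) j"
      using ij(5) ee(1)[OF ij(1,2)] ee(1)[OF ij(3,4)] unfolding cl_def by linarith
    also have "Suc (ee j) = Suc (ee i) + (ee j - ee i)" using ij(6) by simp
    hence "(\<sigma> ^^ Suc (ee j)) j = (\<sigma> ^^ Suc (ee i)) ((\<sigma> ^^ (ee j - ee i)) j)" by (simp only: funpow_add comp_def)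
    finally have "(\<sigma> ^^ Suc (ee i)) i = (\<sigma> ^^ Suc (ee i)) ((\<sigma> ^^ (ee j - ee i)) j)" .
    from injD[OF inj_fn[OF inj] this] have "i = (\<sigma> ^^ (ee j - ee i)) j" .
    thus ?thesis using ee(3)[OF ij(3,4), of "ee j - ee i"] by simp
  qed
  have "cl i < k" if "i < r" "\<sigma> i \<noteq> i" for i using ee(1,2)[OF that] unfolding cl_def by linarith
  moreover have "lq i j \<or> lq j i" if "i < r" "j < r" "\<sigma> i \<noteq> i" "\<sigma> j \<noteq> j" "cl i = cl j" for i j
    using le1[of i j] le1[of j i] that by (metis nat_le_linear)
  ultimately show ?thesis by blast
qed

definition pair_le :: "nat \<times> nat \<Rightarrow> nat \<times> nat \<Rightarrow> bool" where
  "pair_le x y \<longleftrightarrow> fst x \<le> fst y \<and> snd x \<le> snd y"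

definition strict_supp :: "(nat \<times> nat) list \<Rightarrow> (nat \<Rightarrow> nat) \<Rightarrow> 'a::zero mat \<Rightarrow> bool" where
  "strict_supp L ht A \<longleftrightarrow> (\<forall>p<length L. \<forall>q<length L. A $$ (p, q) \<noteq> 0 \<longrightarrow> pair_le (L ! q) (L ! p) \<and> ht q < ht p)"

text \<open>A nonzero Leibniz term of the bordered determinant decomposes the non-fixed indices into \<open>k\<close> paths
  from the border to the border, and strictness of the support makes these paths chains.\<close>

lemma greene_ge_bordered:
  fixes A :: "'a::field mat"
  assumes A: "A \<in> carrier_mat r r" and r: "length L = r" and supp: "strict_supp L ht A"
    and cf: "coeff (det (bordered A r k x y)) (r - d) \<noteq> 0" and d: "d \<le> r"
  shows "d \<le> greene (mset L) k"
proof -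
  let ?Z = "bordered A r k x y"
  have Z: "?Z \<in> carrier_mat (r + k) (r + k)" unfolding bordered_def using A by simp
  obtain \<sigma> where \<sigma>: "\<sigma> permutes {0..<r + k}" "coeff (\<Prod>i=0..<r + k. ?Z $$ (i, \<sigma> i)) (r - d) \<noteq> 0"
    using coeff_det_nonzero_perm[OF Z cf] by blast
  have bnd: "\<sigma> i < r + k" if "i < r + k" for i using permutes_in_image[OF \<sigma>(1), of i] that by simp
  have nz: "?Z $$ (i, \<sigma> i) \<noteq> 0" if "i < r + k" for i
  proof
    assume "?Z $$ (i, \<sigma> i) = 0"
    hence eq: "(\<Prod>i=0..<r + k. ?Z $$ (i, \<sigma> i)) = 0" by (intro prod_zero) (use that in auto)
    show False using \<sigma>(2) unfolding eq by simp
  qed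
  have Zul: "?Z $$ (p, q) = (if p = q then [:0, 1:] else 0) + [:- A $$ (p, q):]" if "p < r" "q < r" for p q
    using that A carrier_matD[OF char_poly_matrix_closed[OF A]] unfolding bordered_def
    by (simp add: char_poly_matrix_index)
  have diag: "A $$ (p, p) = 0" if "p < r" for p using supp that r unfolding strict_supp_def by fastforce
  define F where "F = {i. i < r \<and> \<sigma> i = i}"
  \<comment> \<open>The variable comes only from fixed indices below \<open>r\<close>, where the
    diagonal of \<open>A\<close> vanishes; every other factor is constant. So the product is a
    monomial of degree \<open>card F\<close>.\<close>
  have fac: "?Z $$ (i, \<sigma> i) = (if i \<in> F then monom 1 1 else [:coeff (?Z $$ (i, \<sigma> i)) 0:])" if "i < r + k" for i
  proof -
    consider "i \<in> F" | "i < r" "\<sigma> i < r" "i \<notin> F" | "i < r" "r \<le> \<sigma> i" | "r \<le> i" by (force simp: F_def)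
    thus ?thesis
    proof cases
      case 1 thus ?thesis using Zul[of i i] diag by (simp add: F_def monom_altdef)
    next
      case 2 thus ?thesis using Zul[of i "\<sigma> i"] by (auto simp: F_def)
    next
      case 3
      hence "i \<notin> F" by (simp add: F_def)
      thus ?thesis using 3 bnd[OF that] carrier_matD[OF char_poly_matrix_closed[OF A]] by (simp add: bordered_def)
    next
      case 4
      hence "i \<notin> F" by (simp add: F_def)
      thus ?thesis using 4 bnd[OF that] that carrier_matD[OF char_poly_matrix_closed[OF A]] by (simp add: bordered_def)
    qed
  qed
  have "(\<Prod>i=0..<r + k. ?Z $$ (i, \<sigma> i)) = (\<Prod>i=0..<r + k. if i \<in> F then monom 1 1 else [:coeff (?Z $$ (i, \<sigma> i)) 0:])"
    using fac by (intro prod.cong) auto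
  also have "\<dots> = (\<Prod>i\<in>{0..<r + k} \<inter> F. monom 1 1) * (\<Prod>i\<in>{0..<r + k} \<inter> - F. [:coeff (?Z $$ (i, \<sigma> i)) 0:])"
    by (subst prod.If_cases) auto
  also have "{0..<r + k} \<inter> F = F" by (auto simp: F_def)
  also have "(\<Prod>i\<in>F. monom (1::'a) 1) = monom 1 (card F)" by (simp add: monom_power)
  also have "(\<Prod>i\<in>{0..<r + k} \<inter> - F. [:coeff (?Z $$ (i, \<sigma> i)) 0:]) = [:\<Prod>i\<in>{0..<r + k} \<inter> - F. coeff (?Z $$ (i, \<sigma> i)) 0:]"
    by (induction rule: infinite_finite_induct) (auto simp: one_pCons)
  finally have "coeff (monom 1 (card F) * [:\<Prod>i\<in>{0..<r + k} \<inter> - F. coeff (?Z $$ (i, \<sigma> i)) 0:]) (r - d) \<noteq> 0"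
    using \<sigma>(2) by simp
  hence cardF: "card F = r - d" by (auto simp: smult_monom split: if_splits)
  have step: "ht (\<sigma> i) < ht i \<and> pair_le (L ! \<sigma> i) (L ! i)" if "i < r" "\<sigma> i \<noteq> i" "\<sigma> i < r" for i
  proof -
    have "A $$ (i, \<sigma> i) \<noteq> 0" using nz[of i] Zul[of i "\<sigma> i"] that by auto
    thus ?thesis using supp that r unfolding strict_supp_def by blast
  qed
  obtain cl where cl: "\<And>i. i < r \<Longrightarrow> \<sigma> i \<noteq> i \<Longrightarrow> cl i < k"
    "\<And>i j. i < r \<Longrightarrow> j < r \<Longrightarrow> \<sigma> i \<noteq> i \<Longrightarrow> \<sigma> j \<noteq> j \<Longrightarrow> cl i = cl j \<Longrightarrow> pair_le (L ! i) (L ! j) \<or> pair_le (L ! j) (L ! i)"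
    using perm_chain_colouring[OF \<sigma>(1), of ht "\<lambda>i j. pair_le (L ! i) (L ! j)"] step
    by (auto simp: pair_le_def) (smt (verit) le_trans)
  define c where "c i = (if \<sigma> i = i then k else cl i)" for i
  define W where "W = mset (map (\<lambda>i. (L ! i, c i)) [0..<r])"
  have "map fst (map (\<lambda>i. (L ! i, c i)) [0..<r]) = L" by (rule nth_equalityI) (simp_all add: r)
  hence "image_mset fst W = mset L" unfolding W_def mset_map[symmetric] by (rule arg_cong)
  moreover have "chain_coloured k W" unfolding chain_coloured_def
  proof (intro ballI impI)
    fix z z' assume z: "z \<in># W" "z' \<in># W" "snd z = snd z'" "snd z < k"
    then obtain i j where ij: "i < r" "z = (L ! i, c i)" "j < r" "z' = (L ! j, c j)" unfolding W_def by auto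
    hence "\<sigma> i \<noteq> i" "\<sigma> j \<noteq> j" "cl i = cl j" using z(3,4) by (auto simp: c_def split: if_splits)
    from cl(2)[OF ij(1,3) this] show "comparable (fst z) (fst z')" using ij by (auto simp: comparable_def pair_le_def)
  qed
  ultimately have "size {#z \<in># W. snd z < k#} \<le> greene (mset L) k" by (rule greene_ge)
  moreover have "size {#z \<in># W. snd z < k#} = card ({0..<r} - F)"
  proof -
    have "size {#z \<in># W. snd z < k#} = length (filter (\<lambda>i. c i < k) [0..<r])"
      unfolding W_def mset_filter[symmetric] size_mset filter_map length_map by (simp add: comp_def)
    also have "\<dots> = card {i. i < r \<and> c i < k}"
      unfolding length_filter_conv_card by (rule arg_cong[of _ _ card]) auto
    also have "{i. i < r \<and> c i < k} = {0..<r} - F" using cl(1) by (auto simp: c_def F_def)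
    finally show ?thesis .
  qed
  moreover have "card ({0..<r} - F) = r - card F" by (subst card_Diff_subset) (auto simp: F_def)
  ultimately show ?thesis using cardF d by simp
qed

text \<open>The border consists of generators of the chosen Jordan chains and of the dual
  coordinates at their ends. The bordered determinant, multiplied by a monomial whose degree is the
  total block size, equals a sign times the monomial of degree \<open>r\<close>, so the coefficient
  needed by \<open>greene_ge_bordered\<close> is nonzero.\<close>

lemma jordan_blocks_le_greene:
  fixes A :: "'a::field mat"
  assumes A: "A \<in> carrier_mat r r" and r: "length L = r" and supp: "strict_supp L ht A"
    and nil: "A ^\<^sub>m e = 0\<^sub>m r r" and jnf: "jordan_nf A n_as"
    and ss: "distinct ss" "set ss \<subseteq> {..<length n_as}"
  shows "(\<Sum>s\<in>set ss. fst (n_as ! s)) \<le> greene (mset L) (length ss)"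
proof -
  define k where "k = length ss"
  define J where "J = jordan_matrix n_as"
  obtain P Q where wit: "similar_mat_wit A J P Q" using jnf unfolding jordan_nf_def similar_mat_def J_def by blast
  note W = similar_mat_witD2[OF A wit]
  have N: "sum_list (map fst n_as) = r" using W(5) unfolding J_def by (metis carrier_matD(1) jordan_matrix_dim(1))
  have z: "\<forall>sa\<in>set n_as. snd sa = 0 \<and> 0 < fst sa"
    using nilpotent_jordan_eigenvalue[OF A nil jnf] by fastforce
  obtain u v where uv: "\<And>i. i < length n_as \<Longrightarrow> u i < r \<and> v i < r"
    "\<And>i j l. i < length n_as \<Longrightarrow> j < length n_as \<Longrightarrow> (J ^\<^sub>m l) $$ (u i, v j) = (if i = j \<and> Suc l = fst (n_as ! j) then 1 else 0)"
    "\<And>j p. j < length n_as \<Longrightarrow> p < r \<Longrightarrow> (J ^\<^sub>m (fst (n_as ! j))) $$ (p, v j) = 0"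
    using jordan_matrix_chain_ends[OF z] unfolding N J_def by blast
  have ssn: "ss ! s < length n_as" if "s < k" for s using ss(2) that nth_mem unfolding k_def by fastforce
  have ssi: "ss ! s = ss ! s' \<longleftrightarrow> s = s'" if "s < k" "s' < k" for s s'
    using that ss(1) by (simp add: k_def nth_eq_iff_index_eq)
  define d where "d s = fst (n_as ! (ss ! s))" for s
  define w where "w s l = (A ^\<^sub>m l) *\<^sub>v col P (v (ss ! s))" for s l
  define y where "y s = row Q (u (ss ! s))" for s
  have Al: "A ^\<^sub>m l \<in> carrier_mat r r" for l using A by simp
  have Jl: "J ^\<^sub>m l \<in> carrier_mat r r" for l using W(5) by simp
  have AP: "A ^\<^sub>m l * P = P * J ^\<^sub>m l" for l
  proof -
    have "A ^\<^sub>m l * P = P * J ^\<^sub>m l * Q * P" using similar_mat_wit_pow_id[OF wit] by simp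
    also have "\<dots> = P * J ^\<^sub>m l * (Q * P)" by (rule assoc_mult_mat[OF mult_carrier_mat[OF W(6) Jl] W(7,6)])
    also have "\<dots> = P * J ^\<^sub>m l" using W(2) right_mult_one_mat[OF mult_carrier_mat[OF W(6) Jl]] by simp
    finally show ?thesis .
  qed
  have QAP: "Q * (A ^\<^sub>m l * P) = J ^\<^sub>m l" for l
    unfolding AP assoc_mult_mat[OF W(7,6) Jl, symmetric] W(2) by (rule left_mult_one_mat[OF Jl])
  have wcol: "w s l = col (A ^\<^sub>m l * P) (v (ss ! s))" if "s < k" for s l
    using uv(1)[OF ssn[OF that]] W(6) Al col_mult2[OF Al W(6)] unfolding w_def by simp
  have "det (bordered A r k (\<lambda>s. w s 0) y) * monom 1 (\<Sum>s<k. d s) = char_poly A * (-1) ^ k"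
  proof (rule bordered_det[OF A])
    fix s l assume s: "s < k"
    show "w s l \<in> carrier_vec r" unfolding wcol[OF s] by (rule carrier_vecI) (use A in simp)
    show "w s (Suc l) = A *\<^sub>v w s l"
    proof -
      have "A ^\<^sub>m Suc l = A * A ^\<^sub>m l" by (rule mat_pow_Suc_left[OF A])
      thus ?thesis unfolding w_def using A Al W(6) by (metis assoc_mult_mat_vec col_carrier_vec carrier_matD(2) uv(1)[OF ssn[OF s]])
    qed
    show "y s \<in> carrier_vec r" unfolding y_def using W(7) uv(1)[OF ssn[OF s]] by auto
    show "0 < d s" using z ssn[OF s] unfolding d_def by auto
    show "w s (d s) = 0\<^sub>v r"
    proof (rule eq_vecI)
      fix p assume p: "p < dim_vec (0\<^sub>v r :: 'a vec)"
      have "w s (d s) = P *\<^sub>v col (J ^\<^sub>m d s) (v (ss ! s))"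
        unfolding wcol[OF s] AP using uv(1)[OF ssn[OF s]] col_mult2[OF W(6) Jl] by simp
      also have "col (J ^\<^sub>m d s) (v (ss ! s)) = 0\<^sub>v r"
        using uv(3)[OF ssn[OF s]] uv(1)[OF ssn[OF s]] carrier_matD[OF Jl[of "d s"]] by (intro eq_vecI) (auto simp: d_def)
      finally show "w s (d s) $ p = 0\<^sub>v r $ p" using W(6) p by simp
    qed (use A in \<open>simp add: wcol[OF s]\<close>)
    fix s' assume s': "s' < k"
    have "y s' \<bullet> w s l = (Q * (A ^\<^sub>m l * P)) $$ (u (ss ! s'), v (ss ! s))"
      unfolding wcol[OF s] y_def using W(6,7) Al uv(1)[OF ssn[OF s]] uv(1)[OF ssn[OF s']] by simp
    also have "\<dots> = (if s = s' \<and> Suc l = d s then 1 else 0)"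
      unfolding QAP uv(2)[OF ssn[OF s'] ssn[OF s]] using ssi[OF s' s] by (auto simp: d_def)
    finally show "y s' \<bullet> w s l = (if s = s' \<and> Suc l = d s then 1 else 0)" .
  qed
  also have "char_poly A = monom 1 r" by (rule nilpotent_char_poly[OF A nil])
  finally have det: "det (bordered A r k (\<lambda>s. w s 0) y) * monom 1 (\<Sum>s<k. d s) = monom 1 r * (-1) ^ k" .
  have "(\<Sum>s<k. d s) \<le> r \<and> coeff (det (bordered A r k (\<lambda>s. w s 0) y)) (r - (\<Sum>s<k. d s)) \<noteq> 0"
  proof -
    have "coeff (monom 1 r * (-1) ^ k :: 'a poly) r \<noteq> 0"
      by (cases "even k") auto
    hence "coeff (det (bordered A r k (\<lambda>s. w s 0) y) * monom 1 (\<Sum>s<k. d s)) r \<noteq> 0" unfolding det .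
    thus ?thesis unfolding mult.commute[of "det (bordered A r k (\<lambda>s. w s 0) y)"] coeff_monom_mult
      by (simp split: if_splits)
  qed
  hence "(\<Sum>s<k. d s) \<le> greene (mset L) k" using greene_ge_bordered[OF A r supp] by blast
  moreover have "(\<Sum>s<k. d s) = (\<Sum>s\<in>set ss. fst (n_as ! s))"
  proof -
    have "(\<Sum>s\<in>set ss. fst (n_as ! s)) = sum_list (map (\<lambda>s. fst (n_as ! s)) ss)" using ss(1) by (simp add: sum_list_distinct_conv_sum_set)
    also have "\<dots> = (\<Sum>s<k. d s)" by (simp add: sum_list_sum_nth k_def d_def atLeast0LessThan)
    finally show ?thesis ..
  qed
  ultimately show ?thesis by (simp add: k_def)
qed

section \<open>Order-convex submatrices and triangularisation within classes\<close>

definition submat :: "'a mat \<Rightarrow> nat list \<Rightarrow> 'a mat" where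
  "submat A ix = mat (length ix) (length ix) (\<lambda>(u, v). A $$ (ix ! u, ix ! v))"

lemma submat_carrier [simp]: "submat A ix \<in> carrier_mat (length ix) (length ix)"
  by (simp add: submat_def)

lemma submat_index [simp]: "u < length ix \<Longrightarrow> v < length ix \<Longrightarrow> submat A ix $$ (u, v) = A $$ (ix ! u, ix ! v)"
  by (simp add: submat_def)

lemma submat_dim [simp]: "dim_row (submat A ix) = length ix" "dim_col (submat A ix) = length ix"
  by (simp_all add: submat_def)

definition weak_supp :: "(nat \<times> nat) list \<Rightarrow> 'a::zero mat \<Rightarrow> bool" where
  "weak_supp L A \<longleftrightarrow> (\<forall>p<length L. \<forall>q<length L. A $$ (p, q) \<noteq> 0 \<longrightarrow> pair_le (L ! q) (L ! p))"

definition eq_supp :: "(nat \<times> nat) list \<Rightarrow> 'a::zero mat \<Rightarrow> bool" where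
  "eq_supp L A \<longleftrightarrow> (\<forall>p<length L. \<forall>q<length L. A $$ (p, q) \<noteq> 0 \<longrightarrow> L ! p = L ! q)"

text \<open>The summands present at a vertex form such a set, and so do the copies of one interval;
  these are the two restrictions used below.\<close>

definition convex_index :: "(nat \<times> nat) list \<Rightarrow> nat list \<Rightarrow> bool" where
  "convex_index L ix \<longleftrightarrow> distinct ix \<and> set ix \<subseteq> {..<length L} \<and>
    (\<forall>p\<in>set ix. \<forall>q\<in>set ix. \<forall>r<length L. pair_le (L ! q) (L ! r) \<longrightarrow> pair_le (L ! r) (L ! p) \<longrightarrow> r \<in> set ix)"

lemma convex_indexD:
  assumes "convex_index L ix"
  shows "distinct ix" "set ix \<subseteq> {..<length L}" "u < length ix \<Longrightarrow> ix ! u < length L"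
proof -
  show *: "distinct ix" "set ix \<subseteq> {..<length L}" using assms unfolding convex_index_def by blast+
  show "ix ! u < length L" if "u < length ix" using *(2) nth_mem[OF that] by blast
qed

lemma pair_le_refl [simp]: "pair_le x x"
  by (simp add: pair_le_def)

lemma pair_le_trans: "pair_le x y \<Longrightarrow> pair_le y z \<Longrightarrow> pair_le x z"
  by (auto simp: pair_le_def)

lemma pair_le_antisym: "pair_le x y \<Longrightarrow> pair_le y x \<Longrightarrow> x = y"
  by (auto simp: pair_le_def prod_eq_iff)

lemma eq_supp_weak: "eq_supp L A \<Longrightarrow> weak_supp L A"
  unfolding eq_supp_def weak_supp_def using pair_le_refl by metis

lemma strict_supp_weak: "strict_supp L ht A \<Longrightarrow> weak_supp L A"
  unfolding strict_supp_def weak_supp_def by blast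

lemma mult_mat_index_sum:
  assumes "(A :: 'a::semiring_0 mat) \<in> carrier_mat n l" "B \<in> carrier_mat l m" "p < n" "q < m"
  shows "(A * B) $$ (p, q) = (\<Sum>r<l. A $$ (p, r) * B $$ (r, q))"
  using assms by (simp add: scalar_prod_def atLeast0LessThan)

lemma mult_mat_index_nonzero:
  assumes "(A :: 'a::semiring_0 mat) \<in> carrier_mat n l" "B \<in> carrier_mat l m" "p < n" "q < m"
    and "(A * B) $$ (p, q) \<noteq> 0"
  obtains r where "r < l" "A $$ (p, r) \<noteq> 0" "B $$ (r, q) \<noteq> 0"
proof -
  obtain r where "r \<in> {..<l}" "A $$ (p, r) * B $$ (r, q) \<noteq> 0"
    using assms(5) sum.not_neutral_contains_not_neutral unfolding mult_mat_index_sum[OF assms(1-4)] by blast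
  thus ?thesis using that by (auto dest: mult_not_zero)
qed

lemma weak_supp_mult:
  fixes A B :: "'a::semiring_0 mat"
  assumes "A \<in> carrier_mat (length L) (length L)" "B \<in> carrier_mat (length L) (length L)" "weak_supp L A" "weak_supp L B"
  shows "weak_supp L (A * B)"
  unfolding weak_supp_def
proof (intro allI impI)
  fix p q assume pq: "p < length L" "q < length L" "(A * B) $$ (p, q) \<noteq> 0"
  then obtain r where "r < length L" "A $$ (p, r) \<noteq> 0" "B $$ (r, q) \<noteq> 0"
    using mult_mat_index_nonzero[OF assms(1,2)] by metis
  thus "pair_le (L ! q) (L ! p)" using assms(3,4) pq unfolding weak_supp_def by (meson pair_le_trans)
qed

lemma weak_supp_one: "weak_supp L (1\<^sub>m (length L) :: 'a::semiring_1 mat)"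
  unfolding weak_supp_def by simp

lemma weak_supp_pow:
  fixes A :: "'a::semiring_1 mat"
  assumes "A \<in> carrier_mat (length L) (length L)" "weak_supp L A"
  shows "weak_supp L (A ^\<^sub>m k)"
proof (induction k)
  case 0 thus ?case using assms(1) weak_supp_one by simp
next
  case (Suc k) thus ?case using weak_supp_mult[of "A ^\<^sub>m k" L A] assms by simp
qed

text \<open>An intermediate index that contributes to the product lies between the outer ones in the
  order, so convexity puts it into \<open>ix\<close>.\<close>

lemma submat_mult:
  fixes A B :: "'a::semiring_0 mat"
  assumes A: "A \<in> carrier_mat (length L) (length L)" and B: "B \<in> carrier_mat (length L) (length L)"
    and s: "weak_supp L A" "weak_supp L B" and ix: "convex_index L ix"
  shows "submat (A * B) ix = submat A ix * submat B ix"
proof (rule eq_matI)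
  fix u v assume "u < dim_row (submat A ix * submat B ix)" "v < dim_col (submat A ix * submat B ix)"
  hence uv: "u < length ix" "v < length ix" by auto
  let ?p = "ix ! u" and ?q = "ix ! v"
  have in': "?p \<in> set ix" "?q \<in> set ix" using uv by auto
  have pq: "?p < length L" "?q < length L" using convex_indexD(3)[OF ix] uv by auto
  have "submat (A * B) ix $$ (u, v) = (\<Sum>r<length L. A $$ (?p, r) * B $$ (r, ?q))"
    using uv mult_mat_index_sum[OF A B pq] by simp
  also have "\<dots> = (\<Sum>r\<in>set ix. A $$ (?p, r) * B $$ (r, ?q))"
  proof (rule sum.mono_neutral_right)
    show "set ix \<subseteq> {..<length L}" by (rule convex_indexD(2)[OF ix])
    show "\<forall>r\<in>{..<length L} - set ix. A $$ (?p, r) * B $$ (r, ?q) = 0"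
    proof (rule ballI, rule ccontr)
      fix r assume r: "r \<in> {..<length L} - set ix" "A $$ (?p, r) * B $$ (r, ?q) \<noteq> 0"
      hence "A $$ (?p, r) \<noteq> 0" "B $$ (r, ?q) \<noteq> 0" using mult_not_zero by blast+
      hence "pair_le (L ! ?q) (L ! r)" "pair_le (L ! r) (L ! ?p)" using s pq r(1) unfolding weak_supp_def by auto
      hence "r \<in> set ix" using ix in' r(1) unfolding convex_index_def by blast
      thus False using r(1) by simp
    qed
  qed simp
  also have "\<dots> = (\<Sum>x<length ix. A $$ (?p, ix ! x) * B $$ (ix ! x, ?q))"
  proof (rule sum.reindex_bij_betw[symmetric])
    show "bij_betw ((!) ix) {..<length ix} (set ix)" by (rule bij_betw_nth[OF convex_indexD(1)[OF ix]]) auto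
  qed
  also have "\<dots> = (submat A ix * submat B ix) $$ (u, v)"
    using uv mult_mat_index_sum[OF submat_carrier submat_carrier uv, of A B] by simp
  finally show "submat (A * B) ix $$ (u, v) = (submat A ix * submat B ix) $$ (u, v)" .
qed auto

lemma submat_one: "convex_index L ix \<Longrightarrow> submat (1\<^sub>m (length L) :: 'a::semiring_1 mat) ix = 1\<^sub>m (length ix)"
  by (rule eq_matI) (auto simp: convex_indexD nth_eq_iff_index_eq)

lemma submat_zero: "convex_index L ix \<Longrightarrow> submat (0\<^sub>m (length L) (length L) :: 'a::semiring_1 mat) ix = 0\<^sub>m (length ix) (length ix)"
  by (rule eq_matI) (auto simp: convex_indexD)

lemma submat_pow:
  fixes A :: "'a::semiring_1 mat"
  assumes "A \<in> carrier_mat (length L) (length L)" "weak_supp L A" "convex_index L ix"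
  shows "submat (A ^\<^sub>m k) ix = submat A ix ^\<^sub>m k"
proof (induction k)
  case 0 thus ?case using submat_one[OF assms(3)] assms(1) by simp
next
  case (Suc k)
  thus ?case using submat_mult[of "A ^\<^sub>m k" L A ix] weak_supp_pow[OF assms(1,2)] assms by simp
qed

definition class_pos :: "(nat \<times> nat) list \<Rightarrow> nat \<Rightarrow> nat" where
  "class_pos L p = length (filter (\<lambda>p'. L ! p' = L ! p) [0..<p])"

definition class_list :: "(nat \<times> nat) list \<Rightarrow> nat \<times> nat \<Rightarrow> nat list" where
  "class_list L x = filter (\<lambda>p. L ! p = x) [0..<length L]"

text \<open>Strictly monotone along the product order; summands with equal supports are ranked by
  their position in the list.\<close>

definition height :: "(nat \<times> nat) list \<Rightarrow> nat \<Rightarrow> nat" where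
  "height L p = (fst (L ! p) + snd (L ! p)) * Suc (length L) + (length L - class_pos L p)"

lemma class_list_pos:
  assumes "p < length L"
  shows "class_pos L p < length (class_list L (L ! p))" "class_list L (L ! p) ! class_pos L p = p"
proof -
  have "[0..<length L] = [0..<p] @ p # [Suc p..<length L]"
    using assms by (metis le_add_same_cancel1 less_imp_le_nat upt_add_eq_append upt_conv_Cons zero_le le_add_diff_inverse)
  hence "class_list L (L ! p) = filter (\<lambda>p'. L ! p' = L ! p) [0..<p] @ p # filter (\<lambda>p'. L ! p' = L ! p) [Suc p..<length L]"
    by (simp add: class_list_def)
  thus "class_pos L p < length (class_list L (L ! p))" "class_list L (L ! p) ! class_pos L p = p"
    by (simp_all add: class_pos_def nth_append)
qed

lemma class_list_nth:
  assumes "u < length (class_list L x)"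
  shows "class_list L x ! u < length L" "L ! (class_list L x ! u) = x" "class_pos L (class_list L x ! u) = u"
proof -
  have "class_list L x ! u \<in> set (class_list L x)" using assms by simp
  thus 1: "class_list L x ! u < length L" "L ! (class_list L x ! u) = x" by (auto simp: class_list_def)
  have "distinct (class_list L x)" by (simp add: class_list_def)
  thus "class_pos L (class_list L x ! u) = u"
    using class_list_pos[OF 1(1)] 1(2) assms by (simp add: nth_eq_iff_index_eq)
qed

lemma class_list_convex: "convex_index L (class_list L x)"
  unfolding convex_index_def by (auto simp: class_list_def intro: pair_le_antisym)

lemma class_pos_inj: "p < length L \<Longrightarrow> q < length L \<Longrightarrow> L ! p = L ! q \<Longrightarrow> class_pos L p = class_pos L q \<Longrightarrow> p = q"
  using class_list_pos(2) by metis

lemma class_pos_le: "class_pos L p \<le> p"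
  unfolding class_pos_def by (metis diff_zero length_filter_le length_upt)

lemma height_less:
  assumes "pair_le (L ! p) (L ! q)" "L ! p \<noteq> L ! q"
  shows "height L p < height L q"
proof -
  have "fst (L ! p) + snd (L ! p) < fst (L ! q) + snd (L ! q)" using assms by (auto simp: pair_le_def prod_eq_iff)
  hence "(fst (L ! p) + snd (L ! p)) * Suc (length L) + Suc (length L) \<le> (fst (L ! q) + snd (L ! q)) * Suc (length L)"
    by (metis Suc_leI add.commute mult_Suc mult_le_mono1)
  thus ?thesis unfolding height_def by linarith
qed

lemma height_class_less:
  assumes "p < length L" "q < length L" "L ! p = L ! q" "class_pos L p < class_pos L q"
  shows "height L q < height L p"
  using assms class_pos_le[of L q] by (simp add: height_def)

lemma height_inj:
  assumes "p < length L" "q < length L" "L ! p = L ! q" "p \<noteq> q"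
  shows "height L p \<noteq> height L q"
  using height_class_less[OF assms(1-3)] height_class_less[OF assms(2,1)] assms class_pos_inj[OF assms(1-3)]
  by (metis less_irrefl linorder_neqE_nat)

text \<open>Every factor raises the height, and heights are bounded.\<close>

lemma strict_supp_nilpotent:
  fixes A :: "'a::semiring_1 mat"
  assumes A: "A \<in> carrier_mat (length L) (length L)" and s: "strict_supp L ht A"
  shows "\<exists>k. A ^\<^sub>m k = 0\<^sub>m (length L) (length L)"
proof -
  have *: "ht q + k \<le> ht p" if "p < length L" "q < length L" "(A ^\<^sub>m k) $$ (p, q) \<noteq> 0" for p q k
    using that
  proof (induction k arbitrary: q)
    case 0 thus ?case using A by (auto split: if_splits)
  next
    case (Suc k)
    have "A ^\<^sub>m k \<in> carrier_mat (length L) (length L)" using A by simp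
    from mult_mat_index_nonzero[OF this A Suc.prems(1,2)] Suc.prems(3) 
    obtain r where r: "r < length L" "(A ^\<^sub>m k) $$ (p, r) \<noteq> 0" "A $$ (r, q) \<noteq> 0" by auto
    have "ht r + k \<le> ht p" by (rule Suc.IH[OF Suc.prems(1) r(1,2)])
    moreover have "ht q < ht r" using s r Suc.prems(2) unfolding strict_supp_def by blast
    ultimately show ?case by simp
  qed
  define H where "H = Suc (\<Sum>p<length L. ht p)"
  have "A ^\<^sub>m H = 0\<^sub>m (length L) (length L)"
  proof (rule eq_matI)
    fix p q assume "p < dim_row (0\<^sub>m (length L) (length L) :: 'a mat)" "q < dim_col (0\<^sub>m (length L) (length L) :: 'a mat)"
    hence pq: "p < length L" "q < length L" by auto
    have "ht p < H" unfolding H_def less_Suc_eq_le by (rule member_le_sum) (use pq in auto)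
    thus "(A ^\<^sub>m H) $$ (p, q) = 0\<^sub>m (length L) (length L) $$ (p, q)" using *[OF pq, of H] pq by fastforce
  qed (use A in auto)
  thus ?thesis by blast
qed

text \<open>The blocks on classes of equal intervals are convex restrictions, hence nilpotent, and
  each is made strictly upper triangular. The base changes are assembled into the block diagonal
  \<open>g\<close>, which keeps supports inside the order.\<close>

lemma nilpotent_conj_strict:
  fixes A :: "'a::field mat"
  assumes A: "A \<in> carrier_mat (length L) (length L)" and supp: "weak_supp L A"
    and nil: "A ^\<^sub>m e = 0\<^sub>m (length L) (length L)"
  obtains g h T where "g \<in> carrier_mat (length L) (length L)" "h \<in> carrier_mat (length L) (length L)"
    "T \<in> carrier_mat (length L) (length L)" "g * h = 1\<^sub>m (length L)" "h * g = 1\<^sub>m (length L)" "A = g * T * h"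
    "eq_supp L g" "eq_supp L h" "strict_supp L (height L) T"
proof -
  let ?r = "length L" and ?c = "class_list L"
  have "\<exists>P Q B. similar_mat_wit (submat A (?c x)) B P Q \<and> (\<forall>i<length (?c x). \<forall>j\<le>i. B $$ (i, j) = 0)" for x
  proof -
    have "submat A (?c x) ^\<^sub>m e = 0\<^sub>m (length (?c x)) (length (?c x))"
      using submat_pow[OF A supp class_list_convex[of L x], of e] submat_zero[OF class_list_convex[of L x], where 'a = 'a] nil by simp
    from nilpotent_similar_strict_upper[OF submat_carrier this] show ?thesis unfolding similar_mat_def by blast
  qed
  then obtain P Q B where w: "\<And>x. similar_mat_wit (submat A (?c x)) (B x) (P x) (Q x)" 
    and B0: "\<And>x i j. i < length (?c x) \<Longrightarrow> j \<le> i \<Longrightarrow> B x $$ (i, j) = 0" by metis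
  note W = similar_mat_witD2[OF submat_carrier w]
  define g where "g = mat ?r ?r (\<lambda>(p, q). if L ! p = L ! q then P (L ! p) $$ (class_pos L p, class_pos L q) else 0)"
  define h where "h = mat ?r ?r (\<lambda>(p, q). if L ! p = L ! q then Q (L ! p) $$ (class_pos L p, class_pos L q) else 0)"
  have gc: "g \<in> carrier_mat ?r ?r" and hc: "h \<in> carrier_mat ?r ?r" by (auto simp: g_def h_def)
  have ge: "eq_supp L g" and he: "eq_supp L h" by (auto simp: g_def h_def eq_supp_def)
  have gs: "submat g (?c x) = P x" and hs: "submat h (?c x) = Q x" for x
    using W(6,7)[of x] by (intro eq_matI; auto simp: g_def h_def class_list_nth)+
  have gh: "g * h = 1\<^sub>m ?r"
  proof (rule eq_matI)
    fix p q assume "p < dim_row (1\<^sub>m ?r :: 'a mat)" "q < dim_col (1\<^sub>m ?r :: 'a mat)"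
    hence pq: "p < ?r" "q < ?r" by auto
    show "(g * h) $$ (p, q) = 1\<^sub>m ?r $$ (p, q)"
    proof (cases "L ! p = L ! q")
      case True
      let ?x = "L ! p"
      have "(g * h) $$ (p, q) = submat (g * h) (?c ?x) $$ (class_pos L p, class_pos L q)"
        using class_list_pos[OF pq(1)] class_list_pos[OF pq(2)] True by simp
      also have "submat (g * h) (?c ?x) = 1\<^sub>m (length (?c ?x))"
        unfolding submat_mult[OF gc hc eq_supp_weak[OF ge] eq_supp_weak[OF he] class_list_convex] gs hs by (rule W(1))
      finally show ?thesis using class_list_pos[OF pq(1)] class_list_pos[OF pq(2)] True class_pos_inj[OF pq True] pq by auto
    next
      case False
      have "(g * h) $$ (p, q) = 0"
      proof (rule ccontr)
        assume "(g * h) $$ (p, q) \<noteq> 0"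
        from mult_mat_index_nonzero[OF gc hc pq this] obtain r where "r < ?r" "g $$ (p, r) \<noteq> 0" "h $$ (r, q) \<noteq> 0" .
        thus False using ge he pq False unfolding eq_supp_def by metis
      qed
      thus ?thesis using False pq by auto
    qed
  qed (use gc hc in auto)
  have hg: "h * g = 1\<^sub>m ?r" by (rule mat_mult_left_right_inverse[OF gc hc gh])
  define T where "T = h * A * g"
  have hA: "h * A \<in> carrier_mat ?r ?r" using hc A by simp
  have Tc: "T \<in> carrier_mat ?r ?r" using gc hA by (simp add: T_def)
  have hAs: "weak_supp L (h * A)" by (rule weak_supp_mult[OF hc A eq_supp_weak[OF he] supp])
  have Ts: "weak_supp L T" unfolding T_def by (rule weak_supp_mult[OF hA gc hAs eq_supp_weak[OF ge]])
  have Tsub: "submat T (?c x) = B x" for x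
  proof -
    have "submat T (?c x) = Q x * submat A (?c x) * P x"
      unfolding T_def submat_mult[OF hA gc hAs eq_supp_weak[OF ge] class_list_convex]
        submat_mult[OF hc A eq_supp_weak[OF he] supp class_list_convex] gs hs ..
    also have "\<dots> = B x" using similar_mat_witD2(3)[OF W(5) similar_mat_wit_sym[OF w]] by simp
    finally show ?thesis .
  qed
  have "strict_supp L (height L) T" unfolding strict_supp_def
  proof (intro allI impI)
    fix p q assume pq: "p < ?r" "q < ?r" "T $$ (p, q) \<noteq> 0"
    have pl: "pair_le (L ! q) (L ! p)" using Ts pq unfolding weak_supp_def by blast
    moreover have "height L q < height L p"
    proof (cases "L ! q = L ! p")
      case True
      have "B (L ! p) $$ (class_pos L p, class_pos L q) = T $$ (p, q)"
        unfolding Tsub[symmetric] using class_list_pos[OF pq(1)] class_list_pos[OF pq(2)] True by simp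
      \<comment> \<open>A strictly upper entry leads to a smaller class position;
        \<open>height\<close> counts these positions downwards, so the height rises.\<close>
      hence "class_pos L p < class_pos L q" using B0[of "class_pos L p" "L ! p" "class_pos L q"] pq(3) class_list_pos[OF pq(1)]
        by (metis leI)
      thus ?thesis using height_class_less[OF pq(1,2)] True by simp
    qed (use height_less[OF pl] in simp)
    ultimately show "pair_le (L ! q) (L ! p) \<and> height L q < height L p" by simp
  qed
  moreover have "A = g * T * h"
  proof -
    have "g * T * h = g * (h * (A * g)) * h" unfolding T_def using hc A gc by (simp add: assoc_mult_mat[of _ ?r ?r _ ?r _ ?r])
    also have "g * (h * (A * g)) = A * g"
      using gh A gc hc by (simp add: assoc_mult_mat[of g ?r ?r h ?r "A * g" ?r, symmetric])
    also have "A * g * h = A * (g * h)" using A gc hc by (rule assoc_mult_mat)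
    also have "\<dots> = A" using gh A by simp
    finally show ?thesis ..
  qed
  ultimately show ?thesis using that gc hc Tc gh hg ge he by blast
qed

section \<open>Ranks of powers and recovery of the block sizes\<close>

lemma det_zero_row:
  fixes A :: "'a::comm_ring_1 mat"
  assumes "A \<in> carrier_mat n n" "i < n" "\<And>j. j < n \<Longrightarrow> A $$ (i, j) = 0"
  shows "det A = 0"
proof -
  have "signof \<sigma> * (\<Prod>i=0..<n. A $$ (i, \<sigma> i)) = 0" if "\<sigma> permutes {0..<n}" for \<sigma>
  proof -
    have "\<sigma> i < n" using permutes_in_image[OF that, of i] assms(2) by simp
    hence "(\<Prod>i=0..<n. A $$ (i, \<sigma> i)) = 0"
      using assms by (intro prod_zero) (auto intro!: bexI[of _ i])
    thus ?thesis by simp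
  qed
  thus ?thesis unfolding det_def'[OF assms(1)] by (intro sum.neutral) auto
qed

text \<open>The product factors through the nonzero rows of \<open>Y\<close>, of which there are
  fewer than \<open>\<rho>\<close>. Padding with zeros makes both factors square, and the second one
  has a zero row.\<close>

lemma det_mult_few_rows:
  fixes X Y :: "'a::comm_ring_1 mat"
  assumes X: "X \<in> carrier_mat \<rho> n" and Y: "Y \<in> carrier_mat n \<rho>"
    and S: "card {p. p < n \<and> (\<exists>q<\<rho>. Y $$ (p, q) \<noteq> 0)} < \<rho>"
  shows "det (X * Y) = 0"
proof -
  define S where "S = {p. p < n \<and> (\<exists>q<\<rho>. Y $$ (p, q) \<noteq> 0)}"
  define xs where "xs = sorted_list_of_set S"
  define c where "c = length xs"
  have fS: "finite S" by (simp add: S_def)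
  have xs: "set xs = S" "distinct xs" "c < \<rho>" using fS assms(3) by (simp_all add: xs_def c_def S_def)
  define X1 where "X1 = mat \<rho> \<rho> (\<lambda>(i, t). if t < c then X $$ (i, xs ! t) else 0)"
  define Y1 where "Y1 = mat \<rho> \<rho> (\<lambda>(t, q). if t < c then Y $$ (xs ! t, q) else 0)"
  have c1: "X1 \<in> carrier_mat \<rho> \<rho>" "Y1 \<in> carrier_mat \<rho> \<rho>" by (auto simp: X1_def Y1_def)
  have "X * Y = X1 * Y1"
  proof (rule eq_matI)
    fix i q assume "i < dim_row (X1 * Y1)" "q < dim_col (X1 * Y1)"
    hence iq: "i < \<rho>" "q < \<rho>" using c1 by auto
    have "(X * Y) $$ (i, q) = (\<Sum>p<n. X $$ (i, p) * Y $$ (p, q))" by (rule mult_mat_index_sum[OF X Y iq])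
    also have "\<dots> = (\<Sum>p\<in>S. X $$ (i, p) * Y $$ (p, q))"
      by (rule sum.mono_neutral_right) (use iq in \<open>auto simp: S_def\<close>)
    also have "\<dots> = (\<Sum>t<c. X $$ (i, xs ! t) * Y $$ (xs ! t, q))"
      by (rule sum.reindex_bij_betw[symmetric]) (use xs in \<open>auto simp: c_def intro!: bij_betw_nth\<close>)
    also have "\<dots> = (\<Sum>t<\<rho>. X1 $$ (i, t) * Y1 $$ (t, q))"
      by (rule sum.mono_neutral_cong_left) (use xs(3) iq in \<open>auto simp: X1_def Y1_def\<close>)
    also have "\<dots> = (X1 * Y1) $$ (i, q)" by (rule mult_mat_index_sum[OF c1 iq, symmetric])
    finally show "(X * Y) $$ (i, q) = (X1 * Y1) $$ (i, q)" .
  qed (use X Y c1 in auto)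
  moreover have "det Y1 = 0" by (rule det_zero_row[OF c1(2), of c]) (use xs(3) in \<open>auto simp: Y1_def\<close>)
  ultimately show ?thesis using det_mult[OF c1] by simp
qed

lemma card_nonzero_rows_jordan_pow:
  assumes "\<forall>sa\<in>set n_as. snd sa = (0 :: 'a::field)"
  shows "card {p. p < sum_list (map fst n_as) \<and> (\<exists>q<sum_list (map fst n_as). (jordan_matrix n_as ^\<^sub>m j) $$ (p, q) \<noteq> 0)}
    \<le> sum_list (map (\<lambda>sa. fst sa - j) n_as)"
  using assms
proof (induction n_as)
  case (Cons sa n_as)
  obtain s where sa: "sa = (s, 0)" using Cons.prems by (cases sa) auto
  let ?N = "sum_list (map fst n_as)"
  let ?S = "{p. p < ?N \<and> (\<exists>q<?N. (jordan_matrix n_as ^\<^sub>m j) $$ (p, q) \<noteq> 0)}"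
  have "{p. p < sum_list (map fst (sa # n_as)) \<and> (\<exists>q<sum_list (map fst (sa # n_as)). (jordan_matrix (sa # n_as) ^\<^sub>m j) $$ (p, q) \<noteq> 0)}
    \<subseteq> {..<s - j} \<union> (\<lambda>p. s + p) ` ?S"
  proof
    fix p assume "p \<in> {p. p < sum_list (map fst (sa # n_as)) \<and> (\<exists>q<sum_list (map fst (sa # n_as)). (jordan_matrix (sa # n_as) ^\<^sub>m j) $$ (p, q) \<noteq> 0)}"
    then obtain q where pq: "p < s + ?N" "q < s + ?N" "(jordan_matrix ((s, 0) # n_as) ^\<^sub>m j) $$ (p, q) \<noteq> 0"
      by (auto simp: sa)
    note ix = pq(3)[unfolded jordan_matrix_pow_Cons_index[OF pq(1,2)]]
    show "p \<in> {..<s - j} \<union> (\<lambda>p. s + p) ` ?S"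
    proof (cases "p < s")
      case True
      thus ?thesis using ix by (auto split: if_splits)
    next
      case False
      hence "p - s \<in> ?S" using ix pq by (auto split: if_splits intro!: exI[of _ "q - s"])
      hence "s + (p - s) \<in> (\<lambda>p. s + p) ` ?S" by (rule imageI)
      thus ?thesis using False by simp
    qed
  qed
  hence "card {p. p < sum_list (map fst (sa # n_as)) \<and> (\<exists>q<sum_list (map fst (sa # n_as)). (jordan_matrix (sa # n_as) ^\<^sub>m j) $$ (p, q) \<noteq> 0)}
    \<le> card ({..<s - j} \<union> (\<lambda>p. s + p) ` ?S)" by (intro card_mono) auto
  also have "\<dots> \<le> card {..<s - j} + card ((\<lambda>p. s + p) ` ?S)" by (rule card_Un_le)
  also have "card ((\<lambda>p. s + p) ` ?S) \<le> card ?S" by (rule card_image_le) auto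
  also have "card ?S \<le> sum_list (map (\<lambda>sa. fst sa - j) n_as)" using Cons by simp
  finally show ?case by (simp add: sa)
qed simp

text \<open>A nonzero determinant of size \<open>\<rho>\<close> certifies that the power has rank at
  least \<open>\<rho>\<close>; in Jordan form the nonzero rows of the power are counted block by
  block, and \<open>B\<close> and \<open>C\<close> absorb the base change.\<close>

lemma det_pow_nonzero_imp_le:
  fixes A :: "'a::field mat"
  assumes A: "A \<in> carrier_mat n n" and nil: "A ^\<^sub>m e = 0\<^sub>m n n" and jnf: "jordan_nf A n_as"
    and B: "B \<in> carrier_mat \<rho> n" and C: "C \<in> carrier_mat n \<rho>" and nz: "det (B * (A ^\<^sub>m j) * C) \<noteq> 0"
  shows "\<rho> \<le> sum_list (map (\<lambda>sa. fst sa - j) n_as)"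
proof (rule ccontr)
  assume *: "\<not> ?thesis"
  define J where "J = jordan_matrix n_as"
  obtain P Q where wit: "similar_mat_wit A J P Q" using jnf unfolding jordan_nf_def similar_mat_def J_def by blast
  note W = similar_mat_witD2[OF A wit]
  have N: "sum_list (map fst n_as) = n" using W(5) unfolding J_def by (metis carrier_matD(1) jordan_matrix_dim(1))
  have z: "\<forall>sa\<in>set n_as. snd sa = 0" using nilpotent_jordan_eigenvalue(1)[OF A nil jnf] by fastforce
  have Jj: "J ^\<^sub>m j \<in> carrier_mat n n" using W(5) by simp
  have QC: "Q * C \<in> carrier_mat n \<rho>" using W(7) C by simp
  have BP: "B * P \<in> carrier_mat \<rho> n" using W(6) B by simp
  define Y where "Y = J ^\<^sub>m j * (Q * C)"
  have Y: "Y \<in> carrier_mat n \<rho>" using Jj QC by (simp add: Y_def)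
  have "{p. p < n \<and> (\<exists>q<\<rho>. Y $$ (p, q) \<noteq> 0)} \<subseteq> {p. p < n \<and> (\<exists>q<n. (J ^\<^sub>m j) $$ (p, q) \<noteq> 0)}"
  proof
    fix p assume "p \<in> {p. p < n \<and> (\<exists>q<\<rho>. Y $$ (p, q) \<noteq> 0)}"
    then obtain q where q: "p < n" "q < \<rho>" "Y $$ (p, q) \<noteq> 0" by blast
    from mult_mat_index_nonzero[OF Jj QC q(1,2) q(3)[unfolded Y_def]] q(1)
    show "p \<in> {p. p < n \<and> (\<exists>q<n. (J ^\<^sub>m j) $$ (p, q) \<noteq> 0)}" by blast
  qed
  hence "card {p. p < n \<and> (\<exists>q<\<rho>. Y $$ (p, q) \<noteq> 0)} \<le> card {p. p < n \<and> (\<exists>q<n. (J ^\<^sub>m j) $$ (p, q) \<noteq> 0)}"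
    by (intro card_mono) auto
  also have "\<dots> \<le> sum_list (map (\<lambda>sa. fst sa - j) n_as)"
    using card_nonzero_rows_jordan_pow[OF z, of j] unfolding N J_def .
  finally have "det (B * P * Y) = 0" using * by (intro det_mult_few_rows[OF BP Y]) simp
  moreover have "B * (A ^\<^sub>m j) * C = B * P * Y"
  proof -
    have PJ: "P * J ^\<^sub>m j \<in> carrier_mat n n" using W(6) Jj by simp
    have "B * (A ^\<^sub>m j) * C = B * (P * J ^\<^sub>m j * Q) * C" using similar_mat_wit_pow_id[OF wit] by simp
    also have "\<dots> = B * (P * J ^\<^sub>m j * Q * C)" by (rule assoc_mult_mat[OF B _ C]) (use PJ W(7) in simp)
    also have "P * J ^\<^sub>m j * Q * C = P * J ^\<^sub>m j * (Q * C)" by (rule assoc_mult_mat[OF PJ W(7) C])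
    also have "\<dots> = P * Y" unfolding Y_def by (rule assoc_mult_mat[OF W(6) Jj QC])
    also have "B * (P * Y) = B * P * Y" by (rule assoc_mult_mat[OF B W(6) Y, symmetric])
    finally show ?thesis .
  qed
  ultimately show False using nz by simp
qed

text \<open>Second differences in \<open>j\<close> of these truncated sums are the multiplicities of
  the positive numbers.\<close>

lemma multiset_eq_from_tails:
  fixes X Y :: "nat multiset"
  assumes "\<And>j. (\<Sum>x\<in>#X. x - j) = (\<Sum>y\<in>#Y. y - j)" "0 \<notin># X" "0 \<notin># Y"
  shows "X = Y"
proof (rule multiset_eqI)
  fix t
  have tail: "(\<Sum>x\<in>#N. x - j) = (\<Sum>x\<in>#N. x - Suc j) + size {#x \<in># N. j < x#}" for N :: "nat multiset" and j
    by (induction N) auto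
  have cnt: "size {#x \<in># N. j < x#} = size {#x \<in># N. Suc j < x#} + count N (Suc j)" for N :: "nat multiset" and j
    by (induction N) auto
  have "size {#x \<in># X. j < x#} = size {#x \<in># Y. j < x#}" for j
    using tail[where N = X and j = j] tail[where N = Y and j = j] assms(1)[of j] assms(1)[of "Suc j"] by linarith
  hence "count X (Suc j) = count Y (Suc j)" for j
    using cnt[where N = X and j = j] cnt[where N = Y and j = j] by (metis add_left_cancel)
  thus "count X t = count Y t" using assms(2,3) by (cases t) (auto simp: not_in_iff)
qed

text \<open>Both bounds become statements on truncated sums. Applied to the blocks larger than
  \<open>j\<close>, the upper bound loses \<open>j\<close> for each block and gives the reverse of
  the lower bound, so all truncated sums agree.\<close>

lemma blocks_eq_shape:
  fixes \<mu> :: "nat \<Rightarrow> nat" and n_as :: "(nat \<times> 'b) list"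
  assumes anti: "antimono \<mu>" and fin: "\<And>k. K \<le> k \<Longrightarrow> \<mu> k = 0" and pos: "\<forall>sa\<in>set n_as. 0 < fst sa"
    and upper: "\<And>ss. distinct ss \<Longrightarrow> set ss \<subseteq> {..<length n_as} \<Longrightarrow> (\<Sum>s\<in>set ss. fst (n_as ! s)) \<le> (\<Sum>l<length ss. \<mu> l)"
    and lower: "\<And>j. (\<Sum>l<K. \<mu> l - j) \<le> sum_list (map (\<lambda>sa. fst sa - j) n_as)"
  shows "mset (map fst n_as) = filter_mset (\<lambda>p. 0 < p) (image_mset \<mu> (mset_set {..<K}))"
proof (rule multiset_eq_from_tails)
  fix j
  have sl: "sum_list (map (\<lambda>sa. fst sa - j) n_as) = (\<Sum>s<length n_as. fst (n_as ! s) - j)"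
    by (simp add: sum_list_sum_nth atLeast0LessThan)
  have "sum_list (map (\<lambda>sa. fst sa - j) n_as) \<le> (\<Sum>l<K. \<mu> l - j)"
  proof -
    define S where "S = {s. s < length n_as \<and> j < fst (n_as ! s)}"
    have fS: "finite S" by (simp add: S_def)
    define ss where "ss = sorted_list_of_set S"
    have ss: "distinct ss" "set ss = S" "length ss = card S" using fS by (simp_all add: ss_def)
    have "sum_list (map (\<lambda>sa. fst sa - j) n_as) = (\<Sum>s\<in>S. fst (n_as ! s) - j)"
      unfolding sl by (rule sum.mono_neutral_right) (auto simp: S_def)
    hence "sum_list (map (\<lambda>sa. fst sa - j) n_as) + j * card S = (\<Sum>s\<in>S. (fst (n_as ! s) - j) + j)"
      by (simp add: sum.distrib)
    also have "\<dots> = (\<Sum>s\<in>S. fst (n_as ! s))" by (rule sum.cong[OF refl]) (simp add: S_def)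
    also have "\<dots> \<le> (\<Sum>l<card S. \<mu> l)" using upper[of ss] ss by (auto simp: S_def)
    also have "\<dots> \<le> (\<Sum>l<card S. (\<mu> l - j) + j)" by (intro sum_mono) simp
    also have "\<dots> = (\<Sum>l<card S. \<mu> l - j) + j * card S" by (simp add: sum.distrib)
    also have "(\<Sum>l<card S. \<mu> l - j) \<le> (\<Sum>l<K. \<mu> l - j)"
    proof (cases "card S \<le> K")
      case True thus ?thesis by (intro sum_mono2) auto
    next
      case False
      hence "(\<Sum>l<card S. \<mu> l - j) = (\<Sum>l<K. \<mu> l - j)"
        by (intro sum.mono_neutral_right) (auto simp: fin)
      thus ?thesis by simp
    qed
    finally show ?thesis by simp
  qed
  hence "sum_list (map (\<lambda>sa. fst sa - j) n_as) = (\<Sum>l<K. \<mu> l - j)" using lower[of j] by simp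
  moreover have "(\<Sum>x\<in>#mset (map fst n_as). x - j) = sum_list (map (\<lambda>sa. fst sa - j) n_as)"
    by (induction n_as) auto
  moreover have "(\<Sum>x\<in>#filter_mset (\<lambda>p. 0 < p) N. x - j) = (\<Sum>x\<in>#N. x - j)" for N :: "nat multiset"
    by (induction N) auto
  moreover have "(\<Sum>x\<in>#image_mset \<mu> (mset_set {..<K}). x - j) = (\<Sum>l<K. \<mu> l - j)"
    by (simp add: multiset.map_comp comp_def sum_unfold_sum_mset)
  ultimately show "(\<Sum>x\<in>#mset (map fst n_as). x - j) = (\<Sum>y\<in>#filter_mset (\<lambda>p. 0 < p) (image_mset \<mu> (mset_set {..<K})). y - j)"
    by simp
qed (use pos in auto)

lemma rank_bij:
  fixes f :: "'a \<Rightarrow> nat"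
  assumes fin: "finite S" and inj: "inj_on f S"
  shows "bij_betw (\<lambda>x. card {y \<in> S. f y < f x}) S {..<card S}"
proof -
  let ?r = "\<lambda>x. card {y \<in> S. f y < f x}"
  have lt: "?r x < ?r x'" if "x \<in> S" "f x < f x'" for x x'
  proof (rule psubset_card_mono)
    have "x \<in> {y \<in> S. f y < f x'}" "x \<notin> {y \<in> S. f y < f x}" using that by simp_all
    moreover have "{y \<in> S. f y < f x} \<subseteq> {y \<in> S. f y < f x'}" using that(2) by auto
    ultimately show "{y \<in> S. f y < f x} \<subset> {y \<in> S. f y < f x'}" by blast
  qed (use fin in simp)
  have "inj_on ?r S"
  proof (rule inj_onI)
    fix x x' assume x: "x \<in> S" "x' \<in> S" "?r x = ?r x'"
    hence "f x = f x'" using lt[of x x'] lt[of x' x] by (metis less_irrefl linorder_neqE_nat)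
    thus "x = x'" using inj x by (auto dest: inj_onD)
  qed
  moreover have "?r ` S \<subseteq> {..<card S}"
  proof
    fix n assume "n \<in> ?r ` S"
    then obtain x where "x \<in> S" "n = ?r x" by blast
    thus "n \<in> {..<card S}" using psubset_card_mono[OF fin, of "{y \<in> S. f y < f x}"] by auto
  qed
  ultimately show ?thesis using card_subset_eq[of "{..<card S}" "?r ` S"] by (simp add: bij_betw_def card_image)
qed

text \<open>The witness shifts each basis vector to the next one on its chain of an optimal \<open>k\<close>-chain family.\<close>

lemma chain_shift_matrix:
  fixes ht :: "nat \<Rightarrow> nat"
  assumes ht1: "\<And>p q. p < length L \<Longrightarrow> q < length L \<Longrightarrow> pair_le (L ! p) (L ! q) \<Longrightarrow> L ! p \<noteq> L ! q \<Longrightarrow> ht p < ht q"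
    and ht2: "\<And>p q. p < length L \<Longrightarrow> q < length L \<Longrightarrow> L ! p = L ! q \<Longrightarrow> p \<noteq> q \<Longrightarrow> ht p \<noteq> ht q"
  shows "\<exists>(T :: 'a::field mat) \<in> carrier_mat (length L) (length L). strict_supp L ht T \<and>
    (\<exists>\<rho> B C. greene (mset L) k \<le> \<rho> + k * j \<and> B \<in> carrier_mat \<rho> (length L) \<and> C \<in> carrier_mat (length L) \<rho> \<and>
       det (B * (T ^\<^sub>m j) * C) \<noteq> 0)"
proof -
  let ?r = "length L"
  obtain Z where Z: "image_mset fst Z = mset L" "chain_coloured k Z" "size {#z \<in># Z. snd z < k#} = greene (mset L) k"
    using greene_ex by blast
  obtain zs where zs: "mset zs = Z" "map fst zs = L" using ex_list_image_mset[OF Z(1)] by blast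
  have len: "length zs = ?r" using zs(2) by (metis length_map)
  define cl where "cl p = snd (zs ! p)" for p
  have zsn: "zs ! p = (L ! p, cl p)" if "p < ?r" for p
    using that zs(2) len by (metis cl_def nth_map prod.collapse)
  have cmp: "pair_le (L ! p) (L ! q) \<or> pair_le (L ! q) (L ! p)" if "p < ?r" "q < ?r" "cl p = cl q" "cl p < k" for p q
  proof -
    have "zs ! p \<in># Z" "zs ! q \<in># Z" using that len zs(1) nth_mem[of p zs] nth_mem[of q zs] by (auto simp: in_multiset_in_set)
    hence "comparable (L ! p) (L ! q)" using Z(2) that zsn unfolding chain_coloured_def by fastforce
    thus ?thesis by (auto simp: comparable_def pair_le_def)
  qed
  define S where "S c = {p. p < ?r \<and> cl p = c}" for c
  have fS: "finite (S c)" for c by (simp add: S_def)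
  have inj: "inj_on ht (S c)" if "c < k" for c
  proof (rule inj_onI, rule ccontr)
    fix p q assume pq: "p \<in> S c" "q \<in> S c" "ht p = ht q" "p \<noteq> q"
    hence p: "p < ?r" "q < ?r" "cl p = cl q" "cl p < k" using that by (auto simp: S_def)
    show False using cmp[OF p] ht1[OF p(1,2)] ht1[OF p(2,1)] ht2[OF p(1,2)] pq(3,4) by force
  qed
  \<comment> \<open>The position on the chain, measured by height, which is injective on each
    selected chain.\<close>
  define rk where "rk p = card {q \<in> S (cl p). ht q < ht p}" for p
  have bij: "bij_betw rk (S c) {..<card (S c)}" if "c < k" for c
  proof -
    have "bij_betw (\<lambda>p. card {q \<in> S c. ht q < ht p}) (S c) {..<card (S c)}" by (rule rank_bij[OF fS inj[OF that]])
    thus ?thesis by (subst bij_betw_cong[of _ _ "\<lambda>p. card {q \<in> S c. ht q < ht p}"]) (auto simp: rk_def S_def)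
  qed
  define T where "T = mat ?r ?r (\<lambda>(p, q). if cl p = cl q \<and> cl p < k \<and> rk p = Suc (rk q) then 1 else (0::'a))"
  have T: "T \<in> carrier_mat ?r ?r" by (simp add: T_def)
  have "strict_supp L ht T" unfolding strict_supp_def
  proof (intro allI impI)
    fix p q assume pq: "p < ?r" "q < ?r" "T $$ (p, q) \<noteq> 0"
    hence c: "cl p = cl q" "cl p < k" "rk p = Suc (rk q)" by (auto simp: T_def split: if_splits)
    have h: "ht q < ht p"
    proof (rule ccontr)
      assume "\<not> ?thesis"
      hence "{x \<in> S (cl p). ht x < ht p} \<subseteq> {x \<in> S (cl p). ht x < ht q}" by auto
      hence "rk p \<le> rk q" unfolding rk_def c(1) by (intro card_mono) (auto simp: fS)
      thus False using c(3) by simp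
    qed
    have "pair_le (L ! q) (L ! p)"
    proof (rule ccontr)
      assume n: "\<not> ?thesis"
      hence "pair_le (L ! p) (L ! q)" "L ! p \<noteq> L ! q" using cmp[OF pq(1,2) c(1,2)] by auto
      from ht1[OF pq(1,2) this] h show False by simp
    qed
    thus "pair_le (L ! q) (L ! p) \<and> ht q < ht p" using h by simp
  qed
  moreover have Tj: "(T ^\<^sub>m j) $$ (p, q) = (if cl p = cl q \<and> rk p = rk q + j then 1 else 0)"
    if "p < ?r" "q < ?r" "cl p < k" "cl q < k" for p q j
    using that
  proof (induction j arbitrary: q)
    case 0
    have "p = q" if "cl p = cl q" "rk p = rk q"
      using bij_betw_imp_inj_on[OF bij[OF 0(3)]] that 0 unfolding inj_on_def S_def by simp
    thus ?case using 0 T by auto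
  next
    case (Suc j)
    have Tjc: "T ^\<^sub>m j \<in> carrier_mat ?r ?r" using T by simp
    have "(T ^\<^sub>m Suc j) $$ (p, q) = (\<Sum>x<?r. (T ^\<^sub>m j) $$ (p, x) * T $$ (x, q))"
      using mult_mat_index_sum[OF Tjc T Suc.prems(1,2)] by simp
    also have "\<dots> = (\<Sum>x<?r. if cl x = cl q \<and> rk x = Suc (rk q) \<and> cl p = cl x \<and> rk p = rk x + j then 1 else 0)"
    proof (rule sum.cong[OF refl])
      fix x assume "x \<in> {..<?r}"
      hence x: "x < ?r" by simp
      show "(T ^\<^sub>m j) $$ (p, x) * T $$ (x, q) = (if cl x = cl q \<and> rk x = Suc (rk q) \<and> cl p = cl x \<and> rk p = rk x + j then 1 else 0)"
      proof (cases "cl x = cl q \<and> rk x = Suc (rk q)")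
        case True
        thus ?thesis using Suc.IH[OF Suc.prems(1) x Suc.prems(3)] Suc.prems x by (simp add: T_def)
      next
        case False
        hence "T $$ (x, q) = 0" using Suc.prems x by (auto simp: T_def)
        thus ?thesis using False by auto
      qed
    qed
    also have "\<dots> = (if cl p = cl q \<and> rk p = rk q + Suc j then 1 else 0)"
    proof (cases "cl p = cl q \<and> rk p = rk q + Suc j")
      case True
      have "rk p < card (S (cl q))" using bij_betwE[OF bij[OF Suc.prems(4)]] True Suc.prems(1) by (auto simp: S_def)
      hence "Suc (rk q) \<in> {..<card (S (cl q))}" using True by simp
      then obtain x where x: "x \<in> S (cl q)" "rk x = Suc (rk q)"
        using bij_betw_imp_surj_on[OF bij[OF Suc.prems(4)]] by (metis imageE)
      have "(if cl y = cl q \<and> rk y = Suc (rk q) \<and> cl p = cl y \<and> rk p = rk y + j then 1 else (0::'a)) = (if y = x then 1 else 0)" if "y < ?r" for y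
      proof (cases "y = x")
        case True thus ?thesis using x \<open>cl p = cl q \<and> rk p = rk q + Suc j\<close> by (simp add: S_def)
      next
        case False
        have "\<not> (cl y = cl q \<and> rk y = Suc (rk q))"
        proof
          assume "cl y = cl q \<and> rk y = Suc (rk q)"
          hence "y \<in> S (cl q)" "rk y = rk x" using x(2) that by (simp_all add: S_def)
          with inj_onD[OF bij_betw_imp_inj_on[OF bij[OF Suc.prems(4)]]] x(1) False show False by blast
        qed
        thus ?thesis using False by auto
      qed
      hence "(\<Sum>y<?r. if cl y = cl q \<and> rk y = Suc (rk q) \<and> cl p = cl y \<and> rk p = rk y + j then 1 else (0::'a)) = (\<Sum>y<?r. if y = x then 1 else 0)"
        by (intro sum.cong) auto
      also have "\<dots> = 1" using x(1) by (simp add: S_def)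
      finally show ?thesis using True by simp
    next
      case False
      show ?thesis unfolding if_not_P[OF False] by (rule sum.neutral) (use False in auto)
    qed
    finally show ?case .
  qed
  \<comment> \<open>The selected indices with a \<open>j\<close>-th successor on their chain. The
    \<open>j\<close>-th power maps them injectively to these successors, and \<open>B\<close> and
    \<open>C\<close> cut out the resulting identity matrix.\<close>
  define D where "D = {q. q < ?r \<and> cl q < k \<and> rk q + j < card (S (cl q))}"
  have fD: "finite D" by (simp add: D_def)
  define qs where "qs = sorted_list_of_set D"
  define \<rho> where "\<rho> = length qs"
  have qs: "set qs = D" "distinct qs" "\<rho> = card D" using fD by (simp_all add: qs_def \<rho>_def)
  have "\<exists>p. q \<in> D \<longrightarrow> p < ?r \<and> cl p = cl q \<and> rk p = rk q + j" for q
  proof (cases "q \<in> D")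
    case True
    hence "rk q + j \<in> {..<card (S (cl q))}" "cl q < k" by (auto simp: D_def)
    then obtain x where "x \<in> S (cl q)" "rk x = rk q + j" using bij unfolding bij_betw_def by (metis imageE)
    thus ?thesis by (auto simp: S_def)
  qed simp
  then obtain nx where nx: "\<And>q. q \<in> D \<Longrightarrow> nx q < ?r \<and> cl (nx q) = cl q \<and> rk (nx q) = rk q + j" by metis
  define B where "B = mat \<rho> ?r (\<lambda>(t, p). if p = nx (qs ! t) then 1 else (0::'a))"
  define C where "C = mat ?r \<rho> (\<lambda>(p, t). if p = qs ! t then 1 else (0::'a))"
  have BC: "B \<in> carrier_mat \<rho> ?r" "C \<in> carrier_mat ?r \<rho>" by (auto simp: B_def C_def)
  have Tjc: "T ^\<^sub>m j \<in> carrier_mat ?r ?r" using T by simp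
  have BT: "B * (T ^\<^sub>m j) \<in> carrier_mat \<rho> ?r" using BC(1) Tjc by simp
  have "B * (T ^\<^sub>m j) * C = 1\<^sub>m \<rho>"
  proof (rule eq_matI)
    fix t u assume "t < dim_row (1\<^sub>m \<rho> :: 'a mat)" "u < dim_col (1\<^sub>m \<rho> :: 'a mat)"
    hence tu: "t < \<rho>" "u < \<rho>" by auto
    hence d: "qs ! t \<in> D" "qs ! u \<in> D" using qs(1) nth_mem unfolding \<rho>_def by blast+
    have qu: "qs ! u < ?r" "cl (qs ! u) < k" "qs ! t < ?r" "cl (qs ! t) < k" using d by (auto simp: D_def)
    have "(B * (T ^\<^sub>m j) * C) $$ (t, u) = (\<Sum>x<?r. (B * (T ^\<^sub>m j)) $$ (t, x) * C $$ (x, u))"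
      by (rule mult_mat_index_sum[OF BT BC(2) tu])
    also have "\<dots> = (\<Sum>x<?r. if x = qs ! u then (B * (T ^\<^sub>m j)) $$ (t, qs ! u) else 0)"
      using tu by (intro sum.cong) (auto simp: C_def)
    also have "\<dots> = (B * (T ^\<^sub>m j)) $$ (t, qs ! u)" using qu by simp
    also have "\<dots> = (\<Sum>x<?r. B $$ (t, x) * (T ^\<^sub>m j) $$ (x, qs ! u))"
      by (rule mult_mat_index_sum[OF BC(1) Tjc tu(1) qu(1)])
    also have "\<dots> = (\<Sum>x<?r. if x = nx (qs ! t) then (T ^\<^sub>m j) $$ (nx (qs ! t), qs ! u) else 0)"
      using tu by (intro sum.cong) (auto simp: B_def)
    also have "\<dots> = (T ^\<^sub>m j) $$ (nx (qs ! t), qs ! u)" using nx[OF d(1)] by simp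
    also have "\<dots> = (if cl (qs ! t) = cl (qs ! u) \<and> rk (qs ! t) = rk (qs ! u) then 1 else 0)"
      using Tj[of "nx (qs ! t)" "qs ! u" j] nx[OF d(1)] qu by simp
    also have "\<dots> = (if t = u then 1 else 0)"
    proof -
      have "t = u" if "cl (qs ! t) = cl (qs ! u)" "rk (qs ! t) = rk (qs ! u)"
      proof -
        have "qs ! t = qs ! u"
          using bij_betw_imp_inj_on[OF bij[OF qu(2)]] that qu unfolding inj_on_def S_def by simp
        thus ?thesis using qs(2) tu by (simp add: \<rho>_def nth_eq_iff_index_eq)
      qed
      thus ?thesis by auto
    qed
    finally show "(B * (T ^\<^sub>m j) * C) $$ (t, u) = 1\<^sub>m \<rho> $$ (t, u)" using tu by simp
  qed (use BC in auto)
  hence "det (B * (T ^\<^sub>m j) * C) \<noteq> 0" by simp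
  \<comment> \<open>Each of the \<open>k\<close> chains has at most \<open>j\<close> elements
    without a \<open>j\<close>-th successor.\<close>
  moreover have "greene (mset L) k \<le> \<rho> + k * j"
  proof -
    have "greene (mset L) k = card {p. p < ?r \<and> cl p < k}"
    proof -
      have "greene (mset L) k = length (filter (\<lambda>z. snd z < k) zs)"
        unfolding Z(3)[symmetric] zs(1)[symmetric] mset_filter[symmetric] size_mset ..
      also have "\<dots> = card {p. p < ?r \<and> cl p < k}" unfolding length_filter_conv_card len cl_def ..
      finally show ?thesis .
    qed
    also have "{p. p < ?r \<and> cl p < k} = (\<Union>c<k. S c)" by (auto simp: S_def)
    also have "card \<dots> = (\<Sum>c<k. card (S c))" by (rule card_UN_disjoint) (auto simp: S_def)
    also have "\<dots> \<le> (\<Sum>c<k. card (D \<inter> S c) + j)"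
    proof (rule sum_mono)
      fix c assume "c \<in> {..<k}"
      hence c: "c < k" by simp
      have "{..<card (S c) - j} \<subseteq> rk ` (D \<inter> S c)"
      proof
        fix x assume x: "x \<in> {..<card (S c) - j}"
        then obtain q where q: "q \<in> S c" "rk q = x" using bij[OF c] unfolding bij_betw_def by (metis imageE lessThan_iff less_imp_diff_less diff_le_self order_less_le_trans)
        hence "q \<in> D" using x c by (auto simp: D_def S_def)
        thus "x \<in> rk ` (D \<inter> S c)" using q by blast
      qed
      from surj_card_le[OF _ this] fD show "card (S c) \<le> card (D \<inter> S c) + j" by simp
    qed
    also have "\<dots> = (\<Sum>c<k. card (D \<inter> S c)) + k * j" by (simp add: sum.distrib)
    also have "(\<Sum>c<k. card (D \<inter> S c)) = card (\<Union>c<k. D \<inter> S c)"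
      by (rule card_UN_disjoint[symmetric]) (auto simp: S_def fD)
    also have "(\<Union>c<k. D \<inter> S c) = D" by (auto simp: D_def S_def)
    finally show ?thesis using qs(3) by simp
  qed
  ultimately show ?thesis using T BC by blast
qed

section \<open>Generic Jordan types\<close>

text \<open>Over a finite field, one plus the product of all linear factors takes the value 1
  everywhere and has no root.\<close>

lemma alg_closed_infinite:
  assumes "alg_closed TYPE('k::field)"
  shows "infinite (UNIV :: 'k set)"
proof
  assume fin: "finite (UNIV :: 'k set)"
  define p :: "'k poly" where "p = (\<Prod>a\<in>UNIV. [:- a, 1:])"
  have p1: "poly (p + 1) x = 1" for x using fin by (auto simp: p_def poly_prod)
  have "degree (p + 1) \<noteq> 0"
  proof
    assume "degree (p + 1) = 0"
    then obtain c where c: "p + 1 = [:c:]" by (meson degree_eq_zeroE)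
    have "p + 1 = 1" using p1[of 0] unfolding c by simp
    hence "p = 0" by simp
    thus False using fin by (simp add: p_def)
  qed
  hence "degree (p + 1) \<ge> 1" by simp
  then obtain x where "poly (p + 1) x = 0" using assms unfolding alg_closed_def by blast
  thus False using p1[of x] by simp
qed

section \<open>Polynomial functions, curves and generic properties\<close>

lemma poly_funs_sum: "(\<And>x. x \<in> S \<Longrightarrow> f x \<in> poly_funs d) \<Longrightarrow> (\<lambda>F. \<Sum>x\<in>S. f x F) \<in> poly_funs d"
proof (induction S rule: infinite_finite_induct)
  case (insert x S)
  have "(\<lambda>F. f x F + (\<Sum>x\<in>S. f x F)) \<in> poly_funs d" by (rule poly_funs.add) (use insert in auto)
  thus ?case using insert by simp
qed (auto intro: poly_funs.const)

lemma poly_funs_prod: "(\<And>x. x \<in> S \<Longrightarrow> f x \<in> poly_funs d) \<Longrightarrow> (\<lambda>F. \<Prod>x\<in>S. f x F) \<in> poly_funs d"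
proof (induction S rule: infinite_finite_induct)
  case (insert x S)
  have "(\<lambda>F. f x F * (\<Prod>x\<in>S. f x F)) \<in> poly_funs d" by (rule poly_funs.mult) (use insert in auto)
  thus ?case using insert by simp
qed (auto intro: poly_funs.const)

definition poly_mat_fun :: "(nat \<Rightarrow> nat) \<Rightarrow> nat \<Rightarrow> nat \<Rightarrow> ((nat \<Rightarrow> 'k::field mat) \<Rightarrow> 'k mat) \<Rightarrow> bool" where
  "poly_mat_fun d r c A \<longleftrightarrow> (\<forall>F. A F \<in> carrier_mat r c) \<and> (\<forall>p<r. \<forall>q<c. (\<lambda>F. A F $$ (p, q)) \<in> poly_funs d)"

lemma poly_mat_fun_const: "B \<in> carrier_mat r c \<Longrightarrow> poly_mat_fun d r c (\<lambda>F. B)"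
  by (simp add: poly_mat_fun_def poly_funs.const)

lemma poly_mat_fun_coord: "poly_mat_fun d (d i) (d i) (\<lambda>F. mat (d i) (d i) (\<lambda>pq. F i $$ pq))"
  by (simp add: poly_mat_fun_def poly_funs.coord)

lemma poly_mat_fun_mult:
  assumes A: "poly_mat_fun d r l A" and B: "poly_mat_fun d l c B"
  shows "poly_mat_fun d r c (\<lambda>F. A F * B F)"
proof -
  have c: "A F \<in> carrier_mat r l" "B F \<in> carrier_mat l c" for F using A B by (simp_all add: poly_mat_fun_def)
  have "(\<lambda>F. (A F * B F) $$ (p, q)) \<in> poly_funs d" if "p < r" "q < c" for p q
    unfolding mult_mat_index_sum[OF c that]
    by (rule poly_funs_sum, rule poly_funs.mult) (use A B that in \<open>auto simp: poly_mat_fun_def\<close>)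
  moreover have "A F * B F \<in> carrier_mat r c" for F using c[of F] by simp
  ultimately show ?thesis by (simp add: poly_mat_fun_def)
qed

lemma poly_mat_fun_pow:
  assumes A: "poly_mat_fun d r r A"
  shows "poly_mat_fun d r r (\<lambda>F. A F ^\<^sub>m k)"
proof (induction k)
  case 0
  have "dim_row (A F) = r" for F using A by (auto simp: poly_mat_fun_def)
  thus ?case by (simp add: poly_mat_fun_const)
next
  case (Suc k) thus ?case using poly_mat_fun_mult[OF Suc A] by simp
qed

lemma poly_mat_fun_det:
  assumes A: "poly_mat_fun d r r A"
  shows "(\<lambda>F. det (A F)) \<in> poly_funs d"
proof -
  have "det (A F) = (\<Sum>p\<in>{p. p permutes {0..<r}}. signof p * (\<Prod>i\<in>{0..<r}. A F $$ (i, p i)))" for F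
    using A by (intro det_def') (simp add: poly_mat_fun_def)
  moreover have "(\<lambda>F. \<Sum>p\<in>{p. p permutes {0..<r}}. signof p * (\<Prod>i\<in>{0..<r}. A F $$ (i, p i))) \<in> poly_funs d"
  proof (rule poly_funs_sum, rule poly_funs.mult[OF poly_funs.const], rule poly_funs_prod)
    fix p i assume "p \<in> {p. p permutes {0..<r}}" "i \<in> {0..<r}"
    thus "(\<lambda>F. A F $$ (i, p i)) \<in> poly_funs d" using A permutes_in_image[of p "{0..<r}" i] by (auto simp: poly_mat_fun_def)
  qed
  ultimately show ?thesis by presburger
qed

definition poly_curve :: "('k::field \<Rightarrow> 'k) \<Rightarrow> bool" where
  "poly_curve f \<longleftrightarrow> (\<exists>P. \<forall>t. f t = poly P t)"

lemma poly_curve_const: "poly_curve (\<lambda>t. c)"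
  unfolding poly_curve_def by (rule exI[of _ "[:c:]"]) simp

lemma poly_curve_id: "poly_curve (\<lambda>t. t)"
  unfolding poly_curve_def by (rule exI[of _ "[:0, 1:]"]) simp

lemma poly_curve_add: "poly_curve f \<Longrightarrow> poly_curve g \<Longrightarrow> poly_curve (\<lambda>t. f t + g t)"
  unfolding poly_curve_def by (metis poly_add)

lemma poly_curve_mult: "poly_curve f \<Longrightarrow> poly_curve g \<Longrightarrow> poly_curve (\<lambda>t. f t * g t)"
  unfolding poly_curve_def by (metis poly_mult)

lemma poly_curve_sum: "(\<And>x. x \<in> S \<Longrightarrow> poly_curve (f x)) \<Longrightarrow> poly_curve (\<lambda>t. \<Sum>x\<in>S. f x t)"
  by (induction S rule: infinite_finite_induct) (auto intro: poly_curve_const poly_curve_add)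

lemma poly_funs_curve:
  assumes "f \<in> poly_funs d" and "\<And>i p q. p < d i \<Longrightarrow> q < d i \<Longrightarrow> poly_curve (\<lambda>t. \<phi> t i $$ (p, q))"
  shows "poly_curve (\<lambda>t. f (\<phi> t))"
  using assms(1)
  by induction (auto intro: poly_curve_const poly_curve_add poly_curve_mult assms(2))

lemma zariski_open_Int:
  assumes "zariski_open_in d X U" "zariski_open_in d X V"
  shows "zariski_open_in d X (U \<inter> V)"
proof -
  obtain S where S: "S \<subseteq> poly_funs d" "U = {F \<in> X. \<exists>f \<in> S. f F \<noteq> 0}"
    using assms(1) unfolding zariski_open_in_def by blast
  obtain T where T: "T \<subseteq> poly_funs d" "V = {F \<in> X. \<exists>f \<in> T. f F \<noteq> 0}"
    using assms(2) unfolding zariski_open_in_def by blast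
  have "(\<lambda>(f, g) F. f F * g F) ` (S \<times> T) \<subseteq> poly_funs d" using S(1) T(1) by (auto intro: poly_funs.mult)
  moreover have "U \<inter> V = {F \<in> X. \<exists>f \<in> (\<lambda>(f, g) F. f F * g F) ` (S \<times> T). f F \<noteq> 0}" 
    unfolding S T by (auto simp: Bex_def)
  ultimately show ?thesis unfolding zariski_open_in_def by blast
qed

lemma zariski_open_self: "zariski_open_in d X X"
  unfolding zariski_open_in_def
  by (rule exI[of _ "{\<lambda>F. 1}"]) (auto intro: poly_funs.const)

lemma generically_True: "generically d X (\<lambda>F. True)"
proof -
  have "V \<subseteq> X" if "zariski_open_in d X V" for V using that unfolding zariski_open_in_def by blast
  thus ?thesis unfolding generically_def using zariski_open_self by (metis inf.absorb_iff2)
qed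

text \<open>Density of the intersection: a test set is first intersected with the second open set,
  and the result is a test set for the first.\<close>

lemma generically_conj:
  assumes "generically d X P" "generically d X Q"
  shows "generically d X (\<lambda>F. P F \<and> Q F)"
proof -
  obtain U where U: "zariski_open_in d X U" "\<And>W. zariski_open_in d X W \<Longrightarrow> W \<noteq> {} \<Longrightarrow> U \<inter> W \<noteq> {}" "\<forall>F\<in>U. P F"
    using assms(1) unfolding generically_def by blast
  obtain V where V: "zariski_open_in d X V" "\<And>W. zariski_open_in d X W \<Longrightarrow> W \<noteq> {} \<Longrightarrow> V \<inter> W \<noteq> {}" "\<forall>F\<in>V. Q F"
    using assms(2) unfolding generically_def by blast
  have "U \<inter> V \<inter> W \<noteq> {}" if W: "zariski_open_in d X W" "W \<noteq> {}" for W
    using U(2)[OF zariski_open_Int[OF V(1) W(1)] V(2)[OF W]] by (simp add: Int_assoc)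
  thus ?thesis unfolding generically_def using zariski_open_Int[OF U(1) V(1)] U(3) V(3) by blast
qed

lemma generically_Ball:
  assumes "finite S" "\<And>x. x \<in> S \<Longrightarrow> generically d X (P x)"
  shows "generically d X (\<lambda>F. \<forall>x\<in>S. P x F)"
  using assms
proof (induction S)
  case (insert x S)
  have "generically d X (\<lambda>F. P x F \<and> (\<forall>x\<in>S. P x F))" by (rule generically_conj) (use insert in auto)
  thus ?case by simp
qed (simp add: generically_True)

lemma generically_mono:
  assumes "generically d X P" "\<And>F. F \<in> X \<Longrightarrow> P F \<Longrightarrow> Q F"
  shows "generically d X Q"
proof -
  obtain U where U: "zariski_open_in d X U" "\<forall>V. zariski_open_in d X V \<and> V \<noteq> {} \<longrightarrow> U \<inter> V \<noteq> {}" "\<forall>F\<in>U. P F"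
    using assms(1) unfolding generically_def by blast
  have "U \<subseteq> X" using U(1) unfolding zariski_open_in_def by blast
  thus ?thesis unfolding generically_def using U assms(2) by (metis subsetD)
qed

lemma generically_ex:
  assumes "generically d X P" "X \<noteq> {}"
  shows "\<exists>F\<in>X. P F"
proof -
  obtain U where U: "\<forall>V. zariski_open_in d X V \<and> V \<noteq> {} \<longrightarrow> U \<inter> V \<noteq> {}" "\<forall>F\<in>U. P F"
    using assms(1) unfolding generically_def by blast
  have "U \<inter> X \<noteq> {}" using U(1) zariski_open_self assms(2) by blast
  thus ?thesis using U(2) by blast
qed

text \<open>Every point is joined by a polynomial curve to a point where some function of the family is
  nonzero; a product of two nonzero polynomials on the curve does not vanish identically.\<close>

lemma generically_nonvanishing:
  fixes X :: "(nat \<Rightarrow> 'k::field mat) set"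
  assumes inf: "infinite (UNIV :: 'k set)" and S: "S \<subseteq> poly_funs d"
    and curve: "\<And>F. F \<in> X \<Longrightarrow> \<exists>\<phi>. \<phi> 0 = F \<and> (\<forall>t. \<phi> t \<in> X) \<and>
      (\<forall>i p q. p < d i \<longrightarrow> q < d i \<longrightarrow> poly_curve (\<lambda>t. \<phi> t i $$ (p, q))) \<and> (\<exists>f\<in>S. f (\<phi> 1) \<noteq> 0)"
  shows "generically d X (\<lambda>F. \<exists>f\<in>S. f F \<noteq> 0)"
proof -
  define U where "U = {F \<in> X. \<exists>f\<in>S. f F \<noteq> 0}"
  have "zariski_open_in d X U" unfolding zariski_open_in_def U_def using S by blast
  moreover have "U \<inter> V \<noteq> {}" if V: "zariski_open_in d X V" "V \<noteq> {}" for V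
  proof -
    obtain T where T: "T \<subseteq> poly_funs d" "V = {F \<in> X. \<exists>f\<in>T. f F \<noteq> 0}" using V(1) unfolding zariski_open_in_def by blast
    then obtain F g where F: "F \<in> X" "g \<in> T" "g F \<noteq> 0" using V(2) by blast
    obtain \<phi> f where \<phi>: "\<phi> 0 = F" "\<And>t. \<phi> t \<in> X" "\<And>i p q. p < d i \<Longrightarrow> q < d i \<Longrightarrow> poly_curve (\<lambda>t. \<phi> t i $$ (p, q))"
      and f: "f \<in> S" "f (\<phi> 1) \<noteq> 0" using curve[OF F(1)] by blast
    obtain P where P: "\<And>t. f (\<phi> t) = poly P t"
      using poly_funs_curve[of f d \<phi>] S f(1) \<phi>(3) unfolding poly_curve_def by blast
    obtain R where R: "\<And>t. g (\<phi> t) = poly R t"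
      using poly_funs_curve[of g d \<phi>] T(1) F(2) \<phi>(3) unfolding poly_curve_def by blast
    have "P \<noteq> 0" using f(2) P by fastforce
    moreover have "R \<noteq> 0" using F(3) R \<phi>(1) by fastforce
    ultimately have "finite {t. poly (P * R) t = 0}" by (intro poly_roots_finite) simp
    hence "{t. poly (P * R) t = 0} \<noteq> UNIV" using inf by metis
    then obtain t where "poly (P * R) t \<noteq> 0" by blast
    hence "f (\<phi> t) \<noteq> 0" "g (\<phi> t) \<noteq> 0" using P R by simp_all
    hence "\<phi> t \<in> U \<inter> V" unfolding U_def T(2) using f(1) F(2) \<phi>(2) by blast
    thus ?thesis by blast
  qed
  ultimately show ?thesis unfolding generically_def by (intro exI[of _ U]) (auto simp: U_def)
qed

section \<open>Endomorphisms of the representation as single matrices\<close>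

definition pos :: "nat list \<Rightarrow> nat \<Rightarrow> nat" where
  "pos ix P = (THE u. u < length ix \<and> ix ! u = P)"

text \<open>Entries are addressed by global summand numbers instead of positions at one vertex, so
  that matrices at different vertices can be compared.\<close>

definition ent :: "nat list \<Rightarrow> 'a mat \<Rightarrow> nat \<Rightarrow> nat \<Rightarrow> 'a" where
  "ent ix X P Q = X $$ (pos ix P, pos ix Q)"

lemma pos_nth: "distinct ix \<Longrightarrow> u < length ix \<Longrightarrow> pos ix (ix ! u) = u"
  unfolding pos_def by (rule the_equality) (auto simp: nth_eq_iff_index_eq)

lemma pos_mem:
  assumes "distinct ix" "P \<in> set ix"
  shows "pos ix P < length ix" "ix ! pos ix P = P"
  using assms pos_nth by (metis in_set_conv_nth)+

lemma ent_nth: "distinct ix \<Longrightarrow> u < length ix \<Longrightarrow> v < length ix \<Longrightarrow> ent ix X (ix ! u) (ix ! v) = X $$ (u, v)"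
  by (simp add: ent_def pos_nth)

lemma ent_submat: "distinct ix \<Longrightarrow> P \<in> set ix \<Longrightarrow> Q \<in> set ix \<Longrightarrow> ent ix (submat A ix) P Q = A $$ (P, Q)"
  by (simp add: ent_def pos_mem)

lemma mem_idx: "p \<in> set (idx L i) \<longleftrightarrow> p < length L \<and> fst (L ! p) \<le> i \<and> i \<le> snd (L ! p)"
  by (auto simp: idx_def)

lemma idx_distinct: "distinct (idx L i)"
  by (simp add: idx_def)

lemma idx_nth: "u < length (idx L i) \<Longrightarrow> idx L i ! u \<in> set (idx L i)"
  by simp

lemma idx_convex: "convex_index L (idx L i)"
  unfolding convex_index_def by (auto simp: mem_idx idx_distinct pair_le_def)

lemma mset_idx: "mset (map ((!) L) (idx L i)) = lev (mset L) i"
proof -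
  have "map ((!) L) (idx L i) = filter (\<lambda>x. fst x \<le> i \<and> i \<le> snd x) (map ((!) L) [0..<length L])"
    unfolding idx_def filter_map comp_def ..
  thus ?thesis unfolding lev_def by (simp add: map_nth)
qed

lemma mult_arrow_ent:
  fixes F :: "'a::field mat"
  assumes F: "F \<in> carrier_mat (dimv L i) (dimv L i)" and P: "P \<in> set (idx L i)" and Q: "Q \<in> set (idx L (Suc i))"
  shows "(F * arrow_mat L i) $$ (pos (idx L i) P, pos (idx L (Suc i)) Q) = (if Q \<in> set (idx L i) then ent (idx L i) F P Q else 0)"
proof -
  let ?p = "pos (idx L i) P" and ?q = "pos (idx L (Suc i)) Q"
  have p: "?p < dimv L i" "?q < dimv L (Suc i)" "idx L (Suc i) ! ?q = Q"
    using pos_mem[OF idx_distinct P] pos_mem[OF idx_distinct Q] by (simp_all add: dimv_def)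
  have "(F * arrow_mat L i) $$ (?p, ?q) = (\<Sum>u<dimv L i. F $$ (?p, u) * arrow_mat L i $$ (u, ?q))"
    by (rule mult_mat_index_sum[OF F _ p(1,2)]) (simp add: arrow_mat_def)
  also have "\<dots> = (\<Sum>u<dimv L i. if idx L i ! u = Q then F $$ (?p, u) else 0)"
    by (intro sum.cong) (use p in \<open>auto simp: arrow_mat_def\<close>)
  also have "\<dots> = (if Q \<in> set (idx L i) then ent (idx L i) F P Q else 0)"
  proof (cases "Q \<in> set (idx L i)")
    case True
    have "idx L i ! u = Q \<longleftrightarrow> u = pos (idx L i) Q" if "u < dimv L i" for u
      using pos_nth[OF idx_distinct] pos_mem(2)[OF idx_distinct True] that by (auto simp: dimv_def)
    hence "(\<Sum>u<dimv L i. if idx L i ! u = Q then F $$ (?p, u) else 0)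
        = (\<Sum>u<dimv L i. if u = pos (idx L i) Q then F $$ (?p, u) else 0)" by (intro sum.cong) auto
    also have "\<dots> = ent (idx L i) F P Q" using pos_mem(1)[OF idx_distinct True] by (simp add: ent_def dimv_def)
    finally show ?thesis using True by simp
  next
    case False
    hence "idx L i ! u \<noteq> Q" if "u < dimv L i" for u using that idx_nth by (auto simp: dimv_def)
    thus ?thesis using False by simp
  qed
  finally show ?thesis .
qed

lemma arrow_mult_ent:
  fixes G :: "'a::field mat"
  assumes G: "G \<in> carrier_mat (dimv L (Suc i)) (dimv L (Suc i))" and P: "P \<in> set (idx L i)" and Q: "Q \<in> set (idx L (Suc i))"
  shows "(arrow_mat L i * G) $$ (pos (idx L i) P, pos (idx L (Suc i)) Q) = (if P \<in> set (idx L (Suc i)) then ent (idx L (Suc i)) G P Q else 0)"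
proof -
  let ?p = "pos (idx L i) P" and ?q = "pos (idx L (Suc i)) Q" and ?J = "idx L (Suc i)"
  have p: "?p < dimv L i" "?q < dimv L (Suc i)" "idx L i ! ?p = P"
    using pos_mem[OF idx_distinct P] pos_mem[OF idx_distinct Q] by (simp_all add: dimv_def)
  have "(arrow_mat L i * G) $$ (?p, ?q) = (\<Sum>u<dimv L (Suc i). arrow_mat L i $$ (?p, u) * G $$ (u, ?q))"
    by (rule mult_mat_index_sum[OF _ G p(1,2)]) (simp add: arrow_mat_def)
  also have "\<dots> = (\<Sum>u<dimv L (Suc i). if ?J ! u = P then G $$ (u, ?q) else 0)"
    by (intro sum.cong) (use p in \<open>auto simp: arrow_mat_def\<close>)
  also have "\<dots> = (if P \<in> set ?J then ent ?J G P Q else 0)"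
  proof (cases "P \<in> set ?J")
    case True
    have "?J ! u = P \<longleftrightarrow> u = pos ?J P" if "u < dimv L (Suc i)" for u
      using pos_nth[OF idx_distinct] pos_mem(2)[OF idx_distinct True] that by (auto simp: dimv_def)
    hence "(\<Sum>u<dimv L (Suc i). if ?J ! u = P then G $$ (u, ?q) else 0)
        = (\<Sum>u<dimv L (Suc i). if u = pos ?J P then G $$ (u, ?q) else 0)" by (intro sum.cong) auto
    also have "\<dots> = ent ?J G P Q" using pos_mem(1)[OF idx_distinct True] by (simp add: ent_def dimv_def)
    finally show ?thesis using True by simp
  next
    case False
    hence "?J ! u \<noteq> P" if "u < dimv L (Suc i)" for u using that idx_nth by (auto simp: dimv_def)
    thus ?thesis using False by simp
  qed
  finally show ?thesis .
qed

text \<open>Commutation with an arrow, entry by entry: the arrow is a partial identity, and an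
  absent summand contributes zero on its side.\<close>

lemma nil_endos_ent:
  assumes F: "F \<in> nil_endos n L" and i: "1 \<le> i" "i < n" and P: "P \<in> set (idx L i)" and Q: "Q \<in> set (idx L (Suc i))"
  shows "(if Q \<in> set (idx L i) then ent (idx L i) (F i) P Q else 0)
    = (if P \<in> set (idx L (Suc i)) then ent (idx L (Suc i)) (F (Suc i)) P Q else 0)"
proof -
  have c: "F j \<in> carrier_mat (dimv L j) (dimv L j)" for j using F by (simp add: nil_endos_def)
  have "F i * arrow_mat L i = arrow_mat L i * F (Suc i)" using F i by (simp add: nil_endos_def)
  thus ?thesis using mult_arrow_ent[OF c P Q] arrow_mult_ent[OF c P Q] by metis
qed

definition restr_endo :: "(nat \<times> nat) list \<Rightarrow> 'a mat \<Rightarrow> nat \<Rightarrow> 'a mat" where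
  "restr_endo L A i = submat A (idx L i)"

lemma restr_nil_endos:
  fixes A :: "'a::field mat"
  assumes A: "A \<in> carrier_mat (length L) (length L)" and s: "weak_supp L A" and nil: "A ^\<^sub>m e = 0\<^sub>m (length L) (length L)"
  shows "restr_endo L A \<in> nil_endos n L"
proof -
  have c: "restr_endo L A i \<in> carrier_mat (dimv L i) (dimv L i)" for i by (simp add: restr_endo_def dimv_def)
  have "restr_endo L A i ^\<^sub>m e = 0\<^sub>m (dimv L i) (dimv L i)" for i
    unfolding restr_endo_def dimv_def submat_pow[OF A s idx_convex, symmetric] nil by (rule submat_zero[OF idx_convex])
  moreover have "restr_endo L A i * arrow_mat L i = arrow_mat L i * restr_endo L A (Suc i)" for i
  proof (rule eq_matI)
    fix u v assume "u < dim_row (arrow_mat L i * restr_endo L A (Suc i))" "v < dim_col (arrow_mat L i * restr_endo L A (Suc i))"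
    hence uv: "u < dimv L i" "v < dimv L (Suc i)" using c[of "Suc i"] by (simp_all add: arrow_mat_def)
    define P where "P = idx L i ! u"
    define Q where "Q = idx L (Suc i) ! v"
    have PQ: "P \<in> set (idx L i)" "Q \<in> set (idx L (Suc i))" using uv by (simp_all add: P_def Q_def dimv_def)
    have p: "pos (idx L i) P = u" "pos (idx L (Suc i)) Q = v"
      using pos_nth[OF idx_distinct] uv by (simp_all add: P_def Q_def dimv_def)
    have "Q \<in> set (idx L i)" "P \<in> set (idx L (Suc i))" if "A $$ (P, Q) \<noteq> 0"
    proof -
      have "pair_le (L ! Q) (L ! P)" using s that PQ unfolding weak_supp_def mem_idx by blast
      thus "Q \<in> set (idx L i)" "P \<in> set (idx L (Suc i))" using PQ unfolding mem_idx pair_le_def by auto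
    qed
    moreover have "ent (idx L i) (restr_endo L A i) P Q = A $$ (P, Q)" if "Q \<in> set (idx L i)"
      unfolding restr_endo_def by (rule ent_submat[OF idx_distinct PQ(1) that])
    moreover have "ent (idx L (Suc i)) (restr_endo L A (Suc i)) P Q = A $$ (P, Q)" if "P \<in> set (idx L (Suc i))"
      unfolding restr_endo_def by (rule ent_submat[OF idx_distinct that PQ(2)])
    ultimately show "(restr_endo L A i * arrow_mat L i) $$ (u, v) = (arrow_mat L i * restr_endo L A (Suc i)) $$ (u, v)"
      using mult_arrow_ent[OF c PQ] arrow_mult_ent[OF c PQ] unfolding p by auto
  qed (auto simp: arrow_mat_def restr_endo_def dimv_def)
  ultimately show ?thesis using c unfolding nil_endos_def by blast
qed

text \<open>All summands are present at \<open>m\<close>, so the matrix there is the whole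
  endomorphism; commutation with the arrows carries its entries to the other vertices, and the ends
  of the supports force zeros outside the order.\<close>

lemma nil_endos_restr:
  fixes F :: "nat \<Rightarrow> 'a::field mat"
  assumes F: "F \<in> nil_endos n L" and L: "\<forall>x\<in>set L. x \<in> PQ n m" and m: "1 \<le> m" "m \<le> n"
  obtains A e where "A \<in> carrier_mat (length L) (length L)" "weak_supp L A" "A ^\<^sub>m e = 0\<^sub>m (length L) (length L)" "F = restr_endo L A"
proof -
  let ?r = "length L"
  have Lp: "1 \<le> fst (L ! p)" "fst (L ! p) \<le> m" "m \<le> snd (L ! p)" "snd (L ! p) \<le> n" if "p < ?r" for p
    using L nth_mem[OF that] by (simp_all add: mem_PQ_iff)
  have c: "F j \<in> carrier_mat (dimv L j) (dimv L j)" for j using F by (simp add: nil_endos_def)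
  obtain e where nil: "\<And>i. F i ^\<^sub>m e = 0\<^sub>m (dimv L i) (dimv L i)" using F by (auto simp: nil_endos_def)
  have im: "idx L m = [0..<?r]" unfolding idx_def using Lp by (simp add: filter_id_conv)
  have dm: "dimv L m = ?r" by (simp add: dimv_def im)
  define A where "A = F m"
  have Am: "ent (idx L m) (F m) P Q = A $$ (P, Q)" if "P < ?r" "Q < ?r" for P Q
    using ent_nth[OF idx_distinct, of P L m Q "F m"] that unfolding im A_def by simp
  have up: "\<forall>P\<in>set (idx L i). \<forall>Q\<in>set (idx L i). ent (idx L i) (F i) P Q = A $$ (P, Q)" if "m \<le> i" "i \<le> n" for i
    using that
  proof (induction i rule: dec_induct)
    case base thus ?case using Am by (simp add: im)
  next
    case (step i)
    show ?case
    proof (intro ballI)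
      fix P Q assume PQ: "P \<in> set (idx L (Suc i))" "Q \<in> set (idx L (Suc i))"
      hence "P \<in> set (idx L i)" "Q \<in> set (idx L i)" using step(1) Lp(2) by (force simp: mem_idx)+
      thus "ent (idx L (Suc i)) (F (Suc i)) P Q = A $$ (P, Q)"
        using nil_endos_ent[OF F _ _ \<open>P \<in> set (idx L i)\<close> PQ(2)] step m PQ by simp
    qed
  qed
  have down: "\<forall>P\<in>set (idx L i). \<forall>Q\<in>set (idx L i). ent (idx L i) (F i) P Q = A $$ (P, Q)" if "i \<le> m" "1 \<le> i" for i
    using that
  proof (induction i rule: inc_induct)
    case base thus ?case using Am by (simp add: im)
  next
    case (step i)
    show ?case
    proof (intro ballI)
      fix P Q assume PQ: "P \<in> set (idx L i)" "Q \<in> set (idx L i)"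
      hence PQ': "P \<in> set (idx L (Suc i))" "Q \<in> set (idx L (Suc i))" using step(2) Lp(3) by (force simp: mem_idx)+
      thus "ent (idx L i) (F i) P Q = A $$ (P, Q)"
        using nil_endos_ent[OF F _ _ PQ(1) PQ'(2)] step m PQ by simp
    qed
  qed
  have ent: "ent (idx L i) (F i) P Q = A $$ (P, Q)" if "1 \<le> i" "i \<le> n" "P \<in> set (idx L i)" "Q \<in> set (idx L i)" for i P Q
    using up[of i] down[of i] that by (cases "m \<le> i") auto
  have supp: "weak_supp L A" unfolding weak_supp_def pair_le_def
  proof (intro allI impI)
    fix P Q assume PQ: "P < ?r" "Q < ?r" "A $$ (P, Q) \<noteq> 0"
    have "fst (L ! Q) \<le> fst (L ! P)"
    proof (rule ccontr)
      assume lt: "\<not> ?thesis"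
      \<comment> \<open>The last vertex before the support of \<open>Q\<close>, where
        \<open>P\<close> is already present: the arrow relation there forces the entry to
        vanish.\<close>
      define i where "i = fst (L ! Q) - 1"
      have i: "1 \<le> i" "i < n" "P \<in> set (idx L i)" "P \<in> set (idx L (Suc i))" "Q \<in> set (idx L (Suc i))" "Q \<notin> set (idx L i)"
        using lt Lp[OF PQ(1)] Lp[OF PQ(2)] PQ m by (auto simp: i_def mem_idx)
      show False using nil_endos_ent[OF F i(1,2,3,5)] ent[of "Suc i" P Q] i PQ(3) by simp
    qed
    moreover have "snd (L ! Q) \<le> snd (L ! P)"
    proof (rule ccontr)
      assume lt: "\<not> ?thesis"
      \<comment> \<open>The last vertex of \<open>P\<close>, beyond which \<open>Q\<close>
        continues: again the arrow relation forces zero.\<close>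
      define i where "i = snd (L ! P)"
      have i: "1 \<le> i" "i < n" "P \<in> set (idx L i)" "P \<notin> set (idx L (Suc i))" "Q \<in> set (idx L (Suc i))" "Q \<in> set (idx L i)"
        using lt Lp[OF PQ(1)] Lp[OF PQ(2)] PQ m by (auto simp: i_def mem_idx)
      show False using nil_endos_ent[OF F i(1,2,3,5)] ent[of i P Q] i PQ(3) by simp
    qed
    ultimately show "fst (L ! Q) \<le> fst (L ! P) \<and> snd (L ! Q) \<le> snd (L ! P)" by simp
  qed
  have "F i = restr_endo L A i" for i
  proof (rule eq_matI)
    fix u v assume "u < dim_row (restr_endo L A i)" "v < dim_col (restr_endo L A i)"
    hence uv: "u < length (idx L i)" "v < length (idx L i)" by (simp_all add: restr_endo_def)
    have u: "idx L i ! u \<in> set (idx L i)" using uv by simp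
    have "1 \<le> i" "i \<le> n" using u Lp[of "idx L i ! u"] unfolding mem_idx by linarith+
    with u show "F i $$ (u, v) = restr_endo L A i $$ (u, v)"
      using ent[of i "idx L i ! u" "idx L i ! v"] uv ent_nth[OF idx_distinct uv, of "F i"] by (simp add: restr_endo_def)
  qed (use c[of i] in \<open>auto simp: restr_endo_def dimv_def\<close>)
  hence "F = restr_endo L A" by blast
  moreover have "A \<in> carrier_mat ?r ?r" "A ^\<^sub>m e = 0\<^sub>m ?r ?r" using c[of m] nil[of m] unfolding dm A_def by simp_all
  ultimately show ?thesis using that supp by blast
qed

lemma strict_conj_nilpotent:
  fixes T :: "'a::field mat"
  assumes g: "g \<in> carrier_mat (length L) (length L)" and h: "h \<in> carrier_mat (length L) (length L)"
    and T: "T \<in> carrier_mat (length L) (length L)" and gh: "g * h = 1\<^sub>m (length L)" and hg: "h * g = 1\<^sub>m (length L)"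
    and ge: "eq_supp L g" and he: "eq_supp L h" and s: "strict_supp L ht T"
  shows "g * T * h \<in> carrier_mat (length L) (length L)" "weak_supp L (g * T * h)"
    "\<exists>e. (g * T * h) ^\<^sub>m e = 0\<^sub>m (length L) (length L)"
proof -
  let ?r = "length L"
  show A: "g * T * h \<in> carrier_mat ?r ?r" using g T h by simp
  have "g * T \<in> carrier_mat ?r ?r" using g T by simp
  thus "weak_supp L (g * T * h)"
    using weak_supp_mult[OF _ h weak_supp_mult[OF g T]] eq_supp_weak[OF ge] eq_supp_weak[OF he] strict_supp_weak[OF s] by blast
  obtain e where e: "T ^\<^sub>m e = 0\<^sub>m ?r ?r" using strict_supp_nilpotent[OF T s] by blast
  have "similar_mat_wit (g * T * h) T g h" using g h T A gh hg by (simp add: similar_mat_wit_def Let_def)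
  from similar_mat_wit_pow_id[OF this, of e] have "(g * T * h) ^\<^sub>m e = g * 0\<^sub>m ?r ?r * h" unfolding e .
  also have "\<dots> = 0\<^sub>m ?r ?r" using g h by simp
  finally show "\<exists>e. (g * T * h) ^\<^sub>m e = 0\<^sub>m ?r ?r" by blast
qed

lemma conj_cancel:
  fixes B :: "'a::field mat"
  assumes B: "B \<in> carrier_mat \<rho> d" and C: "C \<in> carrier_mat d \<rho>" and X: "X \<in> carrier_mat d d"
    and g: "g \<in> carrier_mat d d" and h: "h \<in> carrier_mat d d" and hg: "h * g = 1\<^sub>m d"
  shows "B * h * (g * X * h) * (g * C) = B * X * C"
proof -
  have XC: "X * C \<in> carrier_mat d \<rho>" and gC: "g * C \<in> carrier_mat d \<rho>" and gX: "g * X \<in> carrier_mat d d"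
    and Bh: "B * h \<in> carrier_mat \<rho> d" and gXh: "g * X * h \<in> carrier_mat d d" using B C X g h by simp_all
  have "B * h * (g * X * h) * (g * C) = B * h * (g * X * h * (g * C))" by (rule assoc_mult_mat[OF Bh gXh gC])
  also have "g * X * h * (g * C) = g * X * (h * (g * C))" by (rule assoc_mult_mat[OF gX h gC])
  also have "h * (g * C) = h * g * C" by (rule assoc_mult_mat[OF h g C, symmetric])
  also have "\<dots> = C" using hg C by simp
  also have "g * X * C = g * (X * C)" by (rule assoc_mult_mat[OF g X C])
  also have "B * h * (g * (X * C)) = B * (h * (g * (X * C)))"
    by (rule assoc_mult_mat[OF B h mult_carrier_mat[OF g XC]])
  also have "h * (g * (X * C)) = h * g * (X * C)" by (rule assoc_mult_mat[OF h g XC, symmetric])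
  also have "\<dots> = X * C" unfolding hg by (rule left_mult_one_mat[OF XC])
  also have "B * (X * C) = B * X * C" by (rule assoc_mult_mat[OF B X C, symmetric])
  finally show ?thesis .
qed

text \<open>A rank bound is the nonvanishing of some member of a family of determinants that are
  polynomial in the endomorphism. The curve needed for density ends at a conjugate of the chain
  shift for vertex \<open>i\<close>, whose minor is known.\<close>

lemma generic_minor:
  fixes L :: "(nat \<times> nat) list"
  assumes inf: "infinite (UNIV :: 'k::field set)" and L: "\<forall>x\<in>set L. x \<in> PQ n m" and m: "1 \<le> m" "m \<le> n"
  shows "generically (dimv L) (nil_endos n L :: (nat \<Rightarrow> 'k mat) set)
    (\<lambda>F. \<exists>\<rho> B C. greene (lev (mset L) i) k \<le> \<rho> + k * j \<and> B \<in> carrier_mat \<rho> (dimv L i) \<and>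
      C \<in> carrier_mat (dimv L i) \<rho> \<and> det (B * (F i ^\<^sub>m j) * C) \<noteq> 0)"
proof -
  let ?d = "dimv L i" and ?X = "nil_endos n L :: (nat \<Rightarrow> 'k mat) set" and ?r = "length L" and ?ix = "idx L i"
  \<comment> \<open>Rebuilding the matrix fixes its dimensions for arguments outside
    \<open>?X\<close> as well, where the determinants still have to be polynomial functions.\<close>
  define at_i :: "(nat \<Rightarrow> 'k mat) \<Rightarrow> 'k mat" where "at_i F = mat ?d ?d (\<lambda>pq. F i $$ pq)" for F
  define S where "S = {(\<lambda>F. det (B * (at_i F ^\<^sub>m j) * C)) | \<rho> B C.
    greene (lev (mset L) i) k \<le> \<rho> + k * j \<and> B \<in> carrier_mat \<rho> ?d \<and> C \<in> carrier_mat ?d \<rho>}"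
  have at_i: "at_i F = F i" if "F \<in> ?X" for F
  proof -
    have "F i \<in> carrier_mat ?d ?d" using that by (simp add: nil_endos_def)
    thus ?thesis unfolding at_i_def by (intro eq_matI) auto
  qed
  have S: "S \<subseteq> poly_funs (dimv L)"
  proof
    fix f assume "f \<in> S"
    then obtain \<rho> B C where f: "f = (\<lambda>F. det (B * (at_i F ^\<^sub>m j) * C))" and B: "B \<in> carrier_mat \<rho> ?d" and C: "C \<in> carrier_mat ?d \<rho>"
      unfolding S_def by blast
    have "poly_mat_fun (dimv L) ?d ?d at_i" using poly_mat_fun_coord[of "dimv L" i] unfolding at_i_def .
    note poly_mat_fun_mult[OF poly_mat_fun_mult[OF poly_mat_fun_const[OF B] poly_mat_fun_pow[OF this]] poly_mat_fun_const[OF C]]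
    from poly_mat_fun_det[OF this] show "f \<in> poly_funs (dimv L)" unfolding f .
  qed
  have "generically (dimv L) ?X (\<lambda>F. \<exists>f\<in>S. f F \<noteq> 0)"
  proof (rule generically_nonvanishing[OF inf S])
    fix F assume "F \<in> ?X"
    then obtain A e where A: "A \<in> carrier_mat ?r ?r" "weak_supp L A" "A ^\<^sub>m e = 0\<^sub>m ?r ?r" and FA: "F = restr_endo L A"
      by (rule nil_endos_restr[OF _ L m])
    obtain g h T0 where g: "g \<in> carrier_mat ?r ?r" and h: "h \<in> carrier_mat ?r ?r" and T0: "T0 \<in> carrier_mat ?r ?r"
      and gh: "g * h = 1\<^sub>m ?r" and hg: "h * g = 1\<^sub>m ?r" and AT: "A = g * T0 * h"
      and ge: "eq_supp L g" and he: "eq_supp L h" and s0: "strict_supp L (height L) T0"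
      by (rule nilpotent_conj_strict[OF A])
    define Li where "Li = map ((!) L) ?ix"
    have lenLi: "length Li = ?d" by (simp add: Li_def dimv_def)
    have Lin: "Li ! u = L ! (?ix ! u)" if "u < ?d" for u using that by (simp add: Li_def dimv_def)
    have ixL: "?ix ! u < ?r" if "u < ?d" for u using convex_indexD(3)[OF idx_convex] that by (simp add: dimv_def)
    have "\<exists>(T :: 'k mat) \<in> carrier_mat (length Li) (length Li). strict_supp Li (\<lambda>u. height L (?ix ! u)) T \<and>
      (\<exists>\<rho> B C. greene (mset Li) k \<le> \<rho> + k * j \<and> B \<in> carrier_mat \<rho> (length Li) \<and> C \<in> carrier_mat (length Li) \<rho> \<and>
       det (B * (T ^\<^sub>m j) * C) \<noteq> 0)"
    proof (rule chain_shift_matrix)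
      fix p q assume pq: "p < length Li" "q < length Li"
      { assume "pair_le (Li ! p) (Li ! q)" "Li ! p \<noteq> Li ! q"
        thus "height L (?ix ! p) < height L (?ix ! q)" using height_less pq Lin unfolding lenLi by metis }
      { assume eq: "Li ! p = Li ! q" "p \<noteq> q"
        have "?ix ! p \<noteq> ?ix ! q" using eq(2) pq idx_distinct[of L i] unfolding lenLi by (simp add: dimv_def nth_eq_iff_index_eq)
        thus "height L (?ix ! p) \<noteq> height L (?ix ! q)"
          using height_inj[of "?ix ! p" L "?ix ! q"] ixL pq Lin eq(1) unfolding lenLi by metis }
    qed
    moreover have "mset Li = lev (mset L) i" unfolding Li_def by (rule mset_idx)
    ultimately obtain Ti :: "'k mat" and \<rho> B C where Ti: "Ti \<in> carrier_mat ?d ?d" and si: "strict_supp Li (\<lambda>u. height L (?ix ! u)) Ti"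
      and \<rho>: "greene (lev (mset L) i) k \<le> \<rho> + k * j" and B: "B \<in> carrier_mat \<rho> ?d" and C: "C \<in> carrier_mat ?d \<rho>"
      and nz: "det (B * (Ti ^\<^sub>m j) * C) \<noteq> 0" unfolding lenLi by metis
    \<comment> \<open>The shift found at vertex \<open>i\<close>, extended by zero to all
      summands.\<close>
    define T1 where "T1 = mat ?r ?r (\<lambda>(p, q). if p \<in> set ?ix \<and> q \<in> set ?ix then ent ?ix Ti p q else 0)"
    have T1: "T1 \<in> carrier_mat ?r ?r" by (simp add: T1_def)
    have s1: "strict_supp L (height L) T1" unfolding strict_supp_def
    proof (intro allI impI)
      fix p q assume pq: "p < ?r" "q < ?r" "T1 $$ (p, q) \<noteq> 0"
      hence in': "p \<in> set ?ix" "q \<in> set ?ix" and "ent ?ix Ti p q \<noteq> 0" by (auto simp: T1_def split: if_splits)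
      moreover note P = pos_mem[OF idx_distinct in'(1)] and Q = pos_mem[OF idx_distinct in'(2)]
      ultimately have "pair_le (Li ! pos ?ix q) (Li ! pos ?ix p) \<and> height L (?ix ! pos ?ix q) < height L (?ix ! pos ?ix p)"
        using si unfolding strict_supp_def lenLi dimv_def ent_def by blast
      thus "pair_le (L ! q) (L ! p) \<and> height L q < height L p" using P Q Lin by (simp add: dimv_def)
    qed
    have T1i: "submat T1 ?ix = Ti"
      by (rule eq_matI) (use Ti ixL in \<open>auto simp: T1_def dimv_def ent_nth[OF idx_distinct]\<close>)
    \<comment> \<open>Strict support with respect to one height is a linear condition, so the whole
      line consists of nilpotent matrices.\<close>
    define T where "T t = mat ?r ?r (\<lambda>pq. T0 $$ pq + t * (T1 $$ pq - T0 $$ pq))" for t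
    have T: "T t \<in> carrier_mat ?r ?r" for t by (simp add: T_def)
    have s: "strict_supp L (height L) (T t)" for t unfolding strict_supp_def
    proof (intro allI impI)
      fix p q assume pq: "p < ?r" "q < ?r" "T t $$ (p, q) \<noteq> 0"
      hence "T0 $$ (p, q) \<noteq> 0 \<or> T1 $$ (p, q) \<noteq> 0" by (auto simp: T_def)
      thus "pair_le (L ! q) (L ! p) \<and> height L q < height L p" using s0 s1 pq unfolding strict_supp_def by blast
    qed
    have T01: "T 0 = T0" "T 1 = T1" by (rule eq_matI; use T0 T1 in \<open>auto simp: T_def\<close>)+
    define \<phi> where "\<phi> t = restr_endo L (g * T t * h)" for t
    note conj = strict_conj_nilpotent[OF g h T gh hg ge he s]
    have \<phi>0: "\<phi> 0 = F" unfolding \<phi>_def T01 FA AT ..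
    have X: "\<phi> t \<in> ?X" for t unfolding \<phi>_def using conj(3)[of t] restr_nil_endos[OF conj(1,2)] by blast
    have pc: "poly_curve (\<lambda>t. \<phi> t i' $$ (p, q))" if pq: "p < dimv L i'" "q < dimv L i'" for i' p q
    proof -
      let ?P = "idx L i' ! p" and ?Q = "idx L i' ! q"
      have PQ: "?P < ?r" "?Q < ?r" using convex_indexD(3)[OF idx_convex] pq by (simp_all add: dimv_def)
      have gT: "g * T t \<in> carrier_mat ?r ?r" for t using g T[of t] by simp
      have "\<phi> t i' $$ (p, q) = (\<Sum>x<?r. (\<Sum>y<?r. g $$ (?P, y) * (T0 $$ (y, x) + t * (T1 $$ (y, x) - T0 $$ (y, x)))) * h $$ (x, ?Q))" for t
      proof -
        have "\<phi> t i' $$ (p, q) = (g * T t * h) $$ (?P, ?Q)" using pq by (simp add: \<phi>_def restr_endo_def dimv_def)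
        also have "\<dots> = (\<Sum>x<?r. (g * T t) $$ (?P, x) * h $$ (x, ?Q))" by (rule mult_mat_index_sum[OF gT h PQ])
        also have "\<dots> = (\<Sum>x<?r. (\<Sum>y<?r. g $$ (?P, y) * (T0 $$ (y, x) + t * (T1 $$ (y, x) - T0 $$ (y, x)))) * h $$ (x, ?Q))"
        proof (rule sum.cong[OF refl])
          fix x assume "x \<in> {..<?r}"
          hence x: "x < ?r" by simp
          show "(g * T t) $$ (?P, x) * h $$ (x, ?Q)
            = (\<Sum>y<?r. g $$ (?P, y) * (T0 $$ (y, x) + t * (T1 $$ (y, x) - T0 $$ (y, x)))) * h $$ (x, ?Q)"
            unfolding mult_mat_index_sum[OF g T PQ(1) x] using x by (simp add: T_def)
        qed
        finally show ?thesis .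
      qed
      thus ?thesis by (simp only:) (intro poly_curve_sum poly_curve_mult poly_curve_add poly_curve_const poly_curve_id)
    qed
    have "\<exists>f\<in>S. f (\<phi> 1) \<noteq> 0"
    proof -
      define gi where "gi = submat g ?ix"
      define hi where "hi = submat h ?ix"
      have gi: "gi \<in> carrier_mat ?d ?d" and hi: "hi \<in> carrier_mat ?d ?d" by (simp_all add: gi_def hi_def dimv_def)
      note sg = eq_supp_weak[OF ge] and sh = eq_supp_weak[OF he]
      have ghi: "gi * hi = 1\<^sub>m ?d"
        unfolding gi_def hi_def submat_mult[OF g h sg sh idx_convex, symmetric] gh dimv_def by (rule submat_one[OF idx_convex])
      have hgi: "hi * gi = 1\<^sub>m ?d"
        unfolding gi_def hi_def submat_mult[OF h g sh sg idx_convex, symmetric] hg dimv_def by (rule submat_one[OF idx_convex])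
      have gT: "g * T1 \<in> carrier_mat ?r ?r" using g T1 by simp
      note sT = strict_supp_weak[OF s1]
      have "at_i (\<phi> 1) = submat (g * T1 * h) ?ix" unfolding at_i[OF X] by (simp add: \<phi>_def restr_endo_def T01)
      also have "\<dots> = gi * Ti * hi"
        unfolding submat_mult[OF gT h weak_supp_mult[OF g T1 sg sT] sh idx_convex] submat_mult[OF g T1 sg sT idx_convex]
          T1i gi_def hi_def ..
      finally have a: "at_i (\<phi> 1) = gi * Ti * hi" .
      have gTh: "gi * Ti * hi \<in> carrier_mat ?d ?d" using gi Ti hi by simp
      have "similar_mat_wit (gi * Ti * hi) Ti gi hi" using gi hi Ti gTh ghi hgi by (simp add: similar_mat_wit_def Let_def)
      from similar_mat_wit_pow_id[OF this, of j] have aj: "at_i (\<phi> 1) ^\<^sub>m j = gi * Ti ^\<^sub>m j * hi" unfolding a .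
      have "B * hi * (at_i (\<phi> 1) ^\<^sub>m j) * (gi * C) = B * (Ti ^\<^sub>m j) * C"
        unfolding aj by (rule conj_cancel[OF B C _ gi hi hgi]) (use Ti in simp)
      hence nz': "det (B * hi * (at_i (\<phi> 1) ^\<^sub>m j) * (gi * C)) \<noteq> 0" using nz by simp
      have inS: "(\<lambda>F. det (B * hi * (at_i F ^\<^sub>m j) * (gi * C))) \<in> S"
      proof -
        have "B * hi \<in> carrier_mat \<rho> ?d" "gi * C \<in> carrier_mat ?d \<rho>" using B C gi hi by simp_all
        thus ?thesis unfolding S_def using \<rho> by blast
      qed
      show ?thesis by (rule bexI[OF _ inS]) (rule nz')
    qed
    thus "\<exists>\<phi>. \<phi> 0 = F \<and> (\<forall>t. \<phi> t \<in> ?X) \<and>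
      (\<forall>i p q. p < dimv L i \<longrightarrow> q < dimv L i \<longrightarrow> poly_curve (\<lambda>t. \<phi> t i $$ (p, q))) \<and> (\<exists>f\<in>S. f (\<phi> 1) \<noteq> 0)"
      using \<phi>0 X pc by (intro exI[of _ \<phi>]) simp
  qed
  thus ?thesis
  proof (rule generically_mono)
    fix F assume F: "F \<in> ?X" and "\<exists>f\<in>S. f F \<noteq> 0"
    then obtain \<rho> B C where "greene (lev (mset L) i) k \<le> \<rho> + k * j" "B \<in> carrier_mat \<rho> ?d" "C \<in> carrier_mat ?d \<rho>"
      "det (B * (at_i F ^\<^sub>m j) * C) \<noteq> 0" unfolding S_def by blast
    thus "\<exists>\<rho> B C. greene (lev (mset L) i) k \<le> \<rho> + k * j \<and> B \<in> carrier_mat \<rho> ?d \<and>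
      C \<in> carrier_mat ?d \<rho> \<and> det (B * (F i ^\<^sub>m j) * C) \<noteq> 0" unfolding at_i[OF F] by blast
  qed
qed

lemma antimono_superlevel:
  fixes \<mu> :: "nat \<Rightarrow> nat"
  assumes "antimono \<mu>"
  shows "{l. l < K \<and> j < \<mu> l} = {..<card {l. l < K \<and> j < \<mu> l}}"
proof -
  let ?S = "{l. l < K \<and> j < \<mu> l}"
  have fin: "finite ?S" by simp
  have down: "l' \<in> ?S" if "l \<in> ?S" "l' \<le> l" for l l' using that antimonoD[OF assms that(2)] by auto
  show ?thesis
  proof (cases "?S = {}")
    case False
    have "?S = {..Max ?S}"
    proof
      show "{..Max ?S} \<subseteq> ?S" using down[OF Max_in[OF fin False]] by blast
    qed (use fin in auto)
    thus ?thesis by (metis card_atMost lessThan_Suc_atMost)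
  qed (metis card.empty lessThan_0)
qed

text \<open>The chain bound holds at every point; the reverse bound needs one minor for each
  \<open>j\<close> below the largest part, and finitely many generic conditions hold
  together.\<close>

lemma generic_jordan_type:
  fixes L :: "(nat \<times> nat) list"
  assumes inf: "infinite (UNIV :: 'k::field set)" and L: "\<forall>x\<in>set L. x \<in> PQ n m" and m: "1 \<le> m" "m \<le> n" and i: "i \<le> n"
  shows "generically (dimv L) (nil_endos n L :: (nat \<Rightarrow> 'k mat) set)
    (\<lambda>F. jordan_type (F i) = filter_mset (\<lambda>p. 0 < p) (image_mset (shape (mset L) i) (mset_set {..<m})))"
proof -
  define \<mu> where "\<mu> = shape (mset L) i"
  \<comment> \<open>The number of parts exceeding \<open>j\<close>: with this many chains,
    subtracting \<open>j\<close> from each part involves no truncation.\<close>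
  define kk where "kk j = card {l. l < m \<and> j < \<mu> l}" for j
  have LM: "\<forall>x\<in>#mset L. x \<in> PQ n m" using L by simp
  have anti: "antimono \<mu>" and sum: "\<And>k. (\<Sum>l<k. \<mu> l) = greene (lev (mset L) i) k"
    using shape_sum_antimono[OF LM m(2) i] by (simp_all add: \<mu>_def)
  have van: "\<mu> k = 0" if "m \<le> k" for k unfolding \<mu>_def using shape_vanish(1)[OF LM m(2)] that .
  let ?X = "nil_endos n L :: (nat \<Rightarrow> 'k mat) set" and ?d = "dimv L i"
  have "generically (dimv L) ?X (\<lambda>F. \<forall>j\<in>{..<\<mu> 0}. \<exists>\<rho> B C. greene (lev (mset L) i) (kk j) \<le> \<rho> + kk j * j \<and>
      B \<in> carrier_mat \<rho> ?d \<and> C \<in> carrier_mat ?d \<rho> \<and> det (B * (F i ^\<^sub>m j) * C) \<noteq> 0)"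
    by (rule generically_Ball[OF finite_lessThan generic_minor[OF inf L m]])
  thus ?thesis
  proof (rule generically_mono)
    fix F assume F: "F \<in> ?X" and minor: "\<forall>j\<in>{..<\<mu> 0}. \<exists>\<rho> B C. greene (lev (mset L) i) (kk j) \<le> \<rho> + kk j * j \<and>
      B \<in> carrier_mat \<rho> ?d \<and> C \<in> carrier_mat ?d \<rho> \<and> det (B * (F i ^\<^sub>m j) * C) \<noteq> 0"
    let ?r = "length L" and ?ix = "idx L i"
    obtain A e where A: "A \<in> carrier_mat ?r ?r" "weak_supp L A" "A ^\<^sub>m e = 0\<^sub>m ?r ?r" and FA: "F = restr_endo L A"
      by (rule nil_endos_restr[OF F L m])
    define Li where "Li = map ((!) L) ?ix"
    have lenLi: "length Li = ?d" by (simp add: Li_def dimv_def)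
    have Fi: "F i \<in> carrier_mat ?d ?d" using F by (simp add: nil_endos_def)
    have nil: "F i ^\<^sub>m e = 0\<^sub>m ?d ?d"
      unfolding FA restr_endo_def dimv_def submat_pow[OF A(1,2) idx_convex, symmetric] A(3) by (rule submat_zero[OF idx_convex])
    have supp: "weak_supp Li (F i)" unfolding weak_supp_def lenLi
    proof (intro allI impI)
      fix p q assume pq: "p < ?d" "q < ?d" "F i $$ (p, q) \<noteq> 0"
      hence "A $$ (?ix ! p, ?ix ! q) \<noteq> 0" by (simp add: FA restr_endo_def dimv_def)
      moreover have "?ix ! p < ?r" "?ix ! q < ?r" using convex_indexD(3)[OF idx_convex] pq by (simp_all add: dimv_def)
      ultimately show "pair_le (Li ! q) (Li ! p)" using A(2) pq unfolding weak_supp_def by (simp add: Li_def dimv_def)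
    qed
    obtain g h T where g: "g \<in> carrier_mat ?d ?d" and h: "h \<in> carrier_mat ?d ?d" and T: "T \<in> carrier_mat ?d ?d"
      and gh: "g * h = 1\<^sub>m ?d" "h * g = 1\<^sub>m ?d" and FT: "F i = g * T * h" and s: "strict_supp Li (height Li) T"
      using nilpotent_conj_strict[of "F i" Li e, unfolded lenLi, OF Fi supp nil] by metis
    obtain e' where nilT: "T ^\<^sub>m e' = 0\<^sub>m ?d ?d" using strict_supp_nilpotent[of T Li, OF _ s] T unfolding lenLi by blast
    define n_as where "n_as = (SOME n_as. jordan_nf (F i) n_as)"
    have jnf: "jordan_nf (F i) n_as" unfolding n_as_def using someI_ex[OF nilpotent_jordan_nf[OF Fi nil]] .
    have "similar_mat_wit (F i) T g h" using g h T gh FT Fi by (simp add: similar_mat_wit_def Let_def)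
    hence "similar_mat T (F i)" using similar_mat_sym unfolding similar_mat_def by blast
    hence jnfT: "jordan_nf T n_as" using jnf similar_mat_trans unfolding jordan_nf_def by blast
    have "mset (map fst n_as) = filter_mset (\<lambda>p. 0 < p) (image_mset \<mu> (mset_set {..<m}))"
    proof (rule blocks_eq_shape[OF anti van])
      show "\<forall>sa\<in>set n_as. 0 < fst sa" using nilpotent_jordan_eigenvalue(2)[OF Fi nil jnf] by auto
    next
      fix ss assume "distinct ss" "set ss \<subseteq> {..<length n_as}"
      from jordan_blocks_le_greene[OF T lenLi s nilT jnfT this]
      show "(\<Sum>s\<in>set ss. fst (n_as ! s)) \<le> (\<Sum>l<length ss. \<mu> l)" unfolding sum Li_def mset_idx .
    next
      fix j
      show "(\<Sum>l<m. \<mu> l - j) \<le> sum_list (map (\<lambda>sa. fst sa - j) n_as)"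
      proof (cases "j < \<mu> 0")
        case True
        then obtain \<rho> B C where BC: "greene (lev (mset L) i) (kk j) \<le> \<rho> + kk j * j"
          "B \<in> carrier_mat \<rho> ?d" "C \<in> carrier_mat ?d \<rho>" "det (B * (F i ^\<^sub>m j) * C) \<noteq> 0" using minor by blast
        have S: "{l. l < m \<and> j < \<mu> l} = {..<kk j}" unfolding kk_def by (rule antimono_superlevel[OF anti])
        have "(\<Sum>l<m. \<mu> l - j) = (\<Sum>l<kk j. \<mu> l - j)"
        proof (rule sum.mono_neutral_right)
          show "{..<kk j} \<subseteq> {..<m}" "\<forall>l\<in>{..<m} - {..<kk j}. \<mu> l - j = 0" unfolding S[symmetric] by auto
        qed simp
        moreover have "(\<Sum>l<kk j. \<mu> l) = (\<Sum>l<kk j. (\<mu> l - j) + j)"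
          unfolding S[symmetric] by (rule sum.cong[OF refl]) simp
        ultimately have "greene (lev (mset L) i) (kk j) = (\<Sum>l<m. \<mu> l - j) + kk j * j"
          unfolding sum[symmetric] by (simp add: sum.distrib)
        thus ?thesis using BC(1) det_pow_nonzero_imp_le[OF Fi nil jnf BC(2-4)] by linarith
      next
        case False
        have "\<mu> l - j = 0" for l using antimonoD[OF anti, of 0 l] False by simp
        thus ?thesis by simp
      qed
    qed
    thus "jordan_type (F i) = filter_mset (\<lambda>p. 0 < p) (image_mset (shape (mset L) i) (mset_set {..<m}))"
      by (simp add: jordan_type_def n_as_def \<mu>_def)
  qed
qed

lemma mset_summands: "mset (summands M) = M"
  unfolding summands_def by (rule someI_ex[OF ex_mset])

text \<open>Two types cannot both be generic, since both properties then hold at a common point; the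
  variety is nonempty because it contains the zero endomorphism.\<close>

lemma GenJF_eq_shape:
  assumes inf: "infinite (UNIV :: 'k::field set)" and M: "\<forall>x\<in>#M. x \<in> PQ n m" and m: "1 \<le> m" "m \<le> n" and i: "i \<le> n"
  shows "GenJF TYPE('k) n M i = filter_mset (\<lambda>p. 0 < p) (image_mset (shape M i) (mset_set {..<m}))"
proof -
  let ?L = "summands M"
  let ?X = "nil_endos n ?L :: (nat \<Rightarrow> 'k mat) set"
  have L: "\<forall>x\<in>set ?L. x \<in> PQ n m" using M mset_summands[of M] by (metis set_mset_mset)
  have "restr_endo ?L (0\<^sub>m (length ?L) (length ?L)) \<in> ?X"
    by (rule restr_nil_endos[where e = 1]) (simp_all add: weak_supp_def)
  hence X: "?X \<noteq> {}" by blast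
  note gen = generic_jordan_type[OF inf L m i, unfolded mset_summands]
  show ?thesis unfolding GenJF_def
  proof (rule the_equality)
    show "generically (dimv ?L) ?X (\<lambda>F. jordan_type (F i) = filter_mset (\<lambda>p. 0 < p) (image_mset (shape M i) (mset_set {..<m})))"
      by (rule gen)
  next
    fix J assume "generically (dimv ?L) ?X (\<lambda>F. jordan_type (F i) = J)"
    from generically_ex[OF generically_conj[OF gen this] X]
    show "J = filter_mset (\<lambda>p. 0 < p) (image_mset (shape M i) (mset_set {..<m}))" by auto
  qed
qed

section \<open>Parts of a partition and positions in the poset of intervals\<close>

lemma part_positive_antimono:
  fixes \<mu> :: "nat \<Rightarrow> nat"
  assumes anti: "antimono \<mu>" and van: "\<And>k. K \<le> k \<Longrightarrow> \<mu> k = 0"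
  shows "part (filter_mset (\<lambda>p. 0 < p) (image_mset \<mu> (mset_set {..<K}))) k = \<mu> k"
proof -
  define h where "h = card {l. l < K \<and> 0 < \<mu> l}"
  have S: "{l. l < K \<and> 0 < \<mu> l} = {..<h}" unfolding h_def by (rule antimono_superlevel[OF anti])
  have "filter_mset (\<lambda>p. 0 < p) (image_mset \<mu> (mset_set {..<K})) = image_mset \<mu> (mset_set {l \<in> {..<K}. 0 < \<mu> l})"
    by (subst filter_mset_image_mset) simp
  also have "{l \<in> {..<K}. 0 < \<mu> l} = {..<h}" using S by auto
  also have "image_mset \<mu> (mset_set {..<h}) = mset (rev (map \<mu> [0..<h]))"
    unfolding mset_rev mset_map mset_upt atLeast0LessThan ..
  finally have J: "filter_mset (\<lambda>p. 0 < p) (image_mset \<mu> (mset_set {..<K})) = mset (rev (map \<mu> [0..<h]))" .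
  have "sorted (rev (map \<mu> [0..<h]))"
    unfolding sorted_rev_iff_nth_mono using antimonoD[OF anti] by simp
  hence "rev (sorted_list_of_multiset (mset (rev (map \<mu> [0..<h])))) = map \<mu> [0..<h]"
    unfolding sorted_list_of_multiset_mset by (simp add: sorted_sort_id)
  moreover have "\<mu> k = 0" if "h \<le> k"
  proof -
    have "k \<notin> {l. l < K \<and> 0 < \<mu> l}" unfolding S using that by simp
    thus ?thesis using van[of k] by auto
  qed
  ultimately show ?thesis unfolding J part_def by auto
qed

lemma tau_pow: "1 \<le> a \<Longrightarrow> (tau ^^ k) (a, b) = (if k < a then (a - k, b - k) else (0, 0))"
  by (induction k) (auto simp: tau_def)

text \<open>After \<open>a - 1\<close> translations the orbit reaches its projective. The pair
  \<open>(0, 0)\<close> that encodes zero is never mistaken for an interval, since endpoints are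
  positive.\<close>

lemma pi_vertex_eq:
  assumes "(a, b) \<in> PQ n m"
  shows "pi_vertex n (a, b) = b - a + 1"
  unfolding pi_vertex_def
proof (rule the_equality)
  have ab: "1 \<le> a" "a \<le> b" "b \<le> n" using assms by (auto simp: PQ_def)
  have "(tau ^^ (a - 1)) (a, b) = (1, b - a + 1)" using ab by (simp add: tau_pow)
  thus "1 \<le> b - a + 1 \<and> b - a + 1 \<le> n \<and> (1, b - a + 1) \<in> tau_orbit (a, b)"
    using ab unfolding tau_orbit_def by (intro conjI CollectI exI[of _ "a - 1"]) auto
  fix i assume "1 \<le> i \<and> i \<le> n \<and> (1, i) \<in> tau_orbit (a, b)"
  then obtain k where "(tau ^^ k) (a, b) = (1, i) \<or> (tau ^^ k) (1, i) = (a, b)" unfolding tau_orbit_def by blast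
  thus "i = b - a + 1" using ab by (auto simp: tau_pow split: if_splits)
qed

text \<open>The connecting path first raises the right endpoint and then the left one, staying among
  the intervals that contain \<open>m\<close>.\<close>

lemma PQ_le_iff:
  assumes x: "(a, b) \<in> PQ n m" and y: "(a', b') \<in> PQ n m"
  shows "PQ_le n m (a', b') (a, b) \<longleftrightarrow> a' \<le> a \<and> b' \<le> b"
proof
  have "fst u \<le> fst v \<and> snd u \<le> snd v" if "PQ_le n m u v" for u v
    using that unfolding PQ_le_def by induction (auto simp: ar_arrow_def)
  thus "a' \<le> a \<and> b' \<le> b" if "PQ_le n m (a', b') (a, b)" using that by fastforce
next
  assume le: "a' \<le> a \<and> b' \<le> b"
  let ?R = "\<lambda>u v. u \<in> PQ n m \<and> v \<in> PQ n m \<and> ar_arrow n u v"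
  have "?R\<^sup>*\<^sup>* (a', b') (a', c)" if "b' \<le> c" "c \<le> b" for c
    using that
  proof (induction c rule: dec_induct)
    case (step c)
    have "?R\<^sup>*\<^sup>* (a', b') (a', c)" using step by simp
    moreover have "?R (a', c) (a', Suc c)" using step x y by (auto simp: PQ_def ar_arrow_def)
    ultimately show ?case by (rule rtranclp.rtrancl_into_rtrancl)
  qed simp
  moreover have "?R\<^sup>*\<^sup>* (a', b) (c, b)" if "a' \<le> c" "c \<le> a" for c
    using that
  proof (induction c rule: dec_induct)
    case (step c)
    have "?R\<^sup>*\<^sup>* (a', b) (c, b)" using step by simp
    moreover have "?R (c, b) (Suc c, b)" using step x y by (auto simp: PQ_def ar_arrow_def)
    ultimately show ?case by (rule rtranclp.rtrancl_into_rtrancl)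
  qed simp
  ultimately show "PQ_le n m (a', b') (a, b)" unfolding PQ_le_def using le by (meson order.refl rtranclp_trans)
qed

text \<open>Lower elements of the chain are the translates by \<open>s\<close>; the left endpoint
  has to stay at least 1 and the right one at least \<open>m\<close>.\<close>

lemma card_below_in_chain:
  assumes x: "(a, b) \<in> PQ n m"
  shows "card {y \<in> PQ n m. pi_vertex n y = pi_vertex n (a, b) \<and> y \<noteq> (a, b) \<and> PQ_le n m y (a, b)} = min (a - 1) (b - m)"
proof -
  have "{y \<in> PQ n m. pi_vertex n y = pi_vertex n (a, b) \<and> y \<noteq> (a, b) \<and> PQ_le n m y (a, b)}
    = (\<lambda>s. (a - s, b - s)) ` {1..min (a - 1) (b - m)}" (is "?A = ?B")
  proof
    show "?A \<subseteq> ?B"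
    proof
      fix y assume y: "y \<in> ?A"
      obtain a' b' where y': "y = (a', b')" by (cases y)
      have p: "(a', b') \<in> PQ n m" using y y' by simp
      have "a' \<le> a" "b' \<le> b" "b' - a' = b - a" "(a', b') \<noteq> (a, b)" "a' \<le> b'" "a \<le> b" "1 \<le> a'" "m \<le> b'"
        using y PQ_le_iff[OF x p] pi_vertex_eq[OF x] pi_vertex_eq[OF p] p x unfolding y' by (auto simp: PQ_def)
      hence "a - a' \<in> {1..min (a - 1) (b - m)}" "y = (a - (a - a'), b - (a - a'))" by (auto simp: y')
      thus "y \<in> ?B" by blast
    qed
  next
    show "?B \<subseteq> ?A"
    proof
      fix y assume "y \<in> ?B"
      then obtain s where s: "1 \<le> s" "s \<le> a - 1" "s \<le> b - m" "y = (a - s, b - s)" by auto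
      have p: "(a - s, b - s) \<in> PQ n m" using s x by (auto simp: PQ_def)
      show "y \<in> ?A" using s p PQ_le_iff[OF x p] pi_vertex_eq[OF x] pi_vertex_eq[OF p] x by (auto simp: PQ_def)
    qed
  qed
  moreover have "inj_on (\<lambda>s. (a - s, b - s)) {1..min (a - 1) (b - m)}" by (rule inj_onI) auto
  ultimately show ?thesis by (simp add: card_image)
qed

theorem theorem6p3:
  fixes n m :: nat and M :: "(nat \<times> nat) multiset"
  assumes "alg_closed TYPE('k::field)"
    and "1 \<le> m" and "m \<le> n"
    and "\<forall>x \<in># M. x \<in> PQ n m"
  shows "rpp_of n m (rho_QM TYPE('k) n m M) = HG n m M"
proof -
  note inf = alg_closed_infinite[OF assms(1)]
  have rho: "rho_QM TYPE('k) n m M (a, b) = shape M (b - a + 1) (min (a - 1) (b - m))" if ab: "(a, b) \<in> PQ n m" for a b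
  proof -
    have i: "b - a + 1 \<le> n" using ab by (auto simp: PQ_def)
    note shape = shape_sum_antimono(1)[OF assms(4,3) i] shape_vanish(1)[OF assms(4,3)]
    show ?thesis
      unfolding rho_QM_def rho_def card_below_in_chain[OF ab]
      unfolding pi_vertex_eq[OF ab] GenJF_eq_shape[OF inf assms(4,2,3) i]
      by (rule part_positive_antimono[OF shape])
  qed
  have "rpp_of n m (rho_QM TYPE('k) n m M) = fill n m M"
  proof
    fix rc :: "nat \<times> nat"
    obtain r c where rc: "rc = (r, c)" by (cases rc)
    have "(m + 1 - c, n + 1 - r) \<in> PQ n m" if "(r, c) \<in> cells (n + 1 - m) m"
      using that assms(2,3) by (auto simp: cells_def PQ_def)
    thus "rpp_of n m (rho_QM TYPE('k) n m M) rc = fill n m M rc" unfolding rc fill_def rpp_of_def using rho by simp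
  qed
  also have "\<dots> = HG n m M" using HG_eq_fill[OF assms(4,2,3)] by simp
  finally show ?thesis .
qed

end
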